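(* Let $\mathcal X_n$ be either $\mathcal P_n$ (for all $n$) or $\mathcal B_n$ (for all $n$). Assume that $\rho_n=n^kr_n^{d(k-1)}\to\infty$ and $nr_n^d\to0$ as $n\to\infty$. Then, for any Borel set $A\subset\mathbb R^m$, $$-\inf_{\mathbf u\in A^\circ}I(\mathbf u)\le\liminf_{n\to\infty}\frac{\rho_n}{b_n^2}\log\mathbb P\Big(\frac1{b_n}\overline{S_n(\mathcal X_n)}\in A\Big)\le\limsup_{n\to\infty}\frac{\rho_n}{b_n^2}\log\mathbb P\Big(\frac1{b_n}\overline{S_n(\mathcal X_n)}\in A\Big)\le-\inf_{\mathbf u\in\overline A}I(\mathbf u),$$ where $A^\circ$, $\overline A$ are the interior and closure of $A$ in $\mathbb R^m$, and $S_n$ is the vector of component counts of random Čech complexes defined in the context.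
   Context: Fix integers $d\ge2$, $k\ge2$, $m\ge1$. $\mathcal P_n$ is a Poisson point process on $[0,1]^d$ with intensity $n$; $\mathcal B_n$ is the binomial process of $n$ i.i.d. uniform points in $[0,1]^d$. $(r_n)$ is a sequence of positive numbers with $r_n\to0$. $(b_n)$ is a positive sequence with $\rho_n/b_n\to\infty$ and $\rho_n/b_n^2\to0$. $\|\cdot\|$ is the Euclidean norm, $B(x,a)$ the closed ball of center $x$ and radius $a$, $\mathbf 0_d$ the origin of $\mathbb R^d$, and $\overline X=X-\mathbb E[X]$ for a random vector $X$. For a finite set $\mathcal X\subset\mathbb R^d$ and $r>0$, the Čech complex is $\mathcal C(\mathcal X,r)=\{\{x_{i_0},\dots,x_{i_j}\}\subset\mathcal X:j\ge0,\ \bigcap_{l=0}^jB(x_{i_l},r/2)\ne\emptyset\}$. Let $t_1,\dots,t_m\in(0,\infty)$, $\mathbf t=(t_1,\dots,t_m)$, and let $\Gamma_1,\dots,\Gamma_m$ be pairwise non-isomorphic connected Čech complexes (of point sets in $\mathbb R^d$) with $k$ vertices. Define $H=(h^{(1)},\dots,h^{(m)})$ by $h^{(i)}(x_1,\dots,x_k)=\mathbf 1\{\mathcal C(\{x_1,\dots,x_k\},t_i)\cong\Gamma_i\}$, where $\cong$ is isomorphism of simplicial complexes. For a finite set $\mathcal X$ define $S_n(\mathcal X)=(S_n^{(i)}(\mathcal X))_{i=1,\dots,m}$ by $$S_n^{(i)}(\mathcal X)=\sum_{\mathcal Y\subset\mathcal X,\,|\mathcal Y|=k}\mathbf 1\{\|y-y'\|\ge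 r_nt_i\ \forall y\in\mathcal Y,\,y'\in\mathcal X\setminus\mathcal Y\}\,h^{(i)}(r_n^{-1}\mathcal Y);$$ it represents the number of connected components of $\mathcal C(\mathcal X,r_nt_i)$ isomorphic to $\Gamma_i$. The rate function is $I(\mathbf u)=\frac12\langle\mathbf u,\Gamma^{-1}\mathbf u\rangle$, $\mathbf u\in\mathbb R^m$, where $\Gamma$ is the (invertible) $m\times m$ matrix with entries $\frac1{k!}\int_{(\mathbb R^d)^{k-1}}h^{(i)}(\mathbf 0_d,\mathbf y)h^{(j)}(\mathbf 0_d,\mathbf y)\,d\mathbf y$. *)

theory Defs
  imports "HOL-Probability.Probability"
begin

section \<open>Abstract simplicial complexes and the Cech complex\<close>

text \<open>An abstract simplicial complex is represented by its set of (nonempty, finite) simplices;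
  its vertex set is the union of its simplices.\<close>

definition cech_complex :: "'a::metric_space set \<Rightarrow> real \<Rightarrow> 'a set set" where
  "cech_complex X s = {\<sigma>. \<sigma> \<subseteq> X \<and> finite \<sigma> \<and> \<sigma> \<noteq> {} \<and> (\<Inter>x\<in>\<sigma>. cball x (s / 2)) \<noteq> {}}"

definition complex_iso :: "'a set set \<Rightarrow> 'b set set \<Rightarrow> bool" where
  "complex_iso K L \<longleftrightarrow> (\<exists>f. bij_betw f (\<Union>K) (\<Union>L) \<and> (\<lambda>\<sigma>. f ` \<sigma>) ` K = L)"

definition connected_complex :: "'a set set \<Rightarrow> bool" where
  "connected_complex K \<longleftrightarrow>
     K \<noteq> {} \<and> (\<forall>u\<in>\<Union>K. \<forall>v\<in>\<Union>K. (u, v) \<in> {(a, b). {a, b} \<in> K}\<^sup>*)"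

definition connected_cech_complex_on :: "nat \<Rightarrow> (real^'d) set set \<Rightarrow> bool" where
  "connected_cech_complex_on k K \<longleftrightarrow>
     (\<exists>X s. finite X \<and> card X = k \<and> s > 0 \<and> K = cech_complex X s) \<and> connected_complex K"


section \<open>Component counts\<close>

text \<open>The indicator \<open>h(x\<^sub>1, \<dots>, x\<^sub>k)\<close> depends only on the set of its \<open>k\<close> arguments. A tuple with
  repeated entries has fewer than \<open>k\<close> vertices and therefore gets the value \<open>0\<close> when the target
  complex has \<open>k\<close> vertices.\<close>

definition cech_iso_indicator :: "real \<Rightarrow> (real^'d) set set \<Rightarrow> (real^'d) set \<Rightarrow> real" where
  "cech_iso_indicator s K Y = (if complex_iso (cech_complex Y s) K then 1 else 0)"

definition component_counts ::
  "nat \<Rightarrow> real^'m \<Rightarrow> ('m \<Rightarrow> (real^'d) set set) \<Rightarrow> real \<Rightarrow> (real^'d) set \<Rightarrow> real^'m" where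
  "component_counts k t G r X = (\<chi> i. \<Sum>Y | Y \<subseteq> X \<and> card Y = k.
     (if \<forall>y\<in>Y. \<forall>y'\<in>X - Y. norm (y - y') \<ge> r * t $ i then 1 else 0) *
     cech_iso_indicator (t $ i) (G i) ((\<lambda>y. inverse r *\<^sub>R y) ` Y))"


section \<open>Point processes on the unit cube\<close>

text \<open>In \<^typ>\<open>real^'d\<close> the constant \<open>1\<close> is the vector all of whose coordinates are \<open>1\<close>, so
  \<open>cbox 0 1\<close> is the cube \<open>[0,1]\<^sup>d\<close>. Since the intensity measure is diffuse, a Poisson process is
  almost surely simple and is treated as a random finite set.\<close>

definition poisson_process_on_cube ::
  "'a measure \<Rightarrow> real \<Rightarrow> ('a \<Rightarrow> (real^'d) set) \<Rightarrow> bool" where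
  "poisson_process_on_cube M a X \<longleftrightarrow>
     (\<forall>\<omega>\<in>space M. finite (X \<omega>) \<and> X \<omega> \<subseteq> cbox 0 1) \<and>
     (\<forall>B\<in>sets borel. (\<lambda>\<omega>. card (X \<omega> \<inter> B)) \<in> measurable M (count_space UNIV) \<and>
        (\<forall>j. measure M {\<omega> \<in> space M. card (X \<omega> \<inter> B) = j} =
           (let c = a * measure lborel (B \<inter> cbox 0 1) in exp (- c) * c ^ j / fact j))) \<and>
     (\<forall>(q::nat) B. (\<forall>i<q. B i \<in> sets borel) \<longrightarrow> disjoint_family_on B {..<q} \<longrightarrow>
        prob_space.indep_vars M (\<lambda>_. count_space UNIV) (\<lambda>i \<omega>. card (X \<omega> \<inter> B i)) {..<q})"

definition binomial_process_on_cube ::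
  "'a measure \<Rightarrow> nat \<Rightarrow> ('a \<Rightarrow> (real^'d) set) \<Rightarrow> bool" where
  "binomial_process_on_cube M n X \<longleftrightarrow>
     (\<exists>U. prob_space.indep_vars M (\<lambda>_. borel) U {..<n} \<and>
        (\<forall>i<n. distr M borel (U i) = uniform_measure lborel (cbox 0 1)) \<and>
        (\<forall>\<omega>\<in>space M. X \<omega> = (\<lambda>i. U i \<omega>) ` {..<n}))"


section \<open>The rate function\<close>

text \<open>\<open>(\<real>\<^sup>d)\<^sup>k\<^sup>-\<^sup>1\<close> is the product of \<open>k - 1\<close> copies of \<open>\<real>\<^sup>d\<close>, indexed by \<open>{1..<k}\<close>.\<close>

definition limit_covariance ::
  "nat \<Rightarrow> real^'m \<Rightarrow> ('m \<Rightarrow> (real^'d) set set) \<Rightarrow> real^'m^'m" where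
  "limit_covariance k t G = (\<chi> i j. 1 / fact k *
     (\<integral>y. cech_iso_indicator (t $ i) (G i) (insert 0 (y ` {1..<k})) *
          cech_iso_indicator (t $ j) (G j) (insert 0 (y ` {1..<k}))
        \<partial>(\<Pi>\<^sub>M l\<in>{1..<k}. (lborel :: (real^'d) measure))))"

definition rate_function :: "real^'m^'m \<Rightarrow> real^'m \<Rightarrow> real" where
  "rate_function C u = 1 / 2 * (u \<bullet> (matrix_inv C *v u))"


section \<open>Logarithms of probabilities\<close>

text \<open>The real logarithm of the library has \<open>ln 0 = 0\<close>; here \<open>log 0 = -\<infinity>\<close> is needed.\<close>

definition log_prob :: "real \<Rightarrow> ereal" where
  "log_prob p = (if p = 0 then -\<infinity> else ereal (ln p))"

end

theory Submission
  imports Defs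
begin

text \<open>
  The exponent \<open>1/2 * \<langle>u, \<Gamma>\<^sup>-\<^sup>1 u\<rangle>\<close> is the Legendre transform of \<open>1/2 * \<langle>\<theta>, \<Gamma> \<theta>\<rangle>\<close>. By the
  Gaertner-Ellis theorem (\<open>gaertner_ellis_upper\<close>, \<open>gaertner_ellis_lower\<close>) it suffices that, for
  each \<open>\<theta>\<close>, the centred cumulant of \<open>F = \<langle>\<theta>, S\<^sub>n\<rangle>\<close> at the point \<open>\<alpha> = b\<^sub>n / \<rho>\<^sub>n\<close> satisfies
  \<open>ln E exp (\<alpha> * (F - E F)) = (1/2 + o(1)) * \<rho>\<^sub>n * \<alpha>\<^sup>2 * \<langle>\<theta>, \<Gamma> \<theta>\<rangle>\<close>. Since \<open>\<alpha>\<close> tends to \<open>0\<close> and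
  \<open>\<rho>\<^sub>n * \<alpha>\<^sup>2 = b\<^sub>n\<^sup>2 / \<rho>\<^sub>n\<close> to infinity, only the second-order behaviour of the cumulant near
  \<open>0\<close> matters, but every error has to be \<open>o(\<rho>\<^sub>n * \<alpha>\<^sup>2)\<close>.

  For \<open>N\<close> independent points the cumulant is expanded by a direct argument. Write
  \<open>\<phi> \<alpha>\<close> for \<open>E exp (\<alpha> * F)\<close>. Then \<open>F\<close> is a sum over the \<open>k\<close>-subsets \<open>J\<close> of the points, and \<open>J\<close>
  contributes if it has one of the prescribed shapes and no other point is close to it. Given the
  points of \<open>J\<close>, the functional splits as \<open>F = g(J) + F(points outside J)\<close> unless some outside
  point comes close to \<open>J\<close>, which has probability of order \<open>N * r^d\<close>. Tilting by \<open>exp (\<alpha> * F)\<close> does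
  not destroy this estimate: adding or moving one point changes \<open>F\<close> by at most a constant, because
  only boundedly many pairwise separated components can be near one point
  (\<open>packing_constant\<close>). Hence the tilted probability that \<open>J\<close> is a component is, to first order,
  the untilted one plus \<open>\<alpha> * E[g(J); J has the shape]\<close> (\<open>valid_estimate\<close>). Summation over \<open>J\<close> gives
  \<open>(ln \<phi>)' = E F + \<alpha> * V\<close> with \<open>V = \<Sum>\<^sub>J E[g(J)\<^sup>2]\<close>, up to an error which is negligible relative to
  the expected number of \<open>k\<close>-subsets with a prescribed shape, and integration in \<open>\<alpha>\<close> yields
  \<open>cumulant_estimate\<close>. That number is of order \<open>\<rho>\<^sub>n\<close>, and \<open>V / \<rho>\<^sub>n\<close> tends to \<open>\<langle>\<theta>, \<Gamma> \<theta>\<rangle>\<close> by scaling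
  (\<open>pairprob_limit\<close>).

  A Poisson process is a mixture of such \<open>N\<close>-point processes with Poisson weights
  (\<open>poisson_mixture\<close>). Its point number fluctuates by \<open>\<surd>n\<close> around \<open>n\<close>. An additional
  point can affect \<open>F\<close> only if \<open>k - 1\<close> other points are close to it, so \<open>ln \<phi>\<close> changes only by
  \<open>O(\<alpha> * \<rho>\<^sub>n / n)\<close> per point (\<open>\<phi>_insert\<close>). Averaging over the number of points therefore
  perturbs the centred cumulant by \<open>O(1 + \<alpha> * \<rho>\<^sub>n / \<surd>n + (\<alpha> * \<rho>\<^sub>n)\<^sup>2 / n)\<close>
  (\<open>poisson_log_compare\<close>, \<open>poisson_mean_compare\<close>). This is \<open>o(\<rho>\<^sub>n * \<alpha>\<^sup>2)\<close>, as
  \<open>\<rho>\<^sub>n / n = (n * r\<^sub>n^d)^(k-1)\<close> tends to \<open>0\<close>; so both processes have the same limit cumulant.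

  Throughout, point sets are replaced by finite tuples of independent points with law
  \<open>scaledQ r\<close>, the uniform distribution on the cube dilated by \<open>1/r\<close>, and the interaction range is
  then of order \<open>1\<close>. The passage is legitimate because coinciding points and pairs at
  distance exactly \<open>t\<^sub>i\<close> have probability \<open>0\<close>.
\<close>

section \<open>The Gaertner-Ellis theorem for a quadratic limit\<close>

lemma invertible_matrix_inv_right:
  fixes C :: "real^'m^'m"
  assumes "invertible C"
  shows "C ** matrix_inv C = mat 1"
  using assms someI_ex[of "\<lambda>A'. C ** A' = mat 1 \<and> A' ** C = mat 1"]
  unfolding invertible_def matrix_inv_def by blast

lemma (in prob_space) expectation_exp_pos:
  assumes "integrable M (\<lambda>\<omega>. exp (f \<omega> :: real))"
  shows "0 < expectation (\<lambda>\<omega>. exp (f \<omega>))"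
  using integral_less_AE_space[of "\<lambda>_. 0" "\<lambda>\<omega>. exp (f \<omega>)"] assms
  by (simp add: emeasure_space_1)

text \<open>The half-space \<open>{v. s < \<theta> \<bullet> v}\<close> with \<open>\<theta> = C\<^sup>-\<^sup>1 u\<close> contains \<open>u\<close>, and Markov's inequality
  controls its probability at the exponential rate \<open>s - 1/2 * (\<theta> \<bullet> C \<theta>)\<close>, which can be taken above \<open>c\<close>
  when the rate of \<open>u\<close> exceeds \<open>c\<close>. Compactness leaves finitely many of them for a large box, and the
  coordinate half-spaces take care of the outside of the box. These do the work of exponential
  tightness.\<close>
lemma finite_halfspace_cover:
  fixes C :: "real^'m^'m" and B :: "(real^'m) set"
  assumes inv: "invertible C" and B: "closed B" 
    and c: "\<And>u. u \<in> B \<Longrightarrow> c < rate_function C u"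
  obtains H :: "((real^'m) \<times> real) set" where "finite H"
    "B \<subseteq> (\<Union>(\<theta>, s)\<in>H. {v. s < \<theta> \<bullet> v})"
    "\<And>\<theta> s. (\<theta>, s) \<in> H \<Longrightarrow> c + 1/2 * (\<theta> \<bullet> (C *v \<theta>)) \<le> s"
proof -
  define \<Lambda> where "\<Lambda> \<theta> = 1/2 * (\<theta> \<bullet> (C *v \<theta>))" for \<theta> :: "real^'m"
  \<comment> \<open>So large that the coordinate half-spaces outside the box have rate above \<open>c\<close>.\<close>
  define R where "R = (MAX i. \<bar>c\<bar> + 1 + \<bar>\<Lambda> (axis i 1)\<bar> + \<bar>\<Lambda> (- axis i 1)\<bar>)"
  have R: "\<bar>c\<bar> + 1 + \<bar>\<Lambda> (axis i 1)\<bar> + \<bar>\<Lambda> (- axis i 1)\<bar> \<le> R" for i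
    unfolding R_def by (rule Max_ge) auto
  define K where "K = B \<inter> cbox (- (\<chi> i. R)) (\<chi> i. R)"
  have K: "compact K" unfolding K_def using B by (intro closed_Int_compact) auto
  define D where "D u = matrix_inv C *v u" for u :: "real^'m"
  have CD: "C *v D u = u" for u
    unfolding D_def using invertible_matrix_inv_right[OF inv] by (simp add: matrix_vector_mul_assoc)
  have *: "\<Lambda> (D u) + c < D u \<bullet> u" if "u \<in> B" for u
    using c[OF that] CD[of u] unfolding \<Lambda>_def rate_function_def D_def by (simp add: inner_commute)
  let ?V = "\<lambda>u. {v. \<Lambda> (D u) + c < D u \<bullet> v}"
  have "open (?V u)" for u
    by (intro open_Collect_less continuous_intros)
  moreover have "K \<subseteq> (\<Union>u\<in>K. ?V u)"
    using * by (auto simp: K_def)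
  ultimately obtain K' where K': "K' \<subseteq> K" "finite K'" "K \<subseteq> (\<Union>u\<in>K'. ?V u)"
    using compactE_image[OF K, of K ?V] by blast
  define H where "H = (\<lambda>u. (D u, \<Lambda> (D u) + c)) ` K'
    \<union> range (\<lambda>i. (axis i 1, c + \<Lambda> (axis i 1)))
    \<union> range (\<lambda>i. (- axis i 1, c + \<Lambda> (- axis i 1)))"
  show thesis
  proof (rule that)
    show "finite H" unfolding H_def using K' by auto
    show "c + 1/2 * (\<theta> \<bullet> (C *v \<theta>)) \<le> s" if "(\<theta>, s) \<in> H" for \<theta> s
      using that unfolding H_def \<Lambda>_def by auto
    show "B \<subseteq> (\<Union>(\<theta>, s)\<in>H. {v. s < \<theta> \<bullet> v})"
    proof
      fix v assume v: "v \<in> B"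
      show "v \<in> (\<Union>(\<theta>, s)\<in>H. {v. s < \<theta> \<bullet> v})"
      proof (cases "v \<in> K")
        case True
        with K'(3) obtain u where "u \<in> K'" "\<Lambda> (D u) + c < D u \<bullet> v" by auto
        thus ?thesis unfolding H_def by force
      next
        case False
        then obtain i where "v $ i < - R \<or> v $ i > R"
          using v unfolding K_def by (auto simp: mem_box_cart not_le)
        moreover have "axis i 1 \<bullet> v = v $ i" "(- axis i 1) \<bullet> v = - (v $ i)"
          by (simp_all add: inner_axis')
        ultimately have "c + \<Lambda> (axis i 1) < axis i 1 \<bullet> v \<or> c + \<Lambda> (- axis i 1) < (- axis i 1) \<bullet> v"
          using R[of i] by linarith
        thus ?thesis unfolding H_def by blast
      qed
    qed
  qed
qed

lemma (in prob_space) exponential_markov: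
  assumes [measurable]: "f \<in> borel_measurable M" and int: "integrable M (\<lambda>\<omega>. exp (f \<omega>))"
  shows "prob {\<omega>\<in>space M. s < f \<omega>} \<le> exp (- s) * expectation (\<lambda>\<omega>. exp (f \<omega>))"
proof -
  have "prob {\<omega>\<in>space M. s < f \<omega>} = expectation (indicat_real {\<omega>\<in>space M. s < f \<omega>})" by simp
  also have "\<dots> \<le> expectation (\<lambda>\<omega>. exp (- s) * exp (f \<omega>))"
  proof (rule integral_mono)
    show "integrable M (indicat_real {\<omega>\<in>space M. s < f \<omega>})"
      by (auto simp: emeasure_eq_measure)
    show "integrable M (\<lambda>\<omega>. exp (- s) * exp (f \<omega>))" using int by simp
    show "indicat_real {\<omega>\<in>space M. s < f \<omega>} \<omega> \<le> exp (- s) * exp (f \<omega>)" for \<omega>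
      by (auto simp: indicator_def exp_minus field_simps)
  qed
  finally show ?thesis by simp
qed

lemma filterlim_at_top_eventually_ge:
  "filterlim a at_top sequentially \<Longrightarrow> eventually (\<lambda>n. (c::real) \<le> a n) sequentially"
  by (simp add: filterlim_at_top)

text \<open>The half-spaces of \<open>finite_halfspace_cover\<close> have probability at most \<open>exp (- a n * (c - e/2))\<close>
  for large \<open>n\<close>, and their number does not matter on the scale \<open>a n\<close>.\<close>
lemma (in prob_space) gaertner_ellis_upper:
  fixes Z :: "nat \<Rightarrow> 'a \<Rightarrow> real^'m" and C :: "real^'m^'m"
  assumes a: "filterlim a at_top sequentially"
    and [measurable]: "\<And>n. Z n \<in> borel_measurable M"
    and int: "\<And>n \<theta>. integrable M (\<lambda>\<omega>. exp (a n * (\<theta> \<bullet> Z n \<omega>)))"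
    and lim: "\<And>\<theta>. (\<lambda>n. ln (expectation (\<lambda>\<omega>. exp (a n * (\<theta> \<bullet> Z n \<omega>)))) / a n)
        \<longlonglongrightarrow> 1/2 * (\<theta> \<bullet> (C *v \<theta>))"
    and inv: "invertible C" and A: "A \<in> sets borel"
  shows "limsup (\<lambda>n. ereal (1 / a n) * log_prob (prob {\<omega>\<in>space M. Z n \<omega> \<in> A}))
      \<le> - (INF u\<in>closure A. ereal (rate_function C u))"
proof -
  let ?L = "\<lambda>n. ereal (1 / a n) * log_prob (prob {\<omega>\<in>space M. Z n \<omega> \<in> A})"
  note [measurable] = A
  have main: "limsup ?L \<le> - ereal c" if c: "ereal c < (INF u\<in>closure A. ereal (rate_function C u))" for c
  proof -
    have cl: "c < rate_function C u" if "u \<in> closure A" for u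
      using less_le_trans[OF c INF_lower[OF that]] by simp
    from finite_halfspace_cover[OF inv closed_closure cl]
    obtain H where H: "finite H" "closure A \<subseteq> (\<Union>(\<theta>, s)\<in>H. {v. s < \<theta> \<bullet> v})"
       "\<And>\<theta> s. (\<theta>, s) \<in> H \<Longrightarrow> c + 1/2 * (\<theta> \<bullet> (C *v \<theta>)) \<le> s"
      by metis
    have ev: "limsup ?L \<le> ereal (- c + e)" if e: "e > 0" for e
    proof (rule Limsup_bounded)
      have "\<forall>\<^sub>F n in sequentially. \<forall>(\<theta>,s)\<in>H. ln (expectation (\<lambda>\<omega>. exp (a n * (\<theta> \<bullet> Z n \<omega>)))) / a n
          < 1/2 * (\<theta> \<bullet> (C *v \<theta>)) + e/2"
        using H(1) e by (auto simp: eventually_ball_finite_distrib intro!: order_tendstoD(2)[OF lim])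
      moreover have "\<forall>\<^sub>F n in sequentially. max 1 (2 * ln (real (card H) + 1) / e) \<le> a n"
        using filterlim_at_top_eventually_ge[OF a] .
      ultimately show "\<forall>\<^sub>F n in sequentially. ?L n \<le> ereal (- c + e)"
      proof eventually_elim
        case (elim n)
        hence an: "a n > 0" and an2: "ln (real (card H) + 1) \<le> a n * (e/2)"
          using e by (auto simp: field_simps)
        let ?p = "prob {\<omega>\<in>space M. Z n \<omega> \<in> A}"
        have half: "prob {\<omega>\<in>space M. s < \<theta> \<bullet> Z n \<omega>} \<le> exp (a n * (- c + e/2))"
          if "(\<theta>, s) \<in> H" for \<theta> s
        proof -
          let ?m = "expectation (\<lambda>\<omega>. exp (a n * (\<theta> \<bullet> Z n \<omega>)))"
          have "{\<omega>\<in>space M. s < \<theta> \<bullet> Z n \<omega>} = {\<omega>\<in>space M. a n * s < a n * (\<theta> \<bullet> Z n \<omega>)}"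
            using an by auto
          hence "prob {\<omega>\<in>space M. s < \<theta> \<bullet> Z n \<omega>} \<le> exp (- (a n * s)) * ?m"
            using exponential_markov[OF _ int[of n \<theta>], of "a n * s"] by simp
          also have "?m > 0" by (rule expectation_exp_pos[OF int])
          hence "?m = exp (ln ?m)" by simp
          also have "ln ?m \<le> a n * (1/2 * (\<theta> \<bullet> (C *v \<theta>)) + e/2)"
            using elim(1) that an by (auto simp: field_simps)
          also have "1/2 * (\<theta> \<bullet> (C *v \<theta>)) \<le> s - c" using H(3)[OF that] by simp
          finally show ?thesis using an by (simp add: exp_add[symmetric] algebra_simps)
        qed
        have "?p \<le> prob (\<Union>(\<theta>,s)\<in>H. {\<omega>\<in>space M. s < \<theta> \<bullet> Z n \<omega>})"
        proof (rule finite_measure_mono)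
          show "{\<omega>\<in>space M. Z n \<omega> \<in> A} \<subseteq> (\<Union>(\<theta>,s)\<in>H. {\<omega>\<in>space M. s < \<theta> \<bullet> Z n \<omega>})"
            using H(2) closure_subset[of A] by fastforce
        qed (auto intro!: sets.finite_UN H(1))
        also have "\<dots> \<le> (\<Sum>(\<theta>,s)\<in>H. prob {\<omega>\<in>space M. s < \<theta> \<bullet> Z n \<omega>})"
          unfolding case_prod_unfold
          by (rule finite_measure_subadditive_finite[OF H(1)]) auto
        also have "\<dots> \<le> (\<Sum>(\<theta>,s)\<in>H. exp (a n * (- c + e/2)))"
          using half by (intro sum_mono) auto
        also have "\<dots> = real (card H) * exp (a n * (- c + e/2))" by (simp add: case_prod_unfold)
        also have "\<dots> \<le> (real (card H) + 1) * exp (a n * (- c + e/2))" by (simp add: mult_right_mono)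
        also have "\<dots> = exp (ln (real (card H) + 1) + a n * (- c + e/2))" by (simp add: exp_add)
        also have "\<dots> \<le> exp (a n * (- c + e))" using an2 by (simp add: algebra_simps)
        finally have le: "?p \<le> exp (a n * (- c + e))" .
        show ?case
        proof (cases "?p = 0")
          case True thus ?thesis using an by (simp add: log_prob_def)
        next
          case False
          hence "?p > 0" by (simp add: zero_less_measure_iff)
          hence "ln ?p \<le> a n * (- c + e)"
            using le by (metis exp_gt_zero ln_exp ln_le_cancel_iff)
          thus ?thesis using False an by (simp add: log_prob_def field_simps)
        qed
      qed
    qed
    show ?thesis
    proof (rule ereal_le_epsilon2)
      fix e :: real assume "0 < e"
      thus "limsup ?L \<le> - ereal c + ereal e" using ev[of e] by simp
    qed
  qed
  show ?thesis
  proof (subst ereal_minus_le_minus[symmetric], simp, rule dense_le)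
    fix z assume z: "z < (INF u\<in>closure A. ereal (rate_function C u))"
    show "z \<le> - limsup ?L"
    proof (cases z)
      case (real c)
      hence "limsup ?L \<le> - z" using main[of c] z by simp
      thus ?thesis by (subst (asm) ereal_minus_le_minus[symmetric]) simp
    qed (use z in auto)
  qed
qed

text \<open>For \<open>u\<close> in the interior, tilt by \<open>\<theta> = C\<^sup>-\<^sup>1 u\<close>: under the density proportional to
  \<open>exp (a n * (\<theta> \<bullet> Z n))\<close> the variables concentrate at \<open>u\<close>, and on a small ball around \<open>u\<close> the
  density is known up to a small exponential factor. The tilted measure is never formed; instead the
  exponential moment at \<open>\<theta>\<close> is split into the part with \<open>Z n\<close> near \<open>u\<close>
  and a remainder, which Markov's inequality in the coordinate directions bounds by half of the whole.\<close>
lemma (in prob_space) gaertner_ellis_lower: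
  fixes Z :: "nat \<Rightarrow> 'a \<Rightarrow> real^'m" and C :: "real^'m^'m"
  assumes a: "filterlim a at_top sequentially"
    and [measurable]: "\<And>n. Z n \<in> borel_measurable M"
    and int: "\<And>n \<theta>. integrable M (\<lambda>\<omega>. exp (a n * (\<theta> \<bullet> Z n \<omega>)))"
    and lim: "\<And>\<theta>. (\<lambda>n. ln (expectation (\<lambda>\<omega>. exp (a n * (\<theta> \<bullet> Z n \<omega>)))) / a n)
        \<longlonglongrightarrow> 1/2 * (\<theta> \<bullet> (C *v \<theta>))"
    and sym: "\<And>u v. u \<bullet> (C *v v) = v \<bullet> (C *v u)"
    and inv: "invertible C" and A: "A \<in> sets borel"
  shows "- (INF u\<in>interior A. ereal (rate_function C u)) 
      \<le> liminf (\<lambda>n. ereal (1 / a n) * log_prob (prob {\<omega>\<in>space M. Z n \<omega> \<in> A}))"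
proof -
  let ?L = "\<lambda>n. ereal (1 / a n) * log_prob (prob {\<omega>\<in>space M. Z n \<omega> \<in> A})"
  note [measurable] = A
  let ?m = "\<lambda>n \<theta>. expectation (\<lambda>\<omega>. exp (a n * (\<theta> \<bullet> Z n \<omega>)))"
  define \<Lambda> where "\<Lambda> \<theta> = 1/2 * (\<theta> \<bullet> (C *v \<theta>))" for \<theta> :: "real^'m"
  have mpos: "?m n \<theta> > 0" for n \<theta>
    by (rule expectation_exp_pos[OF int])
  have main: "ereal (- rate_function C u) - ereal \<delta> \<le> liminf ?L" if u: "u \<in> interior A" and \<delta>: "\<delta> > 0" for u \<delta>
  proof -
    define \<theta> where "\<theta> = matrix_inv C *v u"
    have C\<theta>: "C *v \<theta> = u"
      unfolding \<theta>_def using invertible_matrix_inv_right[OF inv] by (simp add: matrix_vector_mul_assoc)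
    have I: "rate_function C u = \<theta> \<bullet> u - \<Lambda> \<theta>"
      unfolding rate_function_def \<Lambda>_def C\<theta> by (simp add: \<theta>_def inner_commute)
    obtain e0 where e0: "e0 > 0" "ball u e0 \<subseteq> A" using u by (auto simp: mem_interior)
    define e where "e = min e0 (\<delta> / (4 * (norm \<theta> + 1)))"
    have e: "e > 0" "ball u e \<subseteq> A" and e\<theta>: "e * norm \<theta> \<le> \<delta> / 4"
    proof -
      show "e > 0" "ball u e \<subseteq> A" using e0 \<delta> unfolding e_def by (auto simp: add_nonneg_pos)
      have "e * norm \<theta> \<le> \<delta> / (4 * (norm \<theta> + 1)) * norm \<theta>" unfolding e_def by (intro mult_right_mono) auto
      also have "\<dots> = \<delta> / 4 * (norm \<theta> / (norm \<theta> + 1))" by simp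
      also have "\<dots> \<le> \<delta> / 4 * 1" using \<delta> by (intro mult_left_mono) (auto simp: add_nonneg_pos)
      finally show "e * norm \<theta> \<le> \<delta> / 4" by simp
    qed
    define e' where "e' = e / (2 * real CARD('m))"
    have e': "e' > 0" using e by (simp add: e'_def)
    define cc where "cc = (MAX i. \<bar>\<Lambda> (axis i 1)\<bar>) + 1"
    have cc: "\<Lambda> (axis i 1) \<le> cc - 1" "cc \<ge> 1" for i :: 'm
    proof -
      have "\<bar>\<Lambda> (axis i 1)\<bar> \<le> (MAX i. \<bar>\<Lambda> (axis i 1)\<bar>)" for i :: 'm by (rule Max_ge) auto
      from this[of i] show "\<Lambda> (axis i 1) \<le> cc - 1" "cc \<ge> 1" unfolding cc_def by linarith+
    qed
    \<comment> \<open>Size of the additional tilt in a coordinate direction: its linear gain \<open>s * e'\<close> has to beat its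
    quadratic cost, which is at most \<open>s\<^sup>2 * cc = s * e' / 2\<close>.\<close>
    define s where "s = e' / (2 * cc)"
    have s: "s > 0" "s * s * cc = s * e' / 2" using e' cc by (auto simp: s_def field_simps)
    define D :: "(real^'m) set" where "D = range (\<lambda>i. axis i 1) \<union> range (\<lambda>i. - axis i 1)"
    have D: "finite D" by (auto simp: D_def)
    have expand: "\<Lambda> (\<theta> + s *\<^sub>R w) - \<Lambda> \<theta> - s * (w \<bullet> u) = s * s * \<Lambda> w" for w
    proof -
      have "(\<theta> + s *\<^sub>R w) \<bullet> (C *v (\<theta> + s *\<^sub>R w)) = \<theta> \<bullet> u + 2 * s * (w \<bullet> u) + s * s * (w \<bullet> (C *v w))"
        using C\<theta> sym[of \<theta> w]
        by (simp add: matrix_vector_right_distrib inner_add_left inner_add_right matrix_vector_mult_scaleR algebra_simps)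
      thus ?thesis unfolding \<Lambda>_def C\<theta> by (simp add: algebra_simps)
    qed
    have \<Lambda>D: "\<Lambda> w \<le> cc - 1" if "w \<in> D" for w
    proof -
      have "\<Lambda> (- v) = \<Lambda> v" for v unfolding \<Lambda>_def by (simp add: linear_neg[OF matrix_vector_mul_linear])
      thus ?thesis using that cc by (auto simp: D_def)
    qed
    define \<eta> where "\<eta> = s * e' / 2"
    have \<eta>: "\<eta> > 0" using s e' by (simp add: \<eta>_def)
    have "\<forall>\<^sub>F n in sequentially. \<forall>w\<in>D. ln (?m n (\<theta> + s *\<^sub>R w)) / a n < \<Lambda> (\<theta> + s *\<^sub>R w) + \<eta> / 4"
      using D \<eta> by (auto simp: eventually_ball_finite_distrib \<Lambda>_def intro!: order_tendstoD(2)[OF lim])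
    moreover have "\<forall>\<^sub>F n in sequentially. \<Lambda> \<theta> - min (\<eta> / 4) (\<delta> / 4) < ln (?m n \<theta>) / a n"
      using \<eta> \<delta> by (intro order_tendstoD(1)[OF lim]) (auto simp: \<Lambda>_def)
    moreover have "\<forall>\<^sub>F n in sequentially. max 1 (max (2 * ln (2 * real (card D) + 2) / \<eta>) (4 * ln 2 / \<delta>)) \<le> a n"
      using filterlim_at_top_eventually_ge[OF a] .
    ultimately have "\<forall>\<^sub>F n in sequentially. ereal (- rate_function C u - \<delta>) \<le> ?L n"
    proof eventually_elim
      case (elim n)
      hence an: "a n > 0" and an2: "ln (2 * real (card D) + 2) \<le> a n * (\<eta>/2)" and an3: "ln 2 \<le> a n * (\<delta>/4)"
        using \<eta> \<delta> by (auto simp: field_simps)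
      let ?p = "prob {\<omega>\<in>space M. Z n \<omega> \<in> A}"
      let ?f = "\<lambda>\<omega>. exp (a n * (\<theta> \<bullet> Z n \<omega>))"
      let ?g = "\<lambda>w \<omega>. exp (- (a n * s * (w \<bullet> u + e'))) * exp (a n * ((\<theta> + s *\<^sub>R w) \<bullet> Z n \<omega>))"
      \<comment> \<open>Outside the ball one of the \<open>?g w\<close> dominates \<open>?f\<close>, and each is negligible in mean.\<close>
      have gE: "expectation (?g w) \<le> exp (- (a n * (\<eta>/2))) * ?m n \<theta>" if w: "w \<in> D" for w
      proof -
        have "expectation (?g w) = exp (- (a n * s * (w \<bullet> u + e'))) * ?m n (\<theta> + s *\<^sub>R w)" by simp
        also have "?m n (\<theta> + s *\<^sub>R w) = exp (ln (?m n (\<theta> + s *\<^sub>R w)))" using mpos by simp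
        also have "ln (?m n (\<theta> + s *\<^sub>R w)) \<le> a n * (\<Lambda> (\<theta> + s *\<^sub>R w) + \<eta> / 4)"
          using elim(1) w an by (auto simp: field_simps)
        also have "\<Lambda> (\<theta> + s *\<^sub>R w) = \<Lambda> \<theta> + s * (w \<bullet> u) + s * s * \<Lambda> w" using expand[of w] by simp
        also have "s * s * \<Lambda> w \<le> \<eta>"
        proof -
          have "s * s * \<Lambda> w \<le> s * s * cc" using \<Lambda>D[OF w] s by (intro mult_left_mono) auto
          thus ?thesis using s by (simp add: \<eta>_def)
        qed
        also have "\<Lambda> \<theta> \<le> ln (?m n \<theta>) / a n + \<eta> / 4" using elim(2) by linarith
        finally have "expectation (?g w) \<le> exp (- (a n * s * (w \<bullet> u + e'))) *
           exp (a n * (ln (?m n \<theta>) / a n + \<eta> / 4 + s * (w \<bullet> u) + \<eta> + \<eta> / 4))"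
          using an by simp
        also have "\<dots> = exp (ln (?m n \<theta>) + a n * (\<eta> / 4 + \<eta> + \<eta> / 4 - s * e'))"
          using an by (simp add: exp_add[symmetric] algebra_simps)
        also have "s * e' = 2 * \<eta>" by (simp add: \<eta>_def)
        also have "exp (ln (?m n \<theta>) + a n * (\<eta> / 4 + \<eta> + \<eta> / 4 - 2 * \<eta>)) = exp (- (a n * (\<eta>/2))) * ?m n \<theta>"
        proof -
          have "ln (?m n \<theta>) + a n * (\<eta> / 4 + \<eta> + \<eta> / 4 - 2 * \<eta>) = - (a n * (\<eta>/2)) + ln (?m n \<theta>)"
            by (simp add: field_simps)
          thus ?thesis using mpos[of n \<theta>] by (simp only: exp_add exp_ln)
        qed
        finally show ?thesis .
      qed
      have pt: "?f \<omega> \<le> exp (a n * (\<theta> \<bullet> u + e * norm \<theta>)) * indicat_real {\<omega>\<in>space M. Z n \<omega> \<in> A} \<omega> + (\<Sum>w\<in>D. ?g w \<omega>)"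
        if \<omega>: "\<omega> \<in> space M" for \<omega>
      proof (cases "Z n \<omega> \<in> ball u e")
        case True
        have "\<theta> \<bullet> Z n \<omega> = \<theta> \<bullet> u + \<theta> \<bullet> (Z n \<omega> - u)" by (simp add: inner_diff_right)
        also have "\<theta> \<bullet> (Z n \<omega> - u) \<le> norm \<theta> * norm (Z n \<omega> - u)" by (rule norm_cauchy_schwarz)
        also have "\<dots> \<le> norm \<theta> * e" using True by (intro mult_left_mono) (auto simp: dist_norm norm_minus_commute)
        finally have "?f \<omega> \<le> exp (a n * (\<theta> \<bullet> u + e * norm \<theta>))" using an by (simp add: mult.commute)
        moreover have "0 \<le> (\<Sum>w\<in>D. ?g w \<omega>)" by (intro sum_nonneg) simp
        moreover have "indicat_real {\<omega>\<in>space M. Z n \<omega> \<in> A} \<omega> = 1" using True e \<omega> by auto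
        ultimately show ?thesis by (simp only: mult_1_right)
      next
        case False
        have "\<exists>i. e' \<le> \<bar>(Z n \<omega> - u) $ i\<bar>"
        proof (rule ccontr)
          assume "\<not> ?thesis"
          hence lt: "\<bar>(Z n \<omega> - u) $ i\<bar> < e'" for i by (meson not_le)
          have "norm (Z n \<omega> - u) \<le> (\<Sum>i\<in>UNIV. \<bar>(Z n \<omega> - u) $ i\<bar>)" by (rule norm_le_l1_cart)
          also have "\<dots> \<le> (\<Sum>i\<in>(UNIV::'m set). e')" using lt by (intro sum_mono less_imp_le) auto
          also have "\<dots> < e" using e by (simp add: e'_def)
          finally show False using False by (simp add: dist_norm norm_minus_commute)
        qed
        then obtain i where "e' \<le> \<bar>(Z n \<omega> - u) $ i\<bar>" by auto
        hence "\<exists>w\<in>D. e' \<le> w \<bullet> (Z n \<omega> - u)"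
        proof (cases "0 \<le> (Z n \<omega> - u) $ i")
          case True
          with \<open>e' \<le> _\<close> have "e' \<le> axis i 1 \<bullet> (Z n \<omega> - u)" by (simp add: inner_axis')
          thus ?thesis unfolding D_def by blast
        next
          case False
          with \<open>e' \<le> _\<close> have "e' \<le> (- axis i 1) \<bullet> (Z n \<omega> - u)"
            by (simp add: inner_axis')
          thus ?thesis unfolding D_def by blast
        qed
        then obtain w where w: "w \<in> D" "e' \<le> w \<bullet> (Z n \<omega> - u)" by auto
        have "0 \<le> a n * s * (w \<bullet> (Z n \<omega> - u) - e')" using w an s by simp
        hence "?f \<omega> \<le> ?g w \<omega>"
          by (simp add: exp_add[symmetric] inner_diff_right inner_add_left algebra_simps)
        also have "\<dots> \<le> (\<Sum>w\<in>D. ?g w \<omega>)" using w D by (intro member_le_sum) auto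
        finally show ?thesis by (auto simp: indicator_def add_increasing)
      qed
      have intg: "integrable M (?g w)" for w using int[of n "\<theta> + s *\<^sub>R w"] by simp
      have inti: "integrable M (indicat_real {\<omega>\<in>space M. Z n \<omega> \<in> A})" by (auto simp: emeasure_eq_measure)
      have "?m n \<theta> \<le> expectation (\<lambda>\<omega>. exp (a n * (\<theta> \<bullet> u + e * norm \<theta>)) * indicat_real {\<omega>\<in>space M. Z n \<omega> \<in> A} \<omega> + (\<Sum>w\<in>D. ?g w \<omega>))"
        using int[of n \<theta>] intg inti pt by (intro integral_mono Bochner_Integration.integrable_add integrable_mult_right Bochner_Integration.integrable_sum) auto
      also have "\<dots> = exp (a n * (\<theta> \<bullet> u + e * norm \<theta>)) * ?p + (\<Sum>w\<in>D. expectation (?g w))"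
        using intg inti by (subst Bochner_Integration.integral_add) (auto intro!: integrable_mult_right Bochner_Integration.integrable_sum simp: Bochner_Integration.integral_sum[OF intg] simp del: integral_mult_right_zero)
      also have "(\<Sum>w\<in>D. expectation (?g w)) \<le> (\<Sum>w\<in>D. exp (- (a n * (\<eta>/2))) * ?m n \<theta>)"
        using gE by (rule sum_mono)
      also have "\<dots> = real (card D) * exp (- (a n * (\<eta>/2))) * ?m n \<theta>" by simp
      also have "real (card D) * exp (- (a n * (\<eta>/2))) \<le> 1/2"
      proof -
        have "2 * real (card D) + 2 \<le> exp (a n * (\<eta>/2))"
        proof -
          have "exp (ln (2 * real (card D) + 2)) \<le> exp (a n * (\<eta>/2))" using an2 by (simp only: exp_le_cancel_iff)
          thus ?thesis by simp
        qed
        hence "(2 * real (card D)) * exp (- (a n * (\<eta>/2))) \<le> exp (a n * (\<eta>/2)) * exp (- (a n * (\<eta>/2)))"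
          by (intro mult_right_mono) auto
        thus ?thesis by (simp add: exp_minus)
      qed
      finally have "?m n \<theta> \<le> exp (a n * (\<theta> \<bullet> u + e * norm \<theta>)) * ?p + 1/2 * ?m n \<theta>"
        using mpos[of n \<theta>] by (simp add: mult_right_mono)
      hence "?m n \<theta> / 2 \<le> exp (a n * (\<theta> \<bullet> u + e * norm \<theta>)) * ?p" by simp
      hence "exp (- (a n * (\<theta> \<bullet> u + e * norm \<theta>))) * (?m n \<theta> / 2)
          \<le> exp (- (a n * (\<theta> \<bullet> u + e * norm \<theta>))) * (exp (a n * (\<theta> \<bullet> u + e * norm \<theta>)) * ?p)"
        by (intro mult_left_mono) auto
      hence p: "?p \<ge> exp (- (a n * (\<theta> \<bullet> u + e * norm \<theta>))) * (?m n \<theta> / 2)"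
        by (simp only: mult.assoc[symmetric] exp_add[symmetric]) simp
      have "?m n \<theta> / 2 > 0" using mpos by simp
      with p have ppos: "?p > 0" by (smt (verit) exp_gt_zero mult_pos_pos)
      have "ln ?p \<ge> ln (exp (- (a n * (\<theta> \<bullet> u + e * norm \<theta>))) * (?m n \<theta> / 2))"
        using p ppos mpos by (subst ln_le_cancel_iff) auto
      also have "ln (exp (- (a n * (\<theta> \<bullet> u + e * norm \<theta>))) * (?m n \<theta> / 2)) = - (a n * (\<theta> \<bullet> u + e * norm \<theta>)) + (ln (?m n \<theta>) - ln 2)"
        using mpos[of n \<theta>] by (simp add: ln_mult ln_div)
      finally have "(- (a n * (\<theta> \<bullet> u + e * norm \<theta>)) + (ln (?m n \<theta>) - ln 2)) / a n \<le> ln ?p / a n"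
        using an by (intro divide_right_mono) auto
      hence "ln ?p / a n \<ge> - (\<theta> \<bullet> u) - e * norm \<theta> + ln (?m n \<theta>) / a n - ln 2 / a n"
        using an by (simp add: add_divide_distrib diff_divide_distrib distrib_left)
      moreover have "ln 2 / a n \<le> \<delta>/4" using an3 an by (simp add: field_simps)
      ultimately have "ln ?p / a n \<ge> - rate_function C u - \<delta>"
        unfolding I using e\<theta> elim(2) min.cobounded2[of "\<eta> / 4" "\<delta> / 4"] \<delta> by linarith
      thus ?case using ppos by (simp add: log_prob_def)
    qed
    thus ?thesis by (intro Liminf_bounded) simp
  qed
  have "- ereal (rate_function C u) \<le> liminf ?L" if u: "u \<in> interior A" for u
  proof (rule ereal_le_epsilon2)
    fix e :: real assume e: "0 < e"
    show "- ereal (rate_function C u) \<le> liminf ?L + ereal e"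
      using main[OF u e] by (cases "liminf ?L") auto
  qed
  hence "- liminf ?L \<le> (INF u\<in>interior A. ereal (rate_function C u))"
    by (intro INF_greatest) (simp only: ereal_uminus_le_reorder)
  thus ?thesis by (simp only: ereal_uminus_le_reorder)
qed

section \<open>Components of labelled configurations\<close>

text \<open>A path that leaves \<open>U\<close> must do so along some edge.\<close>
lemma connected_complex_cut:
  assumes "connected_complex K" "U \<subseteq> \<Union>K" "U \<noteq> {}" "U \<noteq> \<Union>K"
  obtains a b where "a \<in> U" "b \<in> \<Union>K - U" "{a, b} \<in> K"
proof -
  obtain u v where u: "u \<in> U" and v: "v \<in> \<Union>K" "v \<notin> U" using assms by blast
  hence "(u, v) \<in> {(a, b). {a, b} \<in> K}\<^sup>*" using assms unfolding connected_complex_def by blast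
  hence "v \<notin> U \<longrightarrow> (\<exists>a b. a \<in> U \<and> b \<notin> U \<and> {a, b} \<in> K)"
  proof (induction rule: rtrancl_induct)
    case base thus ?case using u by simp
  next
    case (step y z) thus ?case by blast
  qed
  then obtain a b where ab: "a \<in> U" "b \<notin> U" "{a, b} \<in> K" using v by blast
  hence "b \<in> \<Union>K" by blast
  thus thesis using ab that by blast
qed

text \<open>The edge found in \<open>L\<close> is the image of a simplex of \<open>K\<close>, which has exactly two vertices because an
  isomorphism is injective on vertices.\<close>
lemma complex_iso_cut:
  assumes iso: "complex_iso K L" and L: "connected_complex L"
    and U: "U \<subseteq> \<Union>K" "U \<noteq> {}" "U \<noteq> \<Union>K"
  obtains a b where "a \<in> U" "b \<in> \<Union>K - U" "{a, b} \<in> K"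
proof -
  obtain f where f: "bij_betw f (\<Union>K) (\<Union>L)" and KL: "(\<lambda>\<sigma>. f ` \<sigma>) ` K = L"
    using iso unfolding complex_iso_def by blast
  have inj: "inj_on f (\<Union>K)" and img: "f ` (\<Union>K) = \<Union>L" using f by (auto simp: bij_betw_def)
  have "f ` U \<subseteq> \<Union>L" "f ` U \<noteq> {}" using U img by blast+
  moreover have "f ` U \<noteq> \<Union>L"
    using U inj img inj_on_image_eq_iff[OF inj U(1) order_refl] by blast
  ultimately obtain c d where cd: "c \<in> f ` U" "d \<in> \<Union>L - f ` U" "{c, d} \<in> L"
    using connected_complex_cut[OF L] by metis
  obtain \<sigma> where \<sigma>: "\<sigma> \<in> K" "f ` \<sigma> = {c, d}" using cd(3) KL by blast
  obtain a where a: "a \<in> U" "f a = c" using cd by blast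
  have "c \<in> f ` \<sigma>" "d \<in> f ` \<sigma>" using \<sigma> by auto
  then obtain a' b where a': "a' \<in> \<sigma>" "f a' = c" and b: "b \<in> \<sigma>" "f b = d" by blast
  have sub: "\<sigma> \<subseteq> \<Union>K" using \<sigma> by blast
  have "a' = a" using inj a a' U(1) sub unfolding inj_on_def by blast
  have "\<sigma> = {a, b}"
  proof
    show "{a, b} \<subseteq> \<sigma>" using a' b \<open>a' = a\<close> by simp
    show "\<sigma> \<subseteq> {a, b}"
    proof
      fix z assume z: "z \<in> \<sigma>"
      hence "f z = c \<or> f z = d" using \<sigma> by blast
      thus "z \<in> {a, b}" using inj z a' b sub \<open>a' = a\<close> unfolding inj_on_def by blast
    qed
  qed
  moreover have "b \<notin> U" using b cd by blast
  ultimately show thesis using that[of a b] a b \<sigma> sub by blast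
qed

lemma Union_cech_complex:
  assumes "s \<ge> 0" shows "\<Union>(cech_complex X s) = X"
proof -
  have "{x} \<in> cech_complex X s" if "x \<in> X" for x using that assms unfolding cech_complex_def by auto
  hence "X \<subseteq> \<Union>(cech_complex X s)" by blast
  moreover have "\<sigma> \<subseteq> X" if "\<sigma> \<in> cech_complex X s" for \<sigma> using that by (simp add: cech_complex_def)
  hence "\<Union>(cech_complex X s) \<subseteq> X" by blast
  ultimately show ?thesis by simp
qed

lemma cech_edge_dist:
  assumes "{a, b} \<in> cech_complex X s" shows "dist a b \<le> s"
proof -
  obtain z where "dist a z \<le> s/2" "dist b z \<le> s/2" using assms unfolding cech_complex_def by auto
  thus ?thesis using dist_triangle2[of a b z] by linarith
qed

text \<open>Cover the unit ball by finitely many balls of radius \<open>1/2\<close>; after rescaling, points with mutual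
  distance larger than \<open>s\<close> lie in different ones. The bound holds for all centres and radii at once.\<close>
lemma cell_packing:
  obtains K :: nat where "\<And>(z :: 'a::euclidean_space) s S. s > 0 \<Longrightarrow> finite S \<Longrightarrow> S \<subseteq> cball z s
    \<Longrightarrow> (\<And>x y. x \<in> S \<Longrightarrow> y \<in> S \<Longrightarrow> x \<noteq> y \<Longrightarrow> s < dist x y) \<Longrightarrow> card S \<le> K"
proof -
  have "\<exists>T. T \<subseteq> cball (0::'a) 1 \<and> finite T \<and> cball 0 1 \<subseteq> (\<Union>c\<in>T. ball c (1/2))"
  proof -
    have "cball (0::'a) 1 \<subseteq> (\<Union>c\<in>cball 0 1. ball c (1/2))" by auto
    thus ?thesis using compactE_image[OF compact_cball, of "cball (0::'a) 1" "\<lambda>c. ball c (1/2)"] by (metis open_ball)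
  qed
  then obtain T :: "'a set" where T: "finite T" "cball 0 1 \<subseteq> (\<Union>c\<in>T. ball c (1/2))" by blast
  show thesis
  proof (rule that[of "card T"])
    fix z :: 'a and s :: real and S
    assume s: "s > 0" and S: "finite S" "S \<subseteq> cball z s" and sep: "\<And>x y. x \<in> S \<Longrightarrow> y \<in> S \<Longrightarrow> x \<noteq> y \<Longrightarrow> s < dist x y"
    define g where "g x = (1/s) *\<^sub>R (x - z)" for x
    have "\<exists>c\<in>T. g x \<in> ball c (1/2)" if "x \<in> S" for x
    proof -
      have "g x \<in> cball 0 1" using that S s by (auto simp: g_def dist_norm norm_minus_commute divide_simps)
      thus ?thesis using T by blast
    qed
    then obtain c where c: "\<And>x. x \<in> S \<Longrightarrow> c x \<in> T \<and> g x \<in> ball (c x) (1/2)" by metis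
    have "inj_on c S"
    proof (rule inj_onI, rule ccontr)
      fix x y assume xy: "x \<in> S" "y \<in> S" "c x = c y" "x \<noteq> y"
      have "dist (g x) (g y) < 1" using c[OF xy(1)] c[OF xy(2)] xy(3) dist_triangle_half_r[of "c x" "g x" 1 "g y"] by simp
      also have "dist (g x) (g y) = dist x y / s"
      proof -
        have "g x - g y = (1/s) *\<^sub>R (x - y)" by (simp add: g_def algebra_simps)
        thus ?thesis using s by (simp add: dist_norm)
      qed
      finally have "dist x y < s" using s by simp
      thus False using sep[OF xy(1,2,4)] by simp
    qed
    thus "card S \<le> card T" using c T by (intro card_inj_on_le[of c]) auto
  qed
qed

locale cech_shapes =
  fixes k :: nat and t :: "real^'m" and G :: "'m \<Rightarrow> (real^'d) set set"
  assumes k2: "k \<ge> 2" and t_pos: "\<And>i. t $ i > 0"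
    and conn: "\<And>i. connected_cech_complex_on k (G i)"
begin

text \<open>Points carry labels, and shapes and components are described by sets of labels: this makes
  resampling of single points easy to express.\<close>
definition shape :: "'m \<Rightarrow> nat set \<Rightarrow> (nat \<Rightarrow> real^'d) \<Rightarrow> bool" where
  "shape i J x \<longleftrightarrow> complex_iso (cech_complex (x ` J) (t $ i)) (G i)"

text \<open>Isolation is imposed with a strict inequality, and only distances between distinct labels
  enter. Almost surely, this agrees with the non-strict condition on point sets
  (\<open>component_counts_generic\<close>).\<close>
definition comps :: "'m \<Rightarrow> nat set \<Rightarrow> (nat \<Rightarrow> real^'d) \<Rightarrow> nat set set" where
  "comps i I x = {J. J \<subseteq> I \<and> card J = k \<and> shape i J x \<and> (\<forall>a\<in>J. \<forall>b\<in>I - J. t $ i < dist (x a) (x b))}"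

definition cnt :: "'m \<Rightarrow> nat set \<Rightarrow> (nat \<Rightarrow> real^'d) \<Rightarrow> real" where
  "cnt i I x = real (card (comps i I x))"

definition tmax :: real where "tmax = (MAX i. t $ i)"

lemma tmax: "t $ i \<le> tmax"
proof -
  have "finite (range (($) t))" by (rule finite_imageI) simp
  thus ?thesis unfolding tmax_def by (rule Max_ge) (rule rangeI)
qed

lemma tmax_pos: "tmax > 0"
  by (rule less_le_trans[OF t_pos tmax])

lemma card_k_finite: "card J = k \<Longrightarrow> finite J"
  using k2 card.infinite[of J] by (metis not_numeral_le_zero)

lemma finite_comps: "finite I \<Longrightarrow> finite (comps i I x)"
  by (rule finite_subset[of _ "Pow I"]) (simp_all add: comps_def Collect_mono subsetI, blast)

lemma connected_G: "connected_complex (G i)" and card_G: "card (\<Union>(G i)) = k"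
proof -
  obtain X s where X: "card X = k" "s > 0" "G i = cech_complex X s" and c: "connected_complex (G i)"
    using conn[of i] unfolding connected_cech_complex_on_def by blast
  show "connected_complex (G i)" by (rule c)
  show "card (\<Union>(G i)) = k" using X Union_cech_complex[of s X] by simp
qed

lemma shape_inj:
  assumes "shape i J x" "card J = k" shows "inj_on x J"
proof -
  have "card (x ` J) = k"
  proof -
    obtain f where "bij_betw f (\<Union>(cech_complex (x ` J) (t $ i))) (\<Union>(G i))"
      using assms(1) unfolding shape_def complex_iso_def by blast
    hence "card (\<Union>(cech_complex (x ` J) (t $ i))) = k" using bij_betw_same_card card_G[of i] by metis
    thus ?thesis using Union_cech_complex[of "t $ i" "x ` J"] t_pos[of i] by simp
  qed
  moreover have "finite J" using assms(2) by (rule card_k_finite)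
  ultimately show ?thesis using assms by (simp add: eq_card_imp_inj_on)
qed

lemma shape_cut:
  assumes s: "shape i J x" and U: "U \<subseteq> J" "U \<noteq> {}" "U \<noteq> J" "card J = k"
  obtains a b where "a \<in> U" "b \<in> J - U" "dist (x a) (x b) \<le> t $ i"
proof -
  have inj: "inj_on x J" using shape_inj[OF s U(4)] .
  have un: "\<Union>(cech_complex (x ` J) (t $ i)) = x ` J" using t_pos[of i] by (simp add: Union_cech_complex)
  have ne: "x ` U \<noteq> x ` J" using U inj by (simp add: inj_on_image_eq_iff)
  obtain p q where pq: "p \<in> x ` U" "q \<in> x ` J - x ` U" "{p, q} \<in> cech_complex (x ` J) (t $ i)"
  proof (rule complex_iso_cut[OF s[unfolded shape_def] connected_G, of "x ` U"])
    show "x ` U \<subseteq> \<Union>(cech_complex (x ` J) (t $ i))" unfolding un using U(1) by blast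
    show "x ` U \<noteq> {}" using U(2) by blast
    show "x ` U \<noteq> \<Union>(cech_complex (x ` J) (t $ i))" unfolding un by (rule ne)
  qed (auto simp: un)
  obtain a b where ab: "a \<in> U" "p = x a" "b \<in> J - U" "q = x b" using pq by blast
  thus thesis using that cech_edge_dist[OF pq(3)] by blast
qed

text \<open>As long as the labels reached within distance \<open>j * t\<close> of \<open>a\<close> do not exhaust \<open>J\<close>, connectedness
  provides one more within distance \<open>(j + 1) * t\<close>.\<close>
lemma shape_diameter:
  assumes s: "shape i J x" and J: "card J = k" and ab: "a \<in> J" "b \<in> J"
  shows "dist (x a) (x b) \<le> real k * t $ i"
proof -
  have fin: "finite J" using J card_k_finite by blast
  define W where "W j = {c\<in>J. dist (x a) (x c) \<le> real j * t $ i}" for j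
  have W: "W j = J \<or> j + 1 \<le> card (W j)" for j
  proof (induction j)
    case 0
    have "a \<in> W 0" "finite (W 0)" using ab fin by (auto simp: W_def)
    hence "0 < card (W 0)" by (auto simp: card_gt_0_iff)
    thus ?case by simp
  next
    case (Suc j)
    have mono: "W j \<subseteq> W (Suc j)"
      unfolding W_def using t_pos[of i] by (auto simp: algebra_simps intro: order_trans)
    show ?case
    proof (cases "W j = J")
      case True thus ?thesis using mono by (auto simp: W_def)
    next
      case False
      have aW: "a \<in> W j" using ab t_pos[of i] by (auto simp: W_def)
      obtain c d where cd: "c \<in> W j" "d \<in> J - W j" "dist (x c) (x d) \<le> t $ i"
      proof (rule shape_cut[OF s, of "W j"])
        show "W j \<subseteq> J" by (auto simp: W_def)
      qed (use False J aW in auto)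
      have "dist (x a) (x d) \<le> real (Suc j) * t $ i"
        using cd dist_triangle[of "x a" "x d" "x c"] by (auto simp: W_def algebra_simps)
      hence "d \<in> W (Suc j)" using cd by (simp add: W_def)
      hence "insert d (W j) \<subseteq> W (Suc j)" using mono by simp
      hence "card (insert d (W j)) \<le> card (W (Suc j))"
        using fin by (intro card_mono) (auto simp: W_def)
      moreover have "card (insert d (W j)) = Suc (card (W j))"
        using cd fin by (intro card_insert_disjoint) (auto simp: W_def)
      ultimately show ?thesis using Suc False by simp
    qed
  qed
  have "card (W k) \<le> k" using fin J card_mono[of J "W k"] by (auto simp: W_def)
  hence "W k = J" using W[of k] by linarith
  thus ?thesis using ab by (auto simp: W_def)
qed

lemma shape_cong:
  assumes "\<And>a. a \<in> J \<Longrightarrow> x a = y a" shows "shape i J x \<longleftrightarrow> shape i J y"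
proof -
  have "x ` J = y ` J" using assms by (intro image_cong) auto
  thus ?thesis by (simp add: shape_def)
qed

lemma comps_cong:
  assumes "\<And>a. a \<in> I \<Longrightarrow> x a = y a" shows "comps i I x = comps i I y"
proof -
  have "J \<in> comps i I x \<longleftrightarrow> J \<in> comps i I y" for J
  proof (cases "J \<subseteq> I")
    case True
    hence "shape i J x = shape i J y" using assms by (intro shape_cong) auto
    thus ?thesis using True assms by (auto simp: comps_def subset_iff)
  qed (auto simp: comps_def)
  thus ?thesis by blast
qed

text \<open>Two different components sharing a label would be cut by an edge, contradicting isolation.\<close>
lemma comps_overlap_eq:
  assumes J: "J \<in> comps i I x" and J': "J' \<in> comps i I x" and ne: "J \<inter> J' \<noteq> {}"
  shows "J = J'"
proof (rule ccontr)
  assume "J \<noteq> J'"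
  have fin: "finite J" "finite J'" using J J' card_k_finite by (auto simp: comps_def)
  have "\<not> J \<subseteq> J'" using J J' \<open>J \<noteq> J'\<close> fin card_subset_eq[of J' J] by (auto simp: comps_def)
  then obtain a b where ab: "a \<in> J \<inter> J'" "b \<in> J - J \<inter> J'" "dist (x a) (x b) \<le> t $ i"
    using shape_cut[of i J x "J \<inter> J'"] J ne by (auto simp: comps_def)
  have "a \<in> J'" "b \<in> I - J'" using ab J by (auto simp: comps_def)
  hence "t $ i < dist (x a) (x b)" using J' unfolding comps_def by blast
  thus False using ab(3) by simp
qed

text \<open>A new point destroys the components it is close to and creates only components containing it.\<close>
lemma comps_insert_decomp:
  assumes "a \<notin> I"
  shows "comps i (insert a I) x = {J \<in> comps i (insert a I) x. a \<in> J} \<union>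
      {J \<in> comps i I x. \<forall>b\<in>J. t $ i < dist (x b) (x a)}"
  using assms by (auto simp: comps_def)

text \<open>By \<open>comps_overlap_eq\<close> at most one component contains the new point. The destroyed components
  each have a point within \<open>t\<close> of the new one, and these points have mutual distance larger than \<open>t\<close>,
  so their number is bounded by \<open>cell_packing\<close>.\<close>
lemma packing_constant:
  obtains K :: nat where "\<And>i a I x. finite I \<Longrightarrow> a \<notin> I \<Longrightarrow> \<bar>cnt i (insert a I) x - cnt i I x\<bar> \<le> real K"
proof -
  obtain K :: nat where K: "\<And>(z :: real^'d) s S. s > 0 \<Longrightarrow> finite S \<Longrightarrow> S \<subseteq> cball z s
    \<Longrightarrow> (\<And>x y. x \<in> S \<Longrightarrow> y \<in> S \<Longrightarrow> x \<noteq> y \<Longrightarrow> s < dist x y) \<Longrightarrow> card S \<le> K"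
    using cell_packing by metis
  show thesis
  proof (rule that[of "K + 1"])
    fix i :: 'm and a :: nat and I and x :: "nat \<Rightarrow> real^'d"
    assume I: "finite I" "a \<notin> I"
    define N where "N = {J \<in> comps i (insert a I) x. a \<in> J}"
    define L where "L = {J \<in> comps i I x. \<not> (\<forall>b\<in>J. t $ i < dist (x b) (x a))}"
    define R where "R = {J \<in> comps i I x. \<forall>b\<in>J. t $ i < dist (x b) (x a)}"
    have fin: "finite N" "finite L" "finite R"
      using finite_comps[of I i x] finite_comps[of "insert a I" i x] I by (auto simp: N_def L_def R_def)
    have "comps i (insert a I) x = N \<union> R" "N \<inter> R = {}"
      using comps_insert_decomp[OF I(2), of i x] I(2) unfolding N_def R_def by (auto simp: comps_def)
    hence 1: "card (comps i (insert a I) x) = card N + card R" using fin by (simp add: card_Un_disjoint)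
    have "comps i I x = L \<union> R" "L \<inter> R = {}" unfolding L_def R_def by auto
    hence 2: "card (comps i I x) = card L + card R" using fin by (simp add: card_Un_disjoint)
    have "J = J'" if "J \<in> N" "J' \<in> N" for J J'
      using that unfolding N_def by (intro comps_overlap_eq) auto
    hence N: "card N \<le> 1" using fin by (metis One_nat_def card_le_Suc0_iff_eq)
    have "\<exists>b\<in>J. dist (x b) (x a) \<le> t $ i" if "J \<in> L" for J using that by (auto simp: L_def not_less)
    then obtain b where b: "\<And>J. J \<in> L \<Longrightarrow> b J \<in> J \<and> dist (x (b J)) (x a) \<le> t $ i" by metis
    have sep: "t $ i < dist (x (b J)) (x (b J'))" if "J \<in> L" "J' \<in> L" "J \<noteq> J'" for J J'
    proof -
      have "J \<inter> J' = {}" using that comps_overlap_eq[of J i I x J'] by (auto simp: L_def)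
      hence "b J' \<in> I - J" using that b[of J'] by (auto simp: L_def comps_def)
      thus ?thesis using that b[of J] by (auto simp: L_def comps_def)
    qed
    have "inj_on (\<lambda>J. x (b J)) L"
    proof (rule inj_onI, rule ccontr)
      fix J J' assume "J \<in> L" "J' \<in> L" "x (b J) = x (b J')" "J \<noteq> J'"
      thus False using sep[of J J'] t_pos[of i] by simp
    qed
    hence "card L = card ((\<lambda>J. x (b J)) ` L)" by (simp add: card_image)
    also have "\<dots> \<le> K"
    proof (rule K[of "t $ i" _ "x a"])
      show "(\<lambda>J. x (b J)) ` L \<subseteq> cball (x a) (t $ i)" using b by (auto simp: dist_commute)
      fix p q assume "p \<in> (\<lambda>J. x (b J)) ` L" "q \<in> (\<lambda>J. x (b J)) ` L" "p \<noteq> q"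
      thus "t $ i < dist p q" using sep by blast
    qed (use fin t_pos[of i] in auto)
    finally show "\<bar>cnt i (insert a I) x - cnt i I x\<bar> \<le> real (K + 1)"
      using 1 2 N unfolding cnt_def by linarith
  qed
qed

text \<open>The component that is created or destroyed has diameter at most \<open>k * tmax\<close> and contains, or comes
  within \<open>tmax\<close> of, the new point. So a new point changes the counts only if \<open>k - 1\<close> other points are
  close to it, which is a rare event in the sparse regime.\<close>
lemma cnt_insert_changed:
  assumes I: "finite I" "a \<notin> I" and ne: "cnt i (insert a I) x \<noteq> cnt i I x"
  obtains B where "B \<subseteq> I" "card B = k - 1" "\<forall>b\<in>B. dist (x b) (x a) \<le> (real k + 1) * tmax"
proof -
  have "comps i (insert a I) x \<noteq> comps i I x" using ne by (auto simp: cnt_def)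
  then consider J where "J \<in> comps i (insert a I) x" "a \<in> J"
    | J b where "J \<in> comps i I x" "b \<in> J" "dist (x b) (x a) \<le> t $ i"
    using comps_insert_decomp[OF I(2), of i x] by (force simp: not_less)
  thus thesis
  proof cases
    case 1
    show thesis
    proof (rule that[of "J - {a}"])
      show "J - {a} \<subseteq> I" using 1 by (auto simp: comps_def)
      show "card (J - {a}) = k - 1" using 1 by (auto simp: comps_def)
      show "\<forall>b\<in>J - {a}. dist (x b) (x a) \<le> (real k + 1) * tmax"
      proof
        fix b assume "b \<in> J - {a}"
        hence "dist (x b) (x a) \<le> real k * t $ i" using 1 by (intro shape_diameter) (auto simp: comps_def)
        also have "\<dots> \<le> (real k + 1) * tmax" using tmax[of i] t_pos[of i] by (intro mult_mono) auto
        finally show "dist (x b) (x a) \<le> (real k + 1) * tmax" .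
      qed
    qed
  next
    case 2
    have "k - 1 \<le> card J" using 2 by (auto simp: comps_def)
    then obtain B where B: "B \<subseteq> J" "card B = k - 1" using obtain_subset_with_card_n by metis
    show thesis
    proof (rule that[of B])
      show "B \<subseteq> I" using B 2 by (auto simp: comps_def)
      show "card B = k - 1" by fact
      show "\<forall>c\<in>B. dist (x c) (x a) \<le> (real k + 1) * tmax"
      proof
        fix c assume "c \<in> B"
        hence "dist (x c) (x b) \<le> real k * t $ i" using 2 B by (intro shape_diameter) (auto simp: comps_def)
        hence "dist (x c) (x a) \<le> (real k + 1) * t $ i"
          using dist_triangle[of "x c" "x a" "x b"] 2(3) by (simp add: algebra_simps)
        also have "\<dots> \<le> (real k + 1) * tmax" using tmax[of i] by (intro mult_left_mono) auto
        finally show "dist (x c) (x a) \<le> (real k + 1) * tmax" .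
      qed
    qed
  qed
qed

text \<open>No component can straddle \<open>J\<close> and its complement, as it would then contain an edge between them.\<close>
lemma comps_split:
  assumes J: "J \<subseteq> I" "card J = k" and far: "\<forall>a\<in>J. \<forall>b\<in>I - J. t $ i < dist (x a) (x b)"
  shows "comps i I x = (if shape i J x then {J} else {}) \<union> comps i (I - J) x"
proof -
  have fin: "finite J" using J card_k_finite by blast
  have disj: "J' = J \<or> J' \<subseteq> I - J" if J': "J' \<in> comps i I x" for J'
  proof (rule ccontr)
    assume H: "\<not> ?thesis"
    have fin': "finite J'" using J' card_k_finite by (auto simp: comps_def)
    have "J' \<inter> J \<noteq> {}" using H J' by (auto simp: comps_def)
    moreover have "J' \<inter> J \<noteq> J'"
    proof
      assume "J' \<inter> J = J'"
      hence "J' \<subseteq> J" by blast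
      moreover have "card J' = card J" using J J' by (simp add: comps_def)
      ultimately have "J' = J" using card_subset_eq[OF fin] by blast
      thus False using H by simp
    qed
    ultimately obtain a b where ab: "a \<in> J' \<inter> J" "b \<in> J' - J' \<inter> J" "dist (x a) (x b) \<le> t $ i"
      using shape_cut[of i J' x "J' \<inter> J"] J' by (auto simp: comps_def)
    have "a \<in> J" "b \<in> I - J" using ab J' by (auto simp: comps_def)
    hence "t $ i < dist (x a) (x b)" using far by blast
    thus False using ab(3) by simp
  qed
  show ?thesis
  proof (intro equalityI subsetI)
    fix J' assume J': "J' \<in> comps i I x"
    thus "J' \<in> (if shape i J x then {J} else {}) \<union> comps i (I - J) x"
      using disj[OF J'] by (auto simp: comps_def)
  next
    fix J' assume J': "J' \<in> (if shape i J x then {J} else {}) \<union> comps i (I - J) x"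
    have "t $ i < dist (x a) (x b)" if "J' \<in> comps i (I - J) x" "a \<in> J'" "b \<in> I - J'" for a b
    proof (cases "b \<in> J")
      case True
      moreover have "a \<in> I - J" using that by (auto simp: comps_def)
      ultimately show ?thesis using far by (auto simp: dist_commute)
    next
      case False
      thus ?thesis using that by (auto simp: comps_def)
    qed
    thus "J' \<in> comps i I x"
      using J J' far by (auto simp: comps_def split: if_splits)
  qed
qed

lemma cnt_split:
  assumes I: "finite I" and J: "J \<subseteq> I" "card J = k" and far: "\<forall>a\<in>J. \<forall>b\<in>I - J. t $ i < dist (x a) (x b)"
  shows "cnt i I x = of_bool (shape i J x) + cnt i (I - J) x"
proof -
  have "J \<noteq> {}" using J k2 by auto
  hence "(if shape i J x then {J} else {}) \<inter> comps i (I - J) x = {}" by (auto simp: comps_def)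
  moreover have "finite (comps i (I - J) x)" using I finite_comps by blast
  ultimately show ?thesis unfolding cnt_def comps_split[OF J far] by (subst card_Un_disjoint) auto
qed

lemma cnt_eq_sum:
  assumes "finite I"
  shows "cnt i I x = (\<Sum>J | J \<subseteq> I \<and> card J = k. of_bool (shape i J x \<and> (\<forall>a\<in>J. \<forall>b\<in>I - J. t $ i < dist (x a) (x b))))"
proof -
  have "finite {J. J \<subseteq> I \<and> card J = k}" using assms by (rule finite_subset[rotated, OF finite_Pow_iff[THEN iffD2]]) auto
  thus ?thesis unfolding cnt_def comps_def
    by (simp add: of_bool_def sum.If_cases Collect_conj_eq Int_assoc[symmetric])
qed

end

section \<open>Resampling independent points\<close>

locale iid_sequence = Q: prob_space Q for Q :: "'b::{second_countable_topology, t2_space} measure" +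
  assumes sets_Q [measurable_cong, simp]: "sets Q = sets borel"
begin

definition P :: "(nat \<Rightarrow> 'b) measure" where "P = PiM UNIV (\<lambda>_. Q)"

sublocale product_prob_space "\<lambda>_::nat. Q" UNIV by unfold_locales

lemma space_Q [simp]: "space Q = UNIV" using sets_eq_imp_space_eq[OF sets_Q] by simp
lemma space_P [simp]: "space P = UNIV" by (auto simp: P_def space_PiM)
lemma sets_P: "sets P = sets (PiM UNIV (\<lambda>_. borel))"
  unfolding P_def by (rule sets_PiM_cong) auto

sublocale PP: prob_space P unfolding P_def by (rule prob_space_PiM) unfold_locales
lemma prob_UNIV [simp]: "measure P UNIV = 1" using PP.prob_space by simp

sublocale PPP: pair_prob_space P P by unfold_locales

lemma coord_meas [measurable]: "(\<lambda>x. x i) \<in> borel_measurable P"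
  unfolding P_def by measurable

text \<open>Resampling: the coordinates in \<open>J\<close> are kept and all others are replaced by those of an
  independent copy.\<close>
definition mix :: "nat set \<Rightarrow> (nat \<Rightarrow> 'b) \<Rightarrow> (nat \<Rightarrow> 'b) \<Rightarrow> nat \<Rightarrow> 'b" where
  "mix J x z = (\<lambda>i. if i \<in> J then x i else z i)"

lemma mix_meas [measurable]: "(\<lambda>(x, z). mix J x z) \<in> P \<Otimes>\<^sub>M P \<rightarrow>\<^sub>M P"
proof -
  have "(\<lambda>w. \<lambda>i. if i \<in> J then fst w i else snd w i) \<in> P \<Otimes>\<^sub>M P \<rightarrow>\<^sub>M PiM UNIV (\<lambda>_. borel)"
  proof (rule measurable_abs_UNIV)
    fix i :: nat
    show "(\<lambda>w. if i \<in> J then fst w i else snd w i) \<in> borel_measurable (P \<Otimes>\<^sub>M P)"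
      by (cases "i \<in> J") simp_all
  qed
  thus ?thesis by (simp add: mix_def case_prod_unfold cong: measurable_cong_sets[OF refl sets_P])
qed

lemma mix_meas_right [measurable]: "(\<lambda>z. mix J x z) \<in> P \<rightarrow>\<^sub>M P"
  using measurable_compose[OF measurable_Pair1'[of x P P] mix_meas, of J] by simp

lemma pred_coord:
  assumes "A \<in> sets borel" shows "Measurable.pred P (\<lambda>x. x i \<in> A)"
proof -
  have "Measurable.pred borel (\<lambda>u. u \<in> A)" using assms by (simp add: pred_def)
  from measurable_compose[OF coord_meas this] show ?thesis by simp
qed

lemma pred_box:
  assumes "finite J" "\<And>i. i \<in> J \<Longrightarrow> A i \<in> sets borel"
  shows "Measurable.pred P (\<lambda>x. \<forall>i\<in>J. x i \<in> A i)"
  using assms by (intro pred_intros_finite pred_coord) auto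

lemma sets_box:
  assumes "finite J" "\<And>i. i \<in> J \<Longrightarrow> A i \<in> sets borel"
  shows "{x. \<forall>i\<in>J. x i \<in> A i} \<in> sets P"
  using pred_box[OF assms] by (simp add: pred_def)

lemma emeasure_P_box:
  assumes "finite J" "\<And>i. i \<in> J \<Longrightarrow> A i \<in> sets borel"
  shows "emeasure P {x. \<forall>i\<in>J. x i \<in> A i} = (\<Prod>i\<in>J. emeasure Q (A i))"
  using emeasure_PiM_Collect[of J A] assms by (simp add: P_def[symmetric])

lemma distr_mix: "distr (P \<Otimes>\<^sub>M P) P (\<lambda>(x, z). mix J x z) = P"
proof -
  have "distr (P \<Otimes>\<^sub>M P) P (\<lambda>(x, z). mix J x z) = PiM UNIV (\<lambda>_. Q)"
  proof (rule PiM_eq)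
    show "sets (distr (P \<Otimes>\<^sub>M P) P (\<lambda>(x, z). mix J x z)) = sets (PiM UNIV (\<lambda>_. Q))" by (simp add: P_def)
    fix K :: "nat set" and F assume K: "finite K" and F: "\<And>j. j \<in> K \<Longrightarrow> F j \<in> sets Q"
    have emb: "prod_emb UNIV (\<lambda>_. Q) K (Pi\<^sub>E K F) = {x. \<forall>i\<in>K. x i \<in> F i}"
      by (auto simp: prod_emb_def PiE_iff)
    have S: "{x. \<forall>i\<in>K. x i \<in> F i} \<in> sets P"
      using K F by (intro sets_box) auto
    have "emeasure (distr (P \<Otimes>\<^sub>M P) P (\<lambda>(x, z). mix J x z)) {x. \<forall>i\<in>K. x i \<in> F i}
      = emeasure (P \<Otimes>\<^sub>M P) ((\<lambda>(x, z). mix J x z) -` {x. \<forall>i\<in>K. x i \<in> F i} \<inter> space (P \<Otimes>\<^sub>M P))"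
      using S by (intro emeasure_distr) auto
    also have "(\<lambda>(x, z). mix J x z) -` {x. \<forall>i\<in>K. x i \<in> F i} \<inter> space (P \<Otimes>\<^sub>M P)
       = {x. \<forall>i\<in>K \<inter> J. x i \<in> F i} \<times> {x. \<forall>i\<in>K - J. x i \<in> F i}"
      by (auto simp: mix_def space_pair_measure split: if_splits)
    also have "emeasure (P \<Otimes>\<^sub>M P) \<dots> = emeasure P {x. \<forall>i\<in>K \<inter> J. x i \<in> F i} * emeasure P {x. \<forall>i\<in>K - J. x i \<in> F i}"
      using K F by (intro PP.emeasure_pair_measure_Times sets_box) auto
    also have "\<dots> = (\<Prod>i\<in>K \<inter> J. emeasure Q (F i)) * (\<Prod>i\<in>K - J. emeasure Q (F i))"
      using K F by (subst (1 2) emeasure_P_box) auto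
    also have "\<dots> = (\<Prod>i\<in>K. emeasure Q (F i))"
      using K by (subst prod.union_disjoint[symmetric]) (auto intro!: prod.cong)
    finally show "emeasure (distr (P \<Otimes>\<^sub>M P) P (\<lambda>(x, z). mix J x z)) (prod_emb UNIV (\<lambda>_. Q) K (Pi\<^sub>E K F)) = (\<Prod>j\<in>K. emeasure Q (F j))"
      unfolding emb .
  qed
  thus ?thesis by (simp add: P_def)
qed

text \<open>Bounded measurable functions form an algebra whose members are all integrable; this settles the
  integrability conditions below.\<close>
definition bm :: "((nat \<Rightarrow> 'b) \<Rightarrow> real) \<Rightarrow> bool" where
  "bm f \<longleftrightarrow> f \<in> borel_measurable P \<and> (\<exists>B. \<forall>x. \<bar>f x\<bar> \<le> B)"

lemma bm_meas: "bm f \<Longrightarrow> f \<in> borel_measurable P" by (simp add: bm_def)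
lemma bmI: "f \<in> borel_measurable P \<Longrightarrow> (\<And>x. \<bar>f x\<bar> \<le> B) \<Longrightarrow> bm f" unfolding bm_def by blast

lemma bm_integrable [simp]: assumes "bm f" shows "integrable P f"
proof -
  obtain B where "\<And>x. \<bar>f x\<bar> \<le> B" using assms unfolding bm_def by blast
  thus ?thesis using assms by (intro PP.integrable_const_bound[of _ B]) (auto simp: bm_def)
qed

lemma bm_const [simp]: "bm (\<lambda>_. c)" unfolding bm_def by auto

lemma bm_mult [intro]: assumes "bm f" "bm g" shows "bm (\<lambda>x. f x * g x)"
proof -
  obtain B1 B2 where "\<And>x. \<bar>f x\<bar> \<le> B1" "\<And>x. \<bar>g x\<bar> \<le> B2" using assms unfolding bm_def by blast
  hence "\<bar>f x * g x\<bar> \<le> B1 * B2" for x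
    unfolding abs_mult by (intro mult_mono) (auto intro: order_trans[OF abs_ge_zero])
  thus ?thesis using assms by (intro bmI) (auto simp: bm_def)
qed

lemma bm_add [intro]: assumes "bm f" "bm g" shows "bm (\<lambda>x. f x + g x)"
proof -
  obtain B1 B2 where B: "\<And>x. \<bar>f x\<bar> \<le> B1" "\<And>x. \<bar>g x\<bar> \<le> B2" using assms unfolding bm_def by blast
  have "\<bar>f x + g x\<bar> \<le> B1 + B2" for x using B[of x] by linarith
  thus ?thesis using assms by (intro bmI) (auto simp: bm_def)
qed

lemma bm_diff [intro]: assumes "bm f" "bm g" shows "bm (\<lambda>x. f x - g x)"
  using bm_add[OF assms(1) bm_mult[OF bm_const[of "-1"] assms(2)]] by simp

lemma bm_abs [intro]: "bm f \<Longrightarrow> bm (\<lambda>x. \<bar>f x\<bar>)" unfolding bm_def by auto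

lemma bm_sum [intro]: "(\<And>i. i \<in> I \<Longrightarrow> bm (f i)) \<Longrightarrow> bm (\<lambda>x. \<Sum>i\<in>I. f i x)"
  by (induction I rule: infinite_finite_induct) auto

lemma bm_exp [intro]: assumes "bm f" shows "bm (\<lambda>x. exp (f x))"
proof -
  obtain B where B: "\<And>x. \<bar>f x\<bar> \<le> B" using assms unfolding bm_def by blast
  have "\<bar>exp (f x)\<bar> \<le> exp B" for x using B[of x] by simp
  thus ?thesis using assms by (intro bmI) (auto simp: bm_def)
qed

lemma bm_of_bool: "Measurable.pred P S \<Longrightarrow> bm (\<lambda>x. of_bool (S x))"
  by (intro bmI[of _ 1]) auto

lemma bm_cmult [intro]: "bm f \<Longrightarrow> bm (\<lambda>x. c * f x)" by (rule bm_mult) simp_all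

lemma bm_mix: "bm f \<Longrightarrow> bm (\<lambda>z. f (mix J x z))" 
  unfolding bm_def using measurable_compose[OF mix_meas_right] by blast

text \<open>The expectation is computed by fixing the points in \<open>J\<close> first. This replaces
  conditional expectations.\<close>
lemma E_mix:
  assumes f: "bm f"
  shows "integral\<^sup>L P f = (\<integral>x. (\<integral>z. f (mix J x z) \<partial>P) \<partial>P)"
    and "bm (\<lambda>x. \<integral>z. f (mix J x z) \<partial>P)"
proof -
  obtain B where B: "\<And>x. \<bar>f x\<bar> \<le> B" using f unfolding bm_def by blast
  have [measurable]: "f \<in> borel_measurable P" using f by (rule bm_meas)
  have "integral\<^sup>L P f = integral\<^sup>L (distr (P \<Otimes>\<^sub>M P) P (\<lambda>(x, z). mix J x z)) f" by (simp add: distr_mix)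
  also have "\<dots> = integral\<^sup>L (P \<Otimes>\<^sub>M P) (\<lambda>w. f (case w of (x, z) \<Rightarrow> mix J x z))" by (rule integral_distr) auto
  also have "\<dots> = (\<integral>x. (\<integral>z. f (mix J x z) \<partial>P) \<partial>P)"
    using PPP.integral_fst'[of "\<lambda>w. f (case w of (x, z) \<Rightarrow> mix J x z)"] B
    by (simp add: PPP.P.integrable_const_bound[of _ B])
  finally show "integral\<^sup>L P f = (\<integral>x. (\<integral>z. f (mix J x z) \<partial>P) \<partial>P)" .
  show "bm (\<lambda>x. \<integral>z. f (mix J x z) \<partial>P)"
  proof (rule bmI)
    have "(\<lambda>w. f (case w of (x, z) \<Rightarrow> mix J x z)) \<in> borel_measurable (P \<Otimes>\<^sub>M P)" by measurable
    thus "(\<lambda>x. \<integral>z. f (mix J x z) \<partial>P) \<in> borel_measurable P" 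
      by (intro PP.borel_measurable_lebesgue_integral) (simp add: case_prod_unfold)
    fix x
    have "\<bar>\<integral>z. f (mix J x z) \<partial>P\<bar> \<le> (\<integral>z. \<bar>f (mix J x z)\<bar> \<partial>P)" by (rule integral_abs_bound)
    also have "\<dots> \<le> (\<integral>z. B \<partial>P)" using B f by (intro integral_mono) (auto intro!: bm_integrable bm_abs bm_mix[OF f])
    finally show "\<bar>\<integral>z. f (mix J x z) \<partial>P\<bar> \<le> B" by (simp add: PP.prob_space)
  qed
qed

lemma E_box:
  assumes "finite J" "\<And>i. i \<in> J \<Longrightarrow> A i \<in> sets borel"
  shows "(\<integral>x. of_bool (\<forall>i\<in>J. x i \<in> A i) \<partial>P) = (\<Prod>i\<in>J. measure Q (A i))"
proof -
  have S: "{x. \<forall>i\<in>J. x i \<in> A i} \<in> sets P" using assms by (rule sets_box)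
  have "(\<integral>x. of_bool (\<forall>i\<in>J. x i \<in> A i) \<partial>P) = (\<integral>x. indicat_real {x. \<forall>i\<in>J. x i \<in> A i} x \<partial>P)"
    by (intro Bochner_Integration.integral_cong) (auto simp: indicator_def)
  also have "\<dots> = measure P {x. \<forall>i\<in>J. x i \<in> A i}" using S by simp
  also have "\<dots> = (\<Prod>i\<in>J. measure Q (A i))"
    using emeasure_P_box[OF assms] by (simp add: PP.emeasure_eq_measure Q.emeasure_eq_measure prod_ennreal prod_nonneg)
  finally show ?thesis .
qed

text \<open>If \<open>f\<close> changes at most by the factor \<open>c\<close> when the point \<open>a\<close> is resampled, then the event
  \<open>x a \<in> N\<close> is nearly independent of the density \<open>f\<close>. For \<open>f = exp (\<alpha> * F)\<close> and small
  \<open>\<alpha>\<close> this says that tilting hardly affects the law of a single point.\<close>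
lemma swap_event:
  assumes N: "N \<in> sets borel" and f: "bm f" "\<And>x. 0 \<le> f x" and c: "1 \<le> c"
    and swap: "\<And>x u. f (x(a := u)) \<le> c * f x"
  shows "\<bar>(\<integral>x. of_bool (x a \<in> N) * f x \<partial>P) - measure Q N * integral\<^sup>L P f\<bar>
     \<le> measure Q N * (c - 1) * integral\<^sup>L P f"
proof -
  have [measurable]: "f \<in> borel_measurable P" using f(1) by (rule bm_meas)
  note [measurable] = N
  have bN: "bm (\<lambda>x. of_bool (x a \<in> N))" by (intro bm_of_bool pred_coord N)
  have EN: "(\<integral>x. of_bool (x a \<in> N) \<partial>P) = measure Q N" using E_box[of "{a}" "\<lambda>_. N"] N by simp
  have mix1: "mix {a} x z = z(a := x a)" for x z by (auto simp: mix_def)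
  have up: "f (mix {a} x z) \<le> c * f z" for x z unfolding mix1 by (rule swap)
  have lo: "f z \<le> c * f (mix {a} x z)" for x z
    using swap[of "z(a := x a)" "z a"] unfolding mix1 by simp
  \<comment> \<open>The lower bound \<open>1/c\<close> is weakened to \<open>2 - c\<close> to make the two-sided estimate symmetric.\<close>
  have lo': "(2 - c) * f z \<le> f (mix {a} x z)" for x z
  proof (cases "c \<le> 2")
    case True
    have "(2 - c) * f z \<le> (2 - c) * (c * f (mix {a} x z))" using True lo[of z x] by (intro mult_left_mono) auto
    also have "\<dots> = ((2 - c) * c) * f (mix {a} x z)" by simp
    also have "(2 - c) * c \<le> 1" using zero_le_power2[of "c - 1"] by (simp add: power2_eq_square algebra_simps)
    finally show ?thesis using f(2)[of "mix {a} x z"] by (simp add: mult_right_mono)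
  next
    case False
    hence "(2 - c) * f z \<le> 0" using f(2)[of z] by (simp add: mult_nonpos_nonneg)
    thus ?thesis using f(2) order_trans by blast
  qed
  let ?b = "\<lambda>x. of_bool (x a \<in> N) :: real"
  have bmf: "bm (\<lambda>x. ?b x * f x)" using bm_mult[OF bN f(1)] .
  have eq: "(\<integral>x. ?b x * f x \<partial>P) = (\<integral>x. (\<integral>z. ?b x * f (mix {a} x z) \<partial>P) \<partial>P)"
    using E_mix(1)[OF bmf, of "{a}"] by (simp add: mix_def)
  have bm2: "bm (\<lambda>x. \<integral>z. ?b x * f (mix {a} x z) \<partial>P)"
    using E_mix(2)[OF bmf, of "{a}"] by (simp add: mix_def)
  have inner_up: "(\<integral>z. ?b x * f (mix {a} x z) \<partial>P) \<le> ?b x * (c * integral\<^sup>L P f)" for x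
  proof -
    have "(\<integral>z. ?b x * f (mix {a} x z) \<partial>P) \<le> (\<integral>z. ?b x * (c * f z) \<partial>P)"
      using up by (intro integral_mono bm_integrable bm_cmult bm_mix[OF f(1)] f(1) mult_left_mono) auto
    thus ?thesis by simp
  qed
  have inner_lo: "?b x * ((2 - c) * integral\<^sup>L P f) \<le> (\<integral>z. ?b x * f (mix {a} x z) \<partial>P)" for x
  proof -
    have "(\<integral>z. ?b x * ((2 - c) * f z) \<partial>P) \<le> (\<integral>z. ?b x * f (mix {a} x z) \<partial>P)"
      using lo' by (intro integral_mono bm_integrable bm_cmult bm_mix[OF f(1)] f(1) mult_left_mono) auto
    thus ?thesis by simp
  qed
  have "(\<integral>x. ?b x * f x \<partial>P) \<le> (\<integral>x. ?b x * (c * integral\<^sup>L P f) \<partial>P)"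
    unfolding eq using bm2 bN inner_up by (intro integral_mono bm_integrable bm_mult) auto
  moreover have "(\<integral>x. ?b x * ((2 - c) * integral\<^sup>L P f) \<partial>P) \<le> (\<integral>x. ?b x * f x \<partial>P)"
    unfolding eq using bm2 bN inner_lo by (intro integral_mono bm_integrable bm_mult) auto
  moreover have "(\<integral>x. ?b x * d \<partial>P) = measure Q N * d" for d using EN by simp
  ultimately show ?thesis by (simp only: abs_le_iff) (simp add: algebra_simps)
qed

text \<open>Resample the points in \<open>B\<close> with the point \<open>a\<close> fixed: they fall near \<open>x a\<close> independently,
  each with probability at most \<open>p\<close>, and the density \<open>f\<close> changes at most by the factor \<open>c\<close>.\<close>
lemma near_event_bound:
  assumes B: "finite B" "a \<notin> B" and f: "bm f" "\<And>x. 0 \<le> f x" and c: "0 \<le> c"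
    and swap: "\<And>x y. (\<And>i. i \<notin> B \<Longrightarrow> x i = y i) \<Longrightarrow> f x \<le> c * f y"
    and Rm: "Measurable.pred (borel \<Otimes>\<^sub>M borel) (\<lambda>(u, v). R u v)"
    and p: "\<And>v. measure Q {u. R u v} \<le> p"
  shows "(\<integral>x. of_bool (\<forall>b\<in>B. R (x b) (x a)) * f x \<partial>P) \<le> c * p ^ card B * integral\<^sup>L P f"
proof -
  have p0: "0 \<le> p" using p measure_nonneg order_trans by blast
  have Rm2 [measurable]: "{u. R u v} \<in> sets borel" for v
  proof -
    have "(\<lambda>u. (u, v)) \<in> borel \<rightarrow>\<^sub>M borel \<Otimes>\<^sub>M borel" by measurable
    from measurable_compose[OF this Rm] show ?thesis by (simp add: pred_def)
  qed
  have pR: "Measurable.pred P (\<lambda>x. R (x b) (x a))" for b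
  proof -
    have "(\<lambda>x. (x b, x a)) \<in> P \<rightarrow>\<^sub>M borel \<Otimes>\<^sub>M borel" by measurable
    from measurable_compose[OF this Rm] show ?thesis by simp
  qed
  have bR: "bm (\<lambda>x. of_bool (\<forall>b\<in>B. R (x b) (x a)))"
    by (rule bm_of_bool, rule pred_intros_finite(3)[OF B(1)], rule pR)
  have bRf: "bm (\<lambda>x. of_bool (\<forall>b\<in>B. R (x b) (x a)) * f x)" using bm_mult[OF bR f(1)] .
  let ?m = "mix (- B)"
  have in1: "(\<integral>z. of_bool (\<forall>b\<in>B. R (?m x z b) (?m x z a)) * f (?m x z) \<partial>P) \<le> c * p ^ card B * f x" for x
  proof -
    have meq: "(\<forall>b\<in>B. R (?m x z b) (?m x z a)) = (\<forall>b\<in>B. z b \<in> {u. R u (x a)})" for z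
    proof (rule ball_cong[OF refl])
      fix b assume "b \<in> B"
      hence "?m x z b = z b" "?m x z a = x a" using B by (simp_all add: mix_def)
      thus "R (?m x z b) (?m x z a) = (z b \<in> {u. R u (x a)})" by (simp only: mem_Collect_eq)
    qed
    have bz: "bm (\<lambda>z. of_bool (\<forall>b\<in>B. z b \<in> {u. R u (x a)}))" using B by (intro bm_of_bool pred_box) auto
    have fle: "f (?m x z) \<le> c * f x" for z by (rule swap) (auto simp: mix_def)
    have "(\<integral>z. of_bool (\<forall>b\<in>B. R (?m x z b) (?m x z a)) * f (?m x z) \<partial>P)
      \<le> (\<integral>z. of_bool (\<forall>b\<in>B. z b \<in> {u. R u (x a)}) * (c * f x) \<partial>P)"
      unfolding meq
      by (intro integral_mono bm_integrable bm_mult bz bm_mix[OF f(1)] bm_const mult_left_mono fle) simp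
    also have "\<dots> = (\<integral>z. of_bool (\<forall>b\<in>B. z b \<in> {u. R u (x a)}) \<partial>P) * (c * f x)" by simp
    also have "(\<integral>z. of_bool (\<forall>b\<in>B. z b \<in> {u. R u (x a)}) \<partial>P) = (\<Prod>b\<in>B. measure Q {u. R u (x a)})"
      using B by (intro E_box) auto
    also have "\<dots> \<le> (\<Prod>b\<in>B. p)" using p by (intro prod_mono) auto
    also have "\<dots> = p ^ card B" by simp
    finally show ?thesis using c f(2)[of x] by (simp add: mult_right_mono mult.commute mult.left_commute)
  qed
  have "(\<integral>x. of_bool (\<forall>b\<in>B. R (x b) (x a)) * f x \<partial>P)
     \<le> (\<integral>x. c * p ^ card B * f x \<partial>P)"
    unfolding E_mix(1)[OF bRf, of "- B"]
    using in1 f E_mix(2)[OF bRf, of "- B"] by (intro integral_mono bm_integrable bm_cmult) auto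
  thus ?thesis by simp
qed

end

section \<open>Measurability of shapes\<close>

text \<open>Whether closed balls meet is an uncountable union over candidate points. Enlarging the radii
  slightly permits a countable dense set of candidates, and compactness recovers a
  common point in the limit.\<close>
lemma cballs_meet_iff_dense:
  fixes y :: "'i \<Rightarrow> 'a::euclidean_space"
  assumes T: "finite T" "T \<noteq> {}" and D: "\<And>U. open U \<Longrightarrow> U \<noteq> {} \<Longrightarrow> \<exists>z\<in>D. z \<in> U"
  shows "(\<Inter>a\<in>T. cball (y a) s) \<noteq> {} \<longleftrightarrow> (\<forall>n. \<exists>z\<in>D. \<forall>a\<in>T. dist (y a) z < s + 1 / real (Suc n))"
proof
  assume "(\<Inter>a\<in>T. cball (y a) s) \<noteq> {}"
  then obtain w where "w \<in> (\<Inter>a\<in>T. cball (y a) s)" by blast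
  hence w: "dist (y a) w \<le> s" if "a \<in> T" for a using that by simp
  show "\<forall>n. \<exists>z\<in>D. \<forall>a\<in>T. dist (y a) z < s + 1 / real (Suc n)"
  proof
    fix n
    obtain z where z: "z \<in> D" "z \<in> ball w (1 / real (Suc n))" using D[of "ball w (1 / real (Suc n))"] by auto
    have "dist (y a) z < s + 1 / real (Suc n)" if "a \<in> T" for a
      using w[OF that] z(2) dist_triangle[of "y a" z w] by simp
    thus "\<exists>z\<in>D. \<forall>a\<in>T. dist (y a) z < s + 1 / real (Suc n)" using z by blast
  qed
next
  assume H: "\<forall>n. \<exists>z\<in>D. \<forall>a\<in>T. dist (y a) z < s + 1 / real (Suc n)"
  define C where "C n = (\<Inter>a\<in>T. cball (y a) (s + 1 / real (Suc n)))" for n :: nat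
  have "\<Inter>(range C) \<noteq> {}"
  proof (rule compact_nest)
    fix n
    obtain a where "a \<in> T" using T by blast
    thus "compact (C n)" unfolding C_def by (intro compact_Inter) auto
    show "C n \<noteq> {}" using H[rule_format, of n] unfolding C_def by (force intro: less_imp_le)
  next
    fix m n :: nat assume "m \<le> n"
    hence "1 / real (Suc n) \<le> 1 / real (Suc m)" by (intro divide_left_mono) auto
    hence "cball (y a) (s + 1 / real (Suc n)) \<subseteq> cball (y a) (s + 1 / real (Suc m))" for a
      by (intro subset_cball) simp
    thus "C n \<subseteq> C m" unfolding C_def by (intro INF_superset_mono order_refl)
  qed
  then obtain w where w: "\<And>n. w \<in> C n" by auto
  have "dist (y a) w \<le> s" if "a \<in> T" for a
  proof (rule field_le_epsilon)
    fix e :: real assume "e > 0"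
    then obtain n where "inverse (real (Suc n)) < e" using reals_Archimedean by blast
    moreover have "dist (y a) w \<le> s + 1 / real (Suc n)" using w[of n] that unfolding C_def by auto
    ultimately show "dist (y a) w \<le> s + e" by (simp add: inverse_eq_divide)
  qed
  hence "w \<in> (\<Inter>a\<in>T. cball (y a) s)" by simp
  thus "(\<Inter>a\<in>T. cball (y a) s) \<noteq> {}" by blast
qed

text \<open>Transport along an injective labelling, so that isomorphism can be tested on
  complexes whose vertices are labels.\<close>
lemma complex_iso_image:
  assumes inj: "inj_on x (\<Union>K)"
  shows "complex_iso ((\<lambda>\<tau>. x ` \<tau>) ` K) L \<longleftrightarrow> complex_iso K L"
proof -
  have un: "\<Union>((\<lambda>\<tau>. x ` \<tau>) ` K) = x ` \<Union>K" by blast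
  show ?thesis
  proof
    assume "complex_iso ((\<lambda>\<tau>. x ` \<tau>) ` K) L"
    then obtain f where f: "bij_betw f (x ` \<Union>K) (\<Union>L)" "(\<lambda>\<sigma>. f ` \<sigma>) ` (\<lambda>\<tau>. x ` \<tau>) ` K = L"
      unfolding complex_iso_def un by blast
    have "bij_betw (f \<circ> x) (\<Union>K) (\<Union>L)"
      using f(1) inj by (intro bij_betw_trans[of x _ "x ` \<Union>K"]) (auto simp: bij_betw_def)
    moreover have "(\<lambda>\<sigma>. (f \<circ> x) ` \<sigma>) ` K = L" using f(2) by (simp add: image_image image_comp)
    ultimately show "complex_iso K L" unfolding complex_iso_def by blast
  next
    assume "complex_iso K L"
    then obtain f where f: "bij_betw f (\<Union>K) (\<Union>L)" "(\<lambda>\<sigma>. f ` \<sigma>) ` K = L"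
      unfolding complex_iso_def by blast
    define g where "g = f \<circ> the_inv_into (\<Union>K) x"
    have "bij_betw (the_inv_into (\<Union>K) x) (x ` \<Union>K) (\<Union>K)"
      using inj by (simp add: bij_betw_the_inv_into inj_on_imp_bij_betw)
    hence "bij_betw g (x ` \<Union>K) (\<Union>L)" unfolding g_def using f(1) by (rule bij_betw_trans)
    moreover have "g ` x ` \<tau> = f ` \<tau>" if "\<tau> \<in> K" for \<tau>
    proof -
      have "g (x a) = f a" if "a \<in> \<tau>" for a
      proof -
        have "a \<in> \<Union>K" using that \<open>\<tau> \<in> K\<close> by blast
        thus ?thesis unfolding g_def o_def by (simp only: the_inv_into_f_f[OF inj])
      qed
      thus ?thesis by (simp add: image_image)
    qed
    hence "(\<lambda>\<sigma>. g ` \<sigma>) ` (\<lambda>\<tau>. x ` \<tau>) ` K = (\<lambda>\<sigma>. f ` \<sigma>) ` K" by (simp add: image_image cong: image_cong)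
    hence "(\<lambda>\<sigma>. g ` \<sigma>) ` (\<lambda>\<tau>. x ` \<tau>) ` K = L" using f(2) by simp
    ultimately show "complex_iso ((\<lambda>\<tau>. x ` \<tau>) ` K) L" unfolding complex_iso_def un by blast
  qed
qed

text \<open>The complex of a labelled configuration as an object on the labels; only finitely many values
  are possible, which reduces measurability of shapes to that of the single intersection patterns.\<close>
definition nerve_pattern :: "nat set \<Rightarrow> real \<Rightarrow> (nat \<Rightarrow> 'a::metric_space) \<Rightarrow> nat set set" where
  "nerve_pattern J s x = {\<tau>. \<tau> \<subseteq> J \<and> \<tau> \<noteq> {} \<and> (\<Inter>a\<in>\<tau>. cball (x a) (s / 2)) \<noteq> {}}"

lemma cech_complex_eq_image_pattern:
  assumes "finite J"
  shows "cech_complex (x ` J) s = (\<lambda>\<tau>. x ` \<tau>) ` nerve_pattern J s x"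
proof (intro equalityI subsetI)
  fix \<sigma> assume \<sigma>: "\<sigma> \<in> cech_complex (x ` J) s"
  define \<tau> where "\<tau> = {a\<in>J. x a \<in> \<sigma>}"
  have \<sigma>': "\<sigma> \<subseteq> x ` J" "\<sigma> \<noteq> {}" "(\<Inter>y\<in>\<sigma>. cball y (s / 2)) \<noteq> {}"
    using \<sigma> by (simp_all add: cech_complex_def)
  have "x ` \<tau> = \<sigma>" using \<sigma>'(1) unfolding \<tau>_def by auto
  moreover have "\<tau> \<in> nerve_pattern J s x"
  proof -
    have "(\<Inter>a\<in>\<tau>. cball (x a) (s / 2)) = (\<Inter>y\<in>x ` \<tau>. cball y (s / 2))" by simp
    moreover have "\<tau> \<noteq> {}" "\<tau> \<subseteq> J" using \<open>x ` \<tau> = \<sigma>\<close> \<sigma>'(2) by (auto simp: \<tau>_def)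
    moreover have "(\<Inter>y\<in>\<sigma>. cball y (s / 2)) \<noteq> {}" by (rule \<sigma>'(3))
    ultimately show ?thesis using \<open>x ` \<tau> = \<sigma>\<close> unfolding nerve_pattern_def by simp
  qed
  ultimately show "\<sigma> \<in> (\<lambda>\<tau>. x ` \<tau>) ` nerve_pattern J s x" by blast
next
  fix \<sigma> assume "\<sigma> \<in> (\<lambda>\<tau>. x ` \<tau>) ` nerve_pattern J s x"
  then obtain \<tau> where \<tau>1: "\<sigma> = x ` \<tau>" and "\<tau> \<in> nerve_pattern J s x" by blast
  hence \<tau>: "\<tau> \<subseteq> J" "\<tau> \<noteq> {}" "(\<Inter>a\<in>\<tau>. cball (x a) (s / 2)) \<noteq> {}"
    by (simp_all add: nerve_pattern_def)
  have "finite \<tau>" using \<tau> assms finite_subset by blast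
  moreover have "(\<Inter>y\<in>\<sigma>. cball y (s / 2)) \<noteq> {}" using \<tau>1 \<tau>(3) by simp
  moreover have "\<sigma> \<subseteq> x ` J" "finite \<sigma>" "\<sigma> \<noteq> {}" using \<tau>1 \<tau> \<open>finite \<tau>\<close> by auto
  ultimately show "\<sigma> \<in> cech_complex (x ` J) s" by (simp add: cech_complex_def)
qed

lemma (in cech_shapes) shape_iff_pattern:
  assumes "card J = k"
  shows "shape i J x \<longleftrightarrow> inj_on x J \<and> nerve_pattern J (t $ i) x \<in> {K. K \<subseteq> Pow J \<and> complex_iso K (G i)}"
proof -
  have fin: "finite J" using assms card_k_finite by blast
  have "complex_iso (cech_complex (x ` J) (t $ i)) (G i) \<longleftrightarrow> complex_iso (nerve_pattern J (t $ i) x) (G i)"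
    if "inj_on x J"
    unfolding cech_complex_eq_image_pattern[OF fin]
  proof (rule complex_iso_image)
    show "inj_on x (\<Union> (nerve_pattern J (t $ i) x))"
      using that by (rule inj_on_subset) (auto simp: nerve_pattern_def)
  qed
  moreover have "nerve_pattern J (t $ i) x \<subseteq> Pow J" by (auto simp: nerve_pattern_def)
  ultimately show ?thesis using shape_inj[OF _ assms, of i x] unfolding shape_def by blast
qed

lemma measurable_shape:
  fixes x :: "'p \<Rightarrow> nat \<Rightarrow> real^'d" 
  assumes "cech_shapes k t G" "card J = k" and x: "\<And>a. a \<in> J \<Longrightarrow> (\<lambda>\<omega>. x \<omega> a) \<in> borel_measurable M"
  shows "Measurable.pred M (\<lambda>\<omega>. cech_shapes.shape t G i J (x \<omega>))"
proof -
  interpret cech_shapes k t G by fact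
  have fin: "finite J" using assms(2) card_k_finite by blast
  obtain D :: "(real^'d) set" where D: "countable D" "\<And>U. open U \<Longrightarrow> U \<noteq> {} \<Longrightarrow> \<exists>z\<in>D. z \<in> U"
    using countable_dense_exists by metis
  have pd: "Measurable.pred M (\<lambda>\<omega>. dist (x \<omega> a) z < c)" if "a \<in> J" for a z c
    using x[OF that] by measurable
  have pm: "Measurable.pred M (\<lambda>\<omega>. (\<Inter>a\<in>\<tau>. cball (x \<omega> a) s) \<noteq> {})" if \<tau>: "\<tau> \<subseteq> J" "\<tau> \<noteq> {}" for \<tau> s
  proof -
    have "finite \<tau>" using \<tau> fin finite_subset by blast
    have "Measurable.pred M (\<lambda>\<omega>. \<forall>n. \<exists>z\<in>D. \<forall>a\<in>\<tau>. dist (x \<omega> a) z < s + 1 / real (Suc n))"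
      unfolding pred_def
    proof (rule sets.sets_Collect_countable_All, rule sets.sets_Collect_countable_Ex'[OF _ D(1)])
      fix n z
      have "Measurable.pred M (\<lambda>\<omega>. \<forall>a\<in>\<tau>. dist (x \<omega> a) z < s + 1 / real (Suc n))"
        using \<tau> by (intro pred_intros_finite(3) \<open>finite \<tau>\<close> pd) auto
      thus "{\<omega> \<in> space M. \<forall>a\<in>\<tau>. dist (x \<omega> a) z < s + 1 / real (Suc n)} \<in> sets M" by (simp add: pred_def)
    qed
    moreover have "(\<lambda>\<omega>. (\<Inter>a\<in>\<tau>. cball (x \<omega> a) s) \<noteq> {})
        = (\<lambda>\<omega>. \<forall>n. \<exists>z\<in>D. \<forall>a\<in>\<tau>. dist (x \<omega> a) z < s + 1 / real (Suc n))"
      by (rule ext, rule cballs_meet_iff_dense[OF \<open>finite \<tau>\<close> \<tau>(2) D(2)])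
    ultimately show ?thesis by (simp only:)
  qed
  have pin: "Measurable.pred M (\<lambda>\<omega>. \<tau> \<in> nerve_pattern J s (x \<omega>))" if "\<tau> \<subseteq> J" for \<tau> s
  proof (cases "\<tau> = {}")
    case False
    have "(\<lambda>\<omega>. \<tau> \<in> nerve_pattern J s (x \<omega>)) = (\<lambda>\<omega>. (\<Inter>a\<in>\<tau>. cball (x \<omega> a) (s/2)) \<noteq> {})"
      using that False by (simp add: nerve_pattern_def)
    thus ?thesis using pm[OF that False, of "s/2"] by simp
  qed (simp add: nerve_pattern_def)
  have peq: "Measurable.pred M (\<lambda>\<omega>. nerve_pattern J s (x \<omega>) = K)" if K: "K \<subseteq> Pow J" for s K
  proof -
    have "(nerve_pattern J s (x \<omega>) = K) \<longleftrightarrow> (\<forall>\<tau>\<in>Pow J. (\<tau> \<in> nerve_pattern J s (x \<omega>)) = (\<tau> \<in> K))" for \<omega>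
    proof -
      have "nerve_pattern J s (x \<omega>) \<subseteq> Pow J" by (auto simp: nerve_pattern_def)
      thus ?thesis using K by blast
    qed
    thus ?thesis using fin pin by (simp only:) (intro pred_intros_finite pred_intros_logic, auto)
  qed
  have pinj: "Measurable.pred M (\<lambda>\<omega>. inj_on (x \<omega>) J)"
  proof -
    have "inj_on (x \<omega>) J \<longleftrightarrow> (\<forall>a\<in>J. \<forall>b\<in>J. a = b \<or> \<not> dist (x \<omega> a) (x \<omega> b) \<le> 0)" for \<omega>
      by (auto simp: inj_on_def)
    moreover have "Measurable.pred M (\<lambda>\<omega>. dist (x \<omega> a) (x \<omega> b) \<le> 0)" if "a \<in> J" "b \<in> J" for a b
      using x[OF that(1)] x[OF that(2)] by measurable
    ultimately show ?thesis using fin by (simp only:) (intro pred_intros_finite pred_intros_logic, auto)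
  qed
  have "shape i J (x \<omega>) \<longleftrightarrow> inj_on (x \<omega>) J \<and> (\<exists>K\<in>{K. K \<subseteq> Pow J \<and> complex_iso K (G i)}. nerve_pattern J (t $ i) (x \<omega>) = K)" for \<omega>
    using shape_iff_pattern[OF assms(2)] by blast
  moreover have "finite {K. K \<subseteq> Pow J \<and> complex_iso K (G i)}"
    by (rule finite_subset[of _ "Pow (Pow J)"]) (use fin in auto)
  ultimately show ?thesis using peq pinj
    by (simp only:) (intro pred_intros_finite pred_intros_logic, auto)
qed

section \<open>Laplace transforms under insertion of a point\<close>

lemma abs_exp_diff_le:
  fixes u v :: real assumes "u \<le> c" "v \<le> c" shows "\<bar>exp u - exp v\<bar> \<le> exp c * \<bar>u - v\<bar>"
proof -
  have *: "exp b - exp a \<le> exp c * (b - a)" if "a \<le> b" "b \<le> c" for a b :: real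
  proof -
    have "exp b * (1 - exp (a - b)) \<le> exp b * (b - a)"
    proof (rule mult_left_mono)
      show "1 - exp (a - b) \<le> b - a" using exp_ge_add_one_self[of "a - b"] by linarith
    qed simp
    also have "\<dots> \<le> exp c * (b - a)" using that by (intro mult_right_mono) auto
    finally show ?thesis by (simp add: right_diff_distrib exp_add[symmetric])
  qed
  show ?thesis
    using *[of u v] *[of v u] assms by (cases "u \<le> v") (auto simp: abs_if)
qed

lemma abs_exp_minus_one_minus_le:
  fixes u :: real assumes "\<bar>u\<bar> \<le> 1" shows "\<bar>exp u - 1 - u\<bar> \<le> u\<^sup>2"
proof (cases "0 \<le> u")
  case True
  hence "exp u \<le> 1 + u + u\<^sup>2" using exp_bound[of u] assms by simp
  thus ?thesis using exp_ge_add_one_self[of u] zero_le_power2[of u] by linarith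
next
  case False
  define v where "v = - u"
  have v: "0 \<le> v" "v \<le> 1" "u = - v" using False assms by (auto simp: v_def)
  have "exp (- v) * exp v = 1" by (simp add: exp_minus)
  have "(1 - v + v\<^sup>2) * (1 + v) = 1 + v ^ 3" by (simp add: algebra_simps power2_eq_square power3_eq_cube)
  hence "1 \<le> (1 - v + v\<^sup>2) * (1 + v)" using v by simp
  also have "\<dots> \<le> (1 - v + v\<^sup>2) * exp v"
    using v exp_ge_add_one_self[of v] by (intro mult_left_mono) (auto simp: add_increasing2)
  finally have "exp (- v) \<le> 1 - v + v\<^sup>2" by (simp add: exp_minus field_simps)
  hence "exp u \<le> 1 + u + u\<^sup>2" by (simp add: v)
  thus ?thesis using exp_ge_add_one_self[of u] zero_le_power2[of u] by linarith
qed

text \<open>The number \<open>p\<close> bounds the probability that a given point falls within the interaction range of another.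
  All estimates are uniform in the law \<open>Q\<close> of the points, given \<open>p\<close> and the packing constant \<open>K\<close>. The
  vector \<open>\<theta>\<close> selects the linear combination of the counts that is studied.\<close>
locale cech_iid = cech_shapes k t G + iid_sequence Q
  for k and t :: "real^'m" and G :: "'m \<Rightarrow> (real^'d) set set" and Q :: "(real^'d) measure" +
  fixes \<theta> :: "real^'m" and K :: nat and p :: real
  assumes packing: "\<And>i a I x. finite I \<Longrightarrow> a \<notin> I \<Longrightarrow> \<bar>cnt i (insert a I) x - cnt i I x\<bar> \<le> real K"
    and ball: "\<And>y. measure Q (cball y ((real k + 1) * tmax)) \<le> p"
begin

text \<open>A common bound for the effect of a single point on \<open>F\<close> and for the contribution of a single
  component.\<close>
definition \<kappa> :: real where "\<kappa> = (\<Sum>i\<in>UNIV. \<bar>\<theta> $ i\<bar>) * (real K + 1)"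

definition F :: "nat set \<Rightarrow> (nat \<Rightarrow> real^'d) \<Rightarrow> real" where
  "F I x = (\<Sum>i\<in>UNIV. \<theta> $ i * cnt i I x)"

definition gsum :: "nat set \<Rightarrow> (nat \<Rightarrow> real^'d) \<Rightarrow> real" where
  "gsum J x = (\<Sum>i\<in>UNIV. \<theta> $ i * of_bool (shape i J x))"

lemma p_nonneg: "0 \<le> p" using ball[of 0] measure_nonneg order_trans by blast

lemma \<kappa>_nonneg: "0 \<le> \<kappa>" by (simp add: \<kappa>_def sum_nonneg)

lemma gsum_bound: "\<bar>gsum J x\<bar> \<le> \<kappa>"
proof -
  have "\<bar>gsum J x\<bar> \<le> (\<Sum>i\<in>UNIV. \<bar>\<theta> $ i * of_bool (shape i J x)\<bar>)" unfolding gsum_def by (rule sum_abs)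
  also have "\<dots> \<le> (\<Sum>i\<in>UNIV. \<bar>\<theta> $ i\<bar>)" by (intro sum_mono) (auto simp: abs_mult)
  also have "\<dots> \<le> \<kappa>" unfolding \<kappa>_def by (simp add: mult_le_cancel_left1 sum_nonneg algebra_simps)
  finally show ?thesis .
qed

lemma F_insert:
  assumes "finite I" "a \<notin> I" shows "\<bar>F (insert a I) x - F I x\<bar> \<le> \<kappa>"
proof -
  have "F (insert a I) x - F I x = (\<Sum>i\<in>UNIV. \<theta> $ i * (cnt i (insert a I) x - cnt i I x))"
    by (simp add: F_def sum_subtractf algebra_simps)
  also have "\<bar>\<dots>\<bar> \<le> (\<Sum>i\<in>UNIV. \<bar>\<theta> $ i * (cnt i (insert a I) x - cnt i I x)\<bar>)" by (rule sum_abs)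
  also have "\<dots> \<le> (\<Sum>i\<in>UNIV. \<bar>\<theta> $ i\<bar> * (real K + 1))"
    unfolding abs_mult
  proof (intro sum_mono mult_left_mono)
    show "\<bar>cnt i (insert a I) x - cnt i I x\<bar> \<le> real K + 1" for i using packing[OF assms, of i x] by linarith
  qed simp
  also have "\<dots> = \<kappa>" by (simp add: \<kappa>_def sum_distrib_right)
  finally show ?thesis .
qed

lemma F_changed:
  assumes "finite I" "a \<notin> I" "F (insert a I) x \<noteq> F I x"
  obtains B where "B \<subseteq> I" "card B = k - 1" "\<forall>b\<in>B. dist (x b) (x a) \<le> (real k + 1) * tmax"
proof -
  obtain i where "cnt i (insert a I) x \<noteq> cnt i I x"
    using assms(3) unfolding F_def by (metis (no_types, lifting) sum.cong)
  thus thesis using cnt_insert_changed[OF assms(1,2)] that by metis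
qed

lemma F_cong: "(\<And>a. a \<in> I \<Longrightarrow> x a = y a) \<Longrightarrow> F I x = F I y"
  using comps_cong[of I x y] by (simp add: F_def cnt_def)

lemma F_union:
  assumes "finite A" "finite I" shows "\<bar>F (I \<union> A) x - F I x\<bar> \<le> \<kappa> * card A"
  using assms(1)
proof (induction A rule: finite_induct)
  case (insert a A)
  show ?case
  proof (cases "a \<in> I")
    case True
    hence "I \<union> insert a A = I \<union> A" by blast
    moreover have "\<kappa> * card A \<le> \<kappa> * card (insert a A)" using insert \<kappa>_nonneg by (intro mult_left_mono) auto
    ultimately show ?thesis using insert by simp
  next
    case False
    hence "\<bar>F (insert a (I \<union> A)) x - F (I \<union> A) x\<bar> \<le> \<kappa>" using insert assms by (intro F_insert) auto
    thus ?thesis using insert by (simp add: algebra_simps)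
  qed
qed simp

text \<open>Remove the points in \<open>B\<close> and put them back at their new positions.\<close>
lemma F_off:
  assumes "finite B" "finite I" "\<And>a. a \<notin> B \<Longrightarrow> x a = y a"
  shows "F I x \<le> 2 * \<kappa> * card B + F I y"
proof -
  have "F (I - B) x = F (I - B) y" using assms by (intro F_cong) auto
  moreover have "I - B \<union> I \<inter> B = I" by blast
  moreover have "\<kappa> * card (I \<inter> B) \<le> \<kappa> * card B"
    using \<kappa>_nonneg assms by (intro mult_left_mono) (auto intro!: card_mono)
  ultimately show ?thesis
    using F_union[of "I \<inter> B" "I - B" x] F_union[of "I \<inter> B" "I - B" y] assms by (auto simp: abs_le_iff)
qed

lemma F_bound:
  assumes "finite I" shows "\<bar>F I x\<bar> \<le> \<kappa> * card I"
proof -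
  have "comps i {} x = {}" for i using k2 by (auto simp: comps_def)
  hence "F {} x = 0" by (simp add: F_def cnt_def)
  thus ?thesis using F_union[OF assms, of "{}" x] by simp
qed

lemma F_split:
  assumes I: "finite I" and J: "J \<subseteq> I" "card J = k" and far: "\<And>a b. a \<in> J \<Longrightarrow> b \<in> I - J \<Longrightarrow> tmax < dist (x a) (x b)"
  shows "F I x = gsum J x + F (I - J) x"
proof -
  have "cnt i I x = of_bool (shape i J x) + cnt i (I - J) x" for i
    using far tmax[of i] by (intro cnt_split I J) (auto intro: le_less_trans)
  thus ?thesis by (simp add: F_def gsum_def sum.distrib algebra_simps)
qed

lemma shape_pred: "card J = k \<Longrightarrow> Measurable.pred P (shape i J)"
  using measurable_shape[OF cech_shapes_axioms, of J "\<lambda>x. x" P i] coord_meas by simp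

lemma far_pred: "Measurable.pred P (\<lambda>x. c < dist (x a) (x b))"
  using coord_meas[of a] coord_meas[of b] by measurable

lemma bm_shape: "card J = k \<Longrightarrow> bm (\<lambda>x. of_bool (shape i J x))"
  by (intro bm_of_bool shape_pred)

lemma bm_gsum: "card J = k \<Longrightarrow> bm (gsum J)"
  unfolding gsum_def by (intro bm_sum bm_cmult bm_shape)

definition valid :: "'m \<Rightarrow> nat set \<Rightarrow> nat set \<Rightarrow> (nat \<Rightarrow> real^'d) \<Rightarrow> bool" where
  "valid i I J x \<longleftrightarrow> shape i J x \<and> (\<forall>a\<in>J. \<forall>b\<in>I - J. t $ i < dist (x a) (x b))"

lemma bm_valid: assumes "finite I" "card J = k" shows "bm (\<lambda>x. of_bool (valid i I J x))"
proof (rule bm_of_bool)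
  have "finite J" using assms card_k_finite by blast
  thus "Measurable.pred P (valid i I J)"
    unfolding valid_def using assms
    by (intro pred_intros_logic shape_pred pred_intros_finite(3) far_pred) auto
qed

lemma cnt_eq_sum_valid: "finite I \<Longrightarrow> cnt i I x = (\<Sum>J | J \<subseteq> I \<and> card J = k. of_bool (valid i I J x))"
  unfolding valid_def by (rule cnt_eq_sum)

lemma bm_cnt: "finite I \<Longrightarrow> bm (cnt i I)"
proof -
  assume I: "finite I"
  have eq: "cnt i I = (\<lambda>x. \<Sum>J | J \<subseteq> I \<and> card J = k. of_bool (valid i I J x))"
    by (rule ext, rule cnt_eq_sum_valid[OF I])
  show ?thesis unfolding eq by (rule bm_sum, rule bm_valid[OF I]) simp
qed

lemma bm_F: "finite I \<Longrightarrow> bm (F I)"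
  unfolding F_def by (intro bm_sum bm_cmult bm_cnt)

text \<open>The Laplace transform of \<open>F\<close>. By exchangeability it depends on \<open>I\<close> only through its cardinality,
  but label sets are more convenient for removing and inserting points.\<close>
definition \<phi> :: "real \<Rightarrow> nat set \<Rightarrow> real" where "\<phi> \<alpha> I = (\<integral>x. exp (\<alpha> * F I x) \<partial>P)"

lemma bm_expF: "finite I \<Longrightarrow> bm (\<lambda>x. exp (\<alpha> * F I x))" by (intro bm_exp bm_cmult bm_F)

lemma \<phi>_pos: "finite I \<Longrightarrow> 0 < \<phi> \<alpha> I"
  using PP.integral_less_AE_space[of "\<lambda>_. 0" "\<lambda>x. exp (\<alpha> * F I x)"] bm_expF
  by (simp add: \<phi>_def PP.emeasure_eq_measure)

lemma \<phi>_0: "\<phi> 0 I = 1" by (simp add: \<phi>_def)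

lemma expF_off:
  assumes "finite B" "finite I" "\<And>a. a \<notin> B \<Longrightarrow> x a = y a" "0 \<le> \<alpha>"
  shows "exp (\<alpha> * F I x) \<le> exp (2 * \<kappa> * \<alpha> * card B) * exp (\<alpha> * F I y)"
proof -
  have "\<alpha> * F I x \<le> \<alpha> * (2 * \<kappa> * card B + F I y)" using F_off[OF assms(1-3)] assms(4) by (intro mult_left_mono) auto
  thus ?thesis by (simp add: exp_add[symmetric] algebra_simps)
qed

text \<open>Avoiding a set \<open>N\<close> is, under the tilted law too, nearly an independent event for each point;
  \<open>swap_event\<close> is applied to one point after the other.\<close>
lemma avoid_estimate:
  assumes I: "finite I" and lam: "0 \<le> \<alpha>" and N: "N \<in> sets borel" and A: "finite A"
  shows "\<bar>(\<integral>x. of_bool (\<forall>a\<in>A. x a \<notin> N) * exp (\<alpha> * F I x) \<partial>P) - (1 - measure Q N) ^ card A * \<phi> \<alpha> I\<bar>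
    \<le> card A * measure Q N * (exp (2 * \<kappa> * \<alpha>) - 1) * \<phi> \<alpha> I"
  using A
proof (induction A rule: finite_induct)
  case empty thus ?case by (simp add: \<phi>_def)
next
  case (insert a A)
  let ?q = "measure Q N" and ?c = "exp (2 * \<kappa> * \<alpha>)"
  define U where "U A = (\<integral>x. of_bool (\<forall>a\<in>A. x a \<notin> N) * exp (\<alpha> * F I x) \<partial>P)" for A
  have bA: "bm (\<lambda>x. of_bool (\<forall>a\<in>A. x a \<notin> N))" for A :: "nat set"
  proof (cases "finite A")
    case True
    show ?thesis
      using pred_box[OF True, of "\<lambda>_. - N"] N by (intro bm_of_bool) (simp add: borel_comp)
  next
    case False
    have "Measurable.pred P (\<lambda>x. \<forall>a\<in>A. x a \<in> - N)"
      by (rule pred_intros_countable_bounded(3), rule pred_coord) (use N in \<open>simp add: borel_comp\<close>)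
    thus ?thesis by (intro bm_of_bool) simp
  qed
  define f where "f x = of_bool (\<forall>a\<in>A. x a \<notin> N) * exp (\<alpha> * F I x)" for x
  have bf: "bm f" unfolding f_def by (rule bm_mult[OF bA bm_expF[OF I]])
  have sw: "f (x(a := u)) \<le> ?c * f x" for x u
  proof -
    have "exp (\<alpha> * F I (x(a := u))) \<le> exp (2 * \<kappa> * \<alpha> * card {a}) * exp (\<alpha> * F I x)"
      using I lam by (intro expF_off) auto
    moreover have "(\<forall>b\<in>A. (x(a := u)) b \<notin> N) = (\<forall>b\<in>A. x b \<notin> N)" using insert(2) by auto
    moreover have "of_bool (\<forall>b\<in>A. x b \<notin> N) * exp (\<alpha> * F I (x(a := u)))
        \<le> of_bool (\<forall>b\<in>A. x b \<notin> N) * (exp (2 * \<kappa> * \<alpha> * card {a}) * exp (\<alpha> * F I x))"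
      using calculation(1) by (rule mult_left_mono) simp
    ultimately show ?thesis unfolding f_def by (simp only: card.empty card.insert_remove) (simp add: mult.left_commute)
  qed
  have sw2: "\<bar>(\<integral>x. of_bool (x a \<in> N) * f x \<partial>P) - ?q * U A\<bar> \<le> ?q * (?c - 1) * U A"
    using swap_event[OF N bf _ _ sw] lam \<kappa>_nonneg unfolding U_def f_def by simp
  have "U (insert a A) = (\<integral>x. f x - of_bool (x a \<in> N) * f x \<partial>P)"
    unfolding U_def f_def by (intro Bochner_Integration.integral_cong) auto
  also have "\<dots> = U A - (\<integral>x. of_bool (x a \<in> N) * f x \<partial>P)"
  proof -
    have "U A = integral\<^sup>L P f"
      unfolding U_def by (intro Bochner_Integration.integral_cong) (simp_all add: f_def)
    thus ?thesis using bf bm_mult[OF bm_of_bool[OF pred_coord[OF N]] bf]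
      by (subst Bochner_Integration.integral_diff) auto
  qed
  finally have 1: "\<bar>U (insert a A) - (1 - ?q) * U A\<bar> \<le> ?q * (?c - 1) * U A"
    using sw2 by (simp add: algebra_simps abs_minus_commute)
  have UA: "U A \<le> \<phi> \<alpha> I" unfolding U_def \<phi>_def
    by (intro integral_mono bm_integrable bm_mult bA bm_expF I) auto
  have c1: "1 \<le> ?c" using lam \<kappa>_nonneg by simp
  have q01: "0 \<le> ?q" "?q \<le> 1" by auto
  have "\<bar>U (insert a A) - (1 - ?q) ^ card (insert a A) * \<phi> \<alpha> I\<bar>
    = \<bar>(U (insert a A) - (1 - ?q) * U A) + (1 - ?q) * (U A - (1 - ?q) ^ card A * \<phi> \<alpha> I)\<bar>"
    using insert by (simp add: algebra_simps)
  also have "\<dots> \<le> \<bar>U (insert a A) - (1 - ?q) * U A\<bar> + (1 - ?q) * \<bar>U A - (1 - ?q) ^ card A * \<phi> \<alpha> I\<bar>"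
  proof -
    have "\<bar>(1 - ?q) * (U A - (1 - ?q) ^ card A * \<phi> \<alpha> I)\<bar> = (1 - ?q) * \<bar>U A - (1 - ?q) ^ card A * \<phi> \<alpha> I\<bar>"
      using q01 by (simp only: abs_mult)
    thus ?thesis using abs_triangle_ineq by metis
  qed
  also have "(1 - ?q) * \<bar>U A - (1 - ?q) ^ card A * \<phi> \<alpha> I\<bar> \<le> 1 * (card A * ?q * (?c - 1) * \<phi> \<alpha> I)"
    using q01 insert.IH unfolding U_def[symmetric] by (intro mult_mono) auto
  also have "\<bar>U (insert a A) - (1 - ?q) * U A\<bar> \<le> ?q * (?c - 1) * \<phi> \<alpha> I"
    using 1 mult_left_mono[OF UA, of "?q * (?c - 1)"] q01 c1 by simp
  finally show ?case using insert unfolding U_def[symmetric] by (simp add: algebra_simps)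
qed

end

context cech_iid begin

abbreviation "ell \<equiv> (real k + 1) * tmax"

lemma close_bound:
  assumes I: "finite I" and lam: "0 \<le> \<alpha>" and B: "finite B" "a \<notin> B"
  shows "(\<integral>x. of_bool (\<forall>b\<in>B. dist (x b) (x a) \<le> ell) * exp (\<alpha> * F I x) \<partial>P)
      \<le> exp (2 * \<kappa> * \<alpha> * card B) * p ^ card B * \<phi> \<alpha> I"
  unfolding \<phi>_def
proof (rule near_event_bound[OF B bm_expF[OF I], of \<alpha> _ "\<lambda>u v. dist u v \<le> ell"])
  show "Measurable.pred (borel \<Otimes>\<^sub>M borel) (\<lambda>(u :: real^'d, v). dist u v \<le> ell)"
    unfolding case_prod_unfold by measurable
  show "measure Q {u. dist u v \<le> ell} \<le> p" for v
    using ball[of v] by (simp add: cball_def dist_commute)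
qed (use lam I B in \<open>auto intro!: expF_off\<close>)

lemma bm_close: "finite B \<Longrightarrow> bm (\<lambda>x. of_bool (\<forall>b\<in>B. dist (x b) (x a) \<le> c))"
proof (intro bm_of_bool pred_intros_finite(3))
  show "Measurable.pred P (\<lambda>x. dist (x b) (x a) \<le> c)" for b
    using coord_meas[of a] coord_meas[of b] by measurable
qed

lemma F_changed_bound:
  assumes I: "finite I" "a \<notin> I"
  shows "of_bool (F (insert a I) x \<noteq> F I x) \<le> (\<Sum>B | B \<subseteq> I \<and> card B = k - 1. of_bool (\<forall>b\<in>B. dist (x b) (x a) \<le> ell) :: real)"
proof (cases "F (insert a I) x = F I x")
  case False
  then obtain B where B: "B \<subseteq> I" "card B = k - 1" "\<forall>b\<in>B. dist (x b) (x a) \<le> ell"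
    using F_changed[OF I] by metis
  have "finite {B. B \<subseteq> I \<and> card B = k - 1}" using I by simp
  hence "of_bool (\<forall>b\<in>B. dist (x b) (x a) \<le> ell) \<le> (\<Sum>B | B \<subseteq> I \<and> card B = k - 1. of_bool (\<forall>b\<in>B. dist (x b) (x a) \<le> ell) :: real)"
    using B by (intro member_le_sum) auto
  thus ?thesis using B False by simp
qed (simp add: sum_nonneg)

text \<open>The union bound over the \<open>k - 1\<close> points which \<open>cnt_insert_changed\<close> finds near the new point gives
  the factor \<open>(card I * p) ^ (k - 1)\<close>. This power is what makes the fluctuations of the number of points of a Poisson
  process harmless.\<close>
lemma changed_bound:
  assumes I: "finite I" "a \<notin> I" and lam: "0 \<le> \<alpha>" 
  shows "(\<integral>x. \<bar>F (insert a I) x - F I x\<bar> * exp (\<alpha> * F I x) \<partial>P)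
     \<le> \<kappa> * exp (2 * \<kappa> * \<alpha> * (k - 1)) * (card I * p) ^ (k - 1) * \<phi> \<alpha> I"
proof -
  let ?S = "{B. B \<subseteq> I \<and> card B = k - 1}"
  have fS: "finite ?S" using I by simp
  have fB: "finite B" "a \<notin> B" if "B \<in> ?S" for B
    using that I finite_subset[of B I] by blast+
  let ?c = "\<lambda>B x. of_bool (\<forall>b\<in>B. dist (x b) (x a) \<le> ell) :: real"
  have "(\<integral>x. \<bar>F (insert a I) x - F I x\<bar> * exp (\<alpha> * F I x) \<partial>P)
    \<le> (\<integral>x. (\<Sum>B\<in>?S. \<kappa> * (?c B x * exp (\<alpha> * F I x))) \<partial>P)"
  proof (rule integral_mono)
    show "integrable P (\<lambda>x. \<bar>F (insert a I) x - F I x\<bar> * exp (\<alpha> * F I x))"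
      using I by (intro bm_integrable bm_mult bm_abs bm_diff bm_F bm_expF) auto
    show "integrable P (\<lambda>x. \<Sum>B\<in>?S. \<kappa> * (?c B x * exp (\<alpha> * F I x)))"
      by (rule bm_integrable, rule bm_sum, rule bm_cmult, rule bm_mult, rule bm_close, erule fB(1), rule bm_expF[OF I(1)])
    fix x
    have "\<bar>F (insert a I) x - F I x\<bar> \<le> \<kappa> * of_bool (F (insert a I) x \<noteq> F I x)"
      using F_insert[OF I, of x] by auto
    also have "\<dots> \<le> \<kappa> * (\<Sum>B\<in>?S. ?c B x)" using F_changed_bound[OF I, of x] \<kappa>_nonneg by (intro mult_left_mono)
    finally have "\<bar>F (insert a I) x - F I x\<bar> * exp (\<alpha> * F I x) \<le> \<kappa> * (\<Sum>B\<in>?S. ?c B x) * exp (\<alpha> * F I x)"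
      by (intro mult_right_mono) auto
    thus "\<bar>F (insert a I) x - F I x\<bar> * exp (\<alpha> * F I x) \<le> (\<Sum>B\<in>?S. \<kappa> * (?c B x * exp (\<alpha> * F I x)))"
      by (simp only: sum_distrib_left sum_distrib_right mult.assoc)
  qed
  also have "\<dots> = (\<Sum>B\<in>?S. (\<integral>x. \<kappa> * (?c B x * exp (\<alpha> * F I x)) \<partial>P))"
    by (rule Bochner_Integration.integral_sum, rule bm_integrable, rule bm_cmult, rule bm_mult, rule bm_close,
        erule fB(1), rule bm_expF[OF I(1)])
  also have "\<dots> \<le> (\<Sum>B\<in>?S. \<kappa> * (exp (2 * \<kappa> * \<alpha> * (k - 1)) * p ^ (k - 1) * \<phi> \<alpha> I))"
  proof (rule sum_mono)
    fix B assume B: "B \<in> ?S"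
    show "(\<integral>x. \<kappa> * (?c B x * exp (\<alpha> * F I x)) \<partial>P) \<le> \<kappa> * (exp (2 * \<kappa> * \<alpha> * (k - 1)) * p ^ (k - 1) * \<phi> \<alpha> I)"
    proof -
      have "card B = k - 1" using B by simp
      hence "(\<integral>x. ?c B x * exp (\<alpha> * F I x) \<partial>P) \<le> exp (2 * \<kappa> * \<alpha> * (k - 1)) * p ^ (k - 1) * \<phi> \<alpha> I"
        using close_bound[OF I(1) lam fB[OF B]] by simp
      from mult_left_mono[OF this \<kappa>_nonneg] show ?thesis by simp
    qed
  qed
  also have "\<dots> = real (card I choose (k - 1)) * (\<kappa> * (exp (2 * \<kappa> * \<alpha> * (k - 1)) * p ^ (k - 1) * \<phi> \<alpha> I))"
    using n_subsets[OF I(1), of "k - 1"] by simp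
  also have "\<dots> \<le> real (card I) ^ (k - 1) * (\<kappa> * (exp (2 * \<kappa> * \<alpha> * (k - 1)) * p ^ (k - 1) * \<phi> \<alpha> I))"
  proof (rule mult_right_mono)
    have "card I choose (k - 1) \<le> card I ^ (k - 1)"
    proof (cases "k - 1 \<le> card I")
      case True thus ?thesis by (rule binomial_le_pow)
    qed (simp add: binomial_eq_0)
    thus "real (card I choose (k - 1)) \<le> real (card I) ^ (k - 1)" by (metis of_nat_le_iff of_nat_power)
    show "0 \<le> \<kappa> * (exp (2 * \<kappa> * \<alpha> * (k - 1)) * p ^ (k - 1) * \<phi> \<alpha> I)"
      using \<phi>_pos[OF I(1), of \<alpha>]
      by (intro mult_nonneg_nonneg \<kappa>_nonneg zero_le_power p_nonneg) auto
  qed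
  finally show ?thesis by (simp add: power_mult_distrib mult_ac)
qed

lemma \<phi>_insert:
  assumes I: "finite I" "a \<notin> I" and lam: "0 \<le> \<alpha>" "\<kappa> * \<alpha> \<le> 1"
  shows "\<bar>\<phi> \<alpha> (insert a I) - \<phi> \<alpha> I\<bar> \<le> \<alpha> * (\<kappa> * exp (2 * real k) * (card I * p) ^ (k - 1)) * \<phi> \<alpha> I"
proof -
  have b1: "bm (\<lambda>x. exp (\<alpha> * F (insert a I) x))" "bm (\<lambda>x. exp (\<alpha> * F I x))" using I by (auto intro!: bm_expF)
  have "\<phi> \<alpha> (insert a I) - \<phi> \<alpha> I = (\<integral>x. exp (\<alpha> * F (insert a I) x) - exp (\<alpha> * F I x) \<partial>P)"
    unfolding \<phi>_def using b1 by simp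
  also have "\<bar>\<dots>\<bar> \<le> (\<integral>x. \<bar>exp (\<alpha> * F (insert a I) x) - exp (\<alpha> * F I x)\<bar> \<partial>P)" by (rule integral_abs_bound)
  also have "\<dots> \<le> (\<integral>x. \<alpha> * exp 1 * (\<bar>F (insert a I) x - F I x\<bar> * exp (\<alpha> * F I x)) \<partial>P)"
  proof (rule integral_mono)
    show "integrable P (\<lambda>x. \<bar>exp (\<alpha> * F (insert a I) x) - exp (\<alpha> * F I x)\<bar>)"
      using b1 by (intro bm_integrable bm_abs bm_diff)
    show "integrable P (\<lambda>x. \<alpha> * exp 1 * (\<bar>F (insert a I) x - F I x\<bar> * exp (\<alpha> * F I x)))"
      using I by (intro bm_integrable bm_cmult bm_mult bm_abs bm_diff bm_F bm_expF) auto
    fix x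
    define D where "D = F (insert a I) x - F I x"
    have "\<bar>D\<bar> \<le> \<kappa>" using F_insert[OF I, of x] by (simp add: D_def)
    hence "\<alpha> * \<bar>D\<bar> \<le> \<alpha> * \<kappa>" using lam by (intro mult_left_mono) auto
    hence D1: "\<alpha> * D \<le> 1" using lam abs_ge_self[of D] mult_left_mono[of D "\<bar>D\<bar>" \<alpha>] by (simp add: mult.commute)
    have "exp (\<alpha> * F (insert a I) x) - exp (\<alpha> * F I x) = exp (\<alpha> * F I x) * (exp (\<alpha> * D) - exp 0)"
      by (simp add: D_def exp_add[symmetric] algebra_simps)
    also have "\<bar>\<dots>\<bar> = exp (\<alpha> * F I x) * \<bar>exp (\<alpha> * D) - exp 0\<bar>" by (simp add: abs_mult)
    also have "\<dots> \<le> exp (\<alpha> * F I x) * (exp 1 * \<bar>\<alpha> * D - 0\<bar>)" using D1 by (intro mult_left_mono abs_exp_diff_le) auto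
    also have "\<dots> = \<alpha> * exp 1 * (\<bar>D\<bar> * exp (\<alpha> * F I x))" using lam by (simp add: abs_mult)
    finally show "\<bar>exp (\<alpha> * F (insert a I) x) - exp (\<alpha> * F I x)\<bar> \<le> \<alpha> * exp 1 * (\<bar>F (insert a I) x - F I x\<bar> * exp (\<alpha> * F I x))"
      by (simp add: D_def)
  qed
  also have "\<dots> = \<alpha> * exp 1 * (\<integral>x. \<bar>F (insert a I) x - F I x\<bar> * exp (\<alpha> * F I x) \<partial>P)" by simp
  also have "\<dots> \<le> \<alpha> * exp 1 * (\<kappa> * exp (2 * \<kappa> * \<alpha> * (k - 1)) * (card I * p) ^ (k - 1) * \<phi> \<alpha> I)"
    by (intro mult_left_mono changed_bound[OF I lam(1)] mult_nonneg_nonneg lam(1)) simp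
  also have "\<dots> = exp (1 + 2 * (\<kappa> * \<alpha>) * (k - 1)) * (\<alpha> * (\<kappa> * (card I * p) ^ (k - 1) * \<phi> \<alpha> I))"
    by (simp add: exp_add mult.commute mult.left_commute)
  also have "\<dots> \<le> exp (2 * real k) * (\<alpha> * (\<kappa> * (card I * p) ^ (k - 1) * \<phi> \<alpha> I))"
  proof (rule mult_right_mono)
    have "2 * (\<kappa> * \<alpha>) * (k - 1) \<le> 2 * 1 * real (k - 1)" using lam by (intro mult_right_mono mult_left_mono) auto
    thus "exp (1 + 2 * (\<kappa> * \<alpha>) * (k - 1)) \<le> exp (2 * real k)" using k2 by (simp add: of_nat_diff)
    show "0 \<le> \<alpha> * (\<kappa> * (card I * p) ^ (k - 1) * \<phi> \<alpha> I)"
      using lam \<phi>_pos[OF I(1), of \<alpha>]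
      by (intro mult_nonneg_nonneg \<kappa>_nonneg zero_le_power p_nonneg) auto
  qed
  finally show ?thesis by (simp add: mult.commute mult.left_commute)
qed

lemma mean_insert:
  assumes I: "finite I" "a \<notin> I"
  shows "\<bar>integral\<^sup>L P (F (insert a I)) - integral\<^sup>L P (F I)\<bar> \<le> \<kappa> * exp (2 * real k) * (card I * p) ^ (k - 1)"
proof -
  have "integral\<^sup>L P (F (insert a I)) - integral\<^sup>L P (F I) = (\<integral>x. F (insert a I) x - F I x \<partial>P)"
    using I bm_F by simp
  also have "\<bar>\<dots>\<bar> \<le> (\<integral>x. \<bar>F (insert a I) x - F I x\<bar> \<partial>P)" by (rule integral_abs_bound)
  also have "\<dots> \<le> \<kappa> * (card I * p) ^ (k - 1)" using changed_bound[OF I, of 0] by (simp add: \<phi>_0)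
  also have "\<dots> \<le> (\<kappa> * exp (2 * real k)) * (card I * p) ^ (k - 1)"
    using \<kappa>_nonneg p_nonneg by (intro mult_right_mono) (auto intro: mult_left_mono[of 1 "exp (2 * real k)" \<kappa>, simplified])
  finally show ?thesis by simp
qed

lemma \<phi>_ratio:
  assumes I: "finite I" "a \<notin> I" and lam: "0 \<le> \<alpha>"
  shows "\<phi> \<alpha> (insert a I) \<le> exp (\<kappa> * \<alpha>) * \<phi> \<alpha> I" "\<phi> \<alpha> I \<le> exp (\<kappa> * \<alpha>) * \<phi> \<alpha> (insert a I)"
proof -
  have *: "exp (\<alpha> * F (insert a I) x) \<le> exp (\<kappa> * \<alpha>) * exp (\<alpha> * F I x)"
      "exp (\<alpha> * F I x) \<le> exp (\<kappa> * \<alpha>) * exp (\<alpha> * F (insert a I) x)" for x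
  proof -
    have "F (insert a I) x \<le> \<kappa> + F I x" "F I x \<le> \<kappa> + F (insert a I) x" using F_insert[OF I, of x] by auto
    from this[THEN mult_left_mono[OF _ lam]]
    show "exp (\<alpha> * F (insert a I) x) \<le> exp (\<kappa> * \<alpha>) * exp (\<alpha> * F I x)"
      "exp (\<alpha> * F I x) \<le> exp (\<kappa> * \<alpha>) * exp (\<alpha> * F (insert a I) x)"
      by (auto simp: exp_add[symmetric] algebra_simps)
  qed
  have "\<phi> \<alpha> (insert a I) \<le> (\<integral>x. exp (\<kappa> * \<alpha>) * exp (\<alpha> * F I x) \<partial>P)"
    unfolding \<phi>_def using I * by (intro integral_mono bm_integrable bm_cmult bm_expF) auto
  thus "\<phi> \<alpha> (insert a I) \<le> exp (\<kappa> * \<alpha>) * \<phi> \<alpha> I" by (simp add: \<phi>_def)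
  have "\<phi> \<alpha> I \<le> (\<integral>x. exp (\<kappa> * \<alpha>) * exp (\<alpha> * F (insert a I) x) \<partial>P)"
    unfolding \<phi>_def using I * by (intro integral_mono bm_integrable bm_cmult bm_expF) auto
  thus "\<phi> \<alpha> I \<le> exp (\<kappa> * \<alpha>) * \<phi> \<alpha> (insert a I)" by (simp add: \<phi>_def)
qed

lemma \<phi>_remove:
  assumes I: "finite I" and J: "J \<subseteq> I" and lam: "0 \<le> \<alpha>"
  shows "\<phi> \<alpha> (I - J) \<le> exp (\<kappa> * \<alpha> * card J) * \<phi> \<alpha> I"
proof -
  have "finite J" using I J finite_subset by blast
  thus ?thesis using J
  proof (induction J rule: finite_induct)
    case (insert a J)
    have "\<phi> \<alpha> (I - insert a J) \<le> exp (\<kappa> * \<alpha>) * \<phi> \<alpha> (insert a (I - insert a J))"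
      using I lam by (intro \<phi>_ratio) auto
    also have "insert a (I - insert a J) = I - J" using insert by auto
    also have "exp (\<kappa> * \<alpha>) * \<phi> \<alpha> (I - J) \<le> exp (\<kappa> * \<alpha>) * (exp (\<kappa> * \<alpha> * card J) * \<phi> \<alpha> I)"
      using insert by (intro mult_left_mono) auto
    finally show ?case using insert by (simp add: exp_add algebra_simps)
  qed simp
qed

text \<open>Here the crude first power of \<open>card I * p\<close> suffices.\<close>
lemma \<phi>_remove_close:
  assumes I: "finite I" and J: "J \<subseteq> I" "card J \<le> k" and lam: "0 \<le> \<alpha>" "\<kappa> * \<alpha> \<le> 1" and s: "card I * p \<le> 1"
  shows "\<bar>\<phi> \<alpha> I - \<phi> \<alpha> (I - J)\<bar> \<le> card J * (\<alpha> * \<kappa> * exp (3 * real k) * (card I * p)) * \<phi> \<alpha> I"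
proof -
  have "finite J" using I J finite_subset by blast
  thus ?thesis using J
  proof (induction J rule: finite_induct)
    case (insert a J)
    let ?I = "I - insert a J"
    have ins: "insert a ?I = I - J" using insert by auto
    have "\<bar>\<phi> \<alpha> (insert a ?I) - \<phi> \<alpha> ?I\<bar> \<le> \<alpha> * (\<kappa> * exp (2 * real k) * (card ?I * p) ^ (k - 1)) * \<phi> \<alpha> ?I"
      using I lam by (intro \<phi>_insert) auto
    also have "\<dots> \<le> \<alpha> * (\<kappa> * exp (2 * real k) * (card I * p)) * (exp (real k) * \<phi> \<alpha> I)"
    proof (intro mult_mono mult_nonneg_nonneg)
      have "card ?I * p \<le> card I * p" using I p_nonneg by (intro mult_right_mono) (auto intro!: card_mono)
      hence "(card ?I * p) ^ (k - 1) \<le> (card I * p) ^ (k - 1)" using p_nonneg by (intro power_mono) auto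
      also have "\<dots> \<le> (card I * p) ^ 1" using s p_nonneg k2 by (intro power_decreasing) auto
      finally show "(card ?I * p) ^ (k - 1) \<le> card I * p" by simp
      have "\<phi> \<alpha> ?I \<le> exp (\<kappa> * \<alpha> * card (insert a J)) * \<phi> \<alpha> I" using insert I lam by (intro \<phi>_remove) auto
      also have "\<dots> \<le> exp (real k) * \<phi> \<alpha> I"
      proof (rule mult_right_mono)
        have "\<kappa> * \<alpha> * card (insert a J) \<le> 1 * real k" using insert lam \<kappa>_nonneg by (intro mult_mono) auto
        thus "exp (\<kappa> * \<alpha> * card (insert a J)) \<le> exp (real k)" by simp
      qed (use \<phi>_pos[OF I, of \<alpha>] in simp)
      finally show "\<phi> \<alpha> ?I \<le> exp (real k) * \<phi> \<alpha> I" .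
    qed (use lam \<kappa>_nonneg p_nonneg \<phi>_pos[of ?I \<alpha>] I in auto)
    also have "\<dots> = \<alpha> * \<kappa> * exp (3 * real k) * (card I * p) * \<phi> \<alpha> I"
      by (simp add: exp_add[symmetric] algebra_simps)
    finally have 1: "\<bar>\<phi> \<alpha> (I - J) - \<phi> \<alpha> ?I\<bar> \<le> \<alpha> * \<kappa> * exp (3 * real k) * (card I * p) * \<phi> \<alpha> I" unfolding ins .
    have "J \<subseteq> I" "card J \<le> k" using insert.prems insert.hyps by simp_all
    hence 2: "\<bar>\<phi> \<alpha> I - \<phi> \<alpha> (I - J)\<bar> \<le> card J * (\<alpha> * \<kappa> * exp (3 * real k) * (card I * p)) * \<phi> \<alpha> I"
      by (rule insert.IH)
    define z where "z = \<alpha> * \<kappa> * exp (3 * real k) * (card I * p)"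
    have "\<bar>\<phi> \<alpha> I - \<phi> \<alpha> ?I\<bar> \<le> card J * z * \<phi> \<alpha> I + z * \<phi> \<alpha> I"
      using 1 2 unfolding z_def[symmetric] by linarith
    also have "\<dots> = (card J + 1) * z * \<phi> \<alpha> I" by (simp add: distrib_right)
    also have "card J + 1 = card (insert a J)" using insert.hyps by simp
    finally show ?case unfolding z_def .
  qed simp
qed

end

section \<open>Second-order expansion of the cumulant\<close>

lemma one_minus_power_bound:
  fixes q :: real assumes "0 \<le> q" "q \<le> 1" shows "1 - (1 - q) ^ n \<le> n * q"
  using Bernoulli_inequality[of "- q" n] assms by simp

context cech_iid begin

text \<open>Complementary to \<open>avoid_estimate\<close>; Bernoulli's inequality reduces it to the expected number of hits.\<close>
lemma hit_bound:
  assumes I: "finite I" and lam: "0 \<le> \<alpha>" and N: "N \<in> sets borel" and A: "finite A"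
  shows "(\<integral>x. of_bool (\<exists>a\<in>A. x a \<in> N) * exp (\<alpha> * F I x) \<partial>P)
     \<le> card A * measure Q N * exp (2 * \<kappa> * \<alpha>) * \<phi> \<alpha> I"
proof -
  let ?q = "measure Q N" and ?c = "exp (2 * \<kappa> * \<alpha>)"
  have bA: "bm (\<lambda>x. of_bool (\<forall>a\<in>A. x a \<notin> N))"
    using pred_box[OF A, of "\<lambda>_. - N"] N by (intro bm_of_bool) (simp add: borel_comp)
  have "(\<integral>x. of_bool (\<exists>a\<in>A. x a \<in> N) * exp (\<alpha> * F I x) \<partial>P)
      = (\<integral>x. exp (\<alpha> * F I x) - of_bool (\<forall>a\<in>A. x a \<notin> N) * exp (\<alpha> * F I x) \<partial>P)"
    by (intro Bochner_Integration.integral_cong) auto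
  also have "\<dots> = \<phi> \<alpha> I - (\<integral>x. of_bool (\<forall>a\<in>A. x a \<notin> N) * exp (\<alpha> * F I x) \<partial>P)"
    unfolding \<phi>_def by (intro Bochner_Integration.integral_diff bm_integrable bm_mult bA bm_expF I)
  also have "\<dots> \<le> \<phi> \<alpha> I - ((1 - ?q) ^ card A * \<phi> \<alpha> I - card A * ?q * (?c - 1) * \<phi> \<alpha> I)"
    using avoid_estimate[OF I lam N A] by linarith
  also have "\<dots> = (1 - (1 - ?q) ^ card A) * \<phi> \<alpha> I + card A * ?q * (?c - 1) * \<phi> \<alpha> I"
    by (simp add: left_diff_distrib)
  also have "(1 - (1 - ?q) ^ card A) * \<phi> \<alpha> I \<le> card A * ?q * \<phi> \<alpha> I"
    using \<phi>_pos[OF I, of \<alpha>] by (intro mult_right_mono one_minus_power_bound) auto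
  finally show ?thesis by (simp add: algebra_simps)
qed

text \<open>The region that the other points have to avoid if \<open>J\<close>, placed at \<open>y\<close>, is to be isolated.\<close>
definition forbidden :: "real \<Rightarrow> nat set \<Rightarrow> (nat \<Rightarrow> real^'d) \<Rightarrow> (real^'d) set" where
  "forbidden s J y = (\<Union>a\<in>J. cball (y a) s)"

lemma forbidden_borel: "finite J \<Longrightarrow> forbidden s J y \<in> sets borel"
  unfolding forbidden_def by (intro sets.finite_UN) auto

lemma tmax_le_ell: "tmax \<le> ell" using tmax_pos by (simp add: algebra_simps)

lemma forbidden_measure:
  assumes J: "finite J" and s: "s \<le> tmax"
  shows "measure Q (forbidden s J y) \<le> card J * p"
proof -
  have "measure Q (forbidden s J y) \<le> (\<Sum>a\<in>J. measure Q (cball (y a) s))"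
    unfolding forbidden_def by (intro Q.finite_measure_subadditive_finite J) auto
  also have "\<dots> \<le> (\<Sum>a\<in>J. p)"
  proof (rule sum_mono)
    fix a
    have "measure Q (cball (y a) s) \<le> measure Q (cball (y a) ell)"
      using s tmax_le_ell by (intro Q.finite_measure_mono subset_cball) auto
    thus "measure Q (cball (y a) s) \<le> p" using ball[of "y a"] by linarith
  qed
  finally show ?thesis by simp
qed

lemma valid_mix:
  assumes "J \<subseteq> I"
  shows "valid i I J (mix J y z) \<longleftrightarrow> shape i J y \<and> (\<forall>b\<in>I - J. z b \<notin> forbidden (t $ i) J y)"
proof -
  have "shape i J (mix J y z) = shape i J y" by (rule shape_cong) (simp add: mix_def)
  thus ?thesis unfolding valid_def forbidden_def by (auto simp: mix_def not_le)
qed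

text \<open>The three error sources in \<open>conditional_estimate\<close>: points in the larger neighbourhood of \<open>J\<close>,
  the lack of independence of the forbidden region under the tilted law, and the linearisation of the exponential.\<close>
definition tilt_const :: real where
  "tilt_const = real k * (real k + 1) * \<kappa> * exp (real k + 2) + 2 * real k * \<kappa> * exp 3 + \<kappa>\<^sup>2 + real k * \<kappa>"

lemma tilt_const_nonneg: "0 \<le> tilt_const" unfolding tilt_const_def by (intro add_nonneg_nonneg mult_nonneg_nonneg \<kappa>_nonneg) auto

text \<open>With the points of \<open>J\<close> frozen at \<open>y\<close>, the tilted mass of the configurations in which \<open>J\<close> is isolated is
  \<open>P(isolated) + \<alpha> * g(y)\<close> times the Laplace transform of the remaining points. The reason is that \<open>F\<close>
  equals \<open>g(y) + F(remaining points)\<close> unless a remaining point is within \<open>tmax\<close> of \<open>J\<close>. The region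
  for isolation depends on \<open>t $ i\<close> and is smaller than the one needed for this splitting when the
  \<open>t $ i\<close> differ; the discrepancy costs a term of order \<open>\<alpha> * card I * p\<close>, because even there the
  integrand changes by a factor \<open>1 + O(\<alpha>)\<close> only.\<close>
lemma conditional_estimate:
  fixes i :: 'm and y :: "nat \<Rightarrow> real^'d"
  assumes I: "finite I" and J: "J \<subseteq> I" "card J = k" and lam: "0 \<le> \<alpha>" "\<kappa> * \<alpha> \<le> 1" and s: "card I * p \<le> 1"
  defines "A \<equiv> \<lambda>z. of_bool (\<forall>b\<in>I - J. z b \<notin> forbidden (t $ i) J y) :: real"
  shows "\<bar>(\<integral>z. A z * exp (\<alpha> * F I (mix J y z)) \<partial>P) - ((\<integral>z. A z \<partial>P) + \<alpha> * gsum J y) * \<phi> \<alpha> (I - J)\<bar>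
     \<le> tilt_const * (\<alpha>\<^sup>2 + \<alpha> * (card I * p)) * \<phi> \<alpha> (I - J)"
proof -
  let ?I = "I - J" and ?s = "card I * p" and ?\<phi> = "\<phi> \<alpha> (I - J)"
  have fin: "finite J" "finite ?I" using I J card_k_finite by auto
  define N where "N = forbidden (t $ i) J y"
  define N' where "N' = forbidden tmax J y"
  define q where "q = measure Q N"
  have Nb: "N \<in> sets borel" "N' \<in> sets borel" unfolding N_def N'_def using forbidden_borel fin by auto
  have qk: "q \<le> k * p" "measure Q N' \<le> k * p"
    unfolding q_def N_def N'_def using forbidden_measure[OF fin(1), of _ y] tmax J by auto
  have q0: "0 \<le> q" "q \<le> 1" by (auto simp: q_def)
  have cI: "card ?I \<le> card I" using I by (intro card_mono) auto
  have pos: "0 < ?\<phi>" using \<phi>_pos[OF fin(2)] .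
  have s0: "0 \<le> ?s" using p_nonneg by simp
  have nq: "card ?I * q \<le> k * ?s" "card ?I * measure Q N' \<le> k * ?s"
  proof -
    have "card ?I * q \<le> card I * (k * p)" using cI qk q0 by (intro mult_mono) auto
    thus "card ?I * q \<le> k * ?s" by (simp add: algebra_simps)
    have "card ?I * measure Q N' \<le> card I * (k * p)" using cI qk by (intro mult_mono) auto
    thus "card ?I * measure Q N' \<le> k * ?s" by (simp add: algebra_simps)
  qed
  have bA: "bm A" unfolding A_def
    using pred_box[OF fin(2), of "\<lambda>_. - N"] Nb by (intro bm_of_bool) (simp add: borel_comp N_def)
  define g where "g = gsum J y"
  have g: "\<bar>g\<bar> \<le> \<kappa>" unfolding g_def by (rule gsum_bound)
  have ag: "\<bar>\<alpha> * g\<bar> \<le> \<alpha> * \<kappa>" "\<alpha> * \<kappa> \<le> 1" using g lam by (auto simp: abs_mult mult.commute intro: mult_left_mono)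
  have eg: "exp (\<alpha> * g) \<le> exp 1" using ag by (simp add: abs_le_iff)
  let ?e = "\<lambda>z. exp (\<alpha> * F ?I z)"
  define T where "T = (\<integral>z. A z * exp (\<alpha> * F I (mix J y z)) \<partial>P)"
  define U where "U = (\<integral>z. A z * ?e z \<partial>P)"
  define R where "R = (\<integral>z. A z \<partial>P)"
  have b1: "bm (\<lambda>z. A z * exp (\<alpha> * F I (mix J y z)))"
    by (intro bm_mult bA bm_mix[OF bm_expF[OF I]])
  have b2: "bm (\<lambda>z. A z * ?e z)" by (intro bm_mult bA bm_expF fin)
  have R: "R = (1 - q) ^ card ?I"
    using avoid_estimate[OF fin(2) order_refl Nb(1) fin(2)] unfolding R_def A_def q_def N_def by (simp add: \<phi>_0)
  have R01: "0 \<le> R" "R \<le> 1" "1 - R \<le> k * ?s"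
    unfolding R using q0 one_minus_power_bound[of q "card ?I"] nq by (auto simp: power_le_one)
  define c where "c = \<alpha> * ((real k + 1) * \<kappa> * exp (real k))"
  have c0: "0 \<le> c" unfolding c_def using lam \<kappa>_nonneg by (intro mult_nonneg_nonneg) auto
  \<comment> \<open>The splitting of \<open>F\<close> is exact unless a remaining point hits \<open>N'\<close>.\<close>
  have pt: "\<bar>A z * exp (\<alpha> * F I (mix J y z)) - exp (\<alpha> * g) * (A z * ?e z)\<bar> \<le> c * (of_bool (\<exists>b\<in>?I. z b \<in> N') * ?e z)" for z
  proof (cases "\<exists>b\<in>?I. z b \<in> N'")
    case False
    have "F I (mix J y z) = gsum J (mix J y z) + F ?I (mix J y z)"
    proof (rule F_split[OF I J])
      fix a b assume "a \<in> J" "b \<in> ?I"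
      thus "tmax < dist (mix J y z a) (mix J y z b)" using False unfolding N'_def forbidden_def by (auto simp: mix_def not_le)
    qed
    moreover have "gsum J (mix J y z) = g"
      unfolding gsum_def g_def using shape_cong[of J "mix J y z" y] by (simp add: mix_def)
    moreover have "F ?I (mix J y z) = F ?I z" by (rule F_cong) (auto simp: mix_def)
    ultimately have "exp (\<alpha> * F I (mix J y z)) = exp (\<alpha> * g) * ?e z" by (simp add: exp_add[symmetric] algebra_simps)
    thus ?thesis using False by simp
  next
    case True
    define D where "D = F I (mix J y z) - F ?I z"
    have "?I \<union> J = I" using J by blast
    moreover have "F ?I (mix J y z) = F ?I z" by (rule F_cong) (auto simp: mix_def)
    ultimately have D: "\<bar>D\<bar> \<le> \<kappa> * k" using F_union[OF fin, of "mix J y z"] J by (simp add: D_def)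
    have Dk: "\<bar>\<alpha> * D\<bar> \<le> k"
    proof -
      have "\<bar>\<alpha> * D\<bar> \<le> \<alpha> * (\<kappa> * k)" using D lam by (auto simp: abs_mult intro: mult_left_mono)
      also have "\<dots> = (\<kappa> * \<alpha>) * k" by simp
      also have "\<dots> \<le> 1 * real k" using lam by (intro mult_right_mono) auto
      finally show ?thesis by simp
    qed
    have "A z * exp (\<alpha> * F I (mix J y z)) - exp (\<alpha> * g) * (A z * ?e z) = A z * ?e z * (exp (\<alpha> * D) - exp (\<alpha> * g))"
      by (simp add: D_def exp_add[symmetric] algebra_simps)
    also have "\<bar>\<dots>\<bar> = A z * ?e z * \<bar>exp (\<alpha> * D) - exp (\<alpha> * g)\<bar>" by (simp add: abs_mult A_def)
    also have "\<dots> \<le> 1 * ?e z * (exp (real k) * \<bar>\<alpha> * D - \<alpha> * g\<bar>)"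
      using Dk ag k2 by (intro mult_mono abs_exp_diff_le) (auto simp: A_def abs_le_iff)
    also have "\<bar>\<alpha> * D - \<alpha> * g\<bar> \<le> \<alpha> * (\<kappa> * k) + \<alpha> * \<kappa>"
    proof -
      have "\<bar>\<alpha> * D\<bar> \<le> \<alpha> * (\<kappa> * k)" using D lam by (auto simp: abs_mult intro: mult_left_mono)
      thus ?thesis using ag by linarith
    qed
    finally have "\<bar>A z * exp (\<alpha> * F I (mix J y z)) - exp (\<alpha> * g) * (A z * ?e z)\<bar> \<le> 1 * ?e z * (exp (real k) * (\<alpha> * (\<kappa> * k) + \<alpha> * \<kappa>))"
      by simp
    also have "\<dots> = c * ?e z" unfolding c_def by (simp add: algebra_simps)
    finally show ?thesis using True by simp
  qed
  have s1: "\<bar>T - exp (\<alpha> * g) * U\<bar> \<le> real k * (real k + 1) * \<kappa> * exp (real k + 2) * (\<alpha> * ?s) * ?\<phi>"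
  proof -
    have bH: "bm (\<lambda>z. of_bool (\<exists>b\<in>?I. z b \<in> N'))"
      using fin Nb by (intro bm_of_bool pred_intros_finite(4) pred_coord) auto
    have eq: "T - exp (\<alpha> * g) * U = (\<integral>z. A z * exp (\<alpha> * F I (mix J y z)) - exp (\<alpha> * g) * (A z * ?e z) \<partial>P)"
      unfolding T_def U_def using b1 b2 by (subst Bochner_Integration.integral_diff) auto
    have "\<bar>T - exp (\<alpha> * g) * U\<bar> \<le> (\<integral>z. \<bar>A z * exp (\<alpha> * F I (mix J y z)) - exp (\<alpha> * g) * (A z * ?e z)\<bar> \<partial>P)"
      unfolding eq by (rule integral_abs_bound)
    also have "\<dots> \<le> (\<integral>z. c * (of_bool (\<exists>b\<in>?I. z b \<in> N') * ?e z) \<partial>P)"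
      by (intro integral_mono bm_integrable bm_abs bm_diff b1 bm_cmult[OF b2] bm_cmult[OF bm_mult[OF bH bm_expF[OF fin(2)]]] pt)
    also have "\<dots> = c * (\<integral>z. of_bool (\<exists>b\<in>?I. z b \<in> N') * ?e z \<partial>P)" by simp
    also have "\<dots> \<le> c * (card ?I * measure Q N' * exp (2 * \<kappa> * \<alpha>) * ?\<phi>)"
      using c0 by (intro mult_left_mono hit_bound fin Nb lam)
    also have "\<dots> \<le> c * ((k * ?s) * exp 2 * ?\<phi>)"
    proof -
      have "card ?I * measure Q N' * exp (2 * \<kappa> * \<alpha>) \<le> (k * ?s) * exp 2"
        by (rule mult_mono[OF nq(2)]) (use lam s0 in auto)
      from mult_left_mono[OF mult_right_mono[OF this, of ?\<phi>] c0] pos show ?thesis by simp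
    qed
    also have "\<dots> = real k * (real k + 1) * \<kappa> * exp (real k + 2) * (\<alpha> * ?s) * ?\<phi>"
      unfolding c_def exp_add by (simp add: mult_ac)
    finally show ?thesis .
  qed
  \<comment> \<open>The isolation event decouples from the tilt by the remaining points.\<close>
  have s2: "\<bar>exp (\<alpha> * g) * U - exp (\<alpha> * g) * R * ?\<phi>\<bar> \<le> 2 * real k * \<kappa> * exp 3 * (\<alpha> * ?s) * ?\<phi>"
  proof -
    have "\<bar>U - R * ?\<phi>\<bar> \<le> card ?I * q * (exp (2 * \<kappa> * \<alpha>) - 1) * ?\<phi>"
      using avoid_estimate[OF fin(2) lam(1) Nb(1) fin(2)] unfolding U_def A_def R q_def N_def .
    also have "\<dots> \<le> (k * ?s) * (exp 2 * (2 * \<kappa> * \<alpha>)) * ?\<phi>"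
    proof (rule mult_right_mono, rule mult_mono[OF nq(1)])
      have "\<bar>exp (2 * \<kappa> * \<alpha>) - exp 0\<bar> \<le> exp 2 * \<bar>2 * \<kappa> * \<alpha> - 0\<bar>"
        using lam by (intro abs_exp_diff_le) auto
      thus "exp (2 * \<kappa> * \<alpha>) - 1 \<le> exp 2 * (2 * \<kappa> * \<alpha>)" using lam \<kappa>_nonneg by simp
    qed (use nq lam \<kappa>_nonneg pos s0 in auto)
    finally have "\<bar>U - R * ?\<phi>\<bar> \<le> (k * ?s) * (exp 2 * (2 * \<kappa> * \<alpha>)) * ?\<phi>" .
    hence "exp (\<alpha> * g) * \<bar>U - R * ?\<phi>\<bar> \<le> exp 1 * ((k * ?s) * (exp 2 * (2 * \<kappa> * \<alpha>)) * ?\<phi>)"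
      using eg by (intro mult_mono) auto
    also have "\<dots> = 2 * real k * \<kappa> * (exp 1 * exp 2) * (\<alpha> * ?s) * ?\<phi>" by (simp add: mult_ac)
    also have "exp 1 * exp 2 = (exp 3 :: real)" by (simp add: exp_add[symmetric])
    finally have "exp (\<alpha> * g) * \<bar>U - R * ?\<phi>\<bar> \<le> 2 * real k * \<kappa> * exp 3 * (\<alpha> * ?s) * ?\<phi>" .
    moreover have "exp (\<alpha> * g) * U - exp (\<alpha> * g) * R * ?\<phi> = exp (\<alpha> * g) * (U - R * ?\<phi>)" by (simp add: right_diff_distrib mult.assoc)
    ultimately show ?thesis by (simp only: abs_mult abs_exp_cancel)
  qed
  \<comment> \<open>Linearise in \<open>\<alpha>\<close>; the factor \<open>R\<close> in front of \<open>\<alpha> * g\<close> may be dropped as \<open>1 - R = O(card I * p)\<close>.\<close>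
  have s3: "\<bar>exp (\<alpha> * g) * R - (R + \<alpha> * g)\<bar> \<le> \<kappa>\<^sup>2 * \<alpha>\<^sup>2 + real k * \<kappa> * (\<alpha> * ?s)"
  proof -
    have "exp (\<alpha> * g) * R - (R + \<alpha> * g) = R * (exp (\<alpha> * g) - 1 - \<alpha> * g) - (\<alpha> * g) * (1 - R)"
      by (simp add: algebra_simps)
    also have "\<bar>\<dots>\<bar> \<le> \<bar>R * (exp (\<alpha> * g) - 1 - \<alpha> * g)\<bar> + \<bar>(\<alpha> * g) * (1 - R)\<bar>" by (rule abs_triangle_ineq4)
    also have "\<bar>R * (exp (\<alpha> * g) - 1 - \<alpha> * g)\<bar> \<le> 1 * (\<alpha> * g)\<^sup>2"
      unfolding abs_mult[of R] using R01 ag by (intro mult_mono abs_exp_minus_one_minus_le) auto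
    also have "1 * (\<alpha> * g)\<^sup>2 \<le> \<kappa>\<^sup>2 * \<alpha>\<^sup>2"
    proof -
      have "(\<alpha> * g)\<^sup>2 \<le> (\<alpha> * \<kappa>)\<^sup>2" using ag(1) by (intro abs_le_square_iff[THEN iffD1]) (auto intro: order_trans)
      thus ?thesis by (simp add: power_mult_distrib mult.commute)
    qed
    also have "\<bar>(\<alpha> * g) * (1 - R)\<bar> \<le> (\<alpha> * \<kappa>) * (k * ?s)"
      unfolding abs_mult[of "\<alpha> * g"] using R01 ag lam \<kappa>_nonneg by (intro mult_mono) auto
    finally show ?thesis by (simp add: mult_ac)
  qed
  have s3': "\<bar>exp (\<alpha> * g) * R * ?\<phi> - (R + \<alpha> * g) * ?\<phi>\<bar> \<le> (\<kappa>\<^sup>2 * \<alpha>\<^sup>2 + real k * \<kappa> * (\<alpha> * ?s)) * ?\<phi>"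
  proof -
    have "exp (\<alpha> * g) * R * ?\<phi> - (R + \<alpha> * g) * ?\<phi> = (exp (\<alpha> * g) * R - (R + \<alpha> * g)) * ?\<phi>" by (simp add: left_diff_distrib)
    thus ?thesis using s3 pos by (simp add: abs_mult mult_right_mono)
  qed
  have "\<bar>T - (R + \<alpha> * g) * ?\<phi>\<bar> \<le> real k * (real k + 1) * \<kappa> * exp (real k + 2) * (\<alpha> * ?s) * ?\<phi>
     + 2 * real k * \<kappa> * exp 3 * (\<alpha> * ?s) * ?\<phi> + (\<kappa>\<^sup>2 * \<alpha>\<^sup>2 + real k * \<kappa> * (\<alpha> * ?s)) * ?\<phi>"
    using s1 s2 s3' by linarith
  also have "\<dots> = (real k * (real k + 1) * \<kappa> * exp (real k + 2) * (\<alpha> * ?s) + 2 * real k * \<kappa> * exp 3 * (\<alpha> * ?s)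
     + \<kappa>\<^sup>2 * \<alpha>\<^sup>2 + real k * \<kappa> * (\<alpha> * ?s)) * ?\<phi>" by (simp only: distrib_right add.assoc)
  also have "\<dots> \<le> (tilt_const * (\<alpha>\<^sup>2 + \<alpha> * ?s)) * ?\<phi>"
  proof (rule mult_right_mono)
    define u where "u = real k * (real k + 1) * \<kappa> * exp (real k + 2)"
    define v where "v = 2 * real k * \<kappa> * exp 3"
    define w where "w = real k * \<kappa>"
    have "0 \<le> u" "0 \<le> v" "0 \<le> w" unfolding u_def v_def w_def using \<kappa>_nonneg by (auto intro!: mult_nonneg_nonneg)
    hence n: "0 \<le> u * \<alpha>\<^sup>2" "0 \<le> v * \<alpha>\<^sup>2" "0 \<le> w * \<alpha>\<^sup>2" "0 \<le> \<kappa>\<^sup>2 * (\<alpha> * ?s)" using lam s0 by auto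
    have "tilt_const = u + v + \<kappa>\<^sup>2 + w" unfolding tilt_const_def u_def v_def w_def ..
    hence "tilt_const * (\<alpha>\<^sup>2 + \<alpha> * ?s) = (u * (\<alpha> * ?s) + v * (\<alpha> * ?s) + \<kappa>\<^sup>2 * \<alpha>\<^sup>2 + w * (\<alpha> * ?s))
      + (u * \<alpha>\<^sup>2 + v * \<alpha>\<^sup>2 + w * \<alpha>\<^sup>2 + \<kappa>\<^sup>2 * (\<alpha> * ?s))" by (simp only: distrib_left distrib_right)
    thus "real k * (real k + 1) * \<kappa> * exp (real k + 2) * (\<alpha> * ?s) + 2 * real k * \<kappa> * exp 3 * (\<alpha> * ?s)
     + \<kappa>\<^sup>2 * \<alpha>\<^sup>2 + real k * \<kappa> * (\<alpha> * ?s) \<le> tilt_const * (\<alpha>\<^sup>2 + \<alpha> * ?s)"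
      using n unfolding u_def[symmetric] v_def[symmetric] w_def[symmetric] by linarith
  qed (use pos in simp)
  finally show ?thesis unfolding T_def R_def g_def .
qed

end

text \<open>Differentiability with an explicit quadratic error avoids differentiation under the integral sign.\<close>
lemma DERIV_quadratic_error:
  fixes f :: "real \<Rightarrow> real"
  assumes d: "0 < d" and le: "\<And>h. \<bar>h\<bar> < d \<Longrightarrow> \<bar>f (x + h) - f x - h * D\<bar> \<le> C * h\<^sup>2"
  shows "(f has_real_derivative D) (at x)"
proof -
  have "((\<lambda>h. (f (x + h) - f x) / h - D) \<longlongrightarrow> 0) (at 0)"
  proof (rule Lim_null_comparison)
    have "\<forall>\<^sub>F h in at 0. \<bar>h\<bar> < d \<and> h \<noteq> (0::real)"
      using d unfolding eventually_at by (intro exI[of _ d]) (simp add: dist_real_def)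
    thus "\<forall>\<^sub>F h in at 0. norm ((f (x + h) - f x) / h - D) \<le> C * \<bar>h\<bar>"
    proof eventually_elim
      case (elim h)
      have "\<bar>(f (x + h) - f x) / h - D\<bar> = \<bar>f (x + h) - f x - h * D\<bar> / \<bar>h\<bar>"
        using elim by (simp add: abs_divide[symmetric] diff_divide_distrib)
      also have "\<dots> \<le> C * h\<^sup>2 / \<bar>h\<bar>" using le elim by (intro divide_right_mono) auto
      also have "h\<^sup>2 = \<bar>h\<bar> * \<bar>h\<bar>" by (simp add: power2_eq_square)
      also have "C * (\<bar>h\<bar> * \<bar>h\<bar>) / \<bar>h\<bar> = C * \<bar>h\<bar>" using elim by (simp del: abs_mult_self_eq)
      finally show ?case by simp
    qed
    have "((\<lambda>h. C * \<bar>h\<bar>) \<longlongrightarrow> C * \<bar>0::real\<bar>) (at 0)" by (intro tendsto_intros)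
    thus "((\<lambda>h. C * \<bar>h\<bar>) \<longlongrightarrow> 0) (at (0::real))" by simp
  qed
  hence "((\<lambda>h. (f (x + h) - f x) / h) \<longlongrightarrow> D) (at 0)" by (simp add: LIM_zero_iff)
  thus ?thesis by (simp add: DERIV_def)
qed

context cech_iid begin

definition cumulant_const :: real where "cumulant_const = tilt_const * exp (real k) + 2 * real k * \<kappa> * exp (3 * real k)"

lemma cumulant_const_nonneg: "0 \<le> cumulant_const" unfolding cumulant_const_def using tilt_const_nonneg \<kappa>_nonneg by (intro add_nonneg_nonneg mult_nonneg_nonneg) auto

definition sprob :: "'m \<Rightarrow> nat set \<Rightarrow> real" where "sprob i J = (\<integral>x. of_bool (shape i J x) \<partial>P)"

lemma sprob_nonneg: "0 \<le> sprob i J" by (simp add: sprob_def)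

text \<open>Integrate \<open>conditional_estimate\<close> over the positions \<open>y\<close> of \<open>J\<close>. Its error is multiplied by
  the indicator that \<open>y\<close> has the right shape, whence the factor \<open>sprob i J\<close>: the error is small
  relative to the main term and not only in absolute terms. Restoring the removed points in the
  Laplace transform costs no more, by \<open>\<phi>_remove_close\<close>.\<close>
lemma valid_estimate:
  fixes i :: 'm
  assumes I: "finite I" and J: "J \<subseteq> I" "card J = k" and lam: "0 \<le> \<alpha>" "\<kappa> * \<alpha> \<le> 1" and s: "card I * p \<le> 1"
  shows "\<bar>(\<integral>x. of_bool (valid i I J x) * exp (\<alpha> * F I x) \<partial>P)
      - ((\<integral>x. of_bool (valid i I J x) \<partial>P) + \<alpha> * (\<integral>x. gsum J x * of_bool (shape i J x) \<partial>P)) * \<phi> \<alpha> I\<bar>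
     \<le> cumulant_const * (\<alpha>\<^sup>2 + \<alpha> * (card I * p)) * sprob i J * \<phi> \<alpha> I"
proof -
  define s where "s = card I * p"
  define \<delta> where "\<delta> = \<alpha>\<^sup>2 + \<alpha> * s"
  define \<psi> where "\<psi> = \<phi> \<alpha> (I - J)"
  define w where "w y = (of_bool (shape i J y) :: real)" for y
  define f where "f x = of_bool (valid i I J x) * exp (\<alpha> * F I x)" for x
  define v where "v x = (of_bool (valid i I J x) :: real)" for x
  have s0: "0 \<le> s" using p_nonneg by (simp add: s_def)
  have \<delta>0: "0 \<le> \<delta>" using lam s0 by (simp add: \<delta>_def)
  have \<psi>0: "0 < \<psi>" unfolding \<psi>_def using I by (intro \<phi>_pos) auto
  have pos: "0 < \<phi> \<alpha> I" using I by (rule \<phi>_pos)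
  have bv: "bm v" unfolding v_def by (rule bm_valid[OF I J(2)])
  have bf: "bm f" unfolding f_def by (rule bm_mult[OF bm_valid[OF I J(2)] bm_expF[OF I]])
  have bw: "bm w" unfolding w_def by (rule bm_shape[OF J(2)])
  have bgw: "bm (\<lambda>x. gsum J x * w x)" by (rule bm_mult[OF bm_gsum[OF J(2)] bw])
  have Ew: "integral\<^sup>L P w = sprob i J" unfolding w_def sprob_def ..
  let ?h = "\<lambda>y. \<integral>z. f (mix J y z) \<partial>P" and ?r = "\<lambda>y. \<integral>z. v (mix J y z) \<partial>P"
  have bh: "bm ?h" by (rule E_mix(2)[OF bf])
  have br: "bm ?r" by (rule E_mix(2)[OF bv])
  have pt: "\<bar>?h y - (?r y + \<alpha> * (gsum J y * w y)) * \<psi>\<bar> \<le> tilt_const * \<delta> * \<psi> * w y" for y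
  proof (cases "shape i J y")
    case False
    thus ?thesis by (simp add: f_def v_def w_def valid_mix[OF J(1)])
  next
    case True
    hence "f (mix J y z) = of_bool (\<forall>b\<in>I - J. z b \<notin> forbidden (t $ i) J y) * exp (\<alpha> * F I (mix J y z))"
      and "v (mix J y z) = of_bool (\<forall>b\<in>I - J. z b \<notin> forbidden (t $ i) J y)" for z
      by (simp_all add: f_def v_def valid_mix[OF J(1)])
    hence "?h y = (\<integral>z. of_bool (\<forall>b\<in>I - J. z b \<notin> forbidden (t $ i) J y) * exp (\<alpha> * F I (mix J y z)) \<partial>P)"
      "?r y = (\<integral>z. of_bool (\<forall>b\<in>I - J. z b \<notin> forbidden (t $ i) J y) \<partial>P)" by (simp_all only:)
    thus ?thesis using conditional_estimate[OF I J lam assms(6), of i y] True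
      by (simp add: w_def \<psi>_def \<delta>_def s_def)
  qed
  define X where "X = integral\<^sup>L P v + \<alpha> * (\<integral>x. gsum J x * w x \<partial>P)"
  have Ef: "integral\<^sup>L P f = (\<integral>y. ?h y \<partial>P)" and Ev: "integral\<^sup>L P v = (\<integral>y. ?r y \<partial>P)"
    by (rule E_mix(1)[OF bf], rule E_mix(1)[OF bv])
  have b3: "bm (\<lambda>y. (?r y + \<alpha> * (gsum J y * w y)) * \<psi>)"
    by (rule bm_mult[OF bm_add[OF br bm_cmult[OF bgw]] bm_const])
  have eq: "integral\<^sup>L P f - X * \<psi> = (\<integral>y. ?h y - (?r y + \<alpha> * (gsum J y * w y)) * \<psi> \<partial>P)"
  proof -
    have "(\<integral>y. (?r y + \<alpha> * (gsum J y * w y)) * \<psi> \<partial>P) = X * \<psi>"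
      unfolding X_def Ev using br bgw bm_cmult[OF bgw, of \<alpha>] by simp
    thus ?thesis unfolding Ef
      using Bochner_Integration.integral_diff[OF bm_integrable[OF bh] bm_integrable[OF b3]] by (simp only:)
  qed
  have "\<bar>integral\<^sup>L P f - X * \<psi>\<bar> \<le> (\<integral>y. \<bar>?h y - (?r y + \<alpha> * (gsum J y * w y)) * \<psi>\<bar> \<partial>P)"
    unfolding eq by (rule integral_abs_bound)
  also have "\<dots> \<le> (\<integral>y. tilt_const * \<delta> * \<psi> * w y \<partial>P)"
    by (rule integral_mono[OF bm_integrable[OF bm_abs[OF bm_diff[OF bh b3]]] bm_integrable[OF bm_cmult[OF bw]] pt])
  also have "\<dots> = tilt_const * \<delta> * \<psi> * sprob i J" by (simp add: Ew)
  finally have 1: "\<bar>integral\<^sup>L P f - X * \<psi>\<bar> \<le> tilt_const * \<delta> * \<psi> * sprob i J" .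
  have Xb: "\<bar>X\<bar> \<le> 2 * sprob i J"
  proof -
    have "\<bar>integral\<^sup>L P v\<bar> \<le> (\<integral>x. \<bar>v x\<bar> \<partial>P)" by (rule integral_abs_bound)
    also have "\<dots> \<le> integral\<^sup>L P w"
      by (rule integral_mono[OF bm_integrable[OF bm_abs[OF bv]] bm_integrable[OF bw]]) (simp add: v_def w_def valid_def)
    finally have 1: "\<bar>integral\<^sup>L P v\<bar> \<le> sprob i J" by (simp add: Ew)
    have "\<bar>\<integral>x. gsum J x * w x \<partial>P\<bar> \<le> (\<integral>x. \<bar>gsum J x * w x\<bar> \<partial>P)" by (rule integral_abs_bound)
    also have "\<dots> \<le> (\<integral>x. \<kappa> * w x \<partial>P)"
    proof (rule integral_mono[OF bm_integrable[OF bm_abs[OF bgw]] bm_integrable[OF bm_cmult[OF bw]]])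
      fix x show "\<bar>gsum J x * w x\<bar> \<le> \<kappa> * w x" using gsum_bound[of J x] by (simp add: w_def)
    qed
    finally have 2: "\<bar>\<integral>x. gsum J x * w x \<partial>P\<bar> \<le> \<kappa> * sprob i J" by (simp add: Ew)
    have "\<bar>\<alpha> * (\<integral>x. gsum J x * w x \<partial>P)\<bar> \<le> \<alpha> * (\<kappa> * sprob i J)"
      using 2 lam by (simp only: abs_mult) (simp add: mult_left_mono)
    also have "\<dots> = (\<kappa> * \<alpha>) * sprob i J" by simp
    also have "\<dots> \<le> 1 * sprob i J" using lam sprob_nonneg by (intro mult_right_mono)
    finally show ?thesis using 1 unfolding X_def by linarith
  qed
  have \<psi>le: "\<psi> \<le> exp (real k) * \<phi> \<alpha> I"
  proof -
    have "\<psi> \<le> exp (\<kappa> * \<alpha> * card J) * \<phi> \<alpha> I" unfolding \<psi>_def by (rule \<phi>_remove[OF I J(1) lam(1)])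
    also have "\<dots> \<le> exp (real k) * \<phi> \<alpha> I"
    proof (rule mult_right_mono)
      have "\<kappa> * \<alpha> * card J \<le> 1 * real k" using lam J by (intro mult_mono) auto
      thus "exp (\<kappa> * \<alpha> * card J) \<le> exp (real k)" by simp
    qed (use pos in simp)
    finally show ?thesis .
  qed
  have "tilt_const * \<delta> * \<psi> * sprob i J = tilt_const * \<delta> * sprob i J * \<psi>" by simp
  also have "\<dots> \<le> tilt_const * \<delta> * sprob i J * (exp (real k) * \<phi> \<alpha> I)"
    using tilt_const_nonneg \<delta>0 sprob_nonneg by (intro mult_left_mono \<psi>le mult_nonneg_nonneg)
  finally have 2: "\<bar>integral\<^sup>L P f - X * \<psi>\<bar> \<le> tilt_const * \<delta> * sprob i J * (exp (real k) * \<phi> \<alpha> I)" using 1 by linarith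
  have "\<bar>X * \<psi> - X * \<phi> \<alpha> I\<bar> = \<bar>X\<bar> * \<bar>\<phi> \<alpha> I - \<psi>\<bar>"
    by (simp add: abs_mult[symmetric] right_diff_distrib abs_minus_commute)
  also have "\<dots> \<le> (2 * sprob i J) * (k * (\<alpha> * \<kappa> * exp (3 * real k) * s) * \<phi> \<alpha> I)"
    using \<phi>_remove_close[OF I J(1) _ lam assms(6)] J unfolding \<psi>_def s_def
    by (intro mult_mono Xb) (auto simp: sprob_nonneg)
  also have "\<dots> = (2 * real k * \<kappa> * exp (3 * real k)) * (\<alpha> * s) * sprob i J * \<phi> \<alpha> I" by (simp add: mult_ac)
  also have "\<dots> \<le> (2 * real k * \<kappa> * exp (3 * real k)) * \<delta> * sprob i J * \<phi> \<alpha> I"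
    using \<kappa>_nonneg sprob_nonneg pos by (intro mult_right_mono mult_left_mono mult_nonneg_nonneg) (auto simp: \<delta>_def)
  finally have "\<bar>X * \<psi> - X * \<phi> \<alpha> I\<bar> \<le> (2 * real k * \<kappa> * exp (3 * real k)) * \<delta> * sprob i J * \<phi> \<alpha> I" .
  hence "\<bar>integral\<^sup>L P f - X * \<phi> \<alpha> I\<bar> \<le> tilt_const * \<delta> * sprob i J * (exp (real k) * \<phi> \<alpha> I)
      + (2 * real k * \<kappa> * exp (3 * real k)) * \<delta> * sprob i J * \<phi> \<alpha> I" using 2 by linarith
  also have "\<dots> = cumulant_const * \<delta> * sprob i J * \<phi> \<alpha> I" unfolding cumulant_const_def by (simp add: algebra_simps)
  finally show ?thesis unfolding X_def f_def v_def w_def \<delta>_def s_def .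
qed

text \<open>The leading term of the variance of \<open>F\<close>: different components are asymptotically independent, and only
  the diagonal terms remain.\<close>
definition vsum :: "nat set \<Rightarrow> real" where
  "vsum I = (\<Sum>J | J \<subseteq> I \<and> card J = k. (\<integral>x. (gsum J x)\<^sup>2 \<partial>P))"

definition hsum :: "nat set \<Rightarrow> real" where
  "hsum I = (\<Sum>J | J \<subseteq> I \<and> card J = k. (\<Sum>i\<in>UNIV. \<bar>\<theta> $ i\<bar> * sprob i J))"

lemma hsum_nonneg: "0 \<le> hsum I" unfolding hsum_def by (intro sum_nonneg mult_nonneg_nonneg sprob_nonneg) auto

text \<open>Summing \<open>valid_estimate\<close> over all \<open>k\<close>-subsets gives the derivative of the Laplace transform. The
  second-order terms \<open>gsum J * of_bool (shape i J)\<close> combine to the squares in \<open>vsum\<close>.\<close>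
lemma tilted_mean_estimate:
  assumes I: "finite I" and lam: "0 \<le> \<alpha>" "\<kappa> * \<alpha> \<le> 1" and s: "card I * p \<le> 1"
  shows "\<bar>(\<integral>x. F I x * exp (\<alpha> * F I x) \<partial>P) - (integral\<^sup>L P (F I) + \<alpha> * vsum I) * \<phi> \<alpha> I\<bar>
     \<le> cumulant_const * (\<alpha>\<^sup>2 + \<alpha> * (card I * p)) * hsum I * \<phi> \<alpha> I"
proof -
  let ?S = "{J. J \<subseteq> I \<and> card J = k}"
  define m where "m i J = (\<integral>x. (of_bool (valid i I J x) :: real) * exp (\<alpha> * F I x) \<partial>P)" for i J
  define v where "v i J = (\<integral>x. (of_bool (valid i I J x) :: real) \<partial>P)" for i J
  define u where "u i J = (\<integral>x. gsum J x * of_bool (shape i J x) \<partial>P)" for i J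
  define \<Phi> where "\<Phi> = \<phi> \<alpha> I"
  define \<delta> where "\<delta> = \<alpha>\<^sup>2 + \<alpha> * (card I * p)"
  have Fx: "F I x = (\<Sum>J\<in>?S. \<Sum>i\<in>UNIV. \<theta> $ i * of_bool (valid i I J x))" for x
    unfolding F_def cnt_eq_sum_valid[OF I] sum_distrib_left by (rule sum.swap)
  have bv: "bm (\<lambda>x. of_bool (valid i I J x))" if "J \<in> ?S" for i J using bm_valid[OF I] that by simp
  have EF: "integral\<^sup>L P (F I) = (\<Sum>J\<in>?S. \<Sum>i\<in>UNIV. \<theta> $ i * v i J)"
  proof -
    have "integral\<^sup>L P (F I) = (\<integral>x. (\<Sum>J\<in>?S. \<Sum>i\<in>UNIV. \<theta> $ i * of_bool (valid i I J x)) \<partial>P)"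
      by (simp only: Fx[symmetric])
    also have "\<dots> = (\<Sum>J\<in>?S. (\<integral>x. (\<Sum>i\<in>UNIV. \<theta> $ i * of_bool (valid i I J x)) \<partial>P))"
      by (rule Bochner_Integration.integral_sum, rule bm_integrable, rule bm_sum, rule bm_cmult, erule bv)
    also have "\<dots> = (\<Sum>J\<in>?S. \<Sum>i\<in>UNIV. (\<integral>x. \<theta> $ i * of_bool (valid i I J x) \<partial>P))"
      by (rule sum.cong[OF refl], rule Bochner_Integration.integral_sum, rule bm_integrable, rule bm_cmult, erule bv)
    finally show ?thesis unfolding v_def by simp
  qed
  have bm2: "bm (\<lambda>x. of_bool (valid i I J x) * exp (\<alpha> * F I x))" if "J \<in> ?S" for i J
    by (rule bm_mult[OF bv[OF that] bm_expF[OF I]])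
  have EFe: "(\<integral>x. F I x * exp (\<alpha> * F I x) \<partial>P) = (\<Sum>J\<in>?S. \<Sum>i\<in>UNIV. \<theta> $ i * m i J)"
  proof -
    have "F I x * exp (\<alpha> * F I x) = (\<Sum>J\<in>?S. \<Sum>i\<in>UNIV. \<theta> $ i * (of_bool (valid i I J x) * exp (\<alpha> * F I x)))" for x
      by (subst (1) Fx) (simp only: sum_distrib_right mult.assoc)
    hence "(\<integral>x. F I x * exp (\<alpha> * F I x) \<partial>P) = (\<integral>x. (\<Sum>J\<in>?S. \<Sum>i\<in>UNIV. \<theta> $ i * (of_bool (valid i I J x) * exp (\<alpha> * F I x))) \<partial>P)"
      by (simp only:)
    also have "\<dots> = (\<Sum>J\<in>?S. (\<integral>x. (\<Sum>i\<in>UNIV. \<theta> $ i * (of_bool (valid i I J x) * exp (\<alpha> * F I x))) \<partial>P))"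
      by (rule Bochner_Integration.integral_sum, rule bm_integrable, rule bm_sum, rule bm_cmult, erule bm2)
    also have "\<dots> = (\<Sum>J\<in>?S. \<Sum>i\<in>UNIV. (\<integral>x. \<theta> $ i * (of_bool (valid i I J x) * exp (\<alpha> * F I x)) \<partial>P))"
      by (rule sum.cong[OF refl], rule Bochner_Integration.integral_sum, rule bm_integrable, rule bm_cmult, erule bm2)
    finally show ?thesis unfolding m_def by simp
  qed
  have VV: "vsum I = (\<Sum>J\<in>?S. \<Sum>i\<in>UNIV. \<theta> $ i * u i J)"
    unfolding vsum_def
  proof (rule sum.cong[OF refl])
    fix J assume J: "J \<in> ?S"
    have "(gsum J x)\<^sup>2 = (\<Sum>i\<in>UNIV. \<theta> $ i * (gsum J x * of_bool (shape i J x)))" for x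
      unfolding power2_eq_square by (subst (2) gsum_def) (simp only: sum_distrib_left mult.left_commute)
    hence "(\<integral>x. (gsum J x)\<^sup>2 \<partial>P) = (\<integral>x. (\<Sum>i\<in>UNIV. \<theta> $ i * (gsum J x * of_bool (shape i J x))) \<partial>P)" by (simp only:)
    also have "\<dots> = (\<Sum>i\<in>UNIV. (\<integral>x. \<theta> $ i * (gsum J x * of_bool (shape i J x)) \<partial>P))"
    proof (rule Bochner_Integration.integral_sum, rule bm_integrable, rule bm_cmult)
      show "bm (\<lambda>x. gsum J x * of_bool (shape i J x))" for i
        using J by (intro bm_mult bm_gsum bm_shape) auto
    qed
    finally show "(\<integral>x. (gsum J x)\<^sup>2 \<partial>P) = (\<Sum>i\<in>UNIV. \<theta> $ i * u i J)" unfolding u_def by simp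
  qed
  have "(\<integral>x. F I x * exp (\<alpha> * F I x) \<partial>P) - (integral\<^sup>L P (F I) + \<alpha> * vsum I) * \<Phi>
     = (\<Sum>J\<in>?S. \<Sum>i\<in>UNIV. \<theta> $ i * (m i J - (v i J + \<alpha> * u i J) * \<Phi>))"
    unfolding EF EFe VV
    by (simp add: sum_subtractf[symmetric] sum.distrib[symmetric] sum_distrib_left sum_distrib_right algebra_simps)
  also have "\<bar>\<dots>\<bar> \<le> (\<Sum>J\<in>?S. \<bar>\<Sum>i\<in>UNIV. \<theta> $ i * (m i J - (v i J + \<alpha> * u i J) * \<Phi>)\<bar>)" by (rule sum_abs)
  also have "\<dots> \<le> (\<Sum>J\<in>?S. \<Sum>i\<in>UNIV. \<bar>\<theta> $ i * (m i J - (v i J + \<alpha> * u i J) * \<Phi>)\<bar>)" by (rule sum_mono, rule sum_abs)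
  also have "\<dots> \<le> (\<Sum>J\<in>?S. \<Sum>i\<in>UNIV. \<bar>\<theta> $ i\<bar> * (cumulant_const * \<delta> * sprob i J * \<Phi>))"
    unfolding abs_mult
  proof (intro sum_mono mult_left_mono)
    fix i J assume "J \<in> ?S"
    thus "\<bar>m i J - (v i J + \<alpha> * u i J) * \<Phi>\<bar> \<le> cumulant_const * \<delta> * sprob i J * \<Phi>"
      unfolding m_def v_def u_def \<Phi>_def \<delta>_def using valid_estimate[OF I _ _ lam s, of J i] by simp
  qed simp
  also have "\<dots> = cumulant_const * \<delta> * hsum I * \<Phi>" unfolding hsum_def by (simp add: sum_distrib_left sum_distrib_right mult_ac)
  finally show ?thesis unfolding \<Phi>_def \<delta>_def .
qed

lemma \<phi>_derivative:
  assumes I: "finite I"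
  shows "((\<lambda>\<alpha>. \<phi> \<alpha> I) has_real_derivative (\<integral>x. F I x * exp (\<alpha> * F I x) \<partial>P)) (at \<alpha>)"
proof (rule DERIV_quadratic_error)
  define B where "B = \<kappa> * card I + 1"
  have B: "1 \<le> B" using \<kappa>_nonneg by (simp add: B_def)
  have FB: "\<bar>F I x\<bar> \<le> B" for x using F_bound[OF I, of x] by (simp add: B_def)
  show "0 < 1 / B" using B by simp
  fix h :: real assume h: "\<bar>h\<bar> < 1 / B"
  let ?d = "\<lambda>x. exp ((\<alpha> + h) * F I x) - exp (\<alpha> * F I x) - h * (F I x * exp (\<alpha> * F I x))"
  have b: "bm (\<lambda>x. F I x * exp (\<alpha> * F I x))" by (rule bm_mult[OF bm_F[OF I] bm_expF[OF I]])
  have bd: "bm ?d" by (rule bm_diff[OF bm_diff[OF bm_expF[OF I] bm_expF[OF I]] bm_cmult[OF b]])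
  have eq: "\<phi> (\<alpha> + h) I - \<phi> \<alpha> I - h * (\<integral>x. F I x * exp (\<alpha> * F I x) \<partial>P) = (\<integral>x. ?d x \<partial>P)"
    unfolding \<phi>_def using bm_expF[OF I] b bm_cmult[OF b, of h]
      bm_diff[OF bm_expF[OF I, of "\<alpha> + h"] bm_expF[OF I, of \<alpha>]] by simp
  have "\<bar>\<integral>x. ?d x \<partial>P\<bar> \<le> (\<integral>x. \<bar>?d x\<bar> \<partial>P)" by (rule integral_abs_bound)
  also have "\<dots> \<le> (\<integral>x. exp (\<bar>\<alpha>\<bar> * B) * B\<^sup>2 * h\<^sup>2 \<partial>P)"
  proof (rule integral_mono[OF bm_integrable[OF bm_abs[OF bd]] bm_integrable[OF bm_const]])
    fix x
    have hF: "\<bar>h * F I x\<bar> \<le> \<bar>h\<bar> * B" using FB[of x] by (simp add: abs_mult mult_left_mono)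
    also have "\<dots> \<le> 1" using h B by (simp add: field_simps)
    finally have hF1: "\<bar>h * F I x\<bar> \<le> 1" .
    have "?d x = exp (\<alpha> * F I x) * (exp (h * F I x) - 1 - h * F I x)" by (simp add: exp_add algebra_simps)
    hence "\<bar>?d x\<bar> = exp (\<alpha> * F I x) * \<bar>exp (h * F I x) - 1 - h * F I x\<bar>" by (simp add: abs_mult)
    also have "\<dots> \<le> exp (\<bar>\<alpha>\<bar> * B) * (B\<^sup>2 * h\<^sup>2)"
    proof (rule mult_mono)
      have "\<alpha> * F I x \<le> \<bar>\<alpha> * F I x\<bar>" by simp
      also have "\<dots> \<le> \<bar>\<alpha>\<bar> * B" using FB[of x] by (simp add: abs_mult mult_left_mono)
      finally show "exp (\<alpha> * F I x) \<le> exp (\<bar>\<alpha>\<bar> * B)" by simp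
      have "\<bar>exp (h * F I x) - 1 - h * F I x\<bar> \<le> (h * F I x)\<^sup>2" using hF1 by (rule abs_exp_minus_one_minus_le)
      also have "\<dots> \<le> (\<bar>h\<bar> * B)\<^sup>2" using hF B by (intro abs_le_square_iff[THEN iffD1]) (simp add: abs_mult)
      also have "\<dots> = B\<^sup>2 * h\<^sup>2" by (simp add: power_mult_distrib)
      finally show "\<bar>exp (h * F I x) - 1 - h * F I x\<bar> \<le> B\<^sup>2 * h\<^sup>2" .
    qed auto
    finally show "\<bar>?d x\<bar> \<le> exp (\<bar>\<alpha>\<bar> * B) * B\<^sup>2 * h\<^sup>2" by (simp add: mult.assoc)
  qed
  also have "\<dots> = exp (\<bar>\<alpha>\<bar> * B) * B\<^sup>2 * h\<^sup>2" by simp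
  finally show "\<bar>\<phi> (\<alpha> + h) I - \<phi> \<alpha> I - h * (\<integral>x. F I x * exp (\<alpha> * F I x) \<partial>P)\<bar> \<le> exp (\<bar>\<alpha>\<bar> * B) * B\<^sup>2 * h\<^sup>2"
    unfolding eq .
qed

text \<open>Integrate the logarithmic derivative of \<open>\<phi>\<close> from \<open>0\<close> to \<open>\<alpha>\<close>, in the form of the mean value
  theorem.\<close>
lemma cumulant_estimate:
  assumes I: "finite I" and lam: "0 \<le> \<alpha>" "\<kappa> * \<alpha> \<le> 1" and s: "card I * p \<le> 1"
  shows "\<bar>ln (\<phi> \<alpha> I) - \<alpha> * integral\<^sup>L P (F I) - \<alpha>\<^sup>2 / 2 * vsum I\<bar> \<le> cumulant_const * (\<alpha> + card I * p) * \<alpha>\<^sup>2 * hsum I"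
proof (cases "\<alpha> = 0")
  case True thus ?thesis by (simp add: \<phi>_0)
next
  case False
  define L where "L \<beta> = ln (\<phi> \<beta> I) - \<beta> * integral\<^sup>L P (F I) - \<beta>\<^sup>2 / 2 * vsum I" for \<beta>
  define D where "D \<beta> = (\<integral>x. F I x * exp (\<beta> * F I x) \<partial>P) / \<phi> \<beta> I - integral\<^sup>L P (F I) - \<beta> * vsum I" for \<beta>
  have deriv: "(L has_real_derivative D \<beta>) (at \<beta>)" for \<beta>
    unfolding L_def D_def using \<phi>_pos[OF I, of \<beta>]
    by (auto intro!: derivative_eq_intros \<phi>_derivative[OF I] simp: field_simps)
  obtain z where z: "0 < z" "z < \<alpha>" "L \<alpha> - L 0 = (\<alpha> - 0) * D z"
    using MVT2[of 0 \<alpha> L D] deriv False lam by auto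
  have zk: "\<kappa> * z \<le> 1" using mult_left_mono[of z \<alpha> \<kappa>] z lam \<kappa>_nonneg by linarith
  have Dz: "\<bar>D z\<bar> \<le> cumulant_const * (z\<^sup>2 + z * (card I * p)) * hsum I"
  proof -
    have pos: "0 < \<phi> z I" using \<phi>_pos[OF I] .
    have "D z = ((\<integral>x. F I x * exp (z * F I x) \<partial>P) - (integral\<^sup>L P (F I) + z * vsum I) * \<phi> z I) / \<phi> z I"
      using pos by (simp add: D_def diff_divide_distrib)
    hence "\<bar>D z\<bar> = \<bar>(\<integral>x. F I x * exp (z * F I x) \<partial>P) - (integral\<^sup>L P (F I) + z * vsum I) * \<phi> z I\<bar> / \<phi> z I"
      using pos by (simp only: abs_divide)
    also have "\<dots> \<le> cumulant_const * (z\<^sup>2 + z * (card I * p)) * hsum I * \<phi> z I / \<phi> z I"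
      using pos z zk by (intro divide_right_mono tilted_mean_estimate I s) auto
    finally show ?thesis using pos by simp
  qed
  have "\<bar>L \<alpha>\<bar> = \<alpha> * \<bar>D z\<bar>" using z lam by (simp add: L_def \<phi>_0 abs_mult)
  also have "\<dots> \<le> \<alpha> * (cumulant_const * (z\<^sup>2 + z * (card I * p)) * hsum I)" using Dz lam by (intro mult_left_mono)
  also have "\<dots> \<le> \<alpha> * (cumulant_const * (\<alpha>\<^sup>2 + \<alpha> * (card I * p)) * hsum I)"
  proof (intro mult_left_mono mult_right_mono hsum_nonneg cumulant_const_nonneg lam add_mono)
    show "z\<^sup>2 \<le> \<alpha>\<^sup>2" using z by (intro power_mono) auto
  qed (use z p_nonneg in auto)
  also have "\<dots> = cumulant_const * (\<alpha> + card I * p) * \<alpha>\<^sup>2 * hsum I" by (simp add: power2_eq_square algebra_simps)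
  finally show ?thesis unfolding L_def .
qed

end

section \<open>Scaling limit of the cluster probabilities\<close>

definition unitQ :: "(real^'d) measure" where "unitQ = uniform_measure lborel (cbox 0 1)"

text \<open>Dilating the cube by \<open>1/r\<close> turns the interaction range from order \<open>r\<close> into order \<open>1\<close>.\<close>
definition scaledQ :: "real \<Rightarrow> (real^'d) measure" where
  "scaledQ r = distr unitQ borel (\<lambda>x. inverse r *\<^sub>R x)"

lemma emeasure_cube:
  assumes "a \<le> b" shows "emeasure lborel (cbox (a *\<^sub>R 1) (b *\<^sub>R 1) :: (real^'d) set) = ennreal ((b - a) ^ CARD('d))"
proof -
  have in1: "(c *\<^sub>R (1::real^'d)) \<bullet> i = c" if "i \<in> Basis" for c i
    using that by (auto simp: Basis_vec_def inner_axis)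
  have "emeasure lborel (cbox (a *\<^sub>R 1) (b *\<^sub>R 1) :: (real^'d) set) = ennreal (\<Prod>i\<in>(Basis :: (real^'d) set). (b *\<^sub>R 1 - a *\<^sub>R (1::real^'d)) \<bullet> i)"
    using assms by (intro emeasure_lborel_cbox) (simp only: in1)
  also have "(\<Prod>i\<in>(Basis :: (real^'d) set). (b *\<^sub>R 1 - a *\<^sub>R (1::real^'d)) \<bullet> i) = (\<Prod>i\<in>(Basis :: (real^'d) set). b - a)"
    by (intro prod.cong refl) (simp only: inner_diff_left in1)
  finally show ?thesis by simp
qed

lemma emeasure_unit_cube: "emeasure lborel (cbox 0 1 :: (real^'d) set) = 1"
  using emeasure_cube[of 0 1, where 'd='d] by simp

lemma prob_space_unitQ: "prob_space (unitQ :: (real^'d) measure)"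
  unfolding unitQ_def by (rule prob_space_uniform_measure) (simp_all add: emeasure_unit_cube)

lemma sets_unitQ [measurable_cong, simp]: "sets unitQ = sets borel" by (simp add: unitQ_def)
lemma sets_scaledQ [measurable_cong, simp]: "sets (scaledQ r) = sets borel" by (simp add: scaledQ_def)

lemma prob_space_scaledQ: "prob_space (scaledQ r)"
  unfolding scaledQ_def by (rule prob_space.prob_space_distr[OF prob_space_unitQ]) simp

lemma nn_integral_unitQ:
  assumes [measurable]: "f \<in> borel_measurable borel"
  shows "(\<integral>\<^sup>+x. f x \<partial>(unitQ :: (real^'d) measure)) = (\<integral>\<^sup>+x. f x * indicator (cbox 0 1) x \<partial>lborel)"
  unfolding unitQ_def by (subst nn_integral_uniform_measure) (simp_all add: emeasure_unit_cube divide_ennreal_def)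

lemma nn_integral_lborel_affine:
  fixes f :: "real^'d \<Rightarrow> ennreal"
  assumes [measurable]: "f \<in> borel_measurable borel" and r: "r > 0"
  shows "(\<integral>\<^sup>+x. f x \<partial>lborel) = ennreal (r ^ CARD('d)) * (\<integral>\<^sup>+y. f (v + r *\<^sub>R y) \<partial>lborel)"
proof -
  have "(\<integral>\<^sup>+x. f x \<partial>lborel) = (\<integral>\<^sup>+x. f x \<partial>density (distr lborel borel (\<lambda>x. v + r *\<^sub>R x)) (\<lambda>_. ennreal (\<bar>r\<bar> ^ DIM(real^'d))))"
    using lborel_affine[of r v] r by simp
  also have "\<dots> = (\<integral>\<^sup>+y. ennreal (r ^ CARD('d)) * f (v + r *\<^sub>R y) \<partial>lborel)"
    using r by (simp add: nn_integral_density nn_integral_distr)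
  also have "\<dots> = ennreal (r ^ CARD('d)) * (\<integral>\<^sup>+y. f (v + r *\<^sub>R y) \<partial>lborel)"
    by (rule nn_integral_cmult) measurable
  finally show ?thesis .
qed

text \<open>The offset \<open>u\<close> will be the position of the first point of a cluster, from which the others are
  measured.\<close>
lemma nn_integral_scaledQ:
  fixes f :: "real^'d \<Rightarrow> ennreal"
  assumes [measurable]: "f \<in> borel_measurable borel" and r: "r > 0"
  shows "(\<integral>\<^sup>+x. f x \<partial>scaledQ r) = ennreal (r ^ CARD('d)) *
      (\<integral>\<^sup>+y. f (u + y) * indicator (cbox 0 1) (r *\<^sub>R (u + y)) \<partial>lborel)"
proof -
  have "(\<integral>\<^sup>+x. f x \<partial>scaledQ r) = (\<integral>\<^sup>+x. f (inverse r *\<^sub>R x) \<partial>unitQ)"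
    unfolding scaledQ_def by (rule nn_integral_distr) auto
  also have "\<dots> = (\<integral>\<^sup>+x. f (inverse r *\<^sub>R x) * indicator (cbox 0 1) x \<partial>lborel)"
    by (rule nn_integral_unitQ) measurable
  also have "\<dots> = ennreal (r ^ CARD('d)) *
      (\<integral>\<^sup>+y. f (inverse r *\<^sub>R (r *\<^sub>R u + r *\<^sub>R y)) * indicator (cbox 0 1) (r *\<^sub>R u + r *\<^sub>R y) \<partial>lborel)"
    by (rule nn_integral_lborel_affine) (use r in auto)
  finally show ?thesis using r by (simp add: scaleR_add_right)
qed

lemma nn_integral_PiM_scaledQ:
  fixes f :: "(nat \<Rightarrow> real^'d) \<Rightarrow> ennreal"
  assumes I: "finite I" and f: "f \<in> borel_measurable (PiM I (\<lambda>_. borel))" and r: "r > 0"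
  shows "(\<integral>\<^sup>+x. f x \<partial>PiM I (\<lambda>_. scaledQ r)) = ennreal (r ^ CARD('d)) ^ card I *
      (\<integral>\<^sup>+y. f (\<lambda>l\<in>I. u + y l) * (\<Prod>l\<in>I. indicator (cbox 0 1) (r *\<^sub>R (u + y l))) \<partial>PiM I (\<lambda>_. lborel))"
  using I f
proof (induction I arbitrary: f rule: finite_induct)
  case empty
  thus ?case by (simp add: PiM_empty nn_integral_count_space_finite)
next
  case (insert i I)
  interpret Q: product_prob_space "\<lambda>_::nat. scaledQ r :: (real^'d) measure"
    by (intro product_prob_spaceI prob_space_scaledQ)
  interpret L: product_sigma_finite "\<lambda>_::nat. lborel :: (real^'d) measure"
    by standard
  note [measurable] = insert(4)
  have S1: "sets (PiM J (\<lambda>_. scaledQ r)) = sets (PiM J (\<lambda>_. borel :: (real^'d) measure))" for J :: "nat set"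
    by (rule sets_PiM_cong) auto
  have S2: "sets (PiM J (\<lambda>_. lborel)) = sets (PiM J (\<lambda>_. borel :: (real^'d) measure))" for J :: "nat set"
    by (rule sets_PiM_cong) auto
  let ?c = "ennreal (r ^ CARD('d))"
  let ?ind = "\<lambda>y. indicator (cbox 0 1) (r *\<^sub>R (u + y)) :: ennreal"
  define g where "g x = (\<integral>\<^sup>+v. f (x(i := u + v)) * ?ind v \<partial>lborel)" for x
  have ad: "(\<lambda>(x, v). x(i := v)) \<in> PiM I (\<lambda>_. borel) \<Otimes>\<^sub>M borel \<rightarrow>\<^sub>M PiM (insert i I) (\<lambda>_. borel :: (real^'d) measure)"
    by (rule measurable_add_dim)
  have fad: "(\<lambda>(x, v). f (x(i := v))) \<in> borel_measurable (PiM I (\<lambda>_. borel) \<Otimes>\<^sub>M borel)"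
    using measurable_compose[OF ad insert(4)] by (simp add: case_prod_unfold)
  have fad2: "(\<lambda>(x, v). f (x(i := u + v)) * ?ind v) \<in> borel_measurable (PiM I (\<lambda>_. borel) \<Otimes>\<^sub>M lborel)"
  proof -
    have "(\<lambda>w. (fst w, u + snd w)) \<in> PiM I (\<lambda>_. borel) \<Otimes>\<^sub>M lborel \<rightarrow>\<^sub>M PiM I (\<lambda>_. borel) \<Otimes>\<^sub>M borel" by measurable
    from measurable_compose[OF this fad] show ?thesis by (simp add: case_prod_unfold)
  qed
  have gm: "g \<in> borel_measurable (PiM I (\<lambda>_. borel))"
    unfolding g_def by (rule lborel.borel_measurable_nn_integral[OF fad2])
  have fx: "(\<lambda>v. f (x(i := v))) \<in> borel_measurable borel" if "x \<in> space (PiM I (\<lambda>_. borel))" for x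
    using measurable_compose[OF measurable_Pair1'[OF that] fad] by simp
  have "(\<integral>\<^sup>+x. f x \<partial>PiM (insert i I) (\<lambda>_. scaledQ r)) = (\<integral>\<^sup>+x. (\<integral>\<^sup>+v. f (x(i := v)) \<partial>scaledQ r) \<partial>PiM I (\<lambda>_. scaledQ r))"
    using insert by (intro Q.product_nn_integral_insert) (auto simp: measurable_cong_sets[OF S1 refl])
  also have "\<dots> = (\<integral>\<^sup>+x. ?c * g x \<partial>PiM I (\<lambda>_. scaledQ r))"
  proof (rule nn_integral_cong)
    fix x assume "x \<in> space (PiM I (\<lambda>_. scaledQ r :: (real^'d) measure))"
    hence "x \<in> space (PiM I (\<lambda>_. borel :: (real^'d) measure))" using sets_eq_imp_space_eq[OF S1] by simp
    thus "(\<integral>\<^sup>+v. f (x(i := v)) \<partial>scaledQ r) = ?c * g x"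
      unfolding g_def by (intro nn_integral_scaledQ r fx)
  qed
  also have "\<dots> = ?c * (\<integral>\<^sup>+x. g x \<partial>PiM I (\<lambda>_. scaledQ r))"
    using gm by (intro nn_integral_cmult) (simp add: measurable_cong_sets[OF S1 refl])
  also have "(\<integral>\<^sup>+x. g x \<partial>PiM I (\<lambda>_. scaledQ r)) = ?c ^ card I *
      (\<integral>\<^sup>+y. g (\<lambda>l\<in>I. u + y l) * (\<Prod>l\<in>I. ?ind (y l)) \<partial>PiM I (\<lambda>_. lborel))"
    by (rule insert.IH[OF gm])
  also have "(\<integral>\<^sup>+y. g (\<lambda>l\<in>I. u + y l) * (\<Prod>l\<in>I. ?ind (y l)) \<partial>PiM I (\<lambda>_. lborel))
    = (\<integral>\<^sup>+y. f (\<lambda>l\<in>insert i I. u + y l) * (\<Prod>l\<in>insert i I. ?ind (y l)) \<partial>PiM (insert i I) (\<lambda>_. lborel))" (is "?lhs = ?rhs")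
  proof -
    have sm: "(\<lambda>y. \<lambda>l\<in>insert i I. u + y l) \<in> PiM (insert i I) (\<lambda>_. borel) \<rightarrow>\<^sub>M PiM (insert i I) (\<lambda>_. borel :: (real^'d) measure)"
      by (rule measurable_restrict) measurable
    have "?rhs = (\<integral>\<^sup>+y. (\<integral>\<^sup>+v. f (\<lambda>l\<in>insert i I. u + (y(i := v)) l) * (\<Prod>l\<in>insert i I. ?ind ((y(i := v)) l)) \<partial>lborel) \<partial>PiM I (\<lambda>_. lborel))"
      using insert measurable_compose[OF sm insert(4)]
      by (intro L.product_nn_integral_insert) (simp_all add: measurable_cong_sets[OF S2 refl])
    also have "\<dots> = ?lhs"
    proof (rule nn_integral_cong)
      fix y assume y: "y \<in> space (PiM I (\<lambda>_. lborel :: (real^'d) measure))"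
      have e1: "(\<lambda>l\<in>insert i I. u + (y(i := v)) l) = (\<lambda>l\<in>I. u + y l)(i := u + v)" for v
        using insert(2) by (auto simp: restrict_def fun_eq_iff)
      have e2: "(\<Prod>l\<in>insert i I. ?ind ((y(i := v)) l)) = ?ind v * (\<Prod>l\<in>I. ?ind (y l))" for v
        using insert(1,2) by (simp add: prod.insert) (intro arg_cong2[where f="(*)"] prod.cong refl, auto)
      have xs: "(\<lambda>l\<in>I. u + y l) \<in> space (PiM I (\<lambda>_. borel :: (real^'d) measure))" by (simp add: space_PiM)
      have m1: "(\<lambda>v. f ((\<lambda>l\<in>I. u + y l)(i := u + v)) * ?ind v) \<in> borel_measurable lborel"
        using measurable_compose[OF measurable_Pair1'[OF xs] fad2] by simp
      show "(\<integral>\<^sup>+v. f (\<lambda>l\<in>insert i I. u + (y(i := v)) l) * (\<Prod>l\<in>insert i I. ?ind ((y(i := v)) l)) \<partial>lborel)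
         = g (\<lambda>l\<in>I. u + y l) * (\<Prod>l\<in>I. ?ind (y l))"
        unfolding e1 e2 g_def mult.assoc[symmetric] by (rule nn_integral_multc[OF m1])
    qed
    finally show ?thesis by simp
  qed
  finally show ?case by (simp only: card_insert_disjoint[OF insert(1,2)] power_Suc mult.assoc)
qed

context cech_shapes begin

lemma nerve_pattern_translate: "nerve_pattern J s (\<lambda>a. u + x a) = nerve_pattern J s (x :: nat \<Rightarrow> real^'d)"
proof -
  have "(\<Inter>a\<in>\<tau>. cball (u + x a) (s / 2)) = (+) u ` (\<Inter>a\<in>\<tau>. cball (x a) (s / 2))" if "\<tau> \<noteq> {}" for \<tau>
  proof (intro equalityI subsetI)
    fix z assume z: "z \<in> (\<Inter>a\<in>\<tau>. cball (u + x a) (s / 2))"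
    have "z - u \<in> (\<Inter>a\<in>\<tau>. cball (x a) (s / 2))"
    proof
      fix a assume "a \<in> \<tau>"
      hence "dist (u + x a) z \<le> s / 2" using z by simp
      moreover have "dist (u + x a) z = dist (x a) (z - u)" by (simp add: dist_norm algebra_simps)
      ultimately show "z - u \<in> cball (x a) (s / 2)" by simp
    qed
    moreover have "z = u + (z - u)" by simp
    ultimately show "z \<in> (+) u ` (\<Inter>a\<in>\<tau>. cball (x a) (s / 2))" by (rule rev_image_eqI)
  qed (use that in auto)
  hence "((\<Inter>a\<in>\<tau>. cball (u + x a) (s / 2)) = {}) = ((\<Inter>a\<in>\<tau>. cball (x a) (s / 2)) = {})" if "\<tau> \<noteq> {}" for \<tau>
    using that by simp
  thus ?thesis unfolding nerve_pattern_def by blast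
qed

lemma shape_translate:
  assumes "card J = k" shows "shape i J (\<lambda>a. u + x a) \<longleftrightarrow> shape i J x"
  unfolding shape_iff_pattern[OF assms] nerve_pattern_translate by (simp add: inj_on_def)

text \<open>The integral in the limit covariance, without the factor \<open>1 / k!\<close>.\<close>
definition pairmass :: "'m \<Rightarrow> 'm \<Rightarrow> real" where
  "pairmass i j = (\<integral>y. cech_iso_indicator (t $ i) (G i) (insert 0 (y ` {1..<k})) *
          cech_iso_indicator (t $ j) (G j) (insert 0 (y ` {1..<k}))
        \<partial>(\<Pi>\<^sub>M l\<in>{1..<k}. (lborel :: (real^'d) measure)))"

text \<open>Extended nonnegative values make Tonelli's theorem applicable before integrability is known.\<close>
definition pairH :: "'m \<Rightarrow> 'm \<Rightarrow> (nat \<Rightarrow> real^'d) \<Rightarrow> ennreal" where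
  "pairH i j x = indicator {x. shape i {..<k} x \<and> shape j {..<k} x} x"

lemma k_insert: "{..<k} = insert 0 {1..<k}" using k2 by auto

lemma pairH_measurable: "pairH i j \<in> borel_measurable (PiM {..<k} (\<lambda>_. borel))"
proof -
  have "Measurable.pred (PiM {..<k} (\<lambda>_. borel)) (shape i {..<k})" for i
    using measurable_shape[OF cech_shapes_axioms, of "{..<k}" "\<lambda>x. x" "PiM {..<k} (\<lambda>_. borel)" i] by simp
  hence "Measurable.pred (PiM {..<k} (\<lambda>_. borel)) (\<lambda>x. shape i {..<k} x \<and> shape j {..<k} x)"
    by (intro pred_intros_logic)
  thus ?thesis unfolding pairH_def indicator_def by simp
qed

lemma pairH0_measurable:
  "(\<lambda>y. pairH i j (y(0 := 0))) \<in> borel_measurable (PiM {1..<k} (\<lambda>_. borel))"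
proof -
  have "(\<lambda>(x, v). x(0 := v)) \<in> PiM {1..<k} (\<lambda>_. borel) \<Otimes>\<^sub>M borel \<rightarrow>\<^sub>M PiM (insert 0 {1..<k}) (\<lambda>_. borel :: (real^'d) measure)"
    by (rule measurable_add_dim)
  from measurable_compose[OF measurable_Pair2' this, of 0]
  have "(\<lambda>y. y(0 := 0)) \<in> PiM {1..<k} (\<lambda>_. borel) \<rightarrow>\<^sub>M PiM {..<k} (\<lambda>_. borel :: (real^'d) measure)"
    unfolding k_insert by simp
  from measurable_compose[OF this pairH_measurable] show ?thesis .
qed

lemma pairH0_eq: "pairH i j (y(0 := 0)) = ennreal (cech_iso_indicator (t $ i) (G i) (insert 0 (y ` {1..<k})) *
          cech_iso_indicator (t $ j) (G j) (insert 0 (y ` {1..<k})))"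
proof -
  have "(y(0 := 0)) ` {..<k} = insert 0 (y ` {1..<k})" unfolding k_insert by auto
  thus ?thesis unfolding pairH_def shape_def cech_iso_indicator_def indicator_def by simp
qed

text \<open>A connected cluster at the origin is bounded. Hence the integral over the whole space is finite, and
  clusters away from the boundary of the cube are not cut off.\<close>
lemma pairH0_support:
  assumes "pairH i j (y(0 := 0)) \<noteq> 0" "l \<in> {1..<k}" shows "norm (y l) \<le> real k * tmax"
proof -
  have "shape i {..<k} (y(0 := 0))" using assms(1) by (auto simp: pairH_def indicator_def split: if_splits)
  hence "dist ((y(0 := 0)) 0) ((y(0 := 0)) l) \<le> real k * t $ i"
    by (rule shape_diameter) (use assms(2) in auto)
  also have "\<dots> \<le> real k * tmax" using tmax by (intro mult_left_mono) auto
  finally show ?thesis using assms(2) by (simp add: dist_norm)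
qed

lemma ennreal_pairmass:
  "ennreal (pairmass i j) = (\<integral>\<^sup>+y. pairH i j (y(0 := 0)) \<partial>PiM {1..<k} (\<lambda>_. lborel))"
  and pairmass_nonneg: "0 \<le> pairmass i j"
proof -
  interpret L: product_sigma_finite "\<lambda>_::nat. lborel :: (real^'d) measure" by standard
  let ?f = "\<lambda>y. cech_iso_indicator (t $ i) (G i) (insert 0 (y ` {1..<k})) *
          cech_iso_indicator (t $ j) (G j) (insert 0 (y ` {1..<k}))"
  have S2: "sets (PiM {1..<k} (\<lambda>_. lborel)) = sets (PiM {1..<k} (\<lambda>_. borel :: (real^'d) measure))"
    by (rule sets_PiM_cong) auto
  have f0: "0 \<le> ?f y" for y by (simp add: cech_iso_indicator_def)
  have fH: "?f y = enn2real (pairH i j (y(0 := 0)))" for y unfolding pairH0_eq using f0[of y] by simp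
  have fm: "?f \<in> borel_measurable (PiM {1..<k} (\<lambda>_. lborel))"
    unfolding fH using pairH0_measurable[of i j] by (simp add: measurable_cong_sets[OF S2 refl])
  have "pairmass i j = enn2real (\<integral>\<^sup>+y. ennreal (?f y) \<partial>PiM {1..<k} (\<lambda>_. lborel))"
    unfolding pairmass_def by (rule integral_eq_nn_integral[OF fm], rule AE_I2, rule f0)
  hence 1: "pairmass i j = enn2real (\<integral>\<^sup>+y. pairH i j (y(0 := 0)) \<partial>PiM {1..<k} (\<lambda>_. lborel))" by (simp only: pairH0_eq)
  thus "0 \<le> pairmass i j" by simp
  have "(\<integral>\<^sup>+y. pairH i j (y(0 := 0)) \<partial>PiM {1..<k} (\<lambda>_. lborel))
     \<le> (\<integral>\<^sup>+y. (\<Prod>l\<in>{1..<k}. indicator (cball 0 (real k * tmax)) (y l)) \<partial>PiM {1..<k} (\<lambda>_. lborel :: (real^'d) measure))"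
  proof (rule nn_integral_mono)
    fix y :: "nat \<Rightarrow> real^'d"
    show "pairH i j (y(0 := 0)) \<le> (\<Prod>l\<in>{1..<k}. indicator (cball 0 (real k * tmax)) (y l))"
    proof (cases "pairH i j (y(0 := 0)) = 0")
      case False
      hence "(\<Prod>l\<in>{1..<k}. indicator (cball 0 (real k * tmax)) (y l)) = (1::ennreal)"
        using pairH0_support[of i j y] by (intro prod.neutral) simp
      thus ?thesis by (simp add: pairH_def indicator_def)
    qed simp
  qed
  also have "\<dots> = (\<Prod>l\<in>{1..<k}. (\<integral>\<^sup>+y. indicator (cball 0 (real k * tmax)) y \<partial>(lborel :: (real^'d) measure)))"
    by (rule L.product_nn_integral_prod) (auto intro!: borel_measurable_indicator)
  also have "\<dots> < \<top>"
    using emeasure_bounded_finite[of "cball 0 (real k * tmax) :: (real^'d) set"]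
    by (simp add: power_eq_top_ennreal less_top[symmetric])
  finally show "ennreal (pairmass i j) = (\<integral>\<^sup>+y. pairH i j (y(0 := 0)) \<partial>PiM {1..<k} (\<lambda>_. lborel))"
    unfolding 1 by simp
qed

text \<open>Translation invariance of shapes moves the first point to the origin.\<close>
lemma pair_integral_scaled:
  assumes r: "r > 0"
  shows "(\<integral>\<^sup>+x. pairH i j x \<partial>PiM {..<k} (\<lambda>_. scaledQ r)) = (\<integral>\<^sup>+u. ennreal (r ^ CARD('d)) ^ (k - 1) *
     (\<integral>\<^sup>+y. pairH i j (y(0 := 0)) * (\<Prod>l\<in>{1..<k}. indicator (cbox 0 1) (r *\<^sub>R (u + y l))) \<partial>PiM {1..<k} (\<lambda>_. lborel)) \<partial>scaledQ r)"
proof -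
  interpret Q: product_prob_space "\<lambda>_::nat. scaledQ r :: (real^'d) measure"
    by (intro product_prob_spaceI prob_space_scaledQ)
  have S1: "sets (PiM J (\<lambda>_. scaledQ r)) = sets (PiM J (\<lambda>_. borel :: (real^'d) measure))" for J :: "nat set"
    by (rule sets_PiM_cong) auto
  have "(\<integral>\<^sup>+x. pairH i j x \<partial>PiM {..<k} (\<lambda>_. scaledQ r)) = (\<integral>\<^sup>+u. (\<integral>\<^sup>+x. pairH i j (x(0 := u)) \<partial>PiM {1..<k} (\<lambda>_. scaledQ r)) \<partial>scaledQ r)"
    using pairH_measurable[of i j] unfolding k_insert
    by (intro Q.product_nn_integral_insert_rev) (auto simp: measurable_cong_sets[OF S1 refl])
  also have "\<dots> = (\<integral>\<^sup>+u. ennreal (r ^ CARD('d)) ^ (k - 1) *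
     (\<integral>\<^sup>+y. pairH i j (y(0 := 0)) * (\<Prod>l\<in>{1..<k}. indicator (cbox 0 1) (r *\<^sub>R (u + y l))) \<partial>PiM {1..<k} (\<lambda>_. lborel)) \<partial>scaledQ r)"
  proof (rule nn_integral_cong)
    fix u :: "real^'d"
    have "(\<lambda>(x, v). x(0 := v)) \<in> PiM {1..<k} (\<lambda>_. borel) \<Otimes>\<^sub>M borel \<rightarrow>\<^sub>M PiM (insert 0 {1..<k}) (\<lambda>_. borel :: (real^'d) measure)"
      by (rule measurable_add_dim)
    from measurable_compose[OF measurable_Pair2' this, of u]
    have "(\<lambda>y. y(0 := u)) \<in> PiM {1..<k} (\<lambda>_. borel) \<rightarrow>\<^sub>M PiM {..<k} (\<lambda>_. borel :: (real^'d) measure)"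
      unfolding k_insert by simp
    from measurable_compose[OF this pairH_measurable]
    have m: "(\<lambda>x. pairH i j (x(0 := u))) \<in> borel_measurable (PiM {1..<k} (\<lambda>_. borel))" .
    have H: "pairH i j ((\<lambda>l\<in>{1..<k}. u + y l)(0 := u)) = pairH i j (y(0 := 0))" for y
    proof -
      have "shape i {..<k} ((\<lambda>l\<in>{1..<k}. u + y l)(0 := u)) = shape i {..<k} (\<lambda>l. u + (y(0 := 0)) l)" for i
        by (rule shape_cong) auto
      thus ?thesis using shape_translate[of "{..<k}" _ u "y(0 := 0)"] by (simp add: pairH_def indicator_def)
    qed
    show "(\<integral>\<^sup>+x. pairH i j (x(0 := u)) \<partial>PiM {1..<k} (\<lambda>_. scaledQ r)) = ennreal (r ^ CARD('d)) ^ (k - 1) *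
     (\<integral>\<^sup>+y. pairH i j (y(0 := 0)) * (\<Prod>l\<in>{1..<k}. indicator (cbox 0 1) (r *\<^sub>R (u + y l))) \<partial>PiM {1..<k} (\<lambda>_. lborel))"
      using nn_integral_PiM_scaledQ[OF finite_atLeastLessThan m r, of u] unfolding H by (simp only: card_atLeastLessThan)
  qed
  finally show ?thesis .
qed

text \<open>Drop the constraint that the cluster lies in the cube.\<close>
lemma pair_integral_upper:
  assumes r: "r > 0"
  shows "(\<integral>\<^sup>+x. pairH i j x \<partial>PiM {..<k} (\<lambda>_. scaledQ r)) \<le> ennreal (r ^ (CARD('d) * (k - 1)) * pairmass i j)"
proof -
  interpret Q: prob_space "scaledQ r :: (real^'d) measure" by (rule prob_space_scaledQ)
  have "(\<integral>\<^sup>+x. pairH i j x \<partial>PiM {..<k} (\<lambda>_. scaledQ r)) \<le> (\<integral>\<^sup>+u. ennreal (r ^ CARD('d)) ^ (k - 1) * ennreal (pairmass i j) \<partial>(scaledQ r :: (real^'d) measure))"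
    unfolding pair_integral_scaled[OF r] ennreal_pairmass
  proof (rule nn_integral_mono, rule mult_left_mono, rule nn_integral_mono)
    fix u :: "real^'d" and y :: "nat \<Rightarrow> real^'d"
    have "(\<Prod>l\<in>{1..<k}. indicator (cbox 0 1) (r *\<^sub>R (u + y l))) \<le> (1 :: ennreal)"
    proof (cases "\<forall>l\<in>{1..<k}. r *\<^sub>R (u + y l) \<in> cbox 0 1")
      case True
      hence "(\<Prod>l\<in>{1..<k}. indicator (cbox 0 1) (r *\<^sub>R (u + y l))) = (1 :: ennreal)" by (intro prod.neutral) simp
      thus ?thesis by simp
    next
      case False
      hence "(\<Prod>l\<in>{1..<k}. indicator (cbox 0 1) (r *\<^sub>R (u + y l))) = (0 :: ennreal)"
        by (intro prod_zero) (auto simp: indicator_def)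
      from order_trans[OF eq_refl[OF this] zero_le_one] show ?thesis .
    qed
    from mult_left_mono[OF this, of "pairH i j (y(0 := 0))"]
    show "pairH i j (y(0 := 0)) * (\<Prod>l\<in>{1..<k}. indicator (cbox 0 1) (r *\<^sub>R (u + y l))) \<le> pairH i j (y(0 := 0))"
      by simp
  qed simp
  also have "\<dots> = ennreal (r ^ CARD('d)) ^ (k - 1) * ennreal (pairmass i j)" by (simp add: Q.emeasure_space_1)
  also have "\<dots> = ennreal (r ^ (CARD('d) * (k - 1)) * pairmass i j)"
    using r pairmass_nonneg by (simp add: ennreal_mult ennreal_power power_mult)
  finally show ?thesis .
qed

text \<open>If the first point has distance at least \<open>r * k * tmax\<close> from the boundary, the
  constraint holds automatically.\<close>
lemma pair_integral_lower:
  assumes r: "r > 0" and c: "c = r * (real k * tmax)" "2 * c \<le> 1"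
  shows "ennreal (r ^ (CARD('d) * (k - 1)) * pairmass i j * (1 - 2 * c) ^ CARD('d))
     \<le> (\<integral>\<^sup>+x. pairH i j x \<partial>PiM {..<k} (\<lambda>_. scaledQ r))"
proof -
  define A where "A = {u :: real^'d. r *\<^sub>R u \<in> cbox (c *\<^sub>R 1) ((1 - c) *\<^sub>R 1)}"
  have "(\<lambda>u. r *\<^sub>R u) -` cbox (c *\<^sub>R 1) ((1 - c) *\<^sub>R 1) \<inter> space borel \<in> sets (borel :: (real^'d) measure)"
    by (rule measurable_sets[of _ _ borel]) auto
  hence Ab: "A \<in> sets borel" by (simp add: A_def vimage_def)
  have c0: "0 \<le> c" using r tmax_pos c by simp
  have sub: "cbox (c *\<^sub>R 1) ((1 - c) *\<^sub>R 1) \<subseteq> (cbox 0 1 :: (real^'d) set)"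
  proof
    fix z :: "real^'d" assume "z \<in> cbox (c *\<^sub>R 1) ((1 - c) *\<^sub>R 1)"
    hence "c \<le> z $ q" "z $ q \<le> 1 - c" for q by (simp_all add: mem_box_cart)
    hence "0 \<le> z $ q" "z $ q \<le> 1" for q using c0 by (smt (verit))+
    thus "z \<in> cbox 0 1" by (simp add: mem_box_cart)
  qed
  have EA: "emeasure (scaledQ r) A = ennreal ((1 - 2 * c) ^ CARD('d))"
  proof -
    have "emeasure (scaledQ r) A = (\<integral>\<^sup>+x. indicator A x \<partial>scaledQ r)" using Ab by simp
    also have "\<dots> = (\<integral>\<^sup>+x. indicator A (inverse r *\<^sub>R x) \<partial>unitQ)"
      unfolding scaledQ_def using Ab by (intro nn_integral_distr) auto
    also have "\<dots> = (\<integral>\<^sup>+x. indicator A (inverse r *\<^sub>R x) * indicator (cbox 0 1) x \<partial>lborel)"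
      by (intro nn_integral_unitQ measurable_compose[of "\<lambda>x. inverse r *\<^sub>R x" borel borel "indicator A"]) (use Ab in auto)
    also have "\<dots> = (\<integral>\<^sup>+x. indicator (cbox (c *\<^sub>R 1) ((1 - c) *\<^sub>R 1)) x \<partial>(lborel :: (real^'d) measure))"
      using sub r by (intro nn_integral_cong) (auto simp: A_def indicator_def split: if_splits)
    also have "\<dots> = ennreal (((1 - c) - c) ^ CARD('d))"
      using emeasure_cube[of c "1 - c", where 'd='d] c(2) by simp
    finally show ?thesis by (simp add: algebra_simps)
  qed
  have "ennreal (r ^ (CARD('d) * (k - 1)) * pairmass i j * (1 - 2 * c) ^ CARD('d))
    = ennreal (r ^ CARD('d)) ^ (k - 1) * ennreal (pairmass i j) * emeasure (scaledQ r) A"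
    using r pairmass_nonneg c unfolding EA by (simp add: ennreal_mult ennreal_power power_mult)
  also have "\<dots> = (\<integral>\<^sup>+u. ennreal (r ^ CARD('d)) ^ (k - 1) * ennreal (pairmass i j) * indicator A u \<partial>scaledQ r)"
    using Ab by (simp add: nn_integral_cmult_indicator)
  also have "\<dots> \<le> (\<integral>\<^sup>+x. pairH i j x \<partial>PiM {..<k} (\<lambda>_. scaledQ r))"
    unfolding pair_integral_scaled[OF r]
  proof (rule nn_integral_mono)
    fix u :: "real^'d"
    show "ennreal (r ^ CARD('d)) ^ (k - 1) * ennreal (pairmass i j) * indicator A u \<le> ennreal (r ^ CARD('d)) ^ (k - 1) *
     (\<integral>\<^sup>+y. pairH i j (y(0 := 0)) * (\<Prod>l\<in>{1..<k}. indicator (cbox 0 1) (r *\<^sub>R (u + y l))) \<partial>PiM {1..<k} (\<lambda>_. lborel))"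
    proof (cases "u \<in> A")
      case True
      have "pairH i j (y(0 := 0)) \<le> pairH i j (y(0 := 0)) * (\<Prod>l\<in>{1..<k}. indicator (cbox 0 1) (r *\<^sub>R (u + y l)))" for y
      proof (cases "pairH i j (y(0 := 0)) = 0")
        case False
        have "r *\<^sub>R (u + y l) \<in> cbox 0 1" if l: "l \<in> {1..<k}" for l
        proof -
          have "\<bar>r * y l $ q\<bar> \<le> c" for q
          proof -
            have "\<bar>y l $ q\<bar> \<le> norm (y l)" by (rule component_le_norm_cart)
            also have "\<dots> \<le> real k * tmax" by (rule pairH0_support[OF False l])
            finally show ?thesis unfolding c using r by (simp add: abs_mult)
          qed
          moreover have "c \<le> r * u $ q" "r * u $ q \<le> 1 - c" for q
            using True by (auto simp: A_def mem_box_cart)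
          ultimately have "0 \<le> r * u $ q + r * y l $ q" "r * u $ q + r * y l $ q \<le> 1" for q
            by (smt (verit))+
          thus ?thesis by (simp add: mem_box_cart distrib_left)
        qed
        hence "(\<Prod>l\<in>{1..<k}. indicator (cbox 0 1) (r *\<^sub>R (u + y l))) = (1::ennreal)" by (intro prod.neutral) simp
        thus ?thesis by simp
      qed simp
      hence "ennreal (pairmass i j) \<le> (\<integral>\<^sup>+y. pairH i j (y(0 := 0)) * (\<Prod>l\<in>{1..<k}. indicator (cbox 0 1) (r *\<^sub>R (u + y l))) \<partial>PiM {1..<k} (\<lambda>_. lborel))"
        unfolding ennreal_pairmass by (intro nn_integral_mono)
      thus ?thesis using True by (simp add: mult_left_mono)
    qed simp
  qed
  finally show ?thesis .
qed

end

section \<open>Poisson processes as mixtures\<close>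

text \<open>A set of \<open>N\<close> points has no canonical enumeration, so sums over all \<open>N!\<close> enumerations are used.\<close>
definition enums :: "nat \<Rightarrow> 'b set \<Rightarrow> (nat \<Rightarrow> 'b) set" where
  "enums N Y = {x \<in> {..<N} \<rightarrow>\<^sub>E Y. inj_on x {..<N} \<and> finite Y \<and> card Y = N}"

text \<open>Choose the values one after the other: a new value for colour \<open>T\<close> must avoid those
  already taken, and values of different colours never collide.\<close>
lemma card_injective_coloured:
  fixes C :: "'c \<Rightarrow> 'b set" and a :: "nat \<Rightarrow> 'c"
  assumes I: "finite I" and R: "finite R" "a ` I \<subseteq> R" and fin: "\<And>T. T \<in> R \<Longrightarrow> finite (C T)"
    and disj: "disjoint_family_on C R"
  shows "card {x \<in> PiE I (\<lambda>i. C (a i)). inj_on x I}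
     = (\<Prod>T\<in>R. \<Prod>j<card {i\<in>I. a i = T}. card (C T) - j)"
  using I R(2)
proof (induction I rule: finite_induct)
  case empty
  have "{x \<in> PiE {} (\<lambda>i. C (a i)). inj_on x {}} = {\<lambda>_. undefined}" by auto
  thus ?case by simp
next
  case (insert i I)
  let ?S = "\<lambda>I. {x \<in> PiE I (\<lambda>i. C (a i)). inj_on x I}"
  let ?m = "\<lambda>T. card {j\<in>I. a j = T}"
  have aR: "a i \<in> R" using insert.prems by simp
  \<comment> \<open>The admissible values at \<open>i\<close> once \<open>x\<close> is chosen on \<open>I\<close>.\<close>
  define D where "D x = C (a i) - x ` {j\<in>I. a j = a i}" for x
  have split: "?S (insert i I) = (\<lambda>(x, v). x(i := v)) ` (SIGMA x:?S I. D x)"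
  proof (intro equalityI subsetI)
    fix y assume y: "y \<in> ?S (insert i I)"
    define x where "x = restrict y I"
    have yi: "y j \<in> C (a j)" if "j \<in> insert i I" for j using y that by (auto simp: PiE_iff)
    have inj: "inj_on y (insert i I)" using y by simp
    have "x \<in> ?S I"
    proof -
      have "inj_on y I" using inj by (rule inj_on_subset) auto
      hence "inj_on x I" by (simp add: x_def inj_on_def)
      thus ?thesis using yi by (auto simp: x_def PiE_iff)
    qed
    moreover have "y i \<in> D x"
      using yi[of i] inj insert.hyps(2) by (auto simp: D_def x_def inj_on_def)
    moreover have "y = x(i := y i)"
    proof
      fix j show "y j = (x(i := y i)) j"
        using y by (cases "j = i"; cases "j \<in> I") (auto simp: x_def PiE_iff extensional_def)
    qed
    ultimately show "y \<in> (\<lambda>(x, v). x(i := v)) ` (SIGMA x:?S I. D x)"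
      by (intro image_eqI[of _ _ "(x, y i)"]) auto
  next
    fix y assume "y \<in> (\<lambda>(x, v). x(i := v)) ` (SIGMA x:?S I. D x)"
    then obtain x v where xv: "x \<in> ?S I" "v \<in> D x" "y = x(i := v)" by auto
    have xj: "x j \<in> C (a j)" if "j \<in> I" for j using xv(1) that by (auto simp: PiE_iff)
    have "v \<noteq> x j" if "j \<in> I" for j
    proof (cases "a j = a i")
      case True thus ?thesis using xv(2) that by (auto simp: D_def)
    next
      case False
      have "a j \<in> R" using insert.prems that by auto
      hence "C (a j) \<inter> C (a i) = {}" using disj aR False by (auto simp: disjoint_family_on_def)
      thus ?thesis using xj[OF that] xv(2) by (auto simp: D_def)
    qed
    hence "inj_on y (insert i I)" using xv(1,3) insert.hyps(2) by (auto simp: inj_on_def)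
    moreover have "y \<in> PiE (insert i I) (\<lambda>i. C (a i))"
      using xv insert.hyps(2) by (auto simp: PiE_iff extensional_def D_def)
    ultimately show "y \<in> ?S (insert i I)" by simp
  qed
  have "inj_on (\<lambda>(x, v). x(i := v)) (SIGMA x:?S I. D x)"
  proof (rule inj_onI, clarify)
    fix x v x' v' assume x: "x \<in> PiE I (\<lambda>i. C (a i))" "x' \<in> PiE I (\<lambda>i. C (a i))" and eq: "x(i := v) = x'(i := v')"
    have "v = v'" using fun_cong[OF eq, of i] by simp
    moreover have "x j = x' j" for j
    proof (cases "j = i")
      case True thus ?thesis using x insert.hyps(2) by (auto simp: PiE_iff extensional_def)
    next
      case False thus ?thesis using fun_cong[OF eq, of j] by simp
    qed
    hence "x = x'" by (rule ext)
    ultimately show "x = x' \<and> v = v'" by simp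
  qed
  hence "card (?S (insert i I)) = card (SIGMA x:?S I. D x)" unfolding split by (rule card_image)
  also have "\<dots> = (\<Sum>x\<in>?S I. card (D x))"
  proof (rule card_SigmaI)
    have "finite (PiE I (\<lambda>i. C (a i)))" using insert fin by (intro finite_PiE) auto
    thus "finite (?S I)" by simp
    show "\<forall>x\<in>?S I. finite (D x)" using fin[OF aR] by (simp add: D_def)
  qed
  also have "\<dots> = (\<Sum>x\<in>?S I. card (C (a i)) - ?m (a i))"
  proof (rule sum.cong[OF refl])
    fix x assume x: "x \<in> ?S I"
    have "x ` {j\<in>I. a j = a i} \<subseteq> C (a i)" using x by (auto simp: PiE_iff)
    moreover have "inj_on x {j\<in>I. a j = a i}" using x by (auto intro: inj_on_subset)
    ultimately show "card (D x) = card (C (a i)) - ?m (a i)"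
      unfolding D_def using fin[OF aR] by (subst card_Diff_subset) (auto simp: card_image intro: finite_subset)
  qed
  also have "\<dots> = (\<Prod>T\<in>R. \<Prod>j<?m T. card (C T) - j) * (card (C (a i)) - ?m (a i))"
    using insert by simp
  also have "\<dots> = (\<Prod>T\<in>R. \<Prod>j<card {j\<in>insert i I. a j = T}. card (C T) - j)"
  proof -
    have c1: "card {j\<in>insert i I. a j = a i} = Suc (?m (a i))"
    proof -
      have "{j\<in>insert i I. a j = a i} = insert i {j\<in>I. a j = a i}" by auto
      thus ?thesis using insert.hyps by simp
    qed
    have c2: "{j\<in>insert i I. a j = T} = {j\<in>I. a j = T}" if "T \<noteq> a i" for T using that by auto
    have "(\<Prod>T\<in>R. \<Prod>j<card {j\<in>insert i I. a j = T}. card (C T) - j)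
       = (\<Prod>j<card {j\<in>insert i I. a j = a i}. card (C (a i)) - j) * (\<Prod>T\<in>R - {a i}. \<Prod>j<card {j\<in>insert i I. a j = T}. card (C T) - j)"
      using R(1) aR by (rule prod.remove)
    also have "(\<Prod>T\<in>R - {a i}. \<Prod>j<card {j\<in>insert i I. a j = T}. card (C T) - j) = (\<Prod>T\<in>R - {a i}. \<Prod>j<?m T. card (C T) - j)"
      by (rule prod.cong[OF refl]) (use c2 in auto)
    also have "(\<Prod>j<card {j\<in>insert i I. a j = a i}. card (C (a i)) - j) = (\<Prod>j<?m (a i). card (C (a i)) - j) * (card (C (a i)) - ?m (a i))"
      unfolding c1 by simp
    also have "\<dots> * (\<Prod>T\<in>R - {a i}. \<Prod>j<?m T. card (C T) - j)
       = ((\<Prod>j<?m (a i). card (C (a i)) - j) * (\<Prod>T\<in>R - {a i}. \<Prod>j<?m T. card (C T) - j)) * (card (C (a i)) - ?m (a i))" by (simp only: mult_ac)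
    also have "(\<Prod>j<?m (a i). card (C (a i)) - j) * (\<Prod>T\<in>R - {a i}. \<Prod>j<?m T. card (C T) - j) = (\<Prod>T\<in>R. \<Prod>j<?m T. card (C T) - j)"
      using R(1) aR by (rule prod.remove[symmetric])
    finally show ?thesis by simp
  qed
  finally show ?case .
qed

lemma prod_diff_eq_fact: "(\<Prod>j<m. m - j) = (fact m :: nat)"
proof -
  have "(\<Prod>j<m. m - j) = (\<Prod>j\<in>{1..m}. j)"
    by (rule prod.reindex_bij_witness[of _ "\<lambda>j. m - j" "\<lambda>j. m - j"]) auto
  thus ?thesis by (simp add: fact_prod)
qed

lemma finite_enums: "finite (enums N Y)"
proof (cases "finite Y")
  case True
  hence "finite ({..<N} \<rightarrow>\<^sub>E Y)" by (intro finite_PiE) auto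
  thus ?thesis unfolding enums_def by simp
qed (simp add: enums_def)

lemma card_enums: "finite Y \<Longrightarrow> card (enums (card Y) Y) = fact (card Y)"
  using card_injective_coloured[where I = "{..<card Y}" and R = "{True}" and a = "\<lambda>_. True" and C = "\<lambda>_. Y"]
  by (simp add: enums_def disjoint_family_on_def prod_diff_eq_fact image_subset_iff)

lemma enums_image:
  assumes "x \<in> enums N Y" shows "x ` {..<N} = Y"
proof (rule card_subset_eq)
  show "finite Y" "x ` {..<N} \<subseteq> Y" using assms by (auto simp: enums_def PiE_iff)
  show "card (x ` {..<N}) = card Y" using assms by (simp add: enums_def card_image)
qed

text \<open>For prescribed atoms there is an enumeration only if every atom contains the right number of points, and then
  the points of each atom can be permuted freely.\<close>
lemma card_enums_atoms:
  fixes A :: "nat \<Rightarrow> 'b set"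
  assumes disj: "disjoint_family_on A {..<q}" and cover: "(\<Union>l<q. A l) = UNIV"
    and a: "\<And>i. i < N \<Longrightarrow> a i < q" and Y: "finite Y"
  defines "m \<equiv> \<lambda>l. card {i. i < N \<and> a i = l}"
  shows "card {x \<in> enums N Y. \<forall>i<N. x i \<in> A (a i)}
    = (if \<forall>l<q. card (Y \<inter> A l) = m l then \<Prod>l<q. fact (m l) else 0)"
proof -
  have sm: "(\<Sum>l<q. m l) = N"
  proof -
    have "(\<Sum>l<q. m l) = card (\<Union>l<q. {i. i < N \<and> a i = l})"
      unfolding m_def by (rule card_UN_disjoint[symmetric]) auto
    also have "(\<Union>l<q. {i. i < N \<and> a i = l}) = {..<N}" using a by auto
    finally show ?thesis by simp
  qed
  have sY: "(\<Sum>l<q. card (Y \<inter> A l)) = card Y"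
  proof -
    have "(\<Sum>l<q. card (Y \<inter> A l)) = card (\<Union>l<q. Y \<inter> A l)"
      using disj Y by (intro card_UN_disjoint[symmetric]) (auto simp: disjoint_family_on_def)
    also have "(\<Union>l<q. Y \<inter> A l) = Y" using cover by blast
    finally show ?thesis .
  qed
  have cnt: "card {x \<in> PiE {..<N} (\<lambda>i. Y \<inter> A (a i)). inj_on x {..<N}} = (\<Prod>l<q. \<Prod>j<m l. card (Y \<inter> A l) - j)"
  proof -
    have "disjoint_family_on (\<lambda>l. Y \<inter> A l) {..<q}" using disj by (auto simp: disjoint_family_on_def)
    moreover have "a ` {..<N} \<subseteq> {..<q}" using a by auto
    ultimately show ?thesis
      using card_injective_coloured[of "{..<N}" "{..<q}" a "\<lambda>l. Y \<inter> A l"] Y by (simp add: m_def)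
  qed
  have eqS: "{x \<in> enums N Y. \<forall>i<N. x i \<in> A (a i)} = (if card Y = N then {x \<in> PiE {..<N} (\<lambda>i. Y \<inter> A (a i)). inj_on x {..<N}} else {})"
    using Y by (auto simp: enums_def PiE_iff)
  show ?thesis
  proof (cases "\<forall>l<q. card (Y \<inter> A l) = m l")
    case True
    hence "card Y = N" using sm sY by simp
    thus ?thesis using True unfolding eqS by (simp add: cnt prod_diff_eq_fact)
  next
    case False
    show ?thesis
    proof (cases "card Y = N")
      case cN: True
      have "\<exists>l<q. card (Y \<inter> A l) < m l"
      proof (rule ccontr)
        assume H: "\<not> ?thesis"
        obtain l where l: "l < q" "card (Y \<inter> A l) \<noteq> m l" using False by blast
        have "(\<Sum>l<q. m l) < (\<Sum>l<q. card (Y \<inter> A l))"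
        proof (rule sum_strict_mono_ex1)
          show le: "\<forall>l\<in>{..<q}. m l \<le> card (Y \<inter> A l)"
          proof (rule ballI, rule ccontr)
            fix l assume "l \<in> {..<q}" "\<not> m l \<le> card (Y \<inter> A l)"
            thus False using H by auto
          qed
          show "\<exists>l\<in>{..<q}. m l < card (Y \<inter> A l)"
          proof (rule bexI)
            have "m l \<le> card (Y \<inter> A l)" using le l(1) by simp
            thus "m l < card (Y \<inter> A l)" using l(2) by simp
          qed (use l(1) in simp)
        qed simp
        thus False using sm sY cN by simp
      qed
      then obtain l where l: "l < q" "card (Y \<inter> A l) < m l" by blast
      hence "(\<Prod>j<m l. card (Y \<inter> A l) - j) = 0" by (intro prod_zero) auto
      hence "(\<Prod>l<q. \<Prod>j<m l. card (Y \<inter> A l) - j) = 0" using l by (intro prod_zero) auto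
      hence "card {x \<in> enums N Y. \<forall>i<N. x i \<in> A (a i)} = 0" unfolding eqS if_P[OF cN] cnt .
      thus ?thesis by (subst if_not_P[OF False])
    next
      case cN: False
      thus ?thesis by (subst if_not_P[OF False]) (simp add: eqS)
    qed
  qed
qed

locale poisson_on_cube = prob_space M for M :: "'a measure" +
  fixes a :: real and X :: "'a \<Rightarrow> (real^'d) set"
  assumes pois: "poisson_process_on_cube M a X" and a0: "0 \<le> a"
begin

lemma X_finite: "\<omega> \<in> space M \<Longrightarrow> finite (X \<omega>)"
  using pois[unfolded poisson_process_on_cube_def, THEN conjunct1, rule_format] by (rule conjunct1)

lemma count_measurable: "B \<in> sets borel \<Longrightarrow> (\<lambda>\<omega>. card (X \<omega> \<inter> B)) \<in> measurable M (count_space UNIV)"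
  using pois[unfolded poisson_process_on_cube_def, THEN conjunct2, THEN conjunct1, rule_format] by (rule conjunct1)

lemma count_prob: 
  assumes "B \<in> sets borel"
  shows "prob {\<omega> \<in> space M. card (X \<omega> \<inter> B) = j} = exp (- (a * measure unitQ B)) * (a * measure unitQ B) ^ j / fact j"
proof -
  have "measure unitQ B = measure lborel (B \<inter> cbox 0 1)"
    using assms unfolding unitQ_def by (simp add: measure_def emeasure_unit_cube Int_commute divide_ennreal_def)
  thus ?thesis
    using pois[unfolded poisson_process_on_cube_def Let_def, THEN conjunct2, THEN conjunct1, rule_format, OF assms,
        THEN conjunct2, rule_format, of j] by (simp only:)
qed

lemma joint_prob:
  fixes q :: nat
  assumes A: "\<And>l. l < q \<Longrightarrow> A l \<in> sets borel" "disjoint_family_on A {..<q}" and q: "0 < q"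
  shows "{\<omega> \<in> space M. \<forall>l<q. card (X \<omega> \<inter> A l) = m l} \<in> events"
    "prob {\<omega> \<in> space M. \<forall>l<q. card (X \<omega> \<inter> A l) = m l}
     = (\<Prod>l<q. exp (- (a * measure unitQ (A l))) * (a * measure unitQ (A l)) ^ m l / fact (m l))"
proof -
  have ind: "indep_vars (\<lambda>_. count_space UNIV) (\<lambda>l \<omega>. card (X \<omega> \<inter> A l)) {..<q}"
  proof -
    have 1: "\<forall>i<q. A i \<in> sets borel" using A(1) by simp
    show ?thesis
      using pois[unfolded poisson_process_on_cube_def, THEN conjunct2, THEN conjunct2, THEN spec[of _ q], THEN spec[of _ A],
        THEN mp, OF 1, THEN mp, OF A(2)] .
  qed
  have eq: "{\<omega> \<in> space M. \<forall>l<q. card (X \<omega> \<inter> A l) = m l} = (\<Inter>l\<in>{..<q}. (\<lambda>\<omega>. card (X \<omega> \<inter> A l)) -` {m l} \<inter> space M)"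
    using q by auto
  have "prob (\<Inter>l\<in>{..<q}. (\<lambda>\<omega>. card (X \<omega> \<inter> A l)) -` {m l} \<inter> space M)
      = (\<Prod>l\<in>{..<q}. prob ((\<lambda>\<omega>. card (X \<omega> \<inter> A l)) -` {m l} \<inter> space M))"
    using q by (intro indep_varsD[OF ind]) auto
  also have "\<dots> = (\<Prod>l<q. exp (- (a * measure unitQ (A l))) * (a * measure unitQ (A l)) ^ m l / fact (m l))"
  proof (rule prod.cong[OF refl])
    fix l assume l: "l \<in> {..<q}"
    have "(\<lambda>\<omega>. card (X \<omega> \<inter> A l)) -` {m l} \<inter> space M = {\<omega> \<in> space M. card (X \<omega> \<inter> A l) = m l}" by auto
    thus "prob ((\<lambda>\<omega>. card (X \<omega> \<inter> A l)) -` {m l} \<inter> space M) = exp (- (a * measure unitQ (A l))) * (a * measure unitQ (A l)) ^ m l / fact (m l)"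
      using count_prob[of "A l" "m l"] A(1) l by simp
  qed
  finally show "prob {\<omega> \<in> space M. \<forall>l<q. card (X \<omega> \<inter> A l) = m l}
     = (\<Prod>l<q. exp (- (a * measure unitQ (A l))) * (a * measure unitQ (A l)) ^ m l / fact (m l))" unfolding eq .
  show "{\<omega> \<in> space M. \<forall>l<q. card (X \<omega> \<inter> A l) = m l} \<in> events" unfolding eq
    using q count_measurable A(1) by (intro sets.finite_INT) (auto intro!: measurable_sets)
qed

text \<open>Summing \<open>u\<close> over all enumerations of the process, when it has exactly \<open>N\<close> points.\<close>
definition W :: "nat \<Rightarrow> ((nat \<Rightarrow> real^'d) \<Rightarrow> ennreal) \<Rightarrow> 'a \<Rightarrow> ennreal" where
  "W N u \<omega> = (\<integral>\<^sup>+x. u x \<partial>count_space (enums N (X \<omega>)))"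

definition QN :: "nat \<Rightarrow> (nat \<Rightarrow> real^'d) measure" where "QN N = PiM {..<N} (\<lambda>_. unitQ)"

lemma sets_QN: "sets (QN N) = sets (PiM {..<N} (\<lambda>_. borel))" unfolding QN_def by (rule sets_PiM_cong) auto
lemma space_QN: "space (QN N) = {..<N} \<rightarrow>\<^sub>E UNIV" using sets_eq_imp_space_eq[OF sets_QN[of N]] by (simp add: space_PiM)

lemma enums_space: "enums N Y \<subseteq> space (QN N)" by (auto simp: enums_def space_QN PiE_iff extensional_def)

abbreviation wt :: "nat \<Rightarrow> ennreal" where "wt N \<equiv> ennreal (exp (- a) * a ^ N)"

lemma QN_box:
  assumes "\<And>i. i < N \<Longrightarrow> B i \<in> sets borel"
  shows "(\<integral>\<^sup>+x. (\<Prod>i<N. indicator (B i) (x i)) \<partial>QN N) = ennreal (\<Prod>i<N. measure unitQ (B i))"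
proof -
  interpret U: prob_space "unitQ :: (real^'d) measure" by (rule prob_space_unitQ)
  interpret Q: product_prob_space "\<lambda>_::nat. unitQ :: (real^'d) measure"
    by (intro product_prob_spaceI prob_space_unitQ)
  have "(\<integral>\<^sup>+x. (\<Prod>i<N. indicator (B i) (x i)) \<partial>QN N) = (\<Prod>i<N. (\<integral>\<^sup>+x. indicator (B i) x \<partial>unitQ))"
    unfolding QN_def using assms by (intro Q.product_nn_integral_prod) (auto intro!: borel_measurable_indicator)
  also have "\<dots> = (\<Prod>i<N. ennreal (measure unitQ (B i)))"
    using assms by (intro prod.cong refl) (simp add: U.emeasure_eq_measure)
  finally show ?thesis by (simp add: prod_ennreal)
qed

text \<open>For indicators of products of atoms of a partition, \<open>W\<close> is a multiple of the indicator that the counts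
  of the atoms are as prescribed. The factorials cancel against those of the Poisson probabilities, and what remains is
  the product measure of the box.\<close>
lemma W_atoms:
  fixes q :: nat
  assumes A: "\<And>l. l < q \<Longrightarrow> A l \<in> sets borel" "disjoint_family_on A {..<q}" "(\<Union>l<q. A l) = UNIV" and q: "0 < q"
    and f: "\<And>i. i < N \<Longrightarrow> f i < q"
  shows "W N (\<lambda>x. \<Prod>i<N. indicator (A (f i)) (x i)) \<in> borel_measurable M"
    and "(\<integral>\<^sup>+\<omega>. W N (\<lambda>x. \<Prod>i<N. indicator (A (f i)) (x i)) \<omega> \<partial>M)
      = wt N * (\<integral>\<^sup>+x. (\<Prod>i<N. indicator (A (f i)) (x i)) \<partial>QN N)"
proof -
  interpret U: prob_space "unitQ :: (real^'d) measure" by (rule prob_space_unitQ)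
  define m where "m l = card {i. i < N \<and> f i = l}" for l
  define E where "E = {\<omega> \<in> space M. \<forall>l<q. card (X \<omega> \<inter> A l) = m l}"
  have E: "E \<in> events" unfolding E_def by (rule joint_prob(1)[OF A(1,2) q])
  have W: "W N (\<lambda>x. \<Prod>i<N. indicator (A (f i)) (x i)) \<omega> = ennreal (\<Prod>l<q. fact (m l)) * indicator E \<omega>" if \<omega>: "\<omega> \<in> space M" for \<omega>
  proof -
    have "W N (\<lambda>x. \<Prod>i<N. indicator (A (f i)) (x i)) \<omega> = (\<integral>\<^sup>+x. indicator {x \<in> enums N (X \<omega>). \<forall>i<N. x i \<in> A (f i)} x \<partial>count_space (enums N (X \<omega>)))"
      unfolding W_def
    proof (rule nn_integral_cong)
      fix x assume x: "x \<in> space (count_space (enums N (X \<omega>)))"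
      show "(\<Prod>i<N. indicator (A (f i)) (x i)) = (indicator {x \<in> enums N (X \<omega>). \<forall>i<N. x i \<in> A (f i)} x :: ennreal)"
      proof (cases "\<forall>i<N. x i \<in> A (f i)")
        case True
        have "(\<Prod>i<N. indicator (A (f i)) (x i)) = (1::ennreal)" using True by (intro prod.neutral) auto
        thus ?thesis using True x by simp
      next
        case False
        have "(\<Prod>i<N. indicator (A (f i)) (x i)) = (0::ennreal)" using False by (intro prod_zero) (auto simp: indicator_def)
        thus ?thesis using False by simp
      qed
    qed
    also have "\<dots> = emeasure (count_space (enums N (X \<omega>))) {x \<in> enums N (X \<omega>). \<forall>i<N. x i \<in> A (f i)}"
      by (rule nn_integral_indicator) auto
    also have "\<dots> = ennreal (real (card {x \<in> enums N (X \<omega>). \<forall>i<N. x i \<in> A (f i)}))"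
      by (subst emeasure_count_space_finite) (auto intro: finite_subset[OF _ finite_enums] simp: ennreal_of_nat_eq_real_of_nat)
    also have "card {x \<in> enums N (X \<omega>). \<forall>i<N. x i \<in> A (f i)} = (if \<forall>l<q. card (X \<omega> \<inter> A l) = m l then \<Prod>l<q. fact (m l) else 0)"
      unfolding m_def by (rule card_enums_atoms) (use A f X_finite[OF \<omega>] in auto)
    finally show ?thesis using \<omega> by (simp add: E_def indicator_def)
  qed
  have "(\<lambda>\<omega>. ennreal (\<Prod>l<q. fact (m l)) * indicator E \<omega>) \<in> borel_measurable M" using E by measurable
  thus "W N (\<lambda>x. \<Prod>i<N. indicator (A (f i)) (x i)) \<in> borel_measurable M" using W by (simp cong: measurable_cong)
  have sumq: "(\<Sum>l<q. measure unitQ (A l)) = 1"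
  proof -
    have "measure unitQ (\<Union>l\<in>{..<q}. A l) = (\<Sum>l<q. measure unitQ (A l))"
      by (rule U.finite_measure_finite_Union) (use A in auto)
    thus ?thesis using A(3) U.prob_space by (simp add: unitQ_def)
  qed
  have fib: "(\<Prod>l<q. measure unitQ (A l) ^ m l) = (\<Prod>i<N. measure unitQ (A (f i)))"
  proof -
    have "(\<Prod>i<N. measure unitQ (A (f i))) = (\<Prod>l<q. \<Prod>i\<in>{i\<in>{..<N}. f i = l}. measure unitQ (A (f i)))"
      using f by (intro prod.group[symmetric]) auto
    also have "\<dots> = (\<Prod>l<q. measure unitQ (A l) ^ m l)"
    proof (rule prod.cong[OF refl])
      fix l
      have "(\<Prod>i\<in>{i\<in>{..<N}. f i = l}. measure unitQ (A (f i))) = (\<Prod>i\<in>{i\<in>{..<N}. f i = l}. measure unitQ (A l))"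
        by (rule prod.cong) auto
      thus "(\<Prod>i\<in>{i\<in>{..<N}. f i = l}. measure unitQ (A (f i))) = measure unitQ (A l) ^ m l" by (simp add: m_def)
    qed
    finally show ?thesis by simp
  qed
  have sm: "(\<Sum>l<q. m l) = N"
  proof -
    have "(\<Sum>l<q. m l) = card (\<Union>l<q. {i. i < N \<and> f i = l})"
      unfolding m_def by (rule card_UN_disjoint[symmetric]) auto
    also have "(\<Union>l<q. {i. i < N \<and> f i = l}) = {..<N}" using f by auto
    finally show ?thesis by simp
  qed
  have pE: "prob E = (\<Prod>l<q. exp (- (a * measure unitQ (A l))) * (a * measure unitQ (A l)) ^ m l / fact (m l))"
    unfolding E_def by (rule joint_prob(2)[OF A(1,2) q])
  have "(\<Prod>l<q. fact (m l)) * prob E = (\<Prod>l<q. fact (m l) * (exp (- (a * measure unitQ (A l))) * (a * measure unitQ (A l)) ^ m l / fact (m l)))"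
    unfolding pE by (simp only: prod.distrib)
  also have "\<dots> = (\<Prod>l<q. exp (- (a * measure unitQ (A l))) * (a ^ m l * measure unitQ (A l) ^ m l))"
    by (simp add: power_mult_distrib)
  also have "\<dots> = exp (\<Sum>l<q. - (a * measure unitQ (A l))) * (a ^ (\<Sum>l<q. m l) * (\<Prod>l<q. measure unitQ (A l) ^ m l))"
    by (simp only: prod.distrib exp_sum[OF finite_lessThan] power_sum)
  also have "(\<Sum>l<q. - (a * measure unitQ (A l))) = - a" using sumq by (simp add: sum_negf sum_distrib_left[symmetric])
  finally have val: "(\<Prod>l<q. fact (m l)) * prob E = exp (- a) * a ^ N * (\<Prod>i<N. measure unitQ (A (f i)))"
    by (simp add: sm fib)
  have "(\<integral>\<^sup>+\<omega>. W N (\<lambda>x. \<Prod>i<N. indicator (A (f i)) (x i)) \<omega> \<partial>M) = (\<integral>\<^sup>+\<omega>. ennreal (\<Prod>l<q. fact (m l)) * indicator E \<omega> \<partial>M)"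
    by (rule nn_integral_cong[OF W])
  also have "\<dots> = ennreal (\<Prod>l<q. fact (m l)) * ennreal (prob E)" using E by (simp add: nn_integral_cmult_indicator emeasure_eq_measure)
  also have "\<dots> = ennreal (exp (- a) * a ^ N * (\<Prod>i<N. measure unitQ (A (f i))))"
    unfolding val[symmetric] by (rule ennreal_mult[symmetric]) (auto intro: prod_nonneg)
  also have "\<dots> = wt N * ennreal (\<Prod>i<N. measure unitQ (A (f i)))" using a0 by (intro ennreal_mult) (auto intro: prod_nonneg)
  also have "ennreal (\<Prod>i<N. measure unitQ (A (f i))) = (\<integral>\<^sup>+x. (\<Prod>i<N. indicator (A (f i)) (x i)) \<partial>QN N)"
    by (rule QN_box[symmetric]) (use A f in auto)
  finally show "(\<integral>\<^sup>+\<omega>. W N (\<lambda>x. \<Prod>i<N. indicator (A (f i)) (x i)) \<omega> \<partial>M) = wt N * (\<integral>\<^sup>+x. (\<Prod>i<N. indicator (A (f i)) (x i)) \<partial>QN N)" .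
qed

text \<open>The multivariate Campbell-type identity: on the event of \<open>N\<close> points, the ordered tuples of distinct points
  have intensity \<open>exp (- a) * a ^ N\<close> times the law of \<open>N\<close> independent uniform points.\<close>
definition good :: "nat \<Rightarrow> ((nat \<Rightarrow> real^'d) \<Rightarrow> ennreal) \<Rightarrow> bool" where
  "good N u \<longleftrightarrow> W N u \<in> borel_measurable M \<and> (\<integral>\<^sup>+\<omega>. W N u \<omega> \<partial>M) = wt N * (\<integral>\<^sup>+x. u x \<partial>QN N)"

lemma W_cong: "(\<And>x. x \<in> space (QN N) \<Longrightarrow> u x = v x) \<Longrightarrow> W N u = W N v"
  unfolding W_def using enums_space by (intro ext nn_integral_cong) auto

lemma good_cong: "(\<And>x. x \<in> space (QN N) \<Longrightarrow> u x = v x) \<Longrightarrow> good N u \<longleftrightarrow> good N v"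
  using W_cong[of N u v] nn_integral_cong[of "QN N" u v] by (simp add: good_def)

lemma good_sum:
  assumes "finite S" "\<And>s. s \<in> S \<Longrightarrow> good N (u s)" "\<And>s. s \<in> S \<Longrightarrow> u s \<in> borel_measurable (QN N)"
  shows "good N (\<lambda>x. \<Sum>s\<in>S. u s x)"
proof -
  have W: "W N (\<lambda>x. \<Sum>s\<in>S. u s x) = (\<lambda>\<omega>. \<Sum>s\<in>S. W N (u s) \<omega>)"
    unfolding W_def by (rule ext, rule nn_integral_sum) simp
  have "(\<integral>\<^sup>+\<omega>. (\<Sum>s\<in>S. W N (u s) \<omega>) \<partial>M) = (\<Sum>s\<in>S. (\<integral>\<^sup>+\<omega>. W N (u s) \<omega> \<partial>M))"
    using assms(2) by (intro nn_integral_sum) (simp add: good_def)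
  also have "\<dots> = (\<Sum>s\<in>S. wt N * (\<integral>\<^sup>+x. u s x \<partial>QN N))" using assms(2) by (intro sum.cong refl) (simp add: good_def)
  also have "\<dots> = wt N * (\<integral>\<^sup>+x. (\<Sum>s\<in>S. u s x) \<partial>QN N)"
    using assms(3) by (simp add: nn_integral_sum sum_distrib_left)
  finally show ?thesis using assms(2) unfolding good_def W by (auto intro!: borel_measurable_sum)
qed

text \<open>The sides of a box generate a finite partition, indexed by the sets \<open>{i. z \<in> B i}\<close>; the box is a
  disjoint union of products of its atoms.\<close>
lemma good_box:
  assumes B: "\<And>i. i < N \<Longrightarrow> B i \<in> sets borel"
  shows "good N (\<lambda>x. \<Prod>i<N. indicator (B i) (x i))"
proof -
  obtain e where e: "bij_betw e {0..<card (Pow {..<N})} (Pow {..<N})"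
    using ex_bij_betw_nat_finite[of "Pow {..<N}"] by auto
  define q where "q = card (Pow {..<N})"
  have q: "0 < q" unfolding q_def by (simp add: card_Pow)
  have e: "bij_betw e {..<q} (Pow {..<N})" using e unfolding q_def atLeast0LessThan .
  define A where "A l = (\<Inter>i\<in>{..<N}. if i \<in> e l then B i else - B i)" for l
  have memA: "z \<in> A l \<longleftrightarrow> e l = {i\<in>{..<N}. z \<in> B i}" if "l < q" for z l
  proof -
    have "e l \<subseteq> {..<N}" using e that by (auto simp: bij_betw_def)
    thus ?thesis unfolding A_def by (auto split: if_splits)
  qed
  have A1: "A l \<in> sets borel" for l
  proof (cases "N = 0")
    case False
    thus ?thesis unfolding A_def using B by (intro sets.finite_INT) (auto simp: borel_comp)
  qed (simp add: A_def)
  have A2: "disjoint_family_on A {..<q}"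
  proof -
    have "l = l'" if "l < q" "l' < q" "z \<in> A l" "z \<in> A l'" for l l' z
    proof -
      have "e l = e l'" using that memA by simp
      thus ?thesis using e that by (auto simp: bij_betw_def inj_on_def)
    qed
    thus ?thesis unfolding disjoint_family_on_def by blast
  qed
  have A3: "(\<Union>l<q. A l) = UNIV"
  proof -
    have "\<exists>l<q. z \<in> A l" for z
    proof -
      have "{i\<in>{..<N}. z \<in> B i} \<in> e ` {..<q}" using e by (auto simp: bij_betw_def)
      thus ?thesis using memA by auto
    qed
    thus ?thesis by blast
  qed
  define L where "L i = {l\<in>{..<q}. i \<in> e l}" for i
  have ind: "indicator (B i) z = (\<Sum>l\<in>L i. indicator (A l) z :: ennreal)" if i: "i < N" for i z
  proof -
    have "{i\<in>{..<N}. z \<in> B i} \<in> e ` {..<q}" using e by (auto simp: bij_betw_def)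
    then obtain l0 where "{i\<in>{..<N}. z \<in> B i} = e l0" "l0 \<in> {..<q}" by (rule imageE)
    hence l0: "l0 < q" "e l0 = {i\<in>{..<N}. z \<in> B i}" by simp_all
    have zA: "z \<in> A l \<longleftrightarrow> l = l0" if "l < q" for l
      using memA[OF that] l0 that e by (auto simp: bij_betw_def inj_on_def)
    have "(\<Sum>l\<in>L i. indicator (A l) z :: ennreal) = (\<Sum>l\<in>L i. if l = l0 then 1 else 0)"
      by (rule sum.cong) (auto simp: L_def indicator_def zA)
    also have "\<dots> = (if l0 \<in> L i then 1 else 0)" by (simp add: L_def)
    also have "\<dots> = indicator (B i) z" using l0 i by (auto simp: L_def indicator_def)
    finally show ?thesis by simp
  qed
  have eq: "(\<Prod>i<N. indicator (B i) (x i)) = (\<Sum>f\<in>PiE {..<N} L. \<Prod>i<N. indicator (A (f i)) (x i) :: ennreal)" for x :: "nat \<Rightarrow> real^'d"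
  proof -
    have "(\<Prod>i<N. indicator (B i) (x i)) = (\<Prod>i<N. \<Sum>l\<in>L i. indicator (A l) (x i) :: ennreal)"
      using ind by (intro prod.cong refl) auto
    also have "\<dots> = (\<Sum>f\<in>PiE {..<N} L. \<Prod>i<N. indicator (A (f i)) (x i))"
      by (rule prod_sum_PiE) (auto simp: L_def)
    finally show ?thesis .
  qed
  show ?thesis unfolding eq
  proof (rule good_sum)
    show "finite (PiE {..<N} L)" by (intro finite_PiE) (auto simp: L_def)
    fix f assume f: "f \<in> PiE {..<N} L"
    hence fq: "f i < q" if "i < N" for i using that by (auto simp: PiE_iff L_def)
    show "good N (\<lambda>x. \<Prod>i<N. indicator (A (f i)) (x i))"
      unfolding good_def using W_atoms[OF A1 A2 A3 q fq] by simp
    show "(\<lambda>x. \<Prod>i<N. indicator (A (f i)) (x i) :: ennreal) \<in> borel_measurable (QN N)"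
    proof (rule borel_measurable_prod_ennreal)
      fix i assume "i \<in> {..<N}"
      hence "(\<lambda>x. x i) \<in> QN N \<rightarrow>\<^sub>M borel" unfolding QN_def by (simp add: measurable_cong_sets[OF refl sets_unitQ[symmetric]])
      from measurable_compose[OF this borel_measurable_indicator[OF A1]]
      show "(\<lambda>x. indicator (A (f i)) (x i) :: ennreal) \<in> borel_measurable (QN N)" .
    qed
  qed
qed

lemma prob_space_QN: "prob_space (QN N)" unfolding QN_def by (intro prob_space_PiM prob_space_unitQ)

text \<open>Boxes form an intersection-stable generator, and the sets with the identity form a Dynkin
  system.\<close>
lemma good_indicator:
  assumes "A \<in> sets (QN N)" shows "good N (indicator A)"
proof -
  interpret Q: prob_space "QN N" by (rule prob_space_QN)
  define \<Omega> where "\<Omega> = ({..<N} \<rightarrow>\<^sub>E UNIV :: (nat \<Rightarrow> real^'d) set)"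
  define \<G> where "\<G> = {Pi\<^sub>E {..<N} B | B. B \<in> {..<N} \<rightarrow> sets (borel :: (real^'d) measure)}"
  have gen: "sets (QN N) = sigma_sets \<Omega> \<G>"
    unfolding sets_QN sets_PiM \<G>_def \<Omega>_def by (subst prod_algebra_eq_finite) auto
  have "Int_stable (prod_algebra {..<N} (\<lambda>_. borel :: (real^'d) measure))" by (rule Int_stable_prod_algebra)
  hence stable: "Int_stable \<G>" unfolding \<G>_def by (subst (asm) prod_algebra_eq_finite) auto
  have sub: "\<G> \<subseteq> Pow \<Omega>" unfolding \<G>_def \<Omega>_def by (auto simp: PiE_iff)
  have box: "good N (indicator (Pi\<^sub>E {..<N} B))" if "B \<in> {..<N} \<rightarrow> sets borel" for B
  proof -
    have "indicator (Pi\<^sub>E {..<N} B) x = (\<Prod>i<N. indicator (B i) (x i) :: ennreal)" if x: "x \<in> space (QN N)" for x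
    proof (cases "x \<in> Pi\<^sub>E {..<N} B")
      case True
      hence "(\<Prod>i<N. indicator (B i) (x i)) = (1::ennreal)" by (intro prod.neutral) (auto simp: PiE_iff)
      thus ?thesis using True by simp
    next
      case False
      hence "\<exists>i<N. x i \<notin> B i" using x by (auto simp: space_QN PiE_iff)
      hence "(\<Prod>i<N. indicator (B i) (x i)) = (0::ennreal)" by (intro prod_zero) (auto simp: indicator_def)
      thus ?thesis using False by simp
    qed
    from good_cong[OF this] show ?thesis using good_box[of N B] that by auto
  qed
  have "A \<in> sigma_sets \<Omega> \<G>" using assms gen by simp
  with stable sub show ?thesis
  proof (induction rule: sigma_sets_induct_disjoint)
    case (basic A) thus ?case using box unfolding \<G>_def by blast
  next
    case empty
    have "W N (indicator {}) = (\<lambda>_. 0)" by (simp add: W_def fun_eq_iff)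
    show ?case unfolding good_def \<open>W N (indicator {}) = (\<lambda>_. 0)\<close> by simp
  next
    case (compl A)
    have A: "A \<in> sets (QN N)" using compl gen by simp
    have top: "good N (indicator \<Omega>)" using box[of "\<lambda>_. UNIV"] unfolding \<Omega>_def by simp
    have Wd: "W N (indicator (\<Omega> - A)) \<omega> = W N (indicator \<Omega>) \<omega> - W N (indicator A) \<omega>" for \<omega>
    proof -
      have AO: "A \<subseteq> \<Omega>" using compl(1) sigma_sets_into_sp[OF sub] by blast
      have "(\<integral>\<^sup>+x. indicator \<Omega> x - indicator A x \<partial>count_space (enums N (X \<omega>)))
         = (\<integral>\<^sup>+x. indicator \<Omega> x \<partial>count_space (enums N (X \<omega>))) - (\<integral>\<^sup>+x. indicator A x \<partial>count_space (enums N (X \<omega>)))"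
      proof (rule nn_integral_diff)
        have "(\<integral>\<^sup>+x. indicator A x \<partial>count_space (enums N (X \<omega>))) \<le> (\<integral>\<^sup>+x. 1 \<partial>count_space (enums N (X \<omega>)))"
          by (intro nn_integral_mono) (auto simp: indicator_def)
        also have "\<dots> < \<infinity>" using finite_enums[of N "X \<omega>"] by (simp add: nn_integral_count_space_finite ennreal_of_nat_eq_real_of_nat)
        finally show "(\<integral>\<^sup>+x. indicator A x \<partial>count_space (enums N (X \<omega>))) \<noteq> \<infinity>" by simp
      qed (use AO in \<open>auto simp: indicator_def\<close>)
      moreover have "(indicator (\<Omega> - A) x :: ennreal) = indicator \<Omega> x - indicator A x" for x
        using AO by (auto simp: indicator_def)
      ultimately show ?thesis by (simp add: W_def)
    qed
    have Wle: "W N (indicator A) \<omega> \<le> W N (indicator \<Omega>) \<omega>" for \<omega>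
    proof -
      have AO: "A \<subseteq> \<Omega>" using compl(1) sigma_sets_into_sp[OF sub] by blast
      thus ?thesis unfolding W_def by (intro nn_integral_mono) (auto simp: indicator_def)
    qed
    have fin: "(\<integral>\<^sup>+\<omega>. W N (indicator A) \<omega> \<partial>M) \<noteq> \<infinity>"
      using compl.IH A Q.emeasure_finite[of A] by (simp add: good_def ennreal_mult_eq_top_iff)
    have "(\<integral>\<^sup>+\<omega>. W N (indicator (\<Omega> - A)) \<omega> \<partial>M) = (\<integral>\<^sup>+\<omega>. W N (indicator \<Omega>) \<omega> \<partial>M) - (\<integral>\<^sup>+\<omega>. W N (indicator A) \<omega> \<partial>M)"
      unfolding Wd using top compl.IH Wle fin by (intro nn_integral_diff) (auto simp: good_def)
    also have "\<dots> = wt N * emeasure (QN N) \<Omega> - wt N * emeasure (QN N) A"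
    proof -
      have "\<Omega> \<in> sets (QN N)" using sets.top[of "QN N"] by (simp add: space_QN \<Omega>_def)
      thus ?thesis using top compl.IH A by (simp add: good_def)
    qed
    also have "\<dots> = wt N * (emeasure (QN N) \<Omega> - emeasure (QN N) A)"
      by (rule ennreal_right_diff_distrib[symmetric]) simp
    also have "emeasure (QN N) \<Omega> - emeasure (QN N) A = emeasure (QN N) (\<Omega> - A)"
      using emeasure_compl[OF A] by (simp add: space_QN \<Omega>_def)
    also have "emeasure (QN N) (\<Omega> - A) = (\<integral>\<^sup>+x. indicator (\<Omega> - A) x \<partial>QN N)"
      using sets.compl_sets[OF A] by (simp add: space_QN \<Omega>_def)
    finally have 1: "(\<integral>\<^sup>+\<omega>. W N (indicator (\<Omega> - A)) \<omega> \<partial>M) = wt N * (\<integral>\<^sup>+x. indicator (\<Omega> - A) x \<partial>QN N)" .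
    have "(\<lambda>\<omega>. W N (indicator \<Omega>) \<omega> - W N (indicator A) \<omega>) \<in> borel_measurable M"
      using top compl.IH by (auto simp: good_def)
    hence "W N (indicator (\<Omega> - A)) \<in> borel_measurable M" unfolding Wd[abs_def, symmetric] by (simp add: Wd)
    thus ?case using 1 by (simp add: good_def)
  next
    case (union A)
    have A: "A i \<in> sets (QN N)" for i using union gen by auto
    have ind: "(indicator (\<Union>i. A i) x :: ennreal) = (\<Sum>i. indicator (A i) x)" for x
      using suminf_indicator[OF union(1)] by simp
    have W: "W N (indicator (\<Union>i. A i)) = (\<lambda>\<omega>. \<Sum>i. W N (indicator (A i)) \<omega>)"
      unfolding W_def ind by (rule ext, rule nn_integral_suminf) simp
    have "(\<integral>\<^sup>+\<omega>. (\<Sum>i. W N (indicator (A i)) \<omega>) \<partial>M) = (\<Sum>i. (\<integral>\<^sup>+\<omega>. W N (indicator (A i)) \<omega> \<partial>M))"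
      using union by (intro nn_integral_suminf) (simp add: good_def)
    also have "\<dots> = (\<Sum>i. wt N * emeasure (QN N) (A i))" using union A by (simp add: good_def)
    also have "\<dots> = wt N * emeasure (QN N) (\<Union>i. A i)"
      using suminf_emeasure[of A "QN N"] A union(1) by (simp add: image_subset_iff)
    also have "\<dots> = wt N * (\<integral>\<^sup>+x. indicator (\<Union>i. A i) x \<partial>QN N)" using A by simp
    finally show ?case unfolding good_def W using union by (auto simp: good_def intro!: borel_measurable_suminf_order)
  qed
qed

lemma good_measurable:
  assumes "u \<in> borel_measurable (QN N)" shows "good N u"
  using assms
proof (induction rule: borel_measurable_induct)
  case (cong f g) thus ?case using good_cong[of N f g] by simp
next
  case (set A) thus ?case by (rule good_indicator)
next
  case (mult u c)
  have "W N (\<lambda>x. c * u x) = (\<lambda>\<omega>. c * W N u \<omega>)"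
    unfolding W_def by (rule ext, rule nn_integral_cmult) simp
  moreover have [measurable]: "W N u \<in> borel_measurable M" using mult by (simp add: good_def)
  moreover have "(\<lambda>\<omega>. c * W N u \<omega>) \<in> borel_measurable M" by measurable
  ultimately show ?case using mult by (simp add: good_def nn_integral_cmult mult.left_commute)
next
  case (add u v)
  have "W N (\<lambda>x. v x + u x) = (\<lambda>\<omega>. W N v \<omega> + W N u \<omega>)"
    unfolding W_def by (rule ext, rule nn_integral_add) simp_all
  moreover have [measurable]: "W N u \<in> borel_measurable M" "W N v \<in> borel_measurable M" using add by (simp_all add: good_def)
  moreover have "(\<lambda>\<omega>. W N v \<omega> + W N u \<omega>) \<in> borel_measurable M" by measurable
  ultimately show ?case using add by (simp add: good_def nn_integral_add distrib_left)
next
  case (seq U)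
  have W: "W N (SUP i. U i) = (\<lambda>\<omega>. SUP i. W N (U i) \<omega>)"
    unfolding W_def SUP_apply by (rule ext, rule nn_integral_monotone_convergence_SUP) (use seq in \<open>auto simp: incseq_def le_fun_def\<close>)
  have incW: "incseq (\<lambda>i. W N (U i))"
    unfolding W_def incseq_def le_fun_def using seq by (auto simp: incseq_def le_fun_def intro!: nn_integral_mono)
  have "(\<integral>\<^sup>+\<omega>. (SUP i. W N (U i) \<omega>) \<partial>M) = (SUP i. (\<integral>\<^sup>+\<omega>. W N (U i) \<omega> \<partial>M))"
    using seq incW by (intro nn_integral_monotone_convergence_SUP) (auto simp: good_def)
  also have "\<dots> = (SUP i. wt N * (\<integral>\<^sup>+x. U i x \<partial>QN N))" using seq by (simp add: good_def)
  also have "\<dots> = wt N * (SUP i. (\<integral>\<^sup>+x. U i x \<partial>QN N))" by (rule SUP_mult_left_ennreal[symmetric])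
  also have "(SUP i. (\<integral>\<^sup>+x. U i x \<partial>QN N)) = (\<integral>\<^sup>+x. (SUP i. U i x) \<partial>QN N)"
    using seq by (intro nn_integral_monotone_convergence_SUP[symmetric]) auto
  also have "(\<integral>\<^sup>+x. (SUP i. U i x) \<partial>QN N) = integral\<^sup>N (QN N) (SUP i. U i)"
    by (rule nn_integral_cong) (simp add: image_comp)
  finally have "(\<integral>\<^sup>+\<omega>. (SUP i. W N (U i) \<omega>) \<partial>M) = wt N * integral\<^sup>N (QN N) (SUP i. U i)" .
  moreover have "(\<lambda>\<omega>. SUP i. W N (U i) \<omega>) \<in> borel_measurable M"
    using seq by (intro borel_measurable_SUP) (auto simp: good_def)
  ultimately show ?case unfolding good_def W by blast
qed

text \<open>Apply the identity to the function \<open>x \<mapsto> \<Psi> (x ` {..<N})\<close>, which has the same value at each of the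
  \<open>N!\<close> enumerations of the process. The measurability of \<open>\<Psi> \<circ> X\<close> is part of the conclusion:
  a Poisson process is only given through its counts.\<close>
theorem poisson_mixture:
  fixes \<Psi> :: "(real^'d) set \<Rightarrow> ennreal"
  assumes \<Psi>: "\<And>N :: nat. (\<lambda>x. \<Psi> (x ` {..<N})) \<in> borel_measurable (PiM {..<N} (\<lambda>_. borel))"
  shows "(\<lambda>\<omega>. \<Psi> (X \<omega>)) \<in> borel_measurable M"
    and "(\<integral>\<^sup>+\<omega>. \<Psi> (X \<omega>) \<partial>M) = (\<Sum>N. ennreal (exp (- a) * a ^ N / fact N) * (\<integral>\<^sup>+x. \<Psi> (x ` {..<N}) \<partial>PiM {..<N} (\<lambda>_. unitQ)))"
proof -
  define u where "u N = (\<lambda>x. \<Psi> (x ` {..<N}))" for N :: nat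
  define c where "c N = ennreal (1 / fact N)" for N
  have u: "good N (u N)" for N
    using \<Psi>[of N] unfolding u_def by (intro good_measurable) (simp add: measurable_cong_sets[OF sets_QN refl])
  have val: "c N * W N (u N) \<omega> = (if N = card (X \<omega>) then \<Psi> (X \<omega>) else 0)" if \<omega>: "\<omega> \<in> space M" for N \<omega>
  proof (cases "N = card (X \<omega>)")
    case True
    have "W N (u N) \<omega> = (\<integral>\<^sup>+x. \<Psi> (X \<omega>) \<partial>count_space (enums N (X \<omega>)))"
      unfolding W_def u_def by (rule nn_integral_cong) (simp add: enums_image)
    also have "\<dots> = \<Psi> (X \<omega>) * ennreal (fact N)"
      using finite_enums[of N "X \<omega>"] card_enums[OF X_finite[OF \<omega>]] True
      by (simp add: emeasure_count_space_finite ennreal_of_nat_eq_real_of_nat)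
    finally have "c N * W N (u N) \<omega> = (c N * ennreal (fact N)) * \<Psi> (X \<omega>)" by (simp add: mult_ac)
    also have "c N * ennreal (fact N) = 1" unfolding c_def by (simp add: ennreal_mult[symmetric])
    finally show ?thesis using True by simp
  next
    case False
    hence "enums N (X \<omega>) = {}" by (auto simp: enums_def)
    thus ?thesis using False by (simp add: W_def nn_integral_empty)
  qed
  have sum: "\<Psi> (X \<omega>) = (\<Sum>N. c N * W N (u N) \<omega>)" if "\<omega> \<in> space M" for \<omega>
    using val[OF that] sums_unique[OF sums_single[of "card (X \<omega>)" "\<lambda>_. \<Psi> (X \<omega>)"]] by (simp add: eq_commute)
  have wm: "W N (u N) \<in> borel_measurable M" for N using u[of N] by (simp add: good_def)
  have m: "(\<lambda>\<omega>. c N * W N (u N) \<omega>) \<in> borel_measurable M" for N using wm[of N] by measurable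
  have "(\<lambda>\<omega>. \<Sum>N. c N * W N (u N) \<omega>) \<in> borel_measurable M" using m by (intro borel_measurable_suminf_order)
  thus "(\<lambda>\<omega>. \<Psi> (X \<omega>)) \<in> borel_measurable M" using sum by (simp cong: measurable_cong)
  have "(\<integral>\<^sup>+\<omega>. \<Psi> (X \<omega>) \<partial>M) = (\<integral>\<^sup>+\<omega>. (\<Sum>N. c N * W N (u N) \<omega>) \<partial>M)" by (rule nn_integral_cong[OF sum])
  also have "\<dots> = (\<Sum>N. (\<integral>\<^sup>+\<omega>. c N * W N (u N) \<omega> \<partial>M))" by (rule nn_integral_suminf[OF m])
  also have "\<dots> = (\<Sum>N. ennreal (exp (- a) * a ^ N / fact N) * (\<integral>\<^sup>+x. \<Psi> (x ` {..<N}) \<partial>PiM {..<N} (\<lambda>_. unitQ)))"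
  proof (rule suminf_cong)
    fix N
    have "(\<integral>\<^sup>+\<omega>. c N * W N (u N) \<omega> \<partial>M) = c N * (\<integral>\<^sup>+\<omega>. W N (u N) \<omega> \<partial>M)" by (rule nn_integral_cmult[OF wm])
    also have "\<dots> = (c N * wt N) * (\<integral>\<^sup>+x. u N x \<partial>QN N)" using u[of N] by (simp add: good_def mult.assoc)
    also have "c N * wt N = ennreal (exp (- a) * a ^ N / fact N)" unfolding c_def using a0 by (simp add: ennreal_mult[symmetric])
    finally show "(\<integral>\<^sup>+\<omega>. c N * W N (u N) \<omega> \<partial>M) = ennreal (exp (- a) * a ^ N / fact N) * (\<integral>\<^sup>+x. \<Psi> (x ` {..<N}) \<partial>PiM {..<N} (\<lambda>_. unitQ))"
      unfolding u_def QN_def .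
  qed
  finally show "(\<integral>\<^sup>+\<omega>. \<Psi> (X \<omega>) \<partial>M) = (\<Sum>N. ennreal (exp (- a) * a ^ N / fact N) * (\<integral>\<^sup>+x. \<Psi> (x ` {..<N}) \<partial>PiM {..<N} (\<lambda>_. unitQ)))" .
qed

end

section \<open>Point sets and tuples\<close>

context cech_shapes begin

text \<open>A tuple may have repetitions; the first occurrences provide one label for each point, chosen measurably.\<close>
definition first_occurrences :: "nat \<Rightarrow> (nat \<Rightarrow> real^'d) \<Rightarrow> nat set" where
  "first_occurrences N x = {a\<in>{..<N}. \<forall>b<a. x b \<noteq> x a}"

lemma first_occurrences_inj: "inj_on x (first_occurrences N x)"
proof (rule inj_onI)
  fix a b assume a: "a \<in> first_occurrences N x" and b: "b \<in> first_occurrences N x" and eq: "x a = x b"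
  show "a = b"
  proof (cases a b rule: linorder_cases)
    case less thus ?thesis using b eq by (simp add: first_occurrences_def)
  next
    case greater
    hence "x b \<noteq> x a" using a by (simp add: first_occurrences_def)
    thus ?thesis using eq by simp
  qed
qed

lemma first_occurrences_image: "x ` first_occurrences N x = x ` {..<N}"
proof (intro equalityI subsetI)
  fix y assume "y \<in> x ` {..<N}"
  then obtain a where a: "a < N" "x a = y" by auto
  define b where "b = (LEAST b. x b = y)"
  have b: "x b = y" "b \<le> a" unfolding b_def using a by (auto intro: LeastI Least_le)
  have "x c \<noteq> x b" if "c < b" for c using that not_less_Least[of c "\<lambda>b. x b = y"] b(1) unfolding b_def by auto
  hence "b \<in> first_occurrences N x" using a b by (simp add: first_occurrences_def)
  thus "y \<in> x ` first_occurrences N x" using b(1) by auto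
qed (auto simp: first_occurrences_def)

definition isolated :: "real \<Rightarrow> 'm \<Rightarrow> nat \<Rightarrow> nat set \<Rightarrow> (nat \<Rightarrow> real^'d) \<Rightarrow> bool" where
  "isolated r i N J x \<longleftrightarrow> (\<forall>a\<in>J. \<forall>b<N. (\<exists>c\<in>J. x b = x c) \<or> r * t $ i \<le> dist (x a) (x b))"

text \<open>A sum over sets of points is rewritten as a sum over sets of labels, each term of which is a
  measurable function of the tuple.\<close>
lemma component_counts_tuple:
  "component_counts k t G r (x ` {..<N}) $ i =
    (\<Sum>J | J \<subseteq> {..<N} \<and> card J = k. of_bool (J \<subseteq> first_occurrences N x \<and> isolated r i N J x
        \<and> shape i J (\<lambda>a. inverse r *\<^sub>R x a)))"
proof -
  let ?D = "first_occurrences N x" and ?X = "x ` {..<N}"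
  let ?S = "{J. J \<subseteq> ?D \<and> card J = k}"
  have inj: "inj_on x ?D" by (rule first_occurrences_inj)
  have img: "x ` ?D = ?X" by (rule first_occurrences_image)
  have DN: "?D \<subseteq> {..<N}" by (auto simp: first_occurrences_def)
  have bij: "bij_betw (image x) ?S {Y. Y \<subseteq> ?X \<and> card Y = k}"
    unfolding bij_betw_def
  proof
    show "inj_on (image x) ?S"
      by (rule inj_on_subset[OF inj_on_image_Pow[OF inj]]) auto
    show "image x ` ?S = {Y. Y \<subseteq> ?X \<and> card Y = k}"
    proof (intro equalityI subsetI)
      fix Y assume "Y \<in> {Y. Y \<subseteq> ?X \<and> card Y = k}"
      hence Y: "Y \<subseteq> x ` ?D" "card Y = k" unfolding img by auto
      then obtain J where J: "J \<subseteq> ?D" "Y = x ` J" by (auto simp: subset_image_iff)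
      have "card J = k" using Y(2) J card_image[OF inj_on_subset[OF inj J(1)]] by simp
      thus "Y \<in> image x ` ?S" using J by auto
    next
      fix Y assume "Y \<in> image x ` ?S"
      then obtain J where J: "J \<subseteq> ?D" "card J = k" "Y = x ` J" by auto
      have "card Y = k" using J card_image[OF inj_on_subset[OF inj J(1)]] by simp
      thus "Y \<in> {Y. Y \<subseteq> ?X \<and> card Y = k}" using J DN by auto
    qed
  qed
  have "component_counts k t G r ?X $ i = (\<Sum>Y | Y \<subseteq> ?X \<and> card Y = k.
     (if \<forall>y\<in>Y. \<forall>y'\<in>?X - Y. norm (y - y') \<ge> r * t $ i then 1 else 0) *
     cech_iso_indicator (t $ i) (G i) ((\<lambda>y. inverse r *\<^sub>R y) ` Y))"
    by (simp add: component_counts_def)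
  also have "\<dots> = (\<Sum>J\<in>?S. (if \<forall>y\<in>x ` J. \<forall>y'\<in>?X - x ` J. norm (y - y') \<ge> r * t $ i then 1 else 0) *
     cech_iso_indicator (t $ i) (G i) ((\<lambda>y. inverse r *\<^sub>R y) ` (x ` J)))"
    by (rule sum.reindex_bij_betw[OF bij, symmetric])
  also have "\<dots> = (\<Sum>J\<in>?S. of_bool (isolated r i N J x \<and> shape i J (\<lambda>a. inverse r *\<^sub>R x a)))"
  proof (rule sum.cong[OF refl])
    fix J
    have 1: "(\<forall>y\<in>x ` J. \<forall>y'\<in>?X - x ` J. norm (y - y') \<ge> r * t $ i) = isolated r i N J x"
      unfolding isolated_def by (auto simp: dist_norm)
    have 2: "cech_iso_indicator (t $ i) (G i) ((\<lambda>y. inverse r *\<^sub>R y) ` (x ` J)) = of_bool (shape i J (\<lambda>a. inverse r *\<^sub>R x a))"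
      by (simp add: cech_iso_indicator_def shape_def image_image)
    show "(if \<forall>y\<in>x ` J. \<forall>y'\<in>?X - x ` J. norm (y - y') \<ge> r * t $ i then 1 else 0) *
     cech_iso_indicator (t $ i) (G i) ((\<lambda>y. inverse r *\<^sub>R y) ` (x ` J)) = of_bool (isolated r i N J x \<and> shape i J (\<lambda>a. inverse r *\<^sub>R x a))"
      unfolding 1 2 by simp
  qed
  also have "\<dots> = (\<Sum>J\<in>?S. of_bool (J \<subseteq> ?D \<and> isolated r i N J x \<and> shape i J (\<lambda>a. inverse r *\<^sub>R x a)))"
    by (rule sum.cong[OF refl]) simp
  also have "\<dots> = (\<Sum>J | J \<subseteq> {..<N} \<and> card J = k. of_bool (J \<subseteq> ?D \<and> isolated r i N J x \<and> shape i J (\<lambda>a. inverse r *\<^sub>R x a)))"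
  proof (rule sum.mono_neutral_left)
    show "finite {J. J \<subseteq> {..<N} \<and> card J = k}" by simp
    show "?S \<subseteq> {J. J \<subseteq> {..<N} \<and> card J = k}" using DN by auto
    show "\<forall>J\<in>{J. J \<subseteq> {..<N} \<and> card J = k} - ?S. of_bool (J \<subseteq> ?D \<and> isolated r i N J x
        \<and> shape i J (\<lambda>a. inverse r *\<^sub>R x a)) = (0 :: real)"
    proof
      fix J assume "J \<in> {J. J \<subseteq> {..<N} \<and> card J = k} - ?S"
      hence "\<not> J \<subseteq> ?D" by auto
      thus "of_bool (J \<subseteq> ?D \<and> isolated r i N J x \<and> shape i J (\<lambda>a. inverse r *\<^sub>R x a)) = (0 :: real)" by simp
    qed
  qed
  finally show ?thesis .
qed

text \<open>Without repetitions and without distances exactly equal to \<open>t $ i\<close>, first occurrences and the choice between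
  strict and non-strict inequalities become immaterial.\<close>
lemma component_counts_generic:
  assumes r: "r > 0"
    and ne: "\<And>a b. a < N \<Longrightarrow> b < N \<Longrightarrow> a \<noteq> b \<Longrightarrow> y a \<noteq> y b"
    and gen: "\<And>a b. a < N \<Longrightarrow> b < N \<Longrightarrow> a \<noteq> b \<Longrightarrow> dist (y a) (y b) \<noteq> t $ i"
  shows "component_counts k t G r ((\<lambda>a. r *\<^sub>R y a) ` {..<N}) $ i = cnt i {..<N} y"
  unfolding component_counts_tuple cnt_eq_sum[OF finite_lessThan]
proof (rule sum.cong[OF refl])
  fix J assume J: "J \<in> {J. J \<subseteq> {..<N} \<and> card J = k}"
  have JN: "a < N" if "a \<in> J" for a using J that by auto
  have "first_occurrences N (\<lambda>a. r *\<^sub>R y a) = {..<N}"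
  proof (intro equalityI subsetI)
    fix a assume a: "a \<in> {..<N}"
    have "r *\<^sub>R y b \<noteq> r *\<^sub>R y a" if "b < a" for b
      using ne[of b a] that a r by simp
    thus "a \<in> first_occurrences N (\<lambda>a. r *\<^sub>R y a)" using a by (simp add: first_occurrences_def)
  qed (simp add: first_occurrences_def)
  hence 1: "J \<subseteq> first_occurrences N (\<lambda>a. r *\<^sub>R y a)" using J by auto
  have sc: "dist (r *\<^sub>R y a) (r *\<^sub>R y b) = r * dist (y a) (y b)" for a b
    using r by (simp add: dist_norm scaleR_diff_right[symmetric])
  have 2: "isolated r i N J (\<lambda>a. r *\<^sub>R y a) \<longleftrightarrow> (\<forall>a\<in>J. \<forall>b\<in>{..<N} - J. t $ i < dist (y a) (y b))"
  proof
    assume H: "isolated r i N J (\<lambda>a. r *\<^sub>R y a)"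
    show "\<forall>a\<in>J. \<forall>b\<in>{..<N} - J. t $ i < dist (y a) (y b)"
    proof (intro ballI)
      fix a b assume a: "a \<in> J" and b: "b \<in> {..<N} - J"
      have "\<not> (\<exists>c\<in>J. r *\<^sub>R y b = r *\<^sub>R y c)" using ne[of b] JN b r by auto
      hence "r * t $ i \<le> r * dist (y a) (y b)" using H a b unfolding isolated_def sc by auto
      hence "t $ i \<le> dist (y a) (y b)" using r by simp
      thus "t $ i < dist (y a) (y b)" using gen[of a b] JN[OF a] a b by fastforce
    qed
  next
    assume H: "\<forall>a\<in>J. \<forall>b\<in>{..<N} - J. t $ i < dist (y a) (y b)"
    have "(\<exists>c\<in>J. y b = y c) \<or> t $ i \<le> dist (y a) (y b)" if "a \<in> J" "b < N" for a b
    proof (cases "b \<in> J")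
      case False
      hence "t $ i < dist (y a) (y b)" using H that by auto
      thus ?thesis by simp
    qed auto
    thus "isolated r i N J (\<lambda>a. r *\<^sub>R y a)" unfolding isolated_def sc using r by auto
  qed
  have 3: "shape i J (\<lambda>a. inverse r *\<^sub>R (r *\<^sub>R y a)) = shape i J y" using r by simp
  show "of_bool (J \<subseteq> first_occurrences N (\<lambda>a. r *\<^sub>R y a) \<and> isolated r i N J (\<lambda>a. r *\<^sub>R y a) \<and> shape i J (\<lambda>a. inverse r *\<^sub>R (r *\<^sub>R y a))) =
    (of_bool (shape i J y \<and> (\<forall>a\<in>J. \<forall>b\<in>{..<N} - J. t $ i < dist (y a) (y b))) :: real)"
    using 1 by (simp only: 2 3 HOL.simp_thms conj_commute)
qed

lemma component_counts_measurable:
  fixes N :: nat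
  assumes x: "\<And>a. a < N \<Longrightarrow> (\<lambda>\<omega>. x \<omega> a) \<in> borel_measurable M"
  shows "(\<lambda>\<omega>. component_counts k t G r (x \<omega> ` {..<N}) $ i) \<in> borel_measurable M"
  unfolding component_counts_tuple
proof (rule borel_measurable_sum)
  fix J assume J: "J \<in> {J. J \<subseteq> {..<N} \<and> card J = k}"
  hence JN: "a < N" if "a \<in> J" for a using that by auto
  have fin: "finite J" using J card_k_finite by auto
  have pd: "Measurable.pred M (\<lambda>\<omega>. dist (x \<omega> a) (x \<omega> b) \<le> 0)" "Measurable.pred M (\<lambda>\<omega>. c \<le> dist (x \<omega> a) (x \<omega> b))" if "a < N" "b < N" for a b c
    using x[OF that(1)] x[OF that(2)] by measurable
  have p1: "Measurable.pred M (\<lambda>\<omega>. J \<subseteq> first_occurrences N (x \<omega>))"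
  proof -
    have "J \<subseteq> first_occurrences N (x \<omega>) \<longleftrightarrow> (\<forall>a\<in>J. \<forall>b\<in>{..<a}. \<not> dist (x \<omega> b) (x \<omega> a) \<le> 0)" for \<omega>
      using J by (auto simp: first_occurrences_def)
    moreover have "Measurable.pred M (\<lambda>\<omega>. \<forall>a\<in>J. \<forall>b\<in>{..<a}. \<not> dist (x \<omega> b) (x \<omega> a) \<le> 0)"
      using fin JN by (intro pred_intros_finite(3) pred_intros_logic pd finite_lessThan) (auto intro: less_trans)
    ultimately show ?thesis by (simp only:)
  qed
  have p2: "Measurable.pred M (\<lambda>\<omega>. isolated r i N J (x \<omega>))"
  proof -
    have "isolated r i N J (x \<omega>) \<longleftrightarrow> (\<forall>a\<in>J. \<forall>b\<in>{..<N}. (\<exists>c\<in>J. dist (x \<omega> b) (x \<omega> c) \<le> 0) \<or> r * t $ i \<le> dist (x \<omega> a) (x \<omega> b))" for \<omega>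
      by (auto simp: isolated_def)
    moreover have "Measurable.pred M (\<lambda>\<omega>. \<forall>a\<in>J. \<forall>b\<in>{..<N}. (\<exists>c\<in>J. dist (x \<omega> b) (x \<omega> c) \<le> 0) \<or> r * t $ i \<le> dist (x \<omega> a) (x \<omega> b))"
      using fin JN by (intro pred_intros_finite(3,4) pred_intros_logic pd finite_lessThan) auto
    ultimately show ?thesis by (simp only:)
  qed
  have p3: "Measurable.pred M (\<lambda>\<omega>. shape i J (\<lambda>a. inverse r *\<^sub>R x \<omega> a))"
  proof (rule measurable_shape[OF cech_shapes_axioms])
    show "card J = k" using J by simp
    show "(\<lambda>\<omega>. inverse r *\<^sub>R x \<omega> a) \<in> borel_measurable M" if "a \<in> J" for a
      using x[OF JN[OF that]] by measurable
  qed
  have "Measurable.pred M (\<lambda>\<omega>. J \<subseteq> first_occurrences N (x \<omega>) \<and> isolated r i N J (x \<omega>) \<and> shape i J (\<lambda>a. inverse r *\<^sub>R x \<omega> a))"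
    by (intro pred_intros_logic p1 p2 p3)
  thus "(\<lambda>\<omega>. of_bool (J \<subseteq> first_occurrences N (x \<omega>) \<and> isolated r i N J (x \<omega>) \<and> shape i J (\<lambda>a. inverse r *\<^sub>R x \<omega> a)) :: real) \<in> borel_measurable M"
    by measurable
qed

end

lemma AE_dist_neq:
  fixes Q :: "(real^'d) measure"
  assumes iid: "iid_sequence Q" and null: "\<And>v. measure Q {u. dist u v = c} = 0" and ab: "a \<noteq> b"
  shows "AE x in iid_sequence.P Q. dist (x a) (x b) \<noteq> c"
proof -
  interpret iid_sequence Q by fact
  have Rm: "Measurable.pred (borel \<Otimes>\<^sub>M borel) (\<lambda>(u :: real^'d, v). dist u v = c)"
    unfolding case_prod_unfold by measurable
  have pred: "Measurable.pred P (\<lambda>x. dist (x a) (x b) = c)"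
  proof -
    have "(\<lambda>x. (x a, x b)) \<in> P \<rightarrow>\<^sub>M borel \<Otimes>\<^sub>M borel" by measurable
    from measurable_compose[OF this Rm] show ?thesis by simp
  qed
  have b: "bm (\<lambda>x. of_bool (dist (x a) (x b) = c))" by (rule bm_of_bool[OF pred])
  have "(\<integral>x. of_bool (\<forall>b'\<in>{a}. dist (x b') (x b) = c) * (1::real) \<partial>P) \<le> 1 * 0 ^ card {a} * (\<integral>x. 1 \<partial>P)"
    by (rule near_event_bound[of "{a}" b "\<lambda>_. 1" 1 "\<lambda>u v. dist u v = c" 0]) (use ab null Rm in auto)
  hence "(\<integral>x. (of_bool (dist (x a) (x b) = c) :: real) \<partial>P) \<le> 0" by simp
  moreover have "(\<integral>x. (of_bool (dist (x a) (x b) = c) :: real) \<partial>P) = measure P {x. dist (x a) (x b) = c}"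
  proof -
    have "(\<integral>x. (of_bool (dist (x a) (x b) = c) :: real) \<partial>P) = (\<integral>x. indicat_real {x. dist (x a) (x b) = c} x \<partial>P)"
      by (intro Bochner_Integration.integral_cong) (auto simp: indicator_def)
    thus ?thesis using pred by (simp add: pred_def)
  qed
  ultimately have "measure P {x. dist (x a) (x b) = c} = 0" using measure_nonneg[of P "{x. dist (x a) (x b) = c}"] by linarith
  hence "emeasure P {x. dist (x a) (x b) = c} = 0" by (simp add: PP.emeasure_eq_measure)
  thus ?thesis using pred by (intro AE_I[of _ _ "{x. dist (x a) (x b) = c}"]) (auto simp: pred_def)
qed

section \<open>Averages over a Poisson variable\<close>

definition poisson_weight :: "real \<Rightarrow> nat \<Rightarrow> real" where "poisson_weight a j = exp (- a) * a ^ j / fact j"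

lemma poisson_weight_nonneg: "0 \<le> a \<Longrightarrow> 0 \<le> poisson_weight a j" by (simp add: poisson_weight_def)

lemma poisson_mgf: "(\<lambda>j. poisson_weight a j * exp (s * real j)) sums exp (a * (exp s - 1))"
proof -
  have "(\<lambda>j. exp (- a) * ((a * exp s) ^ j / fact j)) sums (exp (- a) * exp (a * exp s))"
    using exp_converges[of "a * exp s"] by (intro sums_mult) (simp add: scaleR_conv_of_real divide_inverse mult.commute)
  moreover have "exp (- a) * ((a * exp s) ^ j / fact j) = poisson_weight a j * exp (s * real j)" for j
    by (simp add: poisson_weight_def power_mult_distrib exp_of_nat2_mult)
  moreover have "exp (- a) * exp (a * exp s) = exp (a * (exp s - 1))" by (simp add: exp_add[symmetric] algebra_simps)
  ultimately show ?thesis by simp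
qed

lemma poisson_weight_sums: "poisson_weight a sums 1"
  using poisson_mgf[of a 0] by simp

lemma exp_quad_bound: fixes u :: real assumes "\<bar>u\<bar> \<le> 1" shows "exp u - 1 - u \<le> u\<^sup>2"
  using abs_exp_minus_one_minus_le[OF assms] by linarith

lemma exp_06_le_2: "u \<le> 6/10 \<Longrightarrow> exp u \<le> (2::real)"
proof -
  assume "u \<le> 6/10"
  hence "u \<le> ln 2" using ln2_ge_two_thirds by linarith
  thus ?thesis by (metis exp_le_cancel_iff exp_ln zero_less_numeral)
qed

context
  fixes n :: nat assumes n: "1 \<le> n"
begin

abbreviation "w \<equiv> poisson_weight (real n)"

lemma w0: "0 \<le> w j" by (simp add: poisson_weight_nonneg)

text \<open>Poisson variables have sub-Gaussian exponential moments near \<open>0\<close>, with variance proxy \<open>2 * n\<close>.\<close>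
lemma centred_mgf: 
  assumes "\<bar>s\<bar> \<le> 1"
  obtains z where "(\<lambda>j. w j * exp (s * (real j - real n))) sums z" "z \<le> exp (real n * s\<^sup>2)"
proof -
  have "(\<lambda>j. exp (- (s * n)) * (w j * exp (s * real j))) sums (exp (- (s * n)) * exp (real n * (exp s - 1)))"
    by (intro sums_mult poisson_mgf)
  moreover have "exp (- (s * n)) * (w j * exp (s * real j)) = w j * exp (s * (real j - real n))" for j
    by (simp add: exp_add[symmetric] algebra_simps)
  moreover have "exp (- (s * n)) * exp (real n * (exp s - 1)) = exp (real n * (exp s - 1 - s))"
    by (simp add: exp_add[symmetric] algebra_simps)
  moreover have "exp (real n * (exp s - 1 - s)) \<le> exp (real n * s\<^sup>2)"
    using exp_quad_bound[OF assms] by (simp add: mult_left_mono)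
  ultimately show thesis using that by simp
qed

text \<open>The factor \<open>exp ((j - 2 * n) / 2)\<close> dominates the indicator of \<open>j > 2 * n\<close>. The threshold \<open>1/10\<close>
  guarantees \<open>exp (c + 1/2) \<le> 2\<close>.\<close>
lemma tail_mgf:
  assumes "c \<le> 1/10"
  obtains z where "(\<lambda>j. w j * exp (c * real j + (real j - 2 * real n) / 2)) sums z" "z \<le> 1"
proof -
  have "(\<lambda>j. exp (- real n) * (w j * exp ((c + 1/2) * real j))) sums (exp (- real n) * exp (real n * (exp (c + 1/2) - 1)))"
    by (intro sums_mult poisson_mgf)
  moreover have "exp (- real n) * (w j * exp ((c + 1/2) * real j)) = w j * exp (c * real j + (real j - 2 * real n) / 2)" for j
    by (simp add: exp_add[symmetric] field_simps)
  moreover have "exp (- real n) * exp (real n * (exp (c + 1/2) - 1)) = exp (real n * (exp (c + 1/2) - 2))"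
    by (simp add: exp_add[symmetric] algebra_simps)
  moreover have "exp (real n * (exp (c + 1/2) - 2)) \<le> 1"
    using exp_06_le_2[of "c + 1/2"] assms by (simp add: mult_nonneg_nonpos)
  ultimately show thesis using that by simp
qed

lemma abs_deviation:
  obtains z where "(\<lambda>j. w j * \<bar>real j - real n\<bar>) sums z" "z \<le> 6 * sqrt n"
proof -
  \<comment> \<open>The scale of the fluctuations, for which the exponential moments are of order \<open>1\<close>.\<close>
  define s where "s = 1 / sqrt n"
  have s: "0 < s" "s \<le> 1" "real n * s\<^sup>2 = 1" using n by (auto simp: s_def power_divide)
  obtain z1 where z1: "(\<lambda>j. w j * exp (s * (real j - real n))) sums z1" "z1 \<le> exp (real n * s\<^sup>2)"
    by (rule centred_mgf[of s]) (use s in auto)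
  obtain z2 where z2: "(\<lambda>j. w j * exp (- s * (real j - real n))) sums z2" "z2 \<le> exp (real n * (- s)\<^sup>2)"
    by (rule centred_mgf[of "- s"]) (use s in auto)
  have sum: "(\<lambda>j. (w j * exp (s * (real j - real n)) + w j * exp (- s * (real j - real n))) / s) sums ((z1 + z2) / s)"
    by (intro sums_divide sums_add z1 z2)
  have le: "w j * \<bar>real j - real n\<bar> \<le> (w j * exp (s * (real j - real n)) + w j * exp (- s * (real j - real n))) / s" for j
  proof -
    define u where "u = real j - real n"
    have "s * \<bar>u\<bar> = s * u \<or> s * \<bar>u\<bar> = - s * u" by (simp add: abs_if)
    hence "s * \<bar>u\<bar> \<le> exp (s * u) + exp (- s * u)"
      using exp_ge_add_one_self[of "s * u"] exp_ge_add_one_self[of "- s * u"] exp_gt_zero[of "s * u"] exp_gt_zero[of "- s * u"]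
      by linarith
    hence "\<bar>u\<bar> \<le> (exp (s * u) + exp (- s * u)) / s" using s by (simp add: field_simps)
    from mult_left_mono[OF this w0[of j]] show ?thesis by (simp add: u_def distrib_left)
  qed
  have sm: "summable (\<lambda>j. w j * \<bar>real j - real n\<bar>)"
    by (rule summable_comparison_test'[OF sums_summable[OF sum], of 0]) (use le w0 in \<open>auto simp: abs_mult\<close>)
  have "(\<Sum>j. w j * \<bar>real j - real n\<bar>) \<le> (z1 + z2) / s"
    using suminf_le[OF le sm sums_summable[OF sum]] sums_unique[OF sum] by simp
  also have "\<dots> \<le> (3 + 3) / s"
  proof (rule divide_right_mono)
    have "exp 1 \<le> (3::real)" using exp_le by simp
    thus "z1 + z2 \<le> 3 + 3" using z1(2) z2(2) s by simp
  qed (use s in simp)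
  also have "\<dots> = 6 * sqrt n" by (simp add: s_def)
  finally show thesis using that summable_sums[OF sm] by blast
qed

text \<open>Beyond \<open>2 * n\<close> the deviation is exponentially unlikely, and the crude bound on the increments suffices
  there.\<close>
lemma tail_deviation:
  obtains z where "(\<lambda>j. w j * (of_bool (2 * n < j) * \<bar>real j - real n\<bar>)) sums z" "z \<le> 10"
proof -
  obtain y where y: "(\<lambda>j. w j * exp (1/10 * real j + (real j - 2 * real n) / 2)) sums y" "y \<le> 1"
    by (rule tail_mgf[of "1/10"]) auto
  have sum: "(\<lambda>j. 10 * (w j * exp (1/10 * real j + (real j - 2 * real n) / 2))) sums (10 * y)"
    by (intro sums_mult y)
  have le: "w j * (of_bool (2 * n < j) * \<bar>real j - real n\<bar>) \<le> 10 * (w j * exp (1/10 * real j + (real j - 2 * real n) / 2))" for j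
  proof (cases "2 * n < j")
    case True
    hence "1 \<le> exp ((real j - 2 * real n) / 2)" by simp
    moreover have "real j \<le> 10 * exp (1/10 * real j)" using exp_ge_add_one_self[of "1/10 * real j"] by linarith
    ultimately have "real j * 1 \<le> 10 * exp (1/10 * real j) * exp ((real j - 2 * real n) / 2)" by (intro mult_mono) auto
    hence "\<bar>real j - real n\<bar> \<le> 10 * exp (1/10 * real j + (real j - 2 * real n) / 2)" using True by (simp add: exp_add)
    from mult_left_mono[OF this w0[of j]] show ?thesis using True by simp
  qed (simp add: w0)
  have sm: "summable (\<lambda>j. w j * (of_bool (2 * n < j) * \<bar>real j - real n\<bar>))"
    by (rule summable_comparison_test'[OF sums_summable[OF sum], of 0]) (use le w0 in \<open>auto simp: abs_mult\<close>)
  have "(\<Sum>j. w j * (of_bool (2 * n < j) * \<bar>real j - real n\<bar>)) \<le> 10 * y"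
    using suminf_le[OF le sm sums_summable[OF sum]] sums_unique[OF sum] by simp
  thus thesis using that summable_sums[OF sm] y by force
qed

lemma increments_bound:
  fixes g :: "nat \<Rightarrow> real"
  assumes K: "\<And>j. \<bar>g (Suc j) - g j\<bar> \<le> K" and D: "\<And>j. j < 2 * n \<Longrightarrow> \<bar>g (Suc j) - g j\<bar> \<le> D"
  shows "\<bar>g j - g n\<bar> \<le> K * \<bar>real j - real n\<bar>" "j \<le> 2 * n \<Longrightarrow> \<bar>g j - g n\<bar> \<le> D * \<bar>real j - real n\<bar>"
proof -
  have up: "\<bar>g (i + m) - g i\<bar> \<le> B * real m" if "\<And>j. i \<le> j \<Longrightarrow> j < i + m \<Longrightarrow> \<bar>g (Suc j) - g j\<bar> \<le> B" for i m B
    using that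
  proof (induction m)
    case (Suc m)
    have "\<bar>g (i + m) - g i\<bar> \<le> B * real m" using Suc by simp
    moreover have "\<bar>g (Suc (i + m)) - g (i + m)\<bar> \<le> B" using Suc.prems by simp
    ultimately show ?case by (simp add: algebra_simps)
  qed simp
  have both: "\<bar>g j - g n\<bar> \<le> B * \<bar>real j - real n\<bar>" if B: "\<And>l. l < max j n \<Longrightarrow> \<bar>g (Suc l) - g l\<bar> \<le> B" for B j
  proof (cases "n \<le> j")
    case True
    have "\<bar>g (n + (j - n)) - g n\<bar> \<le> B * real (j - n)" using B True by (intro up) auto
    thus ?thesis using True by (simp add: of_nat_diff)
  next
    case False
    have "\<bar>g (j + (n - j)) - g j\<bar> \<le> B * real (n - j)" using B False by (intro up) auto
    thus ?thesis using False by (simp add: of_nat_diff abs_minus_commute)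
  qed
  show "\<bar>g j - g n\<bar> \<le> K * \<bar>real j - real n\<bar>" by (rule both) (rule K)
  show "\<bar>g j - g n\<bar> \<le> D * \<bar>real j - real n\<bar>" if "j \<le> 2 * n" using that n by (intro both D) auto
qed

lemma mean_deviation:
  fixes g :: "nat \<Rightarrow> real"
  assumes K: "\<And>j. \<bar>g (Suc j) - g j\<bar> \<le> K" and D: "\<And>j. j < 2 * n \<Longrightarrow> \<bar>g (Suc j) - g j\<bar> \<le> D"
  obtains z where "(\<lambda>j. w j * \<bar>g j - g n\<bar>) sums z" "z \<le> D * (6 * sqrt n) + K * 10"
proof -
  have K0: "0 \<le> K" using K[of 0] by linarith
  have D0: "0 \<le> D" using D[of 0] n by (auto intro: order_trans[OF abs_ge_zero])
  obtain z1 where z1: "(\<lambda>j. w j * \<bar>real j - real n\<bar>) sums z1" "z1 \<le> 6 * sqrt n" by (rule abs_deviation)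
  obtain z2 where z2: "(\<lambda>j. w j * (of_bool (2 * n < j) * \<bar>real j - real n\<bar>)) sums z2" "z2 \<le> 10" by (rule tail_deviation)
  have sum: "(\<lambda>j. D * (w j * \<bar>real j - real n\<bar>) + K * (w j * (of_bool (2 * n < j) * \<bar>real j - real n\<bar>))) sums (D * z1 + K * z2)"
    by (intro sums_add sums_mult z1 z2)
  have le: "w j * \<bar>g j - g n\<bar> \<le> D * (w j * \<bar>real j - real n\<bar>) + K * (w j * (of_bool (2 * n < j) * \<bar>real j - real n\<bar>))" for j
  proof -
    have "\<bar>g j - g n\<bar> \<le> D * \<bar>real j - real n\<bar> + K * (of_bool (2 * n < j) * \<bar>real j - real n\<bar>)"
      using increments_bound[of g K D j, OF K D] K0 D0 by (cases "2 * n < j") (auto simp: add_increasing)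
    from mult_left_mono[OF this w0[of j]] show ?thesis by (simp add: algebra_simps)
  qed
  have sm: "summable (\<lambda>j. w j * \<bar>g j - g n\<bar>)"
    by (rule summable_comparison_test'[OF sums_summable[OF sum], of 0]) (use le w0 in \<open>auto simp: abs_mult\<close>)
  have "(\<Sum>j. w j * \<bar>g j - g n\<bar>) \<le> D * z1 + K * z2"
    using suminf_le[OF le sm sums_summable[OF sum]] sums_unique[OF sum] by simp
  also have "\<dots> \<le> D * (6 * sqrt n) + K * 10" using z1 z2 K0 D0 by (intro add_mono mult_left_mono)
  finally show thesis using that summable_sums[OF sm] by blast
qed

text \<open>The increments of \<open>\<mu>\<close> are bounded by \<open>D\<close> in the bulk \<open>j < 2 * n\<close>, where typical deviations are of order \<open>\<surd>n\<close>.
  In the tail only the larger bound \<open>K\<close> is known.\<close>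
lemma poisson_mean_compare:
  fixes \<mu> :: "nat \<Rightarrow> real"
  assumes K: "\<And>j. \<bar>\<mu> (Suc j) - \<mu> j\<bar> \<le> K" and D: "\<And>j. j < 2 * n \<Longrightarrow> \<bar>\<mu> (Suc j) - \<mu> j\<bar> \<le> D"
  shows "summable (\<lambda>j. w j * \<mu> j)" "\<bar>(\<Sum>j. w j * \<mu> j) - \<mu> n\<bar> \<le> D * (6 * sqrt n) + K * 10"
proof -
  obtain z where z: "(\<lambda>j. w j * \<bar>\<mu> j - \<mu> n\<bar>) sums z" "z \<le> D * (6 * sqrt n) + K * 10"
    by (rule mean_deviation[of \<mu> K D, OF K D])
  have sa: "summable (\<lambda>j. \<bar>w j * (\<mu> j - \<mu> n)\<bar>)" using sums_summable[OF z(1)] by (simp add: abs_mult w0)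
  have s: "summable (\<lambda>j. w j * (\<mu> j - \<mu> n))" by (rule summable_rabs_cancel[OF sa])
  have sw: "(\<lambda>j. w j * \<mu> n) sums (1 * \<mu> n)" by (intro sums_mult2 poisson_weight_sums)
  have "(\<lambda>j. w j * (\<mu> j - \<mu> n) + w j * \<mu> n) sums ((\<Sum>j. w j * (\<mu> j - \<mu> n)) + 1 * \<mu> n)"
    by (intro sums_add summable_sums s sw)
  hence S: "(\<lambda>j. w j * \<mu> j) sums ((\<Sum>j. w j * (\<mu> j - \<mu> n)) + \<mu> n)" by (simp add: algebra_simps)
  show "summable (\<lambda>j. w j * \<mu> j)" using sums_summable[OF S] .
  have "\<bar>\<Sum>j. w j * (\<mu> j - \<mu> n)\<bar> \<le> (\<Sum>j. \<bar>w j * (\<mu> j - \<mu> n)\<bar>)" by (rule summable_rabs[OF sa])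
  also have "\<dots> = z" using sums_unique[OF z(1)] by (simp add: abs_mult w0)
  finally show "\<bar>(\<Sum>j. w j * \<mu> j) - \<mu> n\<bar> \<le> D * (6 * sqrt n) + K * 10"
    using sums_unique[OF S] z(2) by simp
qed

lemma abs_ln_ratio:
  fixes x y :: real assumes "0 < x" "0 < y" "\<bar>y - x\<bar> \<le> d * x" "d \<le> 1/2"
  shows "\<bar>ln y - ln x\<bar> \<le> 2 * d"
proof -
  define v where "v = (y - x) / x"
  have v: "\<bar>v\<bar> \<le> d" using assms by (simp add: v_def field_simps)
  have "y / x = 1 + v" using assms by (simp add: v_def field_simps)
  moreover have "ln (y / x) = ln y - ln x" using assms by (simp add: ln_div)
  ultimately have "ln y - ln x = ln (1 + v)" by simp
  moreover have "\<bar>ln (1 + v) - v\<bar> \<le> 2 * v\<^sup>2" using v assms by (intro abs_ln_one_plus_x_minus_x_bound) auto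
  moreover have "2 * v\<^sup>2 \<le> \<bar>v\<bar>"
  proof -
    have "2 * \<bar>v\<bar> * \<bar>v\<bar> \<le> 1 * \<bar>v\<bar>" using v assms by (intro mult_right_mono) auto
    thus ?thesis by (simp add: power2_eq_square)
  qed
  ultimately show ?thesis using v by linarith
qed

text \<open>Apply exponential moments with the increments of \<open>ln \<psi>\<close> for the upper bound. For the lower bound use the
  linear minorant of the exponential function at the mean deviation of \<open>ln \<psi>\<close>, as in Jensen's inequality.\<close>
lemma poisson_log_compare:
  fixes \<psi> :: "nat \<Rightarrow> real" and K D :: real
  assumes pos: "\<And>j. 0 < \<psi> j" and K: "\<And>j. \<psi> (Suc j) \<le> exp K * \<psi> j" "\<And>j. \<psi> j \<le> exp K * \<psi> (Suc j)"
    and D: "\<And>j. j < 2 * n \<Longrightarrow> \<bar>\<psi> (Suc j) - \<psi> j\<bar> \<le> D * \<psi> j" and KD: "K \<le> 1/10" "D \<le> 1/2"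
  shows "summable (\<lambda>j. w j * \<psi> j)" "0 < (\<Sum>j. w j * \<psi> j)"
    "\<bar>ln (\<Sum>j. w j * \<psi> j) - ln (\<psi> n)\<bar> \<le> 2 + 4 * n * D\<^sup>2 + 12 * D * sqrt n + 10 * K"
proof -
  define g where "g j = ln (\<psi> j)" for j
  have \<psi>: "\<psi> j = exp (g j)" for j using pos by (simp add: g_def)
  have gK: "\<bar>g (Suc j) - g j\<bar> \<le> K" for j
    using K(1)[of j] K(2)[of j] unfolding \<psi> exp_add[symmetric] by (simp add: abs_le_iff)
  have gD: "\<bar>g (Suc j) - g j\<bar> \<le> 2 * D" if "j < 2 * n" for j
    unfolding g_def using D[OF that] pos KD by (intro abs_ln_ratio) auto
  have K0: "0 \<le> K" using gK[of 0] by linarith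
  have D0: "0 \<le> D" using gD[of 0] n by force
  define L where "L = 2 * D"
  have L: "0 \<le> L" "L \<le> 1" using D0 KD by (auto simp: L_def)
  note dev = increments_bound[of g K L, OF gK gD[folded L_def]]
  obtain z where z: "(\<lambda>j. w j * \<bar>g j - g n\<bar>) sums z" "z \<le> L * (6 * sqrt n) + K * 10"
    by (rule mean_deviation[of g K L, OF gK gD[folded L_def]])
  obtain a1 where a1: "(\<lambda>j. w j * exp (L * (real j - real n))) sums a1" "a1 \<le> exp (real n * L\<^sup>2)"
    by (rule centred_mgf[of L]) (use L in auto)
  obtain a2 where a2: "(\<lambda>j. w j * exp (- L * (real j - real n))) sums a2" "a2 \<le> exp (real n * (- L)\<^sup>2)"
    by (rule centred_mgf[of "- L"]) (use L in auto)
  obtain a3 where a3: "(\<lambda>j. w j * exp (K * real j + (real j - 2 * real n) / 2)) sums a3" "a3 \<le> 1"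
    by (rule tail_mgf[OF KD(1)])
  have sum: "(\<lambda>j. w j * exp (L * (real j - real n)) + w j * exp (- L * (real j - real n)) + w j * exp (K * real j + (real j - 2 * real n) / 2)) sums (a1 + a2 + a3)"
    by (intro sums_add a1 a2 a3)
  have le: "w j * exp (g j - g n) \<le> w j * exp (L * (real j - real n)) + w j * exp (- L * (real j - real n)) + w j * exp (K * real j + (real j - 2 * real n) / 2)" for j
  proof -
    let ?e1 = "exp (L * (real j - real n))" and ?e2 = "exp (- L * (real j - real n))" and ?e3 = "exp (K * real j + (real j - 2 * real n) / 2)"
    have p: "0 < ?e1" "0 < ?e2" "0 < ?e3" by simp_all
    have "exp (g j - g n) \<le> ?e1 + ?e2 + ?e3"
    proof (cases "2 * n < j")
      case True
      have "g j - g n \<le> K * \<bar>real j - real n\<bar>" using dev(1)[of j] by linarith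
      also have "\<dots> \<le> K * real j" using True K0 by (intro mult_left_mono) auto
      also have "\<dots> \<le> K * real j + (real j - 2 * real n) / 2" using True by simp
      finally have "exp (g j - g n) \<le> ?e3" by simp
      thus ?thesis using p by linarith
    next
      case False
      hence d: "g j - g n \<le> L * \<bar>real j - real n\<bar>" using dev(2)[of j] by linarith
      show ?thesis
      proof (cases "n \<le> j")
        case True
        hence "exp (g j - g n) \<le> ?e1" using d by simp
        thus ?thesis using p by linarith
      next
        case False
        hence "exp (g j - g n) \<le> ?e2" using d by (simp add: abs_if algebra_simps)
        thus ?thesis using p by linarith
      qed
    qed
    from mult_left_mono[OF this w0[of j]] show ?thesis by (simp add: distrib_left)
  qed
  have sm: "summable (\<lambda>j. w j * exp (g j - g n))"
    by (rule summable_comparison_test'[OF sums_summable[OF sum], of 0]) (use le w0 in \<open>auto simp: abs_mult\<close>)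
  define T where "T = (\<Sum>j. w j * exp (g j - g n))"
  have eq: "w j * \<psi> j = w j * exp (g j - g n) * \<psi> n" for j using pos[of n] by (simp add: \<psi> exp_diff)
  have S: "(\<lambda>j. w j * \<psi> j) sums (T * \<psi> n)" unfolding eq T_def by (intro sums_mult2 summable_sums sm)
  show "summable (\<lambda>j. w j * \<psi> j)" using sums_summable[OF S] .
  have "T \<le> a1 + a2 + a3" unfolding T_def
    using suminf_le[OF le sm sums_summable[OF sum]] sums_unique[OF sum] by simp
  also have "\<dots> \<le> exp (real n * L\<^sup>2) + exp (real n * L\<^sup>2) + exp (real n * L\<^sup>2)"
    using a1(2) a2(2) a3(2) one_le_exp_iff[of "real n * L\<^sup>2"] by (intro add_mono) (auto intro: order_trans)
  also have "\<dots> \<le> exp 2 * exp (real n * L\<^sup>2)"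
  proof -
    have "(3::real) \<le> exp 2" using exp_ge_add_one_self[of 2] by simp
    from mult_right_mono[OF this, of "exp (real n * L\<^sup>2)"] show ?thesis by simp
  qed
  finally have Tup: "T \<le> exp (2 + real n * L\<^sup>2)" by (simp add: exp_add)
  \<comment> \<open>Here \<open>exp v \<ge> exp (- z) * (1 + z + v)\<close> is averaged with \<open>v = g j - g n\<close>, whose mean is at least \<open>- z\<close>.\<close>
  have Tlo: "exp (- z) \<le> T"
  proof -
    have "(\<lambda>j. exp (- z) * (w j * (1 + z) - w j * \<bar>g j - g n\<bar>)) sums (exp (- z) * (1 * (1 + z) - z))"
      by (intro sums_mult sums_diff sums_mult2 poisson_weight_sums z)
    hence s1: "(\<lambda>j. exp (- z) * (w j * (1 + z) - w j * \<bar>g j - g n\<bar>)) sums exp (- z)" by simp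
    have le1: "exp (- z) * (w j * (1 + z) - w j * \<bar>g j - g n\<bar>) \<le> w j * exp (g j - g n)" for j
    proof -
      have "1 + z - \<bar>g j - g n\<bar> \<le> exp (z + (g j - g n))"
        using exp_ge_add_one_self[of "z + (g j - g n)"] by linarith
      hence "exp (- z) * (1 + z - \<bar>g j - g n\<bar>) \<le> exp (- z) * exp (z + (g j - g n))" by (intro mult_left_mono) auto
      also have "\<dots> = exp (g j - g n)" by (simp add: exp_add[symmetric])
      finally have "exp (- z) * (1 + z - \<bar>g j - g n\<bar>) \<le> exp (g j - g n)" .
      from mult_left_mono[OF this w0[of j]] show ?thesis by (simp add: algebra_simps)
    qed
    show ?thesis unfolding T_def
      using suminf_le[OF le1 sums_summable[OF s1] sm] sums_unique[OF s1] by simp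
  qed
  hence Tpos: "0 < T" by (rule less_le_trans[OF exp_gt_zero])
  have Sum: "(\<Sum>j. w j * \<psi> j) = T * \<psi> n" using sums_unique[OF S] by simp
  show "0 < (\<Sum>j. w j * \<psi> j)" unfolding Sum using Tpos pos by simp
  have "ln (\<Sum>j. w j * \<psi> j) - ln (\<psi> n) = ln T" unfolding Sum using Tpos pos[of n] by (simp add: ln_mult)
  moreover have "ln T \<le> 2 + real n * L\<^sup>2" using Tup Tpos by (metis exp_gt_zero ln_exp ln_le_cancel_iff)
  moreover have "- z \<le> ln T" using Tlo Tpos by (metis exp_gt_zero ln_exp ln_le_cancel_iff)
  moreover have "0 \<le> real n * L\<^sup>2" "0 \<le> L * (6 * sqrt n)" using L by auto
  ultimately have "\<bar>ln (\<Sum>j. w j * \<psi> j) - ln (\<psi> n)\<bar> \<le> 2 + real n * L\<^sup>2 + L * (6 * sqrt n) + K * 10"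
    using z(2) K0 by linarith
  thus "\<bar>ln (\<Sum>j. w j * \<psi> j) - ln (\<psi> n)\<bar> \<le> 2 + 4 * n * D\<^sup>2 + 12 * D * sqrt n + 10 * K"
    by (simp add: L_def power_mult_distrib mult_ac)
qed

end

section \<open>Estimates for the dilated cube\<close>

lemma iid_scaledQ: "iid_sequence (scaledQ r :: (real^'d) measure)"
proof -
  interpret prob_space "scaledQ r :: (real^'d) measure" by (rule prob_space_scaledQ)
  show ?thesis by unfold_locales simp
qed

lemma emeasure_scaledQ_le:
  assumes r: "r > 0" and A: "A \<in> sets borel"
  shows "emeasure (scaledQ r) A \<le> ennreal (r ^ CARD('d)) * emeasure lborel (A :: (real^'d) set)"
proof -
  have "emeasure (scaledQ r) A = (\<integral>\<^sup>+x. indicator A x \<partial>scaledQ r)" using A by simp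
  also have "\<dots> = ennreal (r ^ CARD('d)) * (\<integral>\<^sup>+y. indicator A (0 + y) * indicator (cbox 0 1) (r *\<^sub>R (0 + y)) \<partial>lborel)"
    using A by (intro nn_integral_scaledQ r) auto
  also have "\<dots> \<le> ennreal (r ^ CARD('d)) * (\<integral>\<^sup>+y. indicator A y \<partial>lborel)"
    by (intro mult_left_mono nn_integral_mono) (auto simp: indicator_def)
  also have "\<dots> = ennreal (r ^ CARD('d)) * emeasure lborel A" using A by simp
  finally show ?thesis .
qed

lemma measure_scaledQ_cball:
  assumes r: "r > 0" and l: "0 \<le> l"
  shows "measure (scaledQ r) (cball (y :: real^'d) l) \<le> unit_ball_vol (real CARD('d)) * l ^ CARD('d) * r ^ CARD('d)"
proof -
  interpret prob_space "scaledQ r :: (real^'d) measure" by (rule prob_space_scaledQ)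
  have "ennreal (measure (scaledQ r) (cball y l)) \<le> ennreal (r ^ CARD('d)) * ennreal (unit_ball_vol (real CARD('d)) * l ^ CARD('d))"
    using emeasure_scaledQ_le[OF r, of "cball y l"] l by (simp add: emeasure_eq_measure emeasure_cball)
  also have "\<dots> = ennreal (unit_ball_vol (real CARD('d)) * l ^ CARD('d) * r ^ CARD('d))"
    using r l by (simp add: ennreal_mult[symmetric] mult_ac)
  finally show ?thesis using r l by (subst (asm) ennreal_le_iff) auto
qed

lemma measure_scaledQ_sphere:
  assumes r: "r > 0" shows "measure (scaledQ r) {u :: real^'d. dist u v = c} = 0"
proof -
  have eq: "{u. dist u v = c} = sphere v c" by (auto simp: dist_commute)
  have "negligible (sphere v c)" by (rule negligible_sphere)
  hence "sphere v c \<in> null_sets lborel"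
    by (simp add: negligible_iff_null_sets null_sets_completion_iff)
  hence "emeasure (scaledQ r) (sphere v c) = 0"
    using emeasure_scaledQ_le[OF r, of "sphere v c"] by (auto simp: null_sets_def)
  thus ?thesis unfolding eq by (simp add: measure_def)
qed

text \<open>Finite tuples of uniform points are obtained from the infinite sequence of dilated points, which serves as
  a common probability space for all \<open>N\<close>.\<close>
lemma distr_scale_iid:
  fixes N :: nat
  assumes r: "r > 0"
  shows "distr (iid_sequence.P (scaledQ r)) (PiM {..<N} (\<lambda>_. unitQ)) (\<lambda>y. \<lambda>a\<in>{..<N}. r *\<^sub>R y a) = PiM {..<N} (\<lambda>_. unitQ :: (real^'d) measure)"
    and "(\<lambda>y. \<lambda>a\<in>{..<N}. r *\<^sub>R y a) \<in> iid_sequence.P (scaledQ r) \<rightarrow>\<^sub>M PiM {..<N} (\<lambda>_. unitQ :: (real^'d) measure)"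
proof -
  interpret I: iid_sequence "scaledQ r :: (real^'d) measure" by (rule iid_scaledQ)
  have sc: "(\<lambda>u. r *\<^sub>R u) \<in> scaledQ r \<rightarrow>\<^sub>M (unitQ :: (real^'d) measure)" by measurable
  have scale_back: "distr (scaledQ r) unitQ (\<lambda>u. r *\<^sub>R u) = (unitQ :: (real^'d) measure)"
  proof -
    have "distr (scaledQ r) unitQ (\<lambda>u. r *\<^sub>R u) = distr unitQ unitQ ((\<lambda>u. r *\<^sub>R u) \<circ> (\<lambda>x. inverse r *\<^sub>R x))"
      unfolding scaledQ_def by (rule distr_distr) measurable
    also have "\<dots> = distr unitQ unitQ (\<lambda>x. x)" using r by (simp add: o_def)
    finally show ?thesis by (simp add: distr_id2)
  qed
  have res: "distr I.P (PiM {..<N} (\<lambda>_. scaledQ r)) (\<lambda>y. restrict y {..<N}) = PiM {..<N} (\<lambda>_. scaledQ r)"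
    unfolding I.P_def by (rule I.distr_PiM_restrict_finite) auto
  have m1: "(\<lambda>y. restrict y {..<N}) \<in> I.P \<rightarrow>\<^sub>M PiM {..<N} (\<lambda>_. scaledQ r)"
    unfolding I.P_def by (rule measurable_restrict_subset) simp
  have m2: "compose {..<N} (\<lambda>u. r *\<^sub>R u) \<in> PiM {..<N} (\<lambda>_. scaledQ r) \<rightarrow>\<^sub>M PiM {..<N} (\<lambda>_. unitQ :: (real^'d) measure)"
  proof -
    have "(\<lambda>x. \<lambda>a\<in>{..<N}. r *\<^sub>R x a) \<in> PiM {..<N} (\<lambda>_. scaledQ r) \<rightarrow>\<^sub>M PiM {..<N} (\<lambda>_. unitQ :: (real^'d) measure)"
    proof (rule measurable_restrict)
      fix a assume "a \<in> {..<N}"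
      hence "(\<lambda>x. x a) \<in> PiM {..<N} (\<lambda>_. scaledQ r) \<rightarrow>\<^sub>M (scaledQ r :: (real^'d) measure)" by (rule measurable_component_singleton)
      from measurable_compose[OF this sc] show "(\<lambda>x. r *\<^sub>R x a) \<in> PiM {..<N} (\<lambda>_. scaledQ r) \<rightarrow>\<^sub>M (unitQ :: (real^'d) measure)" .
    qed
    thus ?thesis unfolding compose_def .
  qed
  have comp: "compose {..<N} (\<lambda>u. r *\<^sub>R u) \<circ> (\<lambda>y. restrict y {..<N}) = (\<lambda>y. \<lambda>a\<in>{..<N}. r *\<^sub>R (y a :: real^'d))"
    by (auto simp: compose_def fun_eq_iff restrict_def)
  show "(\<lambda>y. \<lambda>a\<in>{..<N}. r *\<^sub>R y a) \<in> I.P \<rightarrow>\<^sub>M PiM {..<N} (\<lambda>_. unitQ :: (real^'d) measure)"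
    using measurable_comp[OF m1 m2] unfolding comp .
  have "distr I.P (PiM {..<N} (\<lambda>_. unitQ)) (\<lambda>y. \<lambda>a\<in>{..<N}. r *\<^sub>R y a)
      = distr (distr I.P (PiM {..<N} (\<lambda>_. scaledQ r)) (\<lambda>y. restrict y {..<N})) (PiM {..<N} (\<lambda>_. unitQ)) (compose {..<N} (\<lambda>u. r *\<^sub>R u))"
    unfolding distr_distr[OF m2 m1] comp ..
  also have "\<dots> = PiM {..<N} (\<lambda>i. distr (scaledQ r) unitQ (\<lambda>u. r *\<^sub>R u))"
    unfolding res by (rule distr_PiM_finite_prob_space') (auto intro: prob_space_scaledQ prob_space_unitQ)
  finally show "distr I.P (PiM {..<N} (\<lambda>_. unitQ)) (\<lambda>y. \<lambda>a\<in>{..<N}. r *\<^sub>R y a) = PiM {..<N} (\<lambda>_. unitQ :: (real^'d) measure)"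
    unfolding scale_back .
qed

lemma tuple_integral:
  fixes \<Psi> :: "(real^'d) set \<Rightarrow> ennreal" and N :: nat
  assumes r: "r > 0" and \<Psi>: "(\<lambda>x. \<Psi> (x ` {..<N})) \<in> borel_measurable (PiM {..<N} (\<lambda>_. borel))"
  shows "(\<integral>\<^sup>+x. \<Psi> (x ` {..<N}) \<partial>PiM {..<N} (\<lambda>_. unitQ)) = (\<integral>\<^sup>+y. \<Psi> ((\<lambda>a. r *\<^sub>R y a) ` {..<N}) \<partial>iid_sequence.P (scaledQ r))"
proof -
  have S: "sets (PiM {..<N} (\<lambda>_. unitQ)) = sets (PiM {..<N} (\<lambda>_. borel :: (real^'d) measure))" by (rule sets_PiM_cong) auto
  have m: "(\<lambda>x. \<Psi> (x ` {..<N})) \<in> borel_measurable (PiM {..<N} (\<lambda>_. unitQ))"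
    using \<Psi> by (simp add: measurable_cong_sets[OF S refl])
  have "(\<integral>\<^sup>+x. \<Psi> (x ` {..<N}) \<partial>PiM {..<N} (\<lambda>_. unitQ))
      = (\<integral>\<^sup>+x. \<Psi> (x ` {..<N}) \<partial>distr (iid_sequence.P (scaledQ r)) (PiM {..<N} (\<lambda>_. unitQ)) (\<lambda>y. \<lambda>a\<in>{..<N}. r *\<^sub>R y a))"
    unfolding distr_scale_iid(1)[OF r] ..
  also have "\<dots> = (\<integral>\<^sup>+y. \<Psi> ((\<lambda>a\<in>{..<N}. r *\<^sub>R y a) ` {..<N}) \<partial>iid_sequence.P (scaledQ r))"
    by (rule nn_integral_distr[OF distr_scale_iid(2)[OF r]]) (simp add: m)
  finally show ?thesis by simp
qed

context cech_shapes begin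

lemma AE_component_counts:
  assumes r: "r > 0"
  shows "AE y in iid_sequence.P (scaledQ r). \<forall>i. component_counts k t G r ((\<lambda>a. r *\<^sub>R y a) ` {..<N}) $ i = cnt i {..<N} y"
proof -
  have ne: "AE y in iid_sequence.P (scaledQ r :: (real^'d) measure). dist (y a) (y b) \<noteq> c" if "a \<noteq> b" for a b c
    by (rule AE_dist_neq[OF iid_scaledQ measure_scaledQ_sphere[OF r] that])
  have "AE y in iid_sequence.P (scaledQ r :: (real^'d) measure). \<forall>a\<in>{..<N}. \<forall>b\<in>{..<N} - {a}. \<forall>c\<in>insert 0 (range (($) t)). dist (y a) (y b) \<noteq> c"
    by (intro AE_finite_allI ne) auto
  thus ?thesis
  proof (rule AE_mp, intro AE_I2 impI allI)
    fix y :: "nat \<Rightarrow> real^'d" and i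
    assume H: "\<forall>a\<in>{..<N}. \<forall>b\<in>{..<N} - {a}. \<forall>c\<in>insert 0 (range (($) t)). dist (y a) (y b) \<noteq> c"
    have H': "dist (y a) (y b) \<noteq> 0" "dist (y a) (y b) \<noteq> t $ i" if "a < N" "b < N" "a \<noteq> b" for a b
      using H that by auto
    show "component_counts k t G r ((\<lambda>a. r *\<^sub>R y a) ` {..<N}) $ i = cnt i {..<N} y"
      using H' by (intro component_counts_generic r) auto
  qed
qed

text \<open>The probability that a given \<open>k\<close>-tuple has both shapes. For \<open>i \<noteq> j\<close> it need not vanish: the thresholds
  \<open>t $ i\<close> and \<open>t $ j\<close> may differ, and one cluster can then have several shapes.\<close>
definition pairprob :: "real \<Rightarrow> 'm \<Rightarrow> 'm \<Rightarrow> real" where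
  "pairprob r i j = enn2real (\<integral>\<^sup>+x. pairH i j x \<partial>PiM {..<k} (\<lambda>_. scaledQ r))"

lemma pairprob_nonneg: "0 \<le> pairprob r i j" by (simp add: pairprob_def)

lemma pair_expectation:
  assumes J: "card J = k"
  shows "(\<integral>x. of_bool (shape i J x) * of_bool (shape j J x) \<partial>iid_sequence.P (scaledQ r)) = pairprob r i j"
proof -
  interpret I: iid_sequence "scaledQ r :: (real^'d) measure" by (rule iid_scaledQ)
  have fin: "finite J" using J card_k_finite by blast
  obtain \<pi> where \<pi>: "bij_betw \<pi> {..<k} J" using ex_bij_betw_nat_finite[OF fin] J by (auto simp: atLeast0LessThan)
  have S1: "sets (PiM {..<k} (\<lambda>_. scaledQ r)) = sets (PiM {..<k} (\<lambda>_. borel :: (real^'d) measure))"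
    by (rule sets_PiM_cong) auto
  define T where "T x = (\<lambda>n\<in>{..<k}. x (\<pi> n) :: real^'d)" for x
  have TT: "T = (\<lambda>x. \<lambda>n\<in>{..<k}. x (\<pi> n))" by (simp add: T_def fun_eq_iff)
  have Tm: "T \<in> I.P \<rightarrow>\<^sub>M PiM {..<k} (\<lambda>_. scaledQ r)"
    unfolding TT I.P_def by (rule measurable_restrict) (rule measurable_component_singleton, simp)
  have dT: "distr I.P (PiM {..<k} (\<lambda>_. scaledQ r)) T = PiM {..<k} (\<lambda>_. scaledQ r)"
    unfolding TT I.P_def using \<pi> by (intro distr_PiM_reindex prob_space_scaledQ) (auto simp: bij_betw_def)
  have sh: "shape i {..<k} (T x) = shape i J x" for i x
  proof -
    have "T x ` {..<k} = x ` (\<pi> ` {..<k})" by (auto simp: T_def)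
    also have "\<pi> ` {..<k} = J" using \<pi> by (simp add: bij_betw_def)
    finally show ?thesis by (simp add: shape_def)
  qed
  have eq: "ennreal (of_bool (shape i J x) * of_bool (shape j J x)) = pairH i j (T x)" for x
    by (simp add: pairH_def sh)
  have pm: "pairH i j \<in> borel_measurable (PiM {..<k} (\<lambda>_. scaledQ r))"
    using pairH_measurable by (simp add: measurable_cong_sets[OF S1 refl])
  have fm: "(\<lambda>x. of_bool (shape i J x) * of_bool (shape j J x) :: real) \<in> borel_measurable I.P"
  proof -
    have "Measurable.pred I.P (shape i J)" for i
      using measurable_shape[OF cech_shapes_axioms J, of "\<lambda>x. x" I.P i] I.coord_meas by simp
    thus ?thesis by (intro borel_measurable_times I.bm_meas I.bm_of_bool)
  qed
  have "(\<integral>x. of_bool (shape i J x) * of_bool (shape j J x) \<partial>I.P) = enn2real (\<integral>\<^sup>+x. ennreal (of_bool (shape i J x) * of_bool (shape j J x)) \<partial>I.P)"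
    by (rule integral_eq_nn_integral[OF fm]) simp
  also have "(\<integral>\<^sup>+x. ennreal (of_bool (shape i J x) * of_bool (shape j J x)) \<partial>I.P) = (\<integral>\<^sup>+x. pairH i j x \<partial>distr I.P (PiM {..<k} (\<lambda>_. scaledQ r)) T)"
    unfolding eq by (rule nn_integral_distr[OF Tm, symmetric]) (simp add: pm)
  finally show ?thesis by (simp add: dT pairprob_def)
qed

text \<open>Squeeze between \<open>pair_integral_upper\<close> and \<open>pair_integral_lower\<close>; boundary effects vanish with \<open>r\<close>.\<close>
lemma pairprob_limit:
  assumes r: "\<And>n. r n > 0" "r \<longlonglongrightarrow> 0"
  shows "(\<lambda>n. pairprob (r n) i j / r n ^ (CARD('d) * (k - 1))) \<longlonglongrightarrow> pairmass i j"
proof (rule tendsto_sandwich)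
  define c where "c n = r n * (real k * tmax)" for n
  have c: "c \<longlonglongrightarrow> 0" unfolding c_def using tendsto_mult_left_zero[OF r(2)] by simp
  have "\<forall>\<^sub>F n in sequentially. c n < 1/2" by (rule order_tendstoD[OF c]) simp
  thus "\<forall>\<^sub>F n in sequentially. pairmass i j * (1 - 2 * c n) ^ CARD('d) \<le> pairprob (r n) i j / r n ^ (CARD('d) * (k - 1))"
  proof eventually_elim
    case (elim n)
    have p: "0 < r n ^ (CARD('d) * (k - 1))" using r by simp
    have "(\<integral>\<^sup>+x. pairH i j x \<partial>PiM {..<k} (\<lambda>_. scaledQ (r n))) < \<infinity>"
      using pair_integral_upper[OF r(1), of n i j] by (rule le_less_trans) simp
    hence "ennreal (pairprob (r n) i j) = (\<integral>\<^sup>+x. pairH i j x \<partial>PiM {..<k} (\<lambda>_. scaledQ (r n)))"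
      by (simp add: pairprob_def)
    moreover have "ennreal (r n ^ (CARD('d) * (k - 1)) * pairmass i j * (1 - 2 * c n) ^ CARD('d)) \<le> (\<integral>\<^sup>+x. pairH i j x \<partial>PiM {..<k} (\<lambda>_. scaledQ (r n)))"
      using elim by (intro pair_integral_lower r) (auto simp: c_def)
    ultimately have "r n ^ (CARD('d) * (k - 1)) * pairmass i j * (1 - 2 * c n) ^ CARD('d) \<le> pairprob (r n) i j"
      using pairprob_nonneg by (metis ennreal_le_iff)
    thus ?case using p by (simp add: field_simps)
  qed
  show "\<forall>\<^sub>F n in sequentially. pairprob (r n) i j / r n ^ (CARD('d) * (k - 1)) \<le> pairmass i j"
  proof (rule always_eventually, rule allI)
    fix n
    have p: "0 < r n ^ (CARD('d) * (k - 1))" using r by simp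
    have "pairprob (r n) i j \<le> r n ^ (CARD('d) * (k - 1)) * pairmass i j"
      unfolding pairprob_def
      using enn2real_mono[OF pair_integral_upper[OF r(1), of n i j]] pairmass_nonneg[of i j] p by simp
    thus "pairprob (r n) i j / r n ^ (CARD('d) * (k - 1)) \<le> pairmass i j" using p by (simp add: field_simps)
  qed
  have "(\<lambda>n. pairmass i j * (1 - 2 * c n) ^ CARD('d)) \<longlonglongrightarrow> pairmass i j * (1 - 2 * 0) ^ CARD('d)"
    by (intro tendsto_intros c)
  thus "(\<lambda>n. pairmass i j * (1 - 2 * c n) ^ CARD('d)) \<longlonglongrightarrow> pairmass i j" by simp
qed (rule tendsto_const)

lemma limit_covariance_pairmass: "limit_covariance k t G $ i $ j = pairmass i j / fact k"
  by (simp add: limit_covariance_def pairmass_def)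

lemma pairmass_sym: "pairmass i j = pairmass j i"
  unfolding pairmass_def by (simp add: mult.commute)

definition nu :: "real \<Rightarrow> (nat \<Rightarrow> real^'d) measure" where "nu r = iid_sequence.P (scaledQ r)"

definition Fsum :: "real^'m \<Rightarrow> nat \<Rightarrow> (nat \<Rightarrow> real^'d) \<Rightarrow> real" where
  "Fsum \<theta> N y = (\<Sum>i\<in>UNIV. \<theta> $ i * cnt i {..<N} y)"

definition lap :: "real \<Rightarrow> real^'m \<Rightarrow> real \<Rightarrow> nat \<Rightarrow> real" where
  "lap r \<theta> \<alpha> N = (\<integral>y. exp (\<alpha> * Fsum \<theta> N y) \<partial>nu r)"

definition mean :: "real \<Rightarrow> real^'m \<Rightarrow> nat \<Rightarrow> real" where
  "mean r \<theta> N = (\<integral>y. Fsum \<theta> N y \<partial>nu r)"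

text \<open>An upper bound for the mass that \<open>scaledQ r\<close> gives to a ball of the interaction radius.\<close>
definition pball :: "real \<Rightarrow> real" where
  "pball r = unit_ball_vol (real CARD('d)) * ((real k + 1) * tmax) ^ CARD('d) * r ^ CARD('d)"

definition Vsum :: "real \<Rightarrow> real^'m \<Rightarrow> nat \<Rightarrow> real" where
  "Vsum r \<theta> n = real (n choose k) * (\<Sum>i\<in>UNIV. \<Sum>j\<in>UNIV. \<theta> $ i * \<theta> $ j * pairprob r i j)"

definition Hsum :: "real \<Rightarrow> real^'m \<Rightarrow> nat \<Rightarrow> real" where
  "Hsum r \<theta> n = real (n choose k) * (\<Sum>i\<in>UNIV. \<bar>\<theta> $ i\<bar> * pairprob r i i)"

text \<open>The constants depend on \<open>\<theta>\<close>, \<open>k\<close> and the packing constant only. The estimates therefore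
  hold along any sequence of scales, with explicit dependence on \<open>\<alpha>\<close> and \<open>pball r\<close>.\<close>
lemma scale_uniform_estimates:
  fixes \<theta> :: "real^'m"
  obtains \<kappa> c :: real where "0 \<le> \<kappa>" "0 \<le> c"
    "\<And>r \<alpha> j. r > 0 \<Longrightarrow> 0 < lap r \<theta> \<alpha> j"
    "\<And>r j. r > 0 \<Longrightarrow> (\<lambda>y. Fsum \<theta> j y) \<in> borel_measurable (nu r)"
    "\<And>y j. \<bar>Fsum \<theta> j y\<bar> \<le> \<kappa> * real j"
    "\<And>r \<alpha> j. r > 0 \<Longrightarrow> 0 \<le> \<alpha> \<Longrightarrow> lap r \<theta> \<alpha> (Suc j) \<le> exp (\<kappa> * \<alpha>) * lap r \<theta> \<alpha> j"
    "\<And>r \<alpha> j. r > 0 \<Longrightarrow> 0 \<le> \<alpha> \<Longrightarrow> lap r \<theta> \<alpha> j \<le> exp (\<kappa> * \<alpha>) * lap r \<theta> \<alpha> (Suc j)"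
    "\<And>r \<alpha> j. r > 0 \<Longrightarrow> 0 \<le> \<alpha> \<Longrightarrow> \<kappa> * \<alpha> \<le> 1 \<Longrightarrow>
        \<bar>lap r \<theta> \<alpha> (Suc j) - lap r \<theta> \<alpha> j\<bar> \<le> \<alpha> * (\<kappa> * exp (2 * real k) * (real j * pball r) ^ (k - 1)) * lap r \<theta> \<alpha> j"
    "\<And>r j. r > 0 \<Longrightarrow> \<bar>mean r \<theta> (Suc j) - mean r \<theta> j\<bar> \<le> \<kappa>"
    "\<And>r j. r > 0 \<Longrightarrow> \<bar>mean r \<theta> (Suc j) - mean r \<theta> j\<bar> \<le> \<kappa> * exp (2 * real k) * (real j * pball r) ^ (k - 1)"
    "\<And>r \<alpha> n. r > 0 \<Longrightarrow> 0 \<le> \<alpha> \<Longrightarrow> \<kappa> * \<alpha> \<le> 1 \<Longrightarrow> real n * pball r \<le> 1 \<Longrightarrow>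
        \<bar>ln (lap r \<theta> \<alpha> n) - \<alpha> * mean r \<theta> n - \<alpha>\<^sup>2 / 2 * Vsum r \<theta> n\<bar> \<le> c * (\<alpha> + real n * pball r) * \<alpha>\<^sup>2 * Hsum r \<theta> n"
proof -
  obtain K :: nat where K: "\<And>i a I x. finite I \<Longrightarrow> a \<notin> I \<Longrightarrow> \<bar>cnt i (insert a I) x - cnt i I x\<bar> \<le> real K"
    using packing_constant by blast
  have loc: "cech_iid k t G (scaledQ r) K (pball r)" if r: "r > 0" for r
  proof -
    have "cech_iid_axioms k t G (scaledQ r) K (pball r)"
    proof
      show "\<bar>cnt i (insert a I) x - cnt i I x\<bar> \<le> real K" if "finite I" "a \<notin> I" for i a I x using K that by blast
      show "measure (scaledQ r) (cball y ((real k + 1) * tmax)) \<le> pball r" for y :: "real^'d"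
        unfolding pball_def using tmax_pos by (intro measure_scaledQ_cball r) auto
    qed
    thus ?thesis using cech_shapes_axioms iid_scaledQ by (intro cech_iid.intro)
  qed
  have sI: "{..<Suc j} = insert j {..<j}" for j by auto
  have Fe: "cech_iid.F k t G \<theta> {..<j} = Fsum \<theta> j" if "r > 0" for r :: real and j
    using cech_iid.F_def[OF loc[OF that], of \<theta> "{..<j}"] by (simp add: Fsum_def fun_eq_iff)
  have lape: "cech_iid.\<phi> k t G (scaledQ r) \<theta> \<alpha> {..<j} = lap r \<theta> \<alpha> j" if "r > 0" for r \<alpha> j
    using cech_iid.\<phi>_def[OF loc[OF that], of \<theta> \<alpha> "{..<j}"] Fe[OF that] by (simp add: lap_def nu_def)
  have meane: "integral\<^sup>L (iid_sequence.P (scaledQ r)) (cech_iid.F k t G \<theta> {..<j}) = mean r \<theta> j" if "r > 0" for r j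
    using Fe[OF that] by (simp add: mean_def nu_def)
  define \<kappa> where "\<kappa> = cech_iid.\<kappa> \<theta> K"
  have pb: "0 \<le> pball r" if "r > 0" for r unfolding pball_def using that tmax_pos by auto
  have k0: "0 \<le> \<kappa>" unfolding \<kappa>_def using cech_iid.\<kappa>_nonneg[OF loc[of 1]] by simp
  define c where "c = cech_iid.cumulant_const k \<theta> K"
  have c0: "0 \<le> c" unfolding c_def using cech_iid.cumulant_const_nonneg[OF loc[of 1]] by simp
  have Ve: "cech_iid.vsum k t G (scaledQ r) \<theta> {..<n} = Vsum r \<theta> n" if r: "r > 0" for r n
  proof -
    interpret C: cech_iid k t G "scaledQ r" \<theta> K "pball r" by (rule loc[OF r])
    have "(\<integral>x. (C.gsum J x)\<^sup>2 \<partial>C.P) = (\<Sum>i\<in>UNIV. \<Sum>j\<in>UNIV. \<theta> $ i * \<theta> $ j * pairprob r i j)" if J: "card J = k" for J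
    proof -
      have "(C.gsum J x)\<^sup>2 = (\<Sum>i\<in>UNIV. \<Sum>j\<in>UNIV. \<theta> $ i * \<theta> $ j * (of_bool (shape i J x) * of_bool (shape j J x)))" for x
        unfolding C.gsum_def power2_eq_square sum_product by (intro sum.cong refl) (simp only: mult_ac)
      hence "(\<integral>x. (C.gsum J x)\<^sup>2 \<partial>C.P) = (\<integral>x. (\<Sum>i\<in>UNIV. \<Sum>j\<in>UNIV. \<theta> $ i * \<theta> $ j * (of_bool (shape i J x) * of_bool (shape j J x))) \<partial>C.P)" by (simp only:)
      also have "\<dots> = (\<Sum>i\<in>UNIV. (\<integral>x. (\<Sum>j\<in>UNIV. \<theta> $ i * \<theta> $ j * (of_bool (shape i J x) * of_bool (shape j J x))) \<partial>C.P))"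
        by (rule Bochner_Integration.integral_sum, rule C.bm_integrable, rule C.bm_sum, rule C.bm_cmult, rule C.bm_mult; rule C.bm_shape[OF J])
      also have "\<dots> = (\<Sum>i\<in>UNIV. \<Sum>j\<in>UNIV. (\<integral>x. \<theta> $ i * \<theta> $ j * (of_bool (shape i J x) * of_bool (shape j J x)) \<partial>C.P))"
        by (rule sum.cong[OF refl], rule Bochner_Integration.integral_sum, rule C.bm_integrable, rule C.bm_cmult, rule C.bm_mult; rule C.bm_shape[OF J])
      finally show ?thesis using pair_expectation[OF J, of r] by simp
    qed
    hence "C.vsum {..<n} = (\<Sum>J | J \<subseteq> {..<n} \<and> card J = k. (\<Sum>i\<in>UNIV. \<Sum>j\<in>UNIV. \<theta> $ i * \<theta> $ j * pairprob r i j))"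
      unfolding C.vsum_def by (intro sum.cong) auto
    also have "\<dots> = Vsum r \<theta> n" using n_subsets[of "{..<n}" k] by (simp add: Vsum_def)
    finally show ?thesis .
  qed
  have He: "cech_iid.hsum k t G (scaledQ r) \<theta> {..<n} = Hsum r \<theta> n" if r: "r > 0" for r n
  proof -
    interpret C: cech_iid k t G "scaledQ r" \<theta> K "pball r" by (rule loc[OF r])
    have "C.sprob i J = pairprob r i i" if J: "card J = k" for i J
    proof -
      have "(of_bool (shape i J x) :: real) = of_bool (shape i J x) * of_bool (shape i J x)" for x by simp
      thus ?thesis unfolding C.sprob_def using pair_expectation[OF J, of r i i] by (simp only:)
    qed
    hence "C.hsum {..<n} = (\<Sum>J | J \<subseteq> {..<n} \<and> card J = k. (\<Sum>i\<in>UNIV. \<bar>\<theta> $ i\<bar> * pairprob r i i))"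
      unfolding C.hsum_def by (intro sum.cong) auto
    also have "\<dots> = Hsum r \<theta> n" using n_subsets[of "{..<n}" k] by (simp add: Hsum_def)
    finally show ?thesis .
  qed
  show thesis
  proof (rule that[OF k0 c0])
    show "\<bar>Fsum \<theta> j y\<bar> \<le> \<kappa> * real j" for y j
      using cech_iid.F_bound[OF loc[of 1], of "{..<j}" \<theta> y] Fe[of 1 j] by (simp add: \<kappa>_def)
  next
    fix r :: real and j :: nat assume r: "r > 0"
    interpret C: cech_iid k t G "scaledQ r" \<theta> K "pball r" by (rule loc[OF r])
    note F = Fe[OF r] and L = lape[OF r] and m = meane[OF r]
    show "0 < lap r \<theta> \<alpha> j" for \<alpha> using C.\<phi>_pos[of "{..<j}" \<alpha>] L by simp
    show "(\<lambda>y. Fsum \<theta> j y) \<in> borel_measurable (nu r)" using C.bm_meas[OF C.bm_F[of "{..<j}"]] F by (simp add: nu_def)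
    show "lap r \<theta> \<alpha> (Suc j) \<le> exp (\<kappa> * \<alpha>) * lap r \<theta> \<alpha> j" if "0 \<le> \<alpha>" for \<alpha>
      using C.\<phi>_ratio(1)[of "{..<j}" j \<alpha>] that by (simp add: sI[symmetric] L \<kappa>_def)
    show "lap r \<theta> \<alpha> j \<le> exp (\<kappa> * \<alpha>) * lap r \<theta> \<alpha> (Suc j)" if "0 \<le> \<alpha>" for \<alpha>
      using C.\<phi>_ratio(2)[of "{..<j}" j \<alpha>] that by (simp add: sI[symmetric] L \<kappa>_def)
    show "\<bar>lap r \<theta> \<alpha> (Suc j) - lap r \<theta> \<alpha> j\<bar> \<le> \<alpha> * (\<kappa> * exp (2 * real k) * (real j * pball r) ^ (k - 1)) * lap r \<theta> \<alpha> j"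
      if "0 \<le> \<alpha>" "\<kappa> * \<alpha> \<le> 1" for \<alpha>
      using C.\<phi>_insert[of "{..<j}" j \<alpha>] that by (simp add: sI[symmetric] L \<kappa>_def)
    show "\<bar>mean r \<theta> (Suc j) - mean r \<theta> j\<bar> \<le> \<kappa> * exp (2 * real k) * (real j * pball r) ^ (k - 1)"
      using C.mean_insert[of "{..<j}" j] by (simp add: sI[symmetric] m \<kappa>_def)
    show "\<bar>mean r \<theta> (Suc j) - mean r \<theta> j\<bar> \<le> \<kappa>"
    proof -
      have b: "C.bm (C.F {..<Suc j})" "C.bm (C.F {..<j})" by (auto intro: C.bm_F)
      have "mean r \<theta> (Suc j) - mean r \<theta> j = (\<integral>x. C.F {..<Suc j} x - C.F {..<j} x \<partial>C.P)"
        using b m by simp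
      also have "\<bar>\<dots>\<bar> \<le> (\<integral>x. \<bar>C.F {..<Suc j} x - C.F {..<j} x\<bar> \<partial>C.P)" by (rule integral_abs_bound)
      also have "\<dots> \<le> (\<integral>x. \<kappa> \<partial>C.P)"
        using C.F_insert[of "{..<j}" j] b
        by (intro integral_mono C.bm_integrable C.bm_abs C.bm_diff C.bm_const) (auto simp: sI \<kappa>_def)
      finally show ?thesis by simp
    qed
    show "\<bar>ln (lap r \<theta> \<alpha> j) - \<alpha> * mean r \<theta> j - \<alpha>\<^sup>2 / 2 * Vsum r \<theta> j\<bar> \<le> c * (\<alpha> + real j * pball r) * \<alpha>\<^sup>2 * Hsum r \<theta> j"
      if "0 \<le> \<alpha>" "\<kappa> * \<alpha> \<le> 1" "real j * pball r \<le> 1" for \<alpha>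
      using C.cumulant_estimate[of "{..<j}" \<alpha>] that by (simp add: L m Ve[OF r] He[OF r] \<kappa>_def c_def)
  qed
qed

end

section \<open>The law of the component counts\<close>

text \<open>The common feature of both models: given that there are \<open>N\<close> points, which happens with
  probability \<open>p N\<close>, they are independent and uniform. It is expressed through integrals of set
  functionals, and the exponential moments of \<open>p\<close> guarantee that the counts have all exponential moments.\<close>
definition mixed_point_process :: "(nat \<Rightarrow> real) \<Rightarrow> 'a measure \<Rightarrow> ('a \<Rightarrow> (real^'d) set) \<Rightarrow> bool" where
  "mixed_point_process p M X \<longleftrightarrow> (\<forall>N. 0 \<le> p N) \<and> (\<forall>s. summable (\<lambda>N. p N * exp (s * real N))) \<and>
     (\<forall>\<Psi> :: (real^'d) set \<Rightarrow> ennreal.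
        (\<forall>N::nat. (\<lambda>x. \<Psi> (x ` {..<N})) \<in> borel_measurable (PiM {..<N} (\<lambda>_. borel))) \<longrightarrow>
        (\<lambda>\<omega>. \<Psi> (X \<omega>)) \<in> borel_measurable M \<and>
        (\<integral>\<^sup>+\<omega>. \<Psi> (X \<omega>) \<partial>M) = (\<Sum>N. ennreal (p N) * (\<integral>\<^sup>+x. \<Psi> (x ` {..<N}) \<partial>PiM {..<N} (\<lambda>_. unitQ))))"

lemma poisson_mixed_point_process:
  assumes M: "prob_space M" and P: "poisson_process_on_cube M a X" and a: "0 \<le> a"
  shows "mixed_point_process (poisson_weight a) M X"
proof -
  interpret poisson_on_cube M a X
    using M P a by (simp add: poisson_on_cube_def poisson_on_cube_axioms_def)
  have "summable (\<lambda>N. poisson_weight a N * exp (s * real N))" for s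
    using poisson_mgf by (rule sums_summable)
  thus ?thesis unfolding mixed_point_process_def
    using a poisson_mixture by (auto simp: poisson_weight_nonneg poisson_weight_def)
qed

lemma binomial_mixed_point_process:
  fixes X :: "'a \<Rightarrow> (real^'d) set"
  assumes M: "prob_space M" and B: "binomial_process_on_cube M n X"
  shows "mixed_point_process (\<lambda>j. of_bool (j = n)) M X"
proof -
  interpret prob_space M by (rule M)
  obtain U where ind: "indep_vars (\<lambda>_. borel) U {..<n}"
    and U: "\<And>i. i < n \<Longrightarrow> distr M borel (U i) = (unitQ :: (real^'d) measure)"
    and X: "\<And>\<omega>. \<omega> \<in> space M \<Longrightarrow> X \<omega> = (\<lambda>i. U i \<omega>) ` {..<n}"
    using B by (auto simp: binomial_process_on_cube_def unitQ_def)
  have Um: "U i \<in> borel_measurable M" if "i < n" for i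
    using ind that by (auto simp: indep_vars_def)
  define T where "T \<omega> = (\<lambda>i\<in>{..<n}. U i \<omega>)" for \<omega>
  have Tm: "T \<in> M \<rightarrow>\<^sub>M PiM {..<n} (\<lambda>_. borel)"
    unfolding T_def using Um by (intro measurable_restrict) auto
  have TX: "T \<omega> ` {..<n} = X \<omega>" if "\<omega> \<in> space M" for \<omega>
    using X[OF that] by (auto simp: T_def)
  have S: "sets (PiM {..<n} (\<lambda>_. unitQ)) = sets (PiM {..<n} (\<lambda>_. borel :: (real^'d) measure))"
    by (rule sets_PiM_cong) auto
  have dT: "distr M (PiM {..<n} (\<lambda>_. borel)) T = PiM {..<n} (\<lambda>_. unitQ)"
  \<comment> \<open>The characterisation of independence by product measures requires a nonempty index set.\<close>
  proof (cases "n = 0")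
    case True
    have "T = (\<lambda>_ _. undefined)" by (simp add: T_def True fun_eq_iff)
    hence "distr M (PiM {..<n} (\<lambda>_. borel)) T = distr M (PiM {} (\<lambda>_. borel)) (\<lambda>_. (\<lambda>_. undefined))"
      by (simp add: True)
    also have "\<dots> = return (PiM {} (\<lambda>_. borel)) (\<lambda>_. undefined)"
      by (rule distr_const) (simp add: space_PiM)
    also have "\<dots> = PiM {} (\<lambda>_. unitQ :: (real^'d) measure)"
    proof (rule measure_eqI)
      show "sets (return (PiM {} (\<lambda>_. borel)) (\<lambda>_. undefined)) = sets (PiM {} (\<lambda>_. unitQ :: (real^'d) measure))"
        by (simp add: sets_PiM_empty)
      fix A assume "A \<in> sets (return (PiM {} (\<lambda>_. borel :: (real^'d) measure)) (\<lambda>_. undefined))"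
      hence "A = {} \<or> A = {\<lambda>_. undefined}" by (simp add: sets_PiM_empty)
      thus "emeasure (return (PiM {} (\<lambda>_. borel)) (\<lambda>_. undefined)) A = emeasure (PiM {} (\<lambda>_. unitQ :: (real^'d) measure)) A"
        by (auto simp: sets_PiM_empty emeasure_PiM_empty)
    qed
    finally show ?thesis by (simp add: True)
  next
    case False
    have "distr M (PiM {..<n} (\<lambda>_. borel)) T = PiM {..<n} (\<lambda>i. distr M borel (U i))"
      using ind Um False unfolding T_def by (subst (asm) indep_vars_iff_distr_eq_PiM') auto
    also have "\<dots> = PiM {..<n} (\<lambda>_. unitQ)" using U by (intro PiM_cong) auto
    finally show ?thesis .
  qed
  show ?thesis unfolding mixed_point_process_def
  proof (intro conjI allI impI)
    show "summable (\<lambda>N. of_bool (N = n) * exp (s * real N))" for s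
      by (rule summable_finite[of "{n}"]) auto
    fix \<Psi> :: "(real^'d) set \<Rightarrow> ennreal"
    assume "\<forall>N::nat. (\<lambda>x. \<Psi> (x ` {..<N})) \<in> borel_measurable (PiM {..<N} (\<lambda>_. borel))"
    hence \<Psi>: "(\<lambda>x. \<Psi> (x ` {..<n})) \<in> borel_measurable (PiM {..<n} (\<lambda>_. borel))" by blast
    have "(\<lambda>\<omega>. \<Psi> (T \<omega> ` {..<n})) \<in> borel_measurable M" by (rule measurable_compose[OF Tm \<Psi>])
    thus "(\<lambda>\<omega>. \<Psi> (X \<omega>)) \<in> borel_measurable M" by (subst measurable_cong[of _ _ "\<lambda>\<omega>. \<Psi> (T \<omega> ` {..<n})"]) (auto simp: TX)
    have "(\<integral>\<^sup>+\<omega>. \<Psi> (X \<omega>) \<partial>M) = (\<integral>\<^sup>+\<omega>. \<Psi> (T \<omega> ` {..<n}) \<partial>M)"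
      by (rule nn_integral_cong) (simp add: TX)
    also have "\<dots> = (\<integral>\<^sup>+x. \<Psi> (x ` {..<n}) \<partial>PiM {..<n} (\<lambda>_. unitQ))"
      unfolding dT[symmetric] by (rule nn_integral_distr[symmetric, OF Tm]) (simp add: \<Psi>)
    also have "\<dots> = (\<Sum>N. ennreal (of_bool (N = n)) * (\<integral>\<^sup>+x. \<Psi> (x ` {..<N}) \<partial>PiM {..<N} (\<lambda>_. unitQ)))"
      by (subst suminf_finite[of "{n}"]) auto
    finally show "(\<integral>\<^sup>+\<omega>. \<Psi> (X \<omega>) \<partial>M) = (\<Sum>N. ennreal (of_bool (N = n)) * (\<integral>\<^sup>+x. \<Psi> (x ` {..<N}) \<partial>PiM {..<N} (\<lambda>_. unitQ)))" .
  qed simp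
qed

lemma borel_measurable_vec:
  fixes f :: "'a \<Rightarrow> real^'m"
  assumes "\<And>i. (\<lambda>\<omega>. f \<omega> $ i) \<in> borel_measurable M"
  shows "f \<in> borel_measurable M"
proof (subst borel_measurable_euclidean_space, rule ballI)
  fix e :: "real^'m" assume "e \<in> Basis"
  then obtain i where "e = axis i 1" by (auto simp: Basis_vec_def)
  thus "(\<lambda>\<omega>. f \<omega> \<bullet> e) \<in> borel_measurable M" using assms[of i] by (simp add: inner_axis)
qed

context cech_shapes begin

definition count_vec :: "nat \<Rightarrow> (nat \<Rightarrow> real^'d) \<Rightarrow> real^'m" where
  "count_vec N y = (\<chi> i. cnt i {..<N} y)"

lemma Fsum_count_vec: "Fsum \<theta> N y = \<theta> \<bullet> count_vec N y"
  by (simp add: Fsum_def count_vec_def inner_vec_def)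

lemma mixed_law:
  fixes g :: "real^'m \<Rightarrow> ennreal"
  assumes X: "mixed_point_process p M X" and r: "r > 0" and g: "g \<in> borel_measurable borel"
  shows "(\<lambda>\<omega>. g (component_counts k t G r (X \<omega>))) \<in> borel_measurable M"
    "(\<integral>\<^sup>+\<omega>. g (component_counts k t G r (X \<omega>)) \<partial>M) = (\<Sum>N. ennreal (p N) * (\<integral>\<^sup>+y. g (count_vec N y) \<partial>nu r))"
proof -
  have cm: "(\<lambda>x. component_counts k t G r (x ` {..<N})) \<in> borel_measurable (PiM {..<N} (\<lambda>_. borel))" for N :: nat
    by (intro borel_measurable_vec component_counts_measurable measurable_component_singleton) auto
  have gm: "(\<lambda>x. g (component_counts k t G r (x ` {..<N}))) \<in> borel_measurable (PiM {..<N} (\<lambda>_. borel))" for N :: nat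
    by (rule measurable_compose[OF cm g])
  have law: "(\<lambda>\<omega>. g (component_counts k t G r (X \<omega>))) \<in> borel_measurable M \<and>
     (\<integral>\<^sup>+\<omega>. g (component_counts k t G r (X \<omega>)) \<partial>M) = (\<Sum>N. ennreal (p N) * (\<integral>\<^sup>+x. g (component_counts k t G r (x ` {..<N})) \<partial>PiM {..<N} (\<lambda>_. unitQ)))"
    using X[unfolded mixed_point_process_def, THEN conjunct2, THEN conjunct2, THEN spec, of "\<lambda>Y. g (component_counts k t G r Y)"] gm by simp
  thus "(\<lambda>\<omega>. g (component_counts k t G r (X \<omega>))) \<in> borel_measurable M" ..
  have "(\<integral>\<^sup>+x. g (component_counts k t G r (x ` {..<N})) \<partial>PiM {..<N} (\<lambda>_. unitQ)) = (\<integral>\<^sup>+y. g (count_vec N y) \<partial>nu r)" for N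
  proof -
    have "(\<integral>\<^sup>+x. g (component_counts k t G r (x ` {..<N})) \<partial>PiM {..<N} (\<lambda>_. unitQ))
        = (\<integral>\<^sup>+y. g (component_counts k t G r ((\<lambda>a. r *\<^sub>R y a) ` {..<N})) \<partial>nu r)"
      unfolding nu_def by (rule tuple_integral[OF r, of "\<lambda>Y. g (component_counts k t G r Y)"]) (rule gm)
    also have "\<dots> = (\<integral>\<^sup>+y. g (count_vec N y) \<partial>nu r)"
      unfolding nu_def
    proof (rule nn_integral_cong_AE, rule AE_mp[OF AE_component_counts[OF r, of N]], intro AE_I2 impI)
      fix y :: "nat \<Rightarrow> real^'d"
      assume "\<forall>i. component_counts k t G r ((\<lambda>a. r *\<^sub>R y a) ` {..<N}) $ i = cnt i {..<N} y"
      hence "component_counts k t G r ((\<lambda>a. r *\<^sub>R y a) ` {..<N}) = count_vec N y" by (simp add: count_vec_def vec_eq_iff)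
      thus "g (component_counts k t G r ((\<lambda>a. r *\<^sub>R y a) ` {..<N})) = g (count_vec N y)" by simp
    qed
    finally show ?thesis .
  qed
  thus "(\<integral>\<^sup>+\<omega>. g (component_counts k t G r (X \<omega>)) \<partial>M) = (\<Sum>N. ennreal (p N) * (\<integral>\<^sup>+y. g (count_vec N y) \<partial>nu r))"
    using law by simp
qed

lemma component_counts_nonneg: "0 \<le> component_counts k t G r Y $ i"
  by (simp add: component_counts_def cech_iso_indicator_def sum_nonneg)

lemma component_counts_borel:
  assumes X: "mixed_point_process p M X" and r: "r > 0"
  shows "(\<lambda>\<omega>. component_counts k t G r (X \<omega>)) \<in> borel_measurable M"
proof (rule borel_measurable_vec)
  fix i
  have "(\<lambda>\<omega>. ennreal (component_counts k t G r (X \<omega>) $ i)) \<in> borel_measurable M"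
    by (rule mixed_law(1)[OF X r, of "\<lambda>v. ennreal (v $ i)"]) (intro measurable_compose[OF _ measurable_ennreal] borel_measurable_continuous_onI continuous_intros)
  hence "(\<lambda>\<omega>. enn2real (ennreal (component_counts k t G r (X \<omega>) $ i))) \<in> borel_measurable M" by (rule measurable_compose) measurable
  thus "(\<lambda>\<omega>. component_counts k t G r (X \<omega>) $ i) \<in> borel_measurable M" by (simp add: component_counts_nonneg)
qed

lemma prob_space_nu: "prob_space (nu r)"
proof -
  interpret iid_sequence "scaledQ r :: (real^'d) measure" by (rule iid_scaledQ)
  show ?thesis unfolding nu_def P_def by (rule prob_space_PiM) (rule prob_space_scaledQ)
qed

lemma Fsum_integrable:
  assumes r: "r > 0" shows "integrable (nu r) (Fsum \<theta> N)"
    and "integrable (nu r) (\<lambda>y. exp (\<alpha> * Fsum \<theta> N y))"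
proof -
  interpret prob_space "nu r" by (rule prob_space_nu)
  obtain \<kappa> c where 
    m: "\<And>r j. r > 0 \<Longrightarrow> (\<lambda>y. Fsum \<theta> j y) \<in> borel_measurable (nu r)"
    and b: "\<And>y j. \<bar>Fsum \<theta> j y\<bar> \<le> \<kappa> * real j"
    by (rule scale_uniform_estimates[of \<theta>]) (rule that)
  have [measurable]: "Fsum \<theta> N \<in> borel_measurable (nu r)" using m[OF r] .
  show "integrable (nu r) (Fsum \<theta> N)"
    by (rule integrable_const_bound[of _ "\<kappa> * real N"]) (auto simp: b)
  have "\<bar>\<alpha> * Fsum \<theta> N y\<bar> \<le> \<bar>\<alpha>\<bar> * (\<kappa> * real N)" for y
    using b[of N y] by (simp add: abs_mult mult_left_mono)
  hence "\<alpha> * Fsum \<theta> N y \<le> \<bar>\<alpha>\<bar> * (\<kappa> * real N)" for y by (meson abs_le_D1)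
  thus "integrable (nu r) (\<lambda>y. exp (\<alpha> * Fsum \<theta> N y))"
    by (intro integrable_const_bound[of _ "exp (\<bar>\<alpha>\<bar> * (\<kappa> * real N))"]) auto
qed

lemma lap_mean_growth:
  obtains \<kappa> where "0 \<le> \<kappa>" "\<And>r j. r > 0 \<Longrightarrow> \<bar>mean r \<theta> j\<bar> \<le> \<kappa> * real j"
    "\<And>r \<alpha> j. r > 0 \<Longrightarrow> \<bar>lap r \<theta> \<alpha> j\<bar> \<le> exp (\<bar>\<alpha>\<bar> * \<kappa> * real j)"
proof -
  obtain \<kappa> c where k0: "0 \<le> \<kappa>" and b: "\<And>y j. \<bar>Fsum \<theta> j y\<bar> \<le> \<kappa> * real j"
    by (rule scale_uniform_estimates[of \<theta>]) (rule that)
  have m: "\<bar>mean r \<theta> j\<bar> \<le> \<kappa> * real j" if r: "r > 0" for r j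
  proof -
    interpret prob_space "nu r" by (rule prob_space_nu)
    have "\<bar>mean r \<theta> j\<bar> \<le> (\<integral>y. \<bar>Fsum \<theta> j y\<bar> \<partial>nu r)" unfolding mean_def by (rule integral_abs_bound)
    also have "\<dots> \<le> (\<integral>y. \<kappa> * real j \<partial>nu r)"
      using Fsum_integrable(1)[OF r] b by (intro integral_mono) auto
    finally show ?thesis by (simp add: prob_space)
  qed
  have l: "\<bar>lap r \<theta> \<alpha> j\<bar> \<le> exp (\<bar>\<alpha>\<bar> * \<kappa> * real j)" if r: "r > 0" for r \<alpha> j
  proof -
    interpret prob_space "nu r" by (rule prob_space_nu)
    have le: "\<alpha> * Fsum \<theta> j y \<le> \<bar>\<alpha>\<bar> * \<kappa> * real j" for y
    proof -
      have "\<bar>\<alpha> * Fsum \<theta> j y\<bar> \<le> \<bar>\<alpha>\<bar> * (\<kappa> * real j)" using b[of j y] by (simp add: abs_mult mult_left_mono)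
      thus ?thesis by (simp add: mult.assoc abs_le_iff)
    qed
    have "0 \<le> lap r \<theta> \<alpha> j" by (simp add: lap_def)
    moreover have "lap r \<theta> \<alpha> j \<le> (\<integral>y. exp (\<bar>\<alpha>\<bar> * \<kappa> * real j) \<partial>nu r)"
      unfolding lap_def using Fsum_integrable(2)[OF r] le by (intro integral_mono) auto
    ultimately show ?thesis by (simp add: prob_space)
  qed
  show thesis by (rule that[OF k0 m l])
qed

lemma mixed_summable:
  assumes X: "mixed_point_process p M X" and r: "r > 0"
  shows "summable (\<lambda>j. p j * lap r \<theta> \<alpha> j)" "summable (\<lambda>j. p j * mean r \<theta> j)"
proof -
  obtain \<kappa> where k0: "0 \<le> \<kappa>" and m: "\<And>r j. r > 0 \<Longrightarrow> \<bar>mean r \<theta> j\<bar> \<le> \<kappa> * real j"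
    and l: "\<And>r \<alpha> j. r > 0 \<Longrightarrow> \<bar>lap r \<theta> \<alpha> j\<bar> \<le> exp (\<bar>\<alpha>\<bar> * \<kappa> * real j)"
    by (rule lap_mean_growth[of \<theta>]) (rule that)
  have p: "0 \<le> p j" "summable (\<lambda>j. p j * exp (s * real j))" for j s
    using X by (auto simp: mixed_point_process_def)
  show "summable (\<lambda>j. p j * lap r \<theta> \<alpha> j)"
    by (rule summable_comparison_test'[OF p(2)[of "\<bar>\<alpha>\<bar> * \<kappa>"], of 0]) (simp add: abs_mult p(1) mult_left_mono l[OF r])
  have "\<bar>mean r \<theta> j\<bar> \<le> exp (\<kappa> * real j)" for j
  proof -
    have "\<kappa> * real j \<le> exp (\<kappa> * real j)" using exp_ge_add_one_self[of "\<kappa> * real j"] by linarith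
    thus ?thesis using m[OF r, of j] by linarith
  qed
  thus "summable (\<lambda>j. p j * mean r \<theta> j)"
    by (intro summable_comparison_test'[OF p(2)[of \<kappa>], of 0]) (simp add: abs_mult p(1) mult_left_mono)
qed

lemma mixed_exponential_moment:
  assumes X: "mixed_point_process p M X" and r: "r > 0"
  shows "has_bochner_integral M (\<lambda>\<omega>. exp (\<alpha> * (\<theta> \<bullet> component_counts k t G r (X \<omega>)))) (\<Sum>j. p j * lap r \<theta> \<alpha> j)"
proof -
  have p: "0 \<le> p j" for j using X by (auto simp: mixed_point_process_def)
  have l: "0 \<le> lap r \<theta> \<alpha> j" for j by (simp add: lap_def)
  define g where "g v = ennreal (exp (\<alpha> * (\<theta> \<bullet> v)))" for v :: "real^'m"
  have g: "g \<in> borel_measurable borel"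
    unfolding g_def by (intro measurable_compose[OF _ measurable_ennreal] borel_measurable_continuous_onI continuous_intros)
  have "(\<integral>\<^sup>+\<omega>. g (component_counts k t G r (X \<omega>)) \<partial>M) = (\<Sum>N. ennreal (p N) * (\<integral>\<^sup>+y. g (count_vec N y) \<partial>nu r))"
    by (rule mixed_law(2)[OF X r g])
  also have "(\<lambda>N. \<integral>\<^sup>+y. g (count_vec N y) \<partial>nu r) = (\<lambda>N. ennreal (lap r \<theta> \<alpha> N))"
    unfolding g_def lap_def Fsum_count_vec[symmetric]
    by (intro ext nn_integral_eq_integral Fsum_integrable(2)[OF r]) auto
  also have "(\<Sum>N. ennreal (p N) * ennreal (lap r \<theta> \<alpha> N)) = (\<Sum>N. ennreal (p N * lap r \<theta> \<alpha> N))"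
    using p l by (simp add: ennreal_mult)
  also have "\<dots> = ennreal (\<Sum>j. p j * lap r \<theta> \<alpha> j)"
    using p l mixed_summable(1)[OF X r] by (intro suminf_ennreal2) auto
  finally have eq: "(\<integral>\<^sup>+\<omega>. ennreal (exp (\<alpha> * (\<theta> \<bullet> component_counts k t G r (X \<omega>)))) \<partial>M) = ennreal (\<Sum>j. p j * lap r \<theta> \<alpha> j)"
    by (simp add: g_def)
  note [measurable] = component_counts_borel[OF X r]
  show ?thesis
    using eq p l mixed_summable(1)[OF X r] by (intro has_bochner_integral_nn_integral suminf_nonneg) auto
qed

text \<open>Proved coordinatewise, since the counts are nonnegative and the law is available for nonnegative functionals.\<close>
lemma mixed_mean:
  assumes X: "mixed_point_process p M X" and r: "r > 0"
  shows "\<theta> \<bullet> (\<integral>\<omega>. component_counts k t G r (X \<omega>) \<partial>M) = (\<Sum>j. p j * mean r \<theta> j)"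
proof -
  have p: "0 \<le> p j" for j using X by (auto simp: mixed_point_process_def)
  let ?S = "\<lambda>\<omega>. component_counts k t G r (X \<omega>)"
  note [measurable] = component_counts_borel[OF X r]
  have ax: "Fsum (axis i 1) N y = count_vec N y $ i" for i N y
    by (simp add: Fsum_count_vec inner_axis')
  have c0: "0 \<le> count_vec N y $ i" for N y i by (simp add: count_vec_def cnt_def)
  have m0: "0 \<le> mean r (axis i 1) j" for i j
    unfolding mean_def ax by (intro integral_nonneg_AE) (simp add: c0)
  have comp: "has_bochner_integral M (\<lambda>\<omega>. ?S \<omega> $ i) (\<Sum>j. p j * mean r (axis i 1) j)" for i
  proof -
    define g where "g v = ennreal (v $ i)" for v :: "real^'m"
    have g: "g \<in> borel_measurable borel"
      unfolding g_def by (intro measurable_compose[OF _ measurable_ennreal] borel_measurable_continuous_onI continuous_intros)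
    have "(\<integral>\<^sup>+\<omega>. g (?S \<omega>) \<partial>M) = (\<Sum>N. ennreal (p N) * (\<integral>\<^sup>+y. g (count_vec N y) \<partial>nu r))"
      by (rule mixed_law(2)[OF X r g])
    also have "(\<lambda>N. \<integral>\<^sup>+y. g (count_vec N y) \<partial>nu r) = (\<lambda>N. ennreal (mean r (axis i 1) N))"
      unfolding g_def mean_def ax[symmetric]
      by (intro ext nn_integral_eq_integral Fsum_integrable(1)[OF r]) (simp add: ax c0)
    also have "(\<Sum>N. ennreal (p N) * ennreal (mean r (axis i 1) N)) = (\<Sum>N. ennreal (p N * mean r (axis i 1) N))"
      using p m0 by (simp add: ennreal_mult)
    also have "\<dots> = ennreal (\<Sum>j. p j * mean r (axis i 1) j)"
      using p m0 mixed_summable(2)[OF X r] by (intro suminf_ennreal2) auto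
    finally have eq: "(\<integral>\<^sup>+\<omega>. ennreal (?S \<omega> $ i) \<partial>M) = ennreal (\<Sum>j. p j * mean r (axis i 1) j)"
      by (simp add: g_def)
    have "(\<lambda>v :: real^'m. v $ i) \<in> borel_measurable borel"
      by (intro borel_measurable_continuous_onI continuous_intros)
    from measurable_compose[OF component_counts_borel[OF X r] this]
    show ?thesis
      using eq p m0 mixed_summable(2)[OF X r]
      by (intro has_bochner_integral_nn_integral suminf_nonneg) (auto simp: component_counts_nonneg)
  qed
  have Sd: "?S \<omega> = (\<Sum>i\<in>UNIV. (?S \<omega> $ i) *\<^sub>R axis i 1)" for \<omega>
    by (simp add: vec_eq_iff axis_def if_distrib cong: if_cong)
  have int: "integrable M ?S"
    by (subst Sd, intro Bochner_Integration.integrable_sum integrable_scaleR_left) (use comp in \<open>auto simp: has_bochner_integral_iff\<close>)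
  have "\<theta> \<bullet> (\<integral>\<omega>. ?S \<omega> \<partial>M) = (\<integral>\<omega>. \<theta> \<bullet> ?S \<omega> \<partial>M)" using int by simp
  also have "\<dots> = (\<integral>\<omega>. (\<Sum>i\<in>UNIV. \<theta> $ i * ?S \<omega> $ i) \<partial>M)" by (simp add: inner_vec_def)
  also have "\<dots> = (\<Sum>i\<in>UNIV. \<theta> $ i * (\<Sum>j. p j * mean r (axis i 1) j))"
    using comp by (subst Bochner_Integration.integral_sum) (auto simp: has_bochner_integral_iff)
  also have "\<dots> = (\<Sum>i\<in>UNIV. (\<Sum>j. \<theta> $ i * (p j * mean r (axis i 1) j)))"
    using mixed_summable(2)[OF X r] by (simp add: suminf_mult)
  also have "\<dots> = (\<Sum>j. \<Sum>i\<in>UNIV. \<theta> $ i * (p j * mean r (axis i 1) j))"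
    using mixed_summable(2)[OF X r] by (intro suminf_sum[symmetric] summable_mult)
  also have "\<dots> = (\<Sum>j. p j * mean r \<theta> j)"
  proof (rule suminf_cong)
    fix j
    have "mean r \<theta> j = (\<integral>y. (\<Sum>i\<in>UNIV. \<theta> $ i * Fsum (axis i 1) j y) \<partial>nu r)"
      unfolding mean_def by (rule Bochner_Integration.integral_cong) (simp_all only: ax, simp_all add: Fsum_def count_vec_def)
    also have "\<dots> = (\<Sum>i\<in>UNIV. \<theta> $ i * mean r (axis i 1) j)"
      unfolding mean_def using Fsum_integrable(1)[OF r] by (subst Bochner_Integration.integral_sum) auto
    finally show "(\<Sum>i\<in>UNIV. \<theta> $ i * (p j * mean r (axis i 1) j)) = p j * mean r \<theta> j"
      by (simp add: sum_distrib_left mult_ac)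
  qed
  finally show ?thesis .
qed

end

section \<open>Limits of the cumulants\<close>

text \<open>There are asymptotically \<open>n^k / k!\<close> subsets of size \<open>k\<close>.\<close>
lemma binomial_over_power_limit:
  "(\<lambda>n. real (n choose k) / real n ^ k) \<longlonglongrightarrow> 1 / fact k"
proof -
  have "(\<lambda>n. \<Prod>i = 0..<k. (real n - real i) / real n / real (k - i)) \<longlonglongrightarrow> (\<Prod>i = 0..<k. 1 / real (k - i))"
  proof (rule tendsto_prod)
    fix i
    have "(\<lambda>n. 1 - real i * (1 / real n)) \<longlonglongrightarrow> 1 - real i * 0"
      by (intro tendsto_intros lim_1_over_n)
    moreover have "\<forall>\<^sub>F n in sequentially. 1 - real i * (1 / real n) = (real n - real i) / real n"
      using eventually_gt_at_top[of 0] by eventually_elim (simp add: field_simps)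
    ultimately have "(\<lambda>n. (real n - real i) / real n) \<longlonglongrightarrow> 1" by (simp add: tendsto_cong)
    thus "(\<lambda>n. (real n - real i) / real n / real (k - i)) \<longlonglongrightarrow> 1 / real (k - i)" if "i \<in> {0..<k}"
      using that by (intro tendsto_divide) auto
  qed
  moreover have "(\<Prod>i = 0..<k. 1 / real (k - i)) = 1 / fact k"
    by (simp add: prod_dividef fact_prod_rev)
  moreover have "\<forall>\<^sub>F n in sequentially. (\<Prod>i = 0..<k. (real n - real i) / real n / real (k - i)) = real (n choose k) / real n ^ k"
    using eventually_ge_at_top[of k]
  proof eventually_elim
    case (elim n)
    have "real (n choose k) = (\<Prod>i = 0..<k. real (n - i) / real (k - i))"
      using elim by (rule binomial_altdef_of_nat)
    also have "\<dots> = (\<Prod>i = 0..<k. (real n - real i) / real (k - i))"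
      using elim by (intro prod.cong) (auto simp: of_nat_diff)
    finally show ?case by (simp add: prod_dividef prod.distrib mult.commute)
  qed
  ultimately show ?thesis by (simp add: tendsto_cong)
qed

locale moderate_regime = cech_shapes k t G
  for k :: nat and t :: "real^'m" and G :: "'m \<Rightarrow> (real^'d) set set" +
  fixes r b :: "nat \<Rightarrow> real"
  assumes r_pos: "\<And>n. r n > 0" and r_lim: "r \<longlonglongrightarrow> 0" and b_pos: "\<And>n. b n > 0"
    and rho_b: "filterlim (\<lambda>n. real n ^ k * r n ^ (CARD('d) * (k - 1)) / b n) at_top sequentially"
    and rho_b2: "(\<lambda>n. real n ^ k * r n ^ (CARD('d) * (k - 1)) / (b n)\<^sup>2) \<longlonglongrightarrow> 0"
    and sparse: "(\<lambda>n. real n * r n ^ CARD('d)) \<longlonglongrightarrow> 0"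
begin

definition \<rho> :: "nat \<Rightarrow> real" where "\<rho> n = real n ^ k * r n ^ (CARD('d) * (k - 1))"
definition \<alpha> :: "nat \<Rightarrow> real" where "\<alpha> n = b n / \<rho> n"
definition speed :: "nat \<Rightarrow> real" where "speed n = (b n)\<^sup>2 / \<rho> n"
text \<open>This is \<open>\<rho> n / n\<close>, the order of the probability that a given point has \<open>k - 1\<close> close neighbours.\<close>
definition sparsity :: "nat \<Rightarrow> real" where "sparsity n = (real n * r n ^ CARD('d)) ^ (k - 1)"

lemma rho_pos: "n \<ge> 1 \<Longrightarrow> 0 < \<rho> n" using r_pos by (simp add: \<rho>_def)
lemma rho_nonneg: "0 \<le> \<rho> n" using r_pos[of n] by (simp add: \<rho>_def)
lemma alpha_nonneg: "0 \<le> \<alpha> n" using rho_nonneg[of n] b_pos[of n] by (simp add: \<alpha>_def)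

lemma speed_eq: "speed n = \<rho> n * (\<alpha> n)\<^sup>2"
  by (simp add: speed_def \<alpha>_def power2_eq_square)

lemma rho_eq: "\<rho> n = real n * sparsity n"
proof -
  have "k = Suc (k - 1)" using k2 by simp
  hence "real n ^ k = real n * real n ^ (k - 1)" by (metis power_Suc)
  thus ?thesis by (simp add: \<rho>_def sparsity_def power_mult power_mult_distrib)
qed

lemma alpha_limit: "\<alpha> \<longlonglongrightarrow> 0"
  using tendsto_inverse_0_at_top[OF rho_b] by (simp add: \<alpha>_def[abs_def] \<rho>_def)

lemma speed_limit: "filterlim speed at_top sequentially"
proof -
  have "\<forall>\<^sub>F n in sequentially. 0 < \<rho> n / (b n)\<^sup>2"
    using eventually_ge_at_top[of 1] by eventually_elim (use b_pos rho_pos in \<open>simp add: less_imp_neq[symmetric]\<close>)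
  hence "filterlim (\<lambda>n. inverse (\<rho> n / (b n)\<^sup>2)) at_top sequentially"
    using rho_b2 by (intro filterlim_inverse_at_top) (auto simp: \<rho>_def)
  thus ?thesis by (simp add: speed_def[abs_def])
qed

lemma sparsity_limit: "sparsity \<longlonglongrightarrow> 0"
proof -
  have "(\<lambda>n. (real n * r n ^ CARD('d)) ^ (k - 1)) \<longlonglongrightarrow> 0 ^ (k - 1)" by (intro tendsto_intros sparse)
  moreover have "0 ^ (k - 1) = (0 :: real)" using k2 by simp
  ultimately show ?thesis by (simp only: sparsity_def[abs_def])
qed

lemma pball_limit: "(\<lambda>n. real n * pball (r n)) \<longlonglongrightarrow> 0"
proof -
  have "(\<lambda>n. unit_ball_vol (real CARD('d)) * ((real k + 1) * tmax) ^ CARD('d) * (real n * r n ^ CARD('d))) \<longlonglongrightarrow> 0"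
    by (intro tendsto_mult_right_zero sparse)
  thus ?thesis by (simp add: pball_def mult_ac)
qed

lemma pair_limit: "(\<lambda>n. real (n choose k) * pairprob (r n) i j / \<rho> n) \<longlonglongrightarrow> limit_covariance k t G $ i $ j"
proof -
  have "(\<lambda>n. real (n choose k) / real n ^ k * (pairprob (r n) i j / r n ^ (CARD('d) * (k - 1)))) \<longlonglongrightarrow> 1 / fact k * pairmass i j"
    by (intro tendsto_mult binomial_over_power_limit pairprob_limit r_pos r_lim)
  thus ?thesis by (simp add: \<rho>_def limit_covariance_pairmass)
qed

text \<open>Each of the roughly \<open>n^k / k!\<close> subsets contributes \<open>r^(d*(k-1))\<close> times the integral in the limit covariance.\<close>
lemma Vsum_limit: "(\<lambda>n. Vsum (r n) \<theta> n / \<rho> n) \<longlonglongrightarrow> \<theta> \<bullet> (limit_covariance k t G *v \<theta>)"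
proof -
  have "(\<lambda>n. \<Sum>i\<in>UNIV. \<Sum>j\<in>UNIV. \<theta> $ i * \<theta> $ j * (real (n choose k) * pairprob (r n) i j / \<rho> n))
      \<longlonglongrightarrow> (\<Sum>i\<in>UNIV. \<Sum>j\<in>UNIV. \<theta> $ i * \<theta> $ j * (limit_covariance k t G $ i $ j))"
    by (intro tendsto_sum tendsto_mult_left pair_limit)
  moreover have "Vsum (r n) \<theta> n / \<rho> n = (\<Sum>i\<in>UNIV. \<Sum>j\<in>UNIV. \<theta> $ i * \<theta> $ j * (real (n choose k) * pairprob (r n) i j / \<rho> n))" for n
    by (simp add: Vsum_def sum_distrib_left sum_divide_distrib mult_ac)
  moreover have "\<theta> \<bullet> (limit_covariance k t G *v \<theta>) = (\<Sum>i\<in>UNIV. \<Sum>j\<in>UNIV. \<theta> $ i * \<theta> $ j * (limit_covariance k t G $ i $ j))"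
    by (simp add: inner_vec_def matrix_vector_mult_def sum_distrib_left mult_ac)
  ultimately show ?thesis by simp
qed

lemma Hsum_limit: "(\<lambda>n. Hsum (r n) \<theta> n / \<rho> n) \<longlonglongrightarrow> (\<Sum>i\<in>UNIV. \<bar>\<theta> $ i\<bar> * limit_covariance k t G $ i $ i)"
proof -
  have "(\<lambda>n. \<Sum>i\<in>UNIV. \<bar>\<theta> $ i\<bar> * (real (n choose k) * pairprob (r n) i i / \<rho> n))
      \<longlonglongrightarrow> (\<Sum>i\<in>UNIV. \<bar>\<theta> $ i\<bar> * limit_covariance k t G $ i $ i)"
    by (intro tendsto_sum tendsto_mult_left pair_limit)
  moreover have "Hsum (r n) \<theta> n / \<rho> n = (\<Sum>i\<in>UNIV. \<bar>\<theta> $ i\<bar> * (real (n choose k) * pairprob (r n) i i / \<rho> n))" for n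
    by (simp add: Hsum_def sum_distrib_left sum_divide_distrib mult_ac)
  ultimately show ?thesis by simp
qed

text \<open>The error of the cumulant expansion is \<open>O((\<alpha> + n * r^d) * \<alpha>\<^sup>2 * \<rho>)\<close>, hence \<open>o(speed)\<close>.\<close>
lemma binomial_cumulant_limit:
  "(\<lambda>n. (ln (lap (r n) \<theta> (\<alpha> n) n) - \<alpha> n * mean (r n) \<theta> n) / speed n) \<longlonglongrightarrow> 1/2 * (\<theta> \<bullet> (limit_covariance k t G *v \<theta>))"
proof -
  obtain \<kappa> c where k0: "0 \<le> \<kappa>" and est: "\<And>r \<alpha> n. r > 0 \<Longrightarrow> 0 \<le> \<alpha> \<Longrightarrow> \<kappa> * \<alpha> \<le> 1 \<Longrightarrow> real n * pball r \<le> 1 \<Longrightarrow>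
        \<bar>ln (lap r \<theta> \<alpha> n) - \<alpha> * mean r \<theta> n - \<alpha>\<^sup>2 / 2 * Vsum r \<theta> n\<bar> \<le> c * (\<alpha> + real n * pball r) * \<alpha>\<^sup>2 * Hsum r \<theta> n"
    by (rule scale_uniform_estimates[of \<theta>]) (rule that)
  define X where "X n = ln (lap (r n) \<theta> (\<alpha> n) n) - \<alpha> n * mean (r n) \<theta> n" for n
  have "(\<lambda>n. \<kappa> * \<alpha> n) \<longlonglongrightarrow> 0" by (intro tendsto_mult_right_zero alpha_limit)
  hence e1: "\<forall>\<^sub>F n in sequentially. \<kappa> * \<alpha> n < 1" by (rule order_tendstoD) simp
  have e2: "\<forall>\<^sub>F n in sequentially. real n * pball (r n) < 1" by (rule order_tendstoD[OF pball_limit]) simp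
  have "(\<lambda>n. c * (\<alpha> n + real n * pball (r n)) * (Hsum (r n) \<theta> n / \<rho> n)) \<longlonglongrightarrow> c * (0 + 0) * (\<Sum>i\<in>UNIV. \<bar>\<theta> $ i\<bar> * limit_covariance k t G $ i $ i)"
    by (intro tendsto_intros alpha_limit pball_limit Hsum_limit)
  hence lim0: "(\<lambda>n. c * (\<alpha> n + real n * pball (r n)) * (Hsum (r n) \<theta> n / \<rho> n)) \<longlonglongrightarrow> 0" by simp
  have "(\<lambda>n. X n / speed n - 1/2 * (Vsum (r n) \<theta> n / \<rho> n)) \<longlonglongrightarrow> 0"
  proof (rule Lim_null_comparison[OF _ lim0])
    show "\<forall>\<^sub>F n in sequentially. norm (X n / speed n - 1/2 * (Vsum (r n) \<theta> n / \<rho> n)) \<le> c * (\<alpha> n + real n * pball (r n)) * (Hsum (r n) \<theta> n / \<rho> n)"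
      using e1 e2 eventually_ge_at_top[of 1]
    proof eventually_elim
      case (elim n)
      have rp: "0 < \<rho> n" using elim by (intro rho_pos) simp
      have ap: "0 < \<alpha> n" using rp b_pos[of n] by (simp add: \<alpha>_def)
      have sp: "0 < speed n" using rp ap by (simp add: speed_eq)
      have "X n / speed n - 1/2 * (Vsum (r n) \<theta> n / \<rho> n) = (X n - (\<alpha> n)\<^sup>2 / 2 * Vsum (r n) \<theta> n) / speed n"
        using rp ap by (simp add: speed_eq field_simps)
      hence "norm (X n / speed n - 1/2 * (Vsum (r n) \<theta> n / \<rho> n)) = \<bar>X n - (\<alpha> n)\<^sup>2 / 2 * Vsum (r n) \<theta> n\<bar> / speed n"
        using sp by (simp add: abs_divide)
      also have "\<dots> \<le> c * (\<alpha> n + real n * pball (r n)) * (\<alpha> n)\<^sup>2 * Hsum (r n) \<theta> n / speed n"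
        unfolding X_def using elim sp by (intro divide_right_mono est r_pos alpha_nonneg) auto
      also have "\<dots> = c * (\<alpha> n + real n * pball (r n)) * (Hsum (r n) \<theta> n / \<rho> n)"
        using rp ap by (simp add: speed_eq)
      finally show ?case .
    qed
  qed
  from tendsto_add[OF this tendsto_mult_left[OF Vsum_limit[of \<theta>], of "1/2"]]
  show ?thesis by (simp add: X_def)
qed

text \<open>Compared with the binomial case there is an additional error \<open>O(1 + n * D\<^sup>2)\<close> with
  \<open>D = O(\<alpha> * sparsity)\<close>. As \<open>n * D\<^sup>2 = O(sparsity * speed)\<close>, it is \<open>o(speed)\<close> as well.\<close>
lemma poisson_cumulant_limit:
  "(\<lambda>n. (ln (\<Sum>j. poisson_weight (real n) j * lap (r n) \<theta> (\<alpha> n) j) - \<alpha> n * (\<Sum>j. poisson_weight (real n) j * mean (r n) \<theta> j)) / speed n)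
    \<longlonglongrightarrow> 1/2 * (\<theta> \<bullet> (limit_covariance k t G *v \<theta>))"
proof -
  obtain \<kappa> c :: real where k0: "0 \<le> \<kappa>"
    and lp: "\<And>r \<alpha> j. r > 0 \<Longrightarrow> 0 < lap r \<theta> \<alpha> j"
    and l1: "\<And>r \<alpha> j. r > 0 \<Longrightarrow> 0 \<le> \<alpha> \<Longrightarrow> lap r \<theta> \<alpha> (Suc j) \<le> exp (\<kappa> * \<alpha>) * lap r \<theta> \<alpha> j"
    and l2: "\<And>r \<alpha> j. r > 0 \<Longrightarrow> 0 \<le> \<alpha> \<Longrightarrow> lap r \<theta> \<alpha> j \<le> exp (\<kappa> * \<alpha>) * lap r \<theta> \<alpha> (Suc j)"
    and l3: "\<And>r \<alpha> j. r > 0 \<Longrightarrow> 0 \<le> \<alpha> \<Longrightarrow> \<kappa> * \<alpha> \<le> 1 \<Longrightarrow>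
        \<bar>lap r \<theta> \<alpha> (Suc j) - lap r \<theta> \<alpha> j\<bar> \<le> \<alpha> * (\<kappa> * exp (2 * real k) * (real j * pball r) ^ (k - 1)) * lap r \<theta> \<alpha> j"
    and m1: "\<And>r j. r > 0 \<Longrightarrow> \<bar>mean r \<theta> (Suc j) - mean r \<theta> j\<bar> \<le> \<kappa>"
    and m2: "\<And>r j. r > 0 \<Longrightarrow> \<bar>mean r \<theta> (Suc j) - mean r \<theta> j\<bar> \<le> \<kappa> * exp (2 * real k) * (real j * pball r) ^ (k - 1)"
    by (rule scale_uniform_estimates[of \<theta>]) (rule that)
  define v where "v = unit_ball_vol (real CARD('d)) * ((real k + 1) * tmax) ^ CARD('d)"
  have v0: "0 \<le> v" unfolding v_def using tmax_pos by simp
  define c2 where "c2 = \<kappa> * exp (2 * real k) * (2 * v) ^ (k - 1)"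
  have c20: "0 \<le> c2" using k0 v0 by (simp add: c2_def)
  define \<delta> where "\<delta> n = c2 * sparsity n" for n
  have sp0: "0 \<le> sparsity n" for n using r_pos[of n] by (simp add: sparsity_def)
  have d0: "0 \<le> \<delta> n" for n using c20 sp0 by (simp add: \<delta>_def)
  have dl: "\<kappa> * exp (2 * real k) * (real j * pball (r n)) ^ (k - 1) \<le> \<delta> n" if "j < 2 * n" for j n
  proof -
    have pb: "0 \<le> pball (r n)" using v0 r_pos[of n] by (simp add: pball_def v_def)
    have "real j * pball (r n) \<le> (2 * real n) * pball (r n)" using that pb by (intro mult_right_mono) auto
    also have "\<dots> = (2 * v) * (real n * r n ^ CARD('d))" by (simp add: pball_def v_def)
    finally have "(real j * pball (r n)) ^ (k - 1) \<le> ((2 * v) * (real n * r n ^ CARD('d))) ^ (k - 1)"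
      using pb by (intro power_mono) auto
    hence "(\<kappa> * exp (2 * real k)) * (real j * pball (r n)) ^ (k - 1) \<le> (\<kappa> * exp (2 * real k)) * ((2 * v) * (real n * r n ^ CARD('d))) ^ (k - 1)"
      using k0 by (intro mult_left_mono) auto
    thus ?thesis by (simp add: \<delta>_def c2_def sparsity_def power_mult_distrib mult_ac)
  qed
  define W where "W n = (ln (\<Sum>j. poisson_weight (real n) j * lap (r n) \<theta> (\<alpha> n) j) - \<alpha> n * (\<Sum>j. poisson_weight (real n) j * mean (r n) \<theta> j))" for n
  define Y where "Y n = ln (lap (r n) \<theta> (\<alpha> n) n) - \<alpha> n * mean (r n) \<theta> n" for n
  have "(\<lambda>n. \<kappa> * \<alpha> n) \<longlonglongrightarrow> 0" by (intro tendsto_mult_right_zero alpha_limit)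
  hence e1: "\<forall>\<^sub>F n in sequentially. \<kappa> * \<alpha> n < 1/10" by (rule order_tendstoD) simp
  have "(\<lambda>n. \<alpha> n * \<delta> n) \<longlonglongrightarrow> 0 * (c2 * 0)" unfolding \<delta>_def by (intro tendsto_intros alpha_limit sparsity_limit)
  hence e2: "\<forall>\<^sub>F n in sequentially. \<alpha> n * \<delta> n < 1/2" by (intro order_tendstoD) auto
  have sinv: "(\<lambda>n. inverse (speed n)) \<longlonglongrightarrow> 0" by (rule tendsto_inverse_0_at_top[OF speed_limit])
  have "(\<lambda>n. 13 * inverse (speed n) + 13 * c2\<^sup>2 * sparsity n) \<longlonglongrightarrow> 13 * 0 + 13 * c2\<^sup>2 * 0"
    by (intro tendsto_intros sinv sparsity_limit)
  hence lim0: "(\<lambda>n. 13 * inverse (speed n) + 13 * c2\<^sup>2 * sparsity n) \<longlonglongrightarrow> 0" by simp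
  have "(\<lambda>n. W n / speed n - Y n / speed n) \<longlonglongrightarrow> 0"
  proof (rule Lim_null_comparison[OF _ lim0])
    show "\<forall>\<^sub>F n in sequentially. norm (W n / speed n - Y n / speed n) \<le> 13 * inverse (speed n) + 13 * c2\<^sup>2 * sparsity n"
      using e1 e2 eventually_ge_at_top[of 1]
    proof eventually_elim
      case (elim n)
      have rp: "0 < \<rho> n" using elim by (intro rho_pos) simp
      have ap: "0 < \<alpha> n" using rp b_pos[of n] by (simp add: \<alpha>_def)
      have sp: "0 < speed n" using rp ap by (simp add: speed_eq)
      define D where "D = \<alpha> n * \<delta> n"
      have L: "\<bar>ln (\<Sum>j. poisson_weight (real n) j * lap (r n) \<theta> (\<alpha> n) j) - ln (lap (r n) \<theta> (\<alpha> n) n)\<bar>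
          \<le> 2 + real (4 * n) * D\<^sup>2 + 12 * D * sqrt (real n) + 10 * (\<kappa> * \<alpha> n)"
      proof (rule poisson_log_compare(3))
        show "1 \<le> n" by (rule elim)
        show "0 < lap (r n) \<theta> (\<alpha> n) j" for j by (rule lp[OF r_pos])
        show "lap (r n) \<theta> (\<alpha> n) (Suc j) \<le> exp (\<kappa> * \<alpha> n) * lap (r n) \<theta> (\<alpha> n) j" for j by (rule l1[OF r_pos alpha_nonneg])
        show "lap (r n) \<theta> (\<alpha> n) j \<le> exp (\<kappa> * \<alpha> n) * lap (r n) \<theta> (\<alpha> n) (Suc j)" for j by (rule l2[OF r_pos alpha_nonneg])
        show "\<bar>lap (r n) \<theta> (\<alpha> n) (Suc j) - lap (r n) \<theta> (\<alpha> n) j\<bar> \<le> D * lap (r n) \<theta> (\<alpha> n) j" if "j < 2 * n" for j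
        proof -
          have "\<bar>lap (r n) \<theta> (\<alpha> n) (Suc j) - lap (r n) \<theta> (\<alpha> n) j\<bar> \<le> \<alpha> n * (\<kappa> * exp (2 * real k) * (real j * pball (r n)) ^ (k - 1)) * lap (r n) \<theta> (\<alpha> n) j"
            using elim by (intro l3 r_pos alpha_nonneg) simp
          also have "\<dots> \<le> D * lap (r n) \<theta> (\<alpha> n) j"
            unfolding D_def using lp[OF r_pos, of n "\<alpha> n" j] by (intro mult_right_mono mult_left_mono dl that alpha_nonneg) simp
          finally show ?thesis .
        qed
        show "\<kappa> * \<alpha> n \<le> 1/10" "D \<le> 1/2" using elim by (auto simp: D_def)
      qed
      have "\<bar>(\<Sum>j. poisson_weight (real n) j * mean (r n) \<theta> j) - mean (r n) \<theta> n\<bar> \<le> \<delta> n * (6 * sqrt (real n)) + \<kappa> * 10"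
      proof (rule poisson_mean_compare(2))
        show "1 \<le> n" by (rule elim)
        show "\<bar>mean (r n) \<theta> (Suc j) - mean (r n) \<theta> j\<bar> \<le> \<kappa>" for j by (rule m1[OF r_pos])
        show "\<bar>mean (r n) \<theta> (Suc j) - mean (r n) \<theta> j\<bar> \<le> \<delta> n" if "j < 2 * n" for j
          using m2[OF r_pos, of n j] dl[OF that] by linarith
      qed
      hence "\<alpha> n * \<bar>(\<Sum>j. poisson_weight (real n) j * mean (r n) \<theta> j) - mean (r n) \<theta> n\<bar> \<le> \<alpha> n * (\<delta> n * (6 * sqrt (real n)) + \<kappa> * 10)"
        by (intro mult_left_mono alpha_nonneg)
      hence Mn: "\<bar>\<alpha> n * (\<Sum>j. poisson_weight (real n) j * mean (r n) \<theta> j) - \<alpha> n * mean (r n) \<theta> n\<bar> \<le> 6 * D * sqrt (real n) + 10 * (\<kappa> * \<alpha> n)"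
        using alpha_nonneg[of n] unfolding right_diff_distrib[symmetric] abs_mult D_def
        by (simp add: distrib_left mult_ac)
      \<comment> \<open>Absorb the term linear in \<open>D * \<surd>n\<close> into the quadratic one.\<close>
      have "(D * sqrt (real n) - 1)\<^sup>2 \<ge> 0" by simp
      hence amgm: "2 * (D * sqrt (real n)) \<le> 1 + real n * D\<^sup>2"
        by (simp add: power2_diff power_mult_distrib algebra_simps)
      have "\<bar>W n - Y n\<bar> \<le> 2 + 4 * real n * D\<^sup>2 + 18 * D * sqrt (real n) + 20 * (\<kappa> * \<alpha> n)"
        using L Mn unfolding W_def Y_def of_nat_mult of_nat_numeral by linarith
      also have "\<dots> \<le> 13 + 13 * (real n * D\<^sup>2)" using amgm elim by linarith
      finally have WY: "\<bar>W n - Y n\<bar> \<le> 13 + 13 * (real n * D\<^sup>2)" .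
      have nD: "real n * D\<^sup>2 = c2\<^sup>2 * sparsity n * speed n"
        by (simp add: D_def \<delta>_def speed_eq rho_eq power2_eq_square mult_ac)
      have "norm (W n / speed n - Y n / speed n) = \<bar>W n - Y n\<bar> / speed n"
        using sp by (simp add: diff_divide_distrib[symmetric] abs_divide)
      also have "\<dots> \<le> (13 + 13 * (real n * D\<^sup>2)) / speed n" using sp WY by (intro divide_right_mono) auto
      also have "\<dots> = 13 * inverse (speed n) + 13 * c2\<^sup>2 * sparsity n"
        unfolding nD using sp by (simp add: field_simps)
      finally show ?case .
    qed
  qed
  from tendsto_add[OF this binomial_cumulant_limit[of \<theta>, folded Y_def]]
  show ?thesis by (simp add: W_def)
qed

end

section \<open>Moderate deviations\<close>

context moderate_regime begin

text \<open>The centred cumulant of \<open>Z n\<close> at \<open>speed n * \<theta>\<close> is that of the component counts at \<open>\<alpha> n * \<theta>\<close>, since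
  \<open>speed n / b n = \<alpha> n\<close>; so the assumed limit is what the Gaertner-Ellis theorem needs.\<close>
theorem moderate_deviations_mixed:
  fixes X :: "nat \<Rightarrow> 'a \<Rightarrow> (real^'d) set" and A :: "(real^'m) set"
  assumes M: "prob_space M" and X: "\<And>n. mixed_point_process (p n) M (X n)"
    and lim: "\<And>\<theta>. (\<lambda>n. (ln (\<Sum>j. p n j * lap (r n) \<theta> (\<alpha> n) j) - \<alpha> n * (\<Sum>j. p n j * mean (r n) \<theta> j)) / speed n)
      \<longlonglongrightarrow> 1/2 * (\<theta> \<bullet> (limit_covariance k t G *v \<theta>))"
    and inv: "invertible (limit_covariance k t G)" and A: "A \<in> sets borel"
  defines "S \<equiv> \<lambda>n \<omega>. component_counts k t G (r n) (X n \<omega>)"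
  defines "L \<equiv> \<lambda>n. ereal (\<rho> n / (b n)\<^sup>2) *
     log_prob (measure M {\<omega> \<in> space M. (1 / b n) *\<^sub>R (S n \<omega> - (\<integral>\<omega>'. S n \<omega>' \<partial>M)) \<in> A})"
  shows "- (INF u\<in>interior A. ereal (rate_function (limit_covariance k t G) u)) \<le> liminf L \<and>
         liminf L \<le> limsup L \<and>
         limsup L \<le> - (INF u\<in>closure A. ereal (rate_function (limit_covariance k t G) u))"
proof -
  interpret prob_space M by (rule M)
  define C where "C = limit_covariance k t G"
  define Z where "Z n \<omega> = (1 / b n) *\<^sub>R (S n \<omega> - (\<integral>\<omega>'. S n \<omega>' \<partial>M))" for n \<omega>
  have Sm: "S n \<in> borel_measurable M" for n
    unfolding S_def by (rule component_counts_borel[OF X r_pos])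
  have Zm: "Z n \<in> borel_measurable M" for n
    unfolding Z_def using Sm[of n] by measurable
  have mom: "has_bochner_integral M (\<lambda>\<omega>. exp (speed n * (\<theta> \<bullet> Z n \<omega>)))
      (exp (- (\<alpha> n * (\<Sum>j. p n j * mean (r n) \<theta> j))) * (\<Sum>j. p n j * lap (r n) \<theta> (\<alpha> n) j))" for n \<theta>
  proof -
    have sb: "speed n * (1 / b n) = \<alpha> n" using b_pos[of n] by (simp add: speed_def \<alpha>_def power2_eq_square)
    have "speed n * (\<theta> \<bullet> Z n \<omega>) = speed n * (1 / b n) * (\<theta> \<bullet> S n \<omega> - \<theta> \<bullet> (\<integral>\<omega>'. S n \<omega>' \<partial>M))" for \<omega>
      by (simp add: Z_def inner_diff_right)
    hence "speed n * (\<theta> \<bullet> Z n \<omega>) = - (\<alpha> n * (\<Sum>j. p n j * mean (r n) \<theta> j)) + \<alpha> n * (\<theta> \<bullet> S n \<omega>)" for \<omega>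
      unfolding sb using mixed_mean[OF X[of n] r_pos[of n], of \<theta>] by (simp add: S_def right_diff_distrib)
    hence "(\<lambda>\<omega>. exp (speed n * (\<theta> \<bullet> Z n \<omega>))) = (\<lambda>\<omega>. exp (- (\<alpha> n * (\<Sum>j. p n j * mean (r n) \<theta> j))) * exp (\<alpha> n * (\<theta> \<bullet> S n \<omega>)))"
      by (simp only: exp_add)
    thus ?thesis unfolding S_def
      using has_bochner_integral_mult_right[OF mixed_exponential_moment[OF X[of n] r_pos[of n], of "\<alpha> n" \<theta>], of "exp (- (\<alpha> n * (\<Sum>j. p n j * mean (r n) \<theta> j)))"]
      by simp
  qed
  have pos: "0 < (\<Sum>j. p n j * lap (r n) \<theta> (\<alpha> n) j)" for n \<theta>
  proof -
    have "0 < expectation (\<lambda>\<omega>. exp (speed n * (\<theta> \<bullet> Z n \<omega>)))"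
      by (rule expectation_exp_pos) (use mom[of n \<theta>] in \<open>auto simp: has_bochner_integral_iff\<close>)
    thus ?thesis using mom[of n \<theta>] by (simp add: has_bochner_integral_iff zero_less_mult_iff)
  qed
  have int: "integrable M (\<lambda>\<omega>. exp (speed n * (\<theta> \<bullet> Z n \<omega>)))" for n \<theta>
    using mom by (simp add: has_bochner_integral_iff)
  have "ln (expectation (\<lambda>\<omega>. exp (speed n * (\<theta> \<bullet> Z n \<omega>))))
      = ln (\<Sum>j. p n j * lap (r n) \<theta> (\<alpha> n) j) - \<alpha> n * (\<Sum>j. p n j * mean (r n) \<theta> j)" for n \<theta>
    using mom[of n \<theta>] pos[of n \<theta>] by (simp add: has_bochner_integral_iff ln_mult)
  hence lim': "(\<lambda>n. ln (expectation (\<lambda>\<omega>. exp (speed n * (\<theta> \<bullet> Z n \<omega>)))) / speed n) \<longlonglongrightarrow> 1/2 * (\<theta> \<bullet> (C *v \<theta>))" for \<theta>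
    using lim[of \<theta>] by (simp add: C_def)
  have sym: "u \<bullet> (C *v v) = v \<bullet> (C *v u)" for u v :: "real^'m"
  proof -
    have "transpose C = C" by (simp add: transpose_def C_def vec_eq_iff limit_covariance_pairmass pairmass_sym)
    thus ?thesis by (metis dot_lmul_matrix inner_commute vector_transpose_matrix)
  qed
  have Leq: "L = (\<lambda>n. ereal (1 / speed n) * log_prob (prob {\<omega>\<in>space M. Z n \<omega> \<in> A}))"
    unfolding L_def Z_def by (simp add: speed_def)
  have "- (INF u\<in>interior A. ereal (rate_function C u)) \<le> liminf L"
    unfolding Leq by (rule gaertner_ellis_lower[OF speed_limit Zm int lim' sym inv[folded C_def] A])
  moreover have "limsup L \<le> - (INF u\<in>closure A. ereal (rate_function C u))"
    unfolding Leq by (rule gaertner_ellis_upper[OF speed_limit Zm int lim' inv[folded C_def] A])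
  moreover have "liminf L \<le> limsup L" by (rule Liminf_le_Limsup) simp
  ultimately show ?thesis unfolding C_def by blast
qed

end

theorem corollary2p9:
  fixes M :: "'a measure"
    and X :: "nat \<Rightarrow> 'a \<Rightarrow> (real^'d) set"
    and k :: nat
    and r b \<rho> :: "nat \<Rightarrow> real"
    and t :: "real^'m"
    and G :: "'m \<Rightarrow> (real^'d) set set"
    and A :: "(real^'m) set"
  defines "\<rho> \<equiv> \<lambda>n. real n ^ k * r n ^ (CARD('d) * (k - 1))"
  defines "S \<equiv> \<lambda>n \<omega>. component_counts k t G (r n) (X n \<omega>)"
  defines "C \<equiv> limit_covariance k t G"
  defines "L \<equiv> \<lambda>n. ereal (\<rho> n / (b n)\<^sup>2) *
     log_prob (measure M {\<omega> \<in> space M.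
       (1 / b n) *\<^sub>R (S n \<omega> - (\<integral>\<omega>'. S n \<omega>' \<partial>M)) \<in> A})"
  assumes "prob_space M"
    and "CARD('d) \<ge> 2" and "k \<ge> 2"
    and "(\<forall>n. poisson_process_on_cube M (real n) (X n)) \<or>
         (\<forall>n. binomial_process_on_cube M n (X n))"
    and "\<forall>n. r n > 0" and "r \<longlonglongrightarrow> 0"
    and "\<forall>n. b n > 0"
    and "filterlim (\<lambda>n. \<rho> n / b n) at_top sequentially"
    and "(\<lambda>n. \<rho> n / (b n)\<^sup>2) \<longlonglongrightarrow> 0"
    and "filterlim \<rho> at_top sequentially"
    and "(\<lambda>n. real n * r n ^ CARD('d)) \<longlonglongrightarrow> 0"
    and "\<forall>i. t $ i > 0"
    and "\<forall>i. connected_cech_complex_on k (G i)"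
    and "\<forall>i j. i \<noteq> j \<longrightarrow> \<not> complex_iso (G i) (G j)"
    and "invertible C"
    and "A \<in> sets borel"
  shows "- (INF u\<in>interior A. ereal (rate_function C u)) \<le> liminf L \<and>
         liminf L \<le> limsup L \<and>
         limsup L \<le> - (INF u\<in>closure A. ereal (rate_function C u))"
proof -
  interpret R: moderate_regime k t G r b
    using assms(5-) unfolding \<rho>_def by unfold_locales auto
  have rho: "R.\<rho> = \<rho>" by (simp add: R.\<rho>_def[abs_def] \<rho>_def)
  consider "\<forall>n. poisson_process_on_cube M (real n) (X n)" | "\<forall>n. binomial_process_on_cube M n (X n)"
    using assms(8) by blast
  thus ?thesis
  proof cases
    case 1
    have "mixed_point_process (poisson_weight (real n)) M (X n)" for n
      using 1 by (intro poisson_mixed_point_process assms(5)) auto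
    from R.moderate_deviations_mixed[OF assms(5) this R.poisson_cumulant_limit assms(19)[unfolded C_def] assms(20)]
    show ?thesis unfolding rho L_def S_def C_def .
  next
    case 2
    have X: "mixed_point_process (\<lambda>j. of_bool (j = n)) M (X n)" for n
      using 2 by (intro binomial_mixed_point_process assms(5)) auto
    have eval_at: "(\<Sum>j. of_bool (j = n) * f j) = f n" for n :: nat and f :: "nat \<Rightarrow> real"
      by (subst suminf_finite[of "{n}"]) auto
    have "(\<lambda>n. (ln (\<Sum>j. of_bool (j = n) * R.lap (r n) \<theta> (R.\<alpha> n) j) - R.\<alpha> n * (\<Sum>j. of_bool (j = n) * R.mean (r n) \<theta> j)) / R.speed n)
        \<longlonglongrightarrow> 1/2 * (\<theta> \<bullet> (limit_covariance k t G *v \<theta>))" for \<theta>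
      unfolding eval_at by (rule R.binomial_cumulant_limit)
    from R.moderate_deviations_mixed[OF assms(5) X this assms(19)[unfolded C_def] assms(20)]
    show ?thesis unfolding rho L_def S_def C_def .
  qed
qed

end
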